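(* Let $\ell\in\mathbb Z_{>0}$ and $\lambda=(\lambda_1,\lambda_2)\in P^+$. Let $\lambda_2=(q-1)\ell+m$, $0<m\le\ell$ (with $q,m$ integers). For every $\kappa_1,\dots,\kappa_q\in\mathbb C$ such that $\kappa_1+\dots+\kappa_q=\lambda_1$ and pairwise-distinct $z_1,\dots,z_q\in\mathbb C$, there is an isomorphism of $\mathfrak g[t]$-modules $$D(\ell,\lambda)\cong K(\kappa_1,\ell)^{z_1}*\dots*K(\kappa_{q-1},\ell)^{z_{q-1}}*K(\kappa_q,m)^{z_q}.$$
   Context: All vector spaces are over $\mathbb C$. $\mathfrak g=\mathfrak{sl}(1|2)$ is the Lie superalgebra of $3\times 3$ complex matrices $A=(a_{ij})$ with $a_{11}-a_{22}-a_{33}=0$; the even part consists of block-diagonal matrices (blocks of size $1$ and $2$), the odd part of block-off-diagonal matrices, and $[A,B]=AB-(-1)^{\bar i\bar j}BA$ for $A,B$ of parity $\bar i,\bar j$. Let $E_{i,j}$ be the matrix units, $x_1=E_{1,2}$, $x_2=E_{2,3}$, $x_3=E_{1,3}$, $y_i=x_i^t$ (transpose), $h_1=E_{1,1}+E_{2,2}$, $h_2=E_{2,2}-E_{3,3}$, $\mathfrak h=\mathrm{span}\{h_1,h_2\}$, $\mathfrak n^+=\mathrm{span}\{y_1,x_2,x_3\}$. A weight $\lambda\in\mathfrak h^*$ is identified with $(\lambda_1,\lambda_2)=(\lambda(h_1),\lambda(h_2))$, and $P^+=\{\lambda\in\mathfrak h^*\mid\lambda_2\in\mathbb Z_{\ge1}\}\cup\{0\}$.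 Modules are $\mathbb Z_2$-graded; homomorphisms are linear maps commuting with the action and need not preserve parity. $\mathfrak g[t]=\mathfrak g\otimes\mathbb C[t]$, $x(m):=x\otimes t^m$, $[x(m),y(n)]=[x,y](m+n)$; $x=x(0)$. For $\mu\in P^+$, the generalized Kac module $K(\mu)$ is the quotient of $\mathbf U(\mathfrak g)$ by the left ideal generated by $\mathfrak n^+$, $h-\mu(h)$ ($h\in\mathfrak h$), $y_2^{\mu_2+1}$; $k_\mu$ is the image of $1$. For $\ell\in\mathbb Z_{\ge0}$ and $\lambda\in P^+$, the Demazure-type module $D(\ell,\lambda)$ is the quotient of $\mathbf U(\mathfrak g[t])$ by the left ideal generated by $\mathfrak n^+[t]$, $h(r)-\lambda(h)\delta_{r,0}$ and $y_2(r)^{\max\{0,\lambda_2-\ell r\}+1}$ for all $h\in\mathfrak h$, $r\in\mathbb Z_{\ge0}$. For a $\mathfrak g$-module $V$ and $z\in\mathbb C$, $V^z$ is the $\mathfrak g[t]$-module $V$ with $x(a)v=z^a\,xv$. Grade $\mathbf U(\mathfrak g[t])=\bigoplus_{s\ge0}\mathbf U(\mathfrak g[t])[s]$ by degree in $t$. For a $\mathfrak g[t]$-module $V$ with cyclic vector $v$, put $V^{\le n}=\sum_{i=0}^n\mathbf U(\mathfrak g[t])[i]v$ and let $\mathrm{Gr}_v(V)=\bigoplus_{n\ge0}V^{\le n}/V^{\le n-1}$ (with $V^{\le-1}=0$) be the associated graded $\mathfrak g[t]$-module. For cyclic $\mathfrak g$-modules $V_1,\dots,V_n$ with cyclic homogeneous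 even vectors $v_1,\dots,v_n$ and pairwise-distinct $z_1,\dots,z_n\in\mathbb C$, the fusion product is $V_1^{z_1}*\dots*V_n^{z_n}:=\mathrm{Gr}_{v_1\otimes\dots\otimes v_n}(V_1^{z_1}\otimes\dots\otimes V_n^{z_n})$. For generalized Kac modules the cyclic vector used is $k_\mu$. *)

theory Defs
  imports
    "HOL-Analysis.Finite_Cartesian_Product"
    "HOL-Library.Numeral_Type"
    "HOL-Library.Poly_Mapping"
    "HOL-Library.Z2"
    "HOL-Algebra.Module"
    "HOL-Algebra.QuotRing"
begin

section \<open>Super vector spaces, modules, quotients\<close>

definition complex_ring :: "complex ring" where
  "complex_ring = \<lparr>carrier = UNIV, monoid.mult = (*), one = 1, ring.zero = 0, add = (+)\<rparr>"

text \<open>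
  A \<open>\<int>\<^sub>2\<close>-graded complex vector space with an action of \<open>'x\<close>; \<open>part V d\<close> is the homogeneous
  component of parity \<open>d\<close>.  As usual for \<^typ>\<open>('a, 'b) module\<close>, the inherited fields \<open>mult\<close> and
  \<open>one\<close> carry no information for a mere module; they are used only for associative algebras.
\<close>

record ('x, 'a) super_module = "(complex, 'a) module" +
  part :: "bit \<Rightarrow> 'a set"
  act :: "'x \<Rightarrow> 'a \<Rightarrow> 'a"

text \<open>A Lie superalgebra is given by its adjoint module: \<open>act L x y\<close> is the bracket of \<open>x\<close> and \<open>y\<close>.\<close>

type_synonym 'x lie_superalgebra = "('x, 'x) super_module"

abbreviation bracket :: "'x lie_superalgebra \<Rightarrow> 'x \<Rightarrow> 'x \<Rightarrow> 'x" where
  "bracket L \<equiv> act L"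

definition koszul_sign :: "bit \<Rightarrow> bit \<Rightarrow> complex" where
  "koszul_sign d e = (if d = 1 \<and> e = 1 then -1 else 1)"

definition component :: "('x, 'a) super_module \<Rightarrow> bit \<Rightarrow> 'a \<Rightarrow> 'a" where
  "component V d v = (THE a. a \<in> part V d \<and> (\<exists>b \<in> part V (d + 1). v = a \<oplus>\<^bsub>V\<^esub> b))"

text \<open>
  The map \<open>coset_map M N f\<close> is the map of cosets of \<open>N\<close> induced by a map \<open>f\<close> into \<open>M\<close> that is
  compatible with them.
\<close>

definition coset_map :: "('x, 'a) super_module \<Rightarrow> 'a set \<Rightarrow> ('b \<Rightarrow> 'a) \<Rightarrow> 'b set \<Rightarrow> 'a set" where
  "coset_map M N f X = (\<Union>v\<in>X. N +>\<^bsub>M\<^esub> f v)"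

definition quotient :: "('x, 'a) super_module \<Rightarrow> 'a set \<Rightarrow> ('x, 'a set) super_module" where
  "quotient M N =
    \<lparr>carrier = a_rcosets\<^bsub>M\<^esub> N,
     monoid.mult = rcoset_mult M N,
     one = N +>\<^bsub>M\<^esub> \<one>\<^bsub>M\<^esub>,
     ring.zero = N,
     add = set_add M,
     module.smult = (\<lambda>c. coset_map M N (\<lambda>v. c \<odot>\<^bsub>M\<^esub> v)),
     part = (\<lambda>d. (\<lambda>v. N +>\<^bsub>M\<^esub> v) ` part M d),
     act = (\<lambda>x. coset_map M N (act M x))\<rparr>"

definition generated_submodule :: "('x, 'a) super_module \<Rightarrow> 'a set \<Rightarrow> 'a set" where
  "generated_submodule M S = \<Inter>{N. submodule N complex_ring M \<and> S \<subseteq> N}"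

text \<open>Isomorphisms of modules over \<open>L\<close>; they need not preserve parity.\<close>

definition module_isomorphic ::
  "'x lie_superalgebra \<Rightarrow> ('x, 'a) super_module \<Rightarrow> ('x, 'b) super_module \<Rightarrow> bool" where
  "module_isomorphic L V W \<longleftrightarrow>
    (\<exists>f. bij_betw f (carrier V) (carrier W) \<and>
      (\<forall>u\<in>carrier V. \<forall>v\<in>carrier V. f (u \<oplus>\<^bsub>V\<^esub> v) = f u \<oplus>\<^bsub>W\<^esub> f v) \<and>
      (\<forall>c. \<forall>v\<in>carrier V. f (c \<odot>\<^bsub>V\<^esub> v) = c \<odot>\<^bsub>W\<^esub> f v) \<and>
      (\<forall>x\<in>carrier L. \<forall>v\<in>carrier V. f (act V x v) = act W x (f v)))"


section \<open>Universal enveloping algebras\<close>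

definition homogeneous_words :: "'x lie_superalgebra \<Rightarrow> bit \<Rightarrow> 'x list set" where
  "homogeneous_words L d =
    {w. \<exists>ds. list_all2 (\<lambda>x e. x \<in> part L e) w ds \<and> sum_list ds = d}"

definition word_mult :: "('x list \<Rightarrow>\<^sub>0 complex) \<Rightarrow> ('x list \<Rightarrow>\<^sub>0 complex) \<Rightarrow> 'x list \<Rightarrow>\<^sub>0 complex" where
  "word_mult p q =
    (\<Sum>u\<in>Poly_Mapping.keys p. \<Sum>w\<in>Poly_Mapping.keys q.
      Poly_Mapping.single (u @ w) (Poly_Mapping.lookup p u * Poly_Mapping.lookup q w))"

text \<open>
  The free associative superalgebra on the set \<open>carrier L\<close> (the linear structure of \<open>L\<close> is
  imposed only in the next step), regarded as an \<open>L\<close>-module by left multiplication.  Words with inhomogeneous letters lie in no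
  sum of homogeneous components here; they do so after linearity has been imposed.
\<close>

definition free_algebra :: "'x lie_superalgebra \<Rightarrow> ('x, 'x list \<Rightarrow>\<^sub>0 complex) super_module" where
  "free_algebra L =
    \<lparr>carrier = {p. Poly_Mapping.keys p \<subseteq> lists (carrier L)},
     monoid.mult = word_mult,
     one = Poly_Mapping.single [] 1,
     ring.zero = 0,
     add = (+),
     module.smult = (\<lambda>c. Poly_Mapping.map ((*) c)),
     part = (\<lambda>d. {p. Poly_Mapping.keys p \<subseteq> homogeneous_words L d}),
     act = (\<lambda>x. word_mult (Poly_Mapping.single [x] 1))\<rparr>"

definition UEA_relations :: "'x lie_superalgebra \<Rightarrow> ('x list \<Rightarrow>\<^sub>0 complex) set" where
  "UEA_relations L =
    {Poly_Mapping.single [x \<oplus>\<^bsub>L\<^esub> y] 1 - Poly_Mapping.single [x] 1 - Poly_Mapping.single [y] 1 | x y.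
      x \<in> carrier L \<and> y \<in> carrier L} \<union>
    {Poly_Mapping.single [c \<odot>\<^bsub>L\<^esub> x] 1 - Poly_Mapping.single [x] c | c x. x \<in> carrier L} \<union>
    {Poly_Mapping.single [x, y] 1 - Poly_Mapping.single [y, x] (koszul_sign d e)
       - Poly_Mapping.single [bracket L x y] 1 | x y d e. x \<in> part L d \<and> y \<in> part L e}"

definition UEA_ideal :: "'x lie_superalgebra \<Rightarrow> ('x list \<Rightarrow>\<^sub>0 complex) set" where
  "UEA_ideal L = Idl\<^bsub>free_algebra L\<^esub> (UEA_relations L)"

definition UEA :: "'x lie_superalgebra \<Rightarrow> ('x, ('x list \<Rightarrow>\<^sub>0 complex) set) super_module" where
  "UEA L = quotient (free_algebra L) (UEA_ideal L)"

definition UEA_incl :: "'x lie_superalgebra \<Rightarrow> 'x \<Rightarrow> ('x list \<Rightarrow>\<^sub>0 complex) set" where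
  "UEA_incl L x = UEA_ideal L +>\<^bsub>free_algebra L\<^esub> Poly_Mapping.single [x] 1"

definition left_ideal :: "('x, 'a) super_module \<Rightarrow> 'a set \<Rightarrow> bool" where
  "left_ideal U I \<longleftrightarrow>
    additive_subgroup I U \<and> (\<forall>a\<in>carrier U. \<forall>u\<in>I. a \<otimes>\<^bsub>U\<^esub> u \<in> I)"

definition generated_left_ideal :: "('x, 'a) super_module \<Rightarrow> 'a set \<Rightarrow> 'a set" where
  "generated_left_ideal U S = \<Inter>{I. left_ideal U I \<and> S \<subseteq> I}"

text \<open>
  The action of the enveloping algebra on an \<open>L\<close>-module, computed on an arbitrary representative
  in the free algebra.
\<close>

definition UEA_act :: "('x, 'a) super_module \<Rightarrow> ('x list \<Rightarrow>\<^sub>0 complex) set \<Rightarrow> 'a \<Rightarrow> 'a" where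
  "UEA_act V u v =
    (let p = (SOME p. p \<in> u) in
      \<Oplus>\<^bsub>V\<^esub>w\<in>Poly_Mapping.keys p. Poly_Mapping.lookup p w \<odot>\<^bsub>V\<^esub> foldr (act V) w v)"


section \<open>Tensor products\<close>

text \<open>The free vector space on the tuples in \<open>V\<^sub>1 \<times> \<dots> \<times> V\<^sub>n\<close> modulo multilinearity.\<close>

definition multilinear_relations :: "('x, 'a) super_module list \<Rightarrow> ('a list \<Rightarrow>\<^sub>0 complex) set" where
  "multilinear_relations Vs =
    {Poly_Mapping.single (w[i := a \<oplus>\<^bsub>Vs ! i\<^esub> b]) 1 - Poly_Mapping.single (w[i := a]) 1
       - Poly_Mapping.single (w[i := b]) 1 | w i a b.
      w \<in> listset (map carrier Vs) \<and> i < length Vs \<and>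
      a \<in> carrier (Vs ! i) \<and> b \<in> carrier (Vs ! i)} \<union>
    {Poly_Mapping.single (w[i := c \<odot>\<^bsub>Vs ! i\<^esub> a]) 1 - Poly_Mapping.single (w[i := a]) c | w i c a.
      w \<in> listset (map carrier Vs) \<and> i < length Vs \<and> a \<in> carrier (Vs ! i)}"

text \<open>\<open>parity_twist V d\<close> maps a homogeneous \<open>v\<close> of parity \<open>e\<close> to \<open>(-1)\<^sup>d\<^sup>e v\<close>.\<close>

definition parity_twist :: "('x, 'a) super_module \<Rightarrow> bit \<Rightarrow> 'a \<Rightarrow> 'a" where
  "parity_twist V d v =
    (\<Oplus>\<^bsub>V\<^esub>e\<in>UNIV. koszul_sign d e \<odot>\<^bsub>V\<^esub> component V e v)"

text \<open>
  For homogeneous \<open>x\<close> and \<open>v\<^sub>j\<close>,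
  \<open>x (v\<^sub>1 \<otimes> \<dots> \<otimes> v\<^sub>n) = (\<Sum>i. (-1) ^ (|x| (|v\<^sub>1| + \<dots> + |v\<^sub>i\<^sub>-\<^sub>1|)) v\<^sub>1 \<otimes> \<dots> \<otimes> x v\<^sub>i \<otimes> \<dots> \<otimes> v\<^sub>n)\<close>.
\<close>

definition tensor_act ::
  "'x lie_superalgebra \<Rightarrow> ('x, 'a) super_module list \<Rightarrow> 'x \<Rightarrow> ('a list \<Rightarrow>\<^sub>0 complex) \<Rightarrow> 'a list \<Rightarrow>\<^sub>0 complex"
  where
  "tensor_act L Vs x p =
    (\<Sum>w\<in>Poly_Mapping.keys p. \<Sum>d\<in>UNIV. \<Sum>i<length Vs.
      Poly_Mapping.single
        (map2 (\<lambda>V v. parity_twist V d v) (take i Vs) (take i w)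
          @ [act (Vs ! i) (component L d x) (w ! i)] @ drop (Suc i) w)
        (Poly_Mapping.lookup p w))"

definition free_tensor ::
  "'x lie_superalgebra \<Rightarrow> ('x, 'a) super_module list \<Rightarrow> ('x, 'a list \<Rightarrow>\<^sub>0 complex) super_module" where
  "free_tensor L Vs =
    \<lparr>carrier = {p. Poly_Mapping.keys p \<subseteq> listset (map carrier Vs)},
     monoid.mult = undefined,
     one = undefined,
     ring.zero = 0,
     add = (+),
     module.smult = (\<lambda>c. Poly_Mapping.map ((*) c)),
     part = (\<lambda>d. {p. Poly_Mapping.keys p \<subseteq>
       (\<Union>ds\<in>{ds. length ds = length Vs \<and> sum_list ds = d}. listset (map2 part Vs ds))}),
     act = tensor_act L Vs\<rparr>"

definition tensor_kernel ::
  "'x lie_superalgebra \<Rightarrow> ('x, 'a) super_module list \<Rightarrow> ('a list \<Rightarrow>\<^sub>0 complex) set" where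
  "tensor_kernel L Vs = generated_submodule (free_tensor L Vs) (multilinear_relations Vs)"

definition tensor_product ::
  "'x lie_superalgebra \<Rightarrow> ('x, 'a) super_module list \<Rightarrow> ('x, ('a list \<Rightarrow>\<^sub>0 complex) set) super_module" where
  "tensor_product L Vs = quotient (free_tensor L Vs) (tensor_kernel L Vs)"

definition pure_tensor ::
  "'x lie_superalgebra \<Rightarrow> ('x, 'a) super_module list \<Rightarrow> 'a list \<Rightarrow> ('a list \<Rightarrow>\<^sub>0 complex) set" where
  "pure_tensor L Vs vs = tensor_kernel L Vs +>\<^bsub>free_tensor L Vs\<^esub> Poly_Mapping.single vs 1"


section \<open>The Lie superalgebras \<open>sl(1|2)\<close> and \<open>sl(1|2)[t]\<close>\<close>

type_synonym mat3 = "complex ^ 3 ^ 3"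

definition E :: "3 \<Rightarrow> 3 \<Rightarrow> mat3" where
  "E i j = (\<chi> a b. if a = i \<and> b = j then 1 else 0)"

definition mscale :: "complex \<Rightarrow> mat3 \<Rightarrow> mat3" (infixr "*\<^sub>M" 75) where
  "c *\<^sub>M A = (\<chi> i j. c * A $ i $ j)"

text \<open>Block of parity \<open>d\<close> of a matrix, for the partition \<open>{1}\<close>, \<open>{2, 3}\<close> of the indices.\<close>

definition block :: "bit \<Rightarrow> mat3 \<Rightarrow> mat3" where
  "block d A = (\<chi> i j. if (d = 0) = ((i = 1) = (j = 1)) then A $ i $ j else 0)"

definition super_commutator :: "mat3 \<Rightarrow> mat3 \<Rightarrow> mat3" where
  "super_commutator A B =
    (\<Sum>d\<in>UNIV. \<Sum>e\<in>UNIV.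
      block d A ** block e B - koszul_sign d e *\<^sub>M (block e B ** block d A))"

definition sl12 :: "mat3 lie_superalgebra" where
  "sl12 =
    (let g = {A. A $ 1 $ 1 - A $ 2 $ 2 - A $ 3 $ 3 = 0} in
    \<lparr>carrier = g,
     monoid.mult = undefined,
     one = undefined,
     ring.zero = 0,
     add = (+),
     module.smult = (*\<^sub>M),
     part = (\<lambda>d. {A \<in> g. block d A = A}),
     act = super_commutator\<rparr>)"

text \<open>
  An element of \<open>sl(1|2) \<otimes> \<complex>[t]\<close> is a finitely supported sequence of coefficients;
  \<open>x(m) = x \<otimes> t\<^sup>m\<close> is \<open>single m x\<close>.
\<close>

definition sl12_t :: "(nat \<Rightarrow>\<^sub>0 mat3) lie_superalgebra" where
  "sl12_t =
    \<lparr>carrier = {p. \<forall>m. Poly_Mapping.lookup p m \<in> carrier sl12},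
     monoid.mult = undefined,
     one = undefined,
     ring.zero = 0,
     add = (+),
     module.smult = (\<lambda>c. Poly_Mapping.map ((*\<^sub>M) c)),
     part = (\<lambda>d. {p. \<forall>m. Poly_Mapping.lookup p m \<in> part sl12 d}),
     act = (\<lambda>p q. \<Sum>m\<in>Poly_Mapping.keys p. \<Sum>n\<in>Poly_Mapping.keys q.
       Poly_Mapping.single (m + n)
         (bracket sl12 (Poly_Mapping.lookup p m) (Poly_Mapping.lookup q n)))\<rparr>"

definition h1 :: mat3 where "h1 = E 1 1 + E 2 2"
definition h2 :: mat3 where "h2 = E 2 2 - E 3 3"

definition y2 :: mat3 where "y2 = E 3 2"

text \<open>The span of \<open>y\<^sub>1 = E 2 1\<close>, \<open>x\<^sub>2 = E 2 3\<close> and \<open>x\<^sub>3 = E 1 3\<close>.\<close>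

definition n_plus :: "mat3 set" where
  "n_plus = {a *\<^sub>M E 2 1 + b *\<^sub>M E 2 3 + c *\<^sub>M E 1 3 | a b c. True}"

text \<open>The pair \<open>(\<lambda>\<^sub>1, \<lambda>\<^sub>2)\<close> stands for the weight \<open>\<lambda>\<close> with \<open>\<lambda> (a h\<^sub>1 + b h\<^sub>2) = a \<lambda>\<^sub>1 + b \<lambda>\<^sub>2\<close>.\<close>

type_synonym weight = "complex \<times> complex"

definition P_plus :: "weight set" where
  "P_plus = {\<mu>. \<exists>n::nat. n \<ge> 1 \<and> snd \<mu> = of_nat n} \<union> {(0, 0)}"


section \<open>The modules\<close>

definition K_ideal :: "weight \<Rightarrow> (mat3 list \<Rightarrow>\<^sub>0 complex) set set" where
  "K_ideal \<mu> = (let U = UEA sl12; \<iota> = UEA_incl sl12 in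
    generated_left_ideal U
     (\<iota> ` n_plus \<union>
      {\<iota> (a *\<^sub>M h1 + b *\<^sub>M h2) \<ominus>\<^bsub>U\<^esub> (a * fst \<mu> + b * snd \<mu>) \<odot>\<^bsub>U\<^esub> \<one>\<^bsub>U\<^esub> | a b. True} \<union>
      {\<iota> y2 [^]\<^bsub>U\<^esub> (n + 1) | n::nat. snd \<mu> = of_nat n}))"

definition K :: "weight \<Rightarrow> (mat3, (mat3 list \<Rightarrow>\<^sub>0 complex) set set) super_module" where
  "K \<mu> = quotient (UEA sl12) (K_ideal \<mu>)"

definition K_vec :: "weight \<Rightarrow> (mat3 list \<Rightarrow>\<^sub>0 complex) set set" where
  "K_vec \<mu> = K_ideal \<mu> +>\<^bsub>UEA sl12\<^esub> \<one>\<^bsub>UEA sl12\<^esub>"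

definition D_ideal :: "nat \<Rightarrow> weight \<Rightarrow> ((nat \<Rightarrow>\<^sub>0 mat3) list \<Rightarrow>\<^sub>0 complex) set set" where
  "D_ideal l \<mu> = (let U = UEA sl12_t; \<iota> = UEA_incl sl12_t in
    generated_left_ideal U
     (\<iota> ` {p. \<forall>r. Poly_Mapping.lookup p r \<in> n_plus} \<union>
      {\<iota> (Poly_Mapping.single r (a *\<^sub>M h1 + b *\<^sub>M h2))
        \<ominus>\<^bsub>U\<^esub> (if r = 0 then a * fst \<mu> + b * snd \<mu> else 0) \<odot>\<^bsub>U\<^esub> \<one>\<^bsub>U\<^esub> | r a b. True} \<union>
      {\<iota> (Poly_Mapping.single r y2) [^]\<^bsub>U\<^esub> (nat (max 0 (int n - int l * int r)) + 1) | n r.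
        snd \<mu> = of_nat n}))"

definition D :: "nat \<Rightarrow> weight \<Rightarrow>
    (nat \<Rightarrow>\<^sub>0 mat3, ((nat \<Rightarrow>\<^sub>0 mat3) list \<Rightarrow>\<^sub>0 complex) set set) super_module" where
  "D l \<mu> = quotient (UEA sl12_t) (D_ideal l \<mu>)"

text \<open>The module \<open>V\<^sup>z\<close>, on which \<open>x(m)\<close> acts as \<open>z\<^sup>m x\<close>.\<close>

definition eval_module :: "(mat3, 'a) super_module \<Rightarrow> complex \<Rightarrow> (nat \<Rightarrow>\<^sub>0 mat3, 'a) super_module" where
  "eval_module V z =
    \<lparr>carrier = carrier V,
     monoid.mult = undefined,
     one = undefined,
     ring.zero = \<zero>\<^bsub>V\<^esub>,
     add = add V,
     module.smult = module.smult V,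
     part = part V,
     act = (\<lambda>p v. \<Oplus>\<^bsub>V\<^esub>m\<in>Poly_Mapping.keys p.
       (z ^ m) \<odot>\<^bsub>V\<^esub> act V (Poly_Mapping.lookup p m) v)\<rparr>"


section \<open>Associated graded modules and fusion products\<close>

text \<open>The component of degree \<open>s\<close> of the enveloping algebra of \<open>sl(1|2)[t]\<close>.\<close>

definition UEA_degree :: "nat \<Rightarrow> ((nat \<Rightarrow>\<^sub>0 mat3) list \<Rightarrow>\<^sub>0 complex) set set" where
  "UEA_degree s =
    (\<lambda>p. UEA_ideal sl12_t +>\<^bsub>free_algebra sl12_t\<^esub> p) `
      {p. Poly_Mapping.keys p \<subseteq>
        {map (\<lambda>(m, x). Poly_Mapping.single m x) ps | ps.
          snd ` set ps \<subseteq> carrier sl12 \<and> sum_list (map fst ps) = s}}"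

definition filtration :: "(nat \<Rightarrow>\<^sub>0 mat3, 'a) super_module \<Rightarrow> 'a \<Rightarrow> nat \<Rightarrow> 'a set" where
  "filtration V v n = {\<Oplus>\<^bsub>V\<^esub>i\<in>{..n}. UEA_act V (u i) v | u. \<forall>i\<le>n. u i \<in> UEA_degree i}"

text \<open>The previous filtration step, with the step of index \<open>-1\<close> being zero.\<close>

definition filtration_pred :: "(nat \<Rightarrow>\<^sub>0 mat3, 'a) super_module \<Rightarrow> 'a \<Rightarrow> nat \<Rightarrow> 'a set" where
  "filtration_pred V v n = (case n of 0 \<Rightarrow> {\<zero>\<^bsub>V\<^esub>} | Suc k \<Rightarrow> filtration V v k)"

text \<open>
  Only the graded vector space structure of \<open>graded_piece V v n\<close> is used: an element of positive
  degree in \<open>t\<close> does not preserve the filtration steps.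
\<close>

definition graded_piece ::
  "(nat \<Rightarrow>\<^sub>0 mat3, 'a) super_module \<Rightarrow> 'a \<Rightarrow> nat \<Rightarrow> (nat \<Rightarrow>\<^sub>0 mat3, 'a set) super_module" where
  "graded_piece V v n =
    quotient
      (V\<lparr>carrier := filtration V v n, part := (\<lambda>d. part V d \<inter> filtration V v n)\<rparr>)
      (filtration_pred V v n)"

text \<open>
  An element of the direct sum is a finitely supported sequence of cosets, and \<open>x(r)\<close> maps
  \<open>w + V\<^sup>\<le>\<^sup>k\<^sup>-\<^sup>1\<close> in degree \<open>k\<close> to \<open>x(r) w + V\<^sup>\<le>\<^sup>k\<^sup>+\<^sup>r\<^sup>-\<^sup>1\<close> in degree \<open>k + r\<close>.
\<close>

definition associated_graded ::
  "(nat \<Rightarrow>\<^sub>0 mat3, 'a) super_module \<Rightarrow> 'a \<Rightarrow> (nat \<Rightarrow>\<^sub>0 mat3, nat \<Rightarrow> 'a set) super_module" where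
  "associated_graded V v =
    \<lparr>carrier = {f. (\<forall>n. f n \<in> carrier (graded_piece V v n)) \<and>
       finite {n. f n \<noteq> \<zero>\<^bsub>graded_piece V v n\<^esub>}},
     monoid.mult = undefined,
     one = undefined,
     ring.zero = (\<lambda>n. \<zero>\<^bsub>graded_piece V v n\<^esub>),
     add = (\<lambda>f g n. f n \<oplus>\<^bsub>graded_piece V v n\<^esub> g n),
     module.smult = (\<lambda>c f n. c \<odot>\<^bsub>graded_piece V v n\<^esub> f n),
     part = (\<lambda>d. {f. (\<forall>n. f n \<in> part (graded_piece V v n) d) \<and>
       finite {n. f n \<noteq> \<zero>\<^bsub>graded_piece V v n\<^esub>}}),
     act = (\<lambda>p f n. \<Oplus>\<^bsub>graded_piece V v n\<^esub>r\<in>{..n}.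
       coset_map V (filtration_pred V v n)
         (act V (Poly_Mapping.single r (Poly_Mapping.lookup p r))) (f (n - r)))\<rparr>"

text \<open>
  The fusion product of a list of triples \<open>(V, v, z)\<close>: a cyclic \<open>sl(1|2)\<close>-module, its even cyclic
  vector, and its evaluation parameter.
\<close>

definition fusion_product ::
  "((mat3, 'a) super_module \<times> 'a \<times> complex) list \<Rightarrow>
    (nat \<Rightarrow>\<^sub>0 mat3, nat \<Rightarrow> ('a list \<Rightarrow>\<^sub>0 complex) set set) super_module" where
  "fusion_product Ms =
    (let Vs = map (\<lambda>(V, v, z). eval_module V z) Ms; vs = map (\<lambda>(V, v, z). v) Ms in
      associated_graded (tensor_product sl12_t Vs) (pure_tensor sl12_t Vs vs))"

end

theory Submission
  imports
    Defs
    "HOL-Library.Multiset"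
    "HOL-Library.Product_Plus"
    "HOL-Library.Function_Algebras"
    "HOL-Computational_Algebra.Polynomial"
    "HOL-Analysis.Cartesian_Space"
begin

text \<open>
  Write \<open>N\<close> for \<open>4^q\<close> times the product of the second weights \<open>l, \<dots>, l, m\<close>; it is the dimension of the
  tensor product of the \<open>q\<close> Kac modules.  The theorem follows from three facts: the cyclic vector of
  the fusion product satisfies the relations of \<open>D l lam\<close>; the module \<open>D l lam\<close> is spanned by \<open>N\<close> words that
  are homogeneous in \<open>t\<close>; and the tensor product contains \<open>N\<close> linearly independent elements that are
  reached from the cyclic vector.  The words then map to a basis of the tensor product adapted to the
  filtration, so the fusion product has no relations beyond those of \<open>D l lam\<close>
  (\<open>associated_graded_isomorphic\<close>).

  Relations (\<open>D_relations_comps\<close>).  On the tensor product, \<open>x \<otimes> f(t)\<close> acts on the factor with parameter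
  \<open>z\<close> as \<open>f(z) x\<close>.  The element \<open>y2(r)\<close> has the same leading term as \<open>y2 \<otimes> f\<close> with
  \<open>f = \<Prod>i<r. (t - z\<^sub>i)\<close>, which annihilates the first \<open>r\<close> factors; on the other factors its power is zero
  as soon as the exponent exceeds the sum of the remaining second weights.

  Upper bound (\<open>highest_weight_span_bound\<close>).  Let \<open>Y(u)\<close> be the generating series of the \<open>E32(p)\<close>.
  By an identity of Garland the coefficient of \<open>u^e\<close> in \<open>Y(u)^r\<close> kills the generator for
  \<open>r + e > \<Sum>i. min \<xi>\<^sub>i r\<close>, where \<open>\<xi> = (l, \<dots>, l, m)\<close>.  A recursion on the parts shows that such relations
  leave at most \<open>\<Prod>(\<xi>\<^sub>i + 1)\<close> monomials in the \<open>E32(p)\<close>, and \<open>\<Prod>(2 \<xi>\<^sub>i + 1)\<close> words if the \<open>E31(p)\<close> are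
  admitted.  A product of the \<open>E12(p)\<close> over a set \<open>A\<close> of indices lowers the parts indexed by \<open>A\<close> by one,
  modulo products that come earlier, and the sum of \<open>\<Prod>(2 (\<xi>\<^sub>i - [i \<in> A]) + 1)\<close> over all \<open>A\<close> is \<open>\<Prod>4 \<xi>\<^sub>i = N\<close>.

  Lower bound (\<open>tensor_lower_bound\<close>).  Each Kac module maps to an explicit module on quadruples of
  polynomials, whose coordinates give \<open>N\<close> functionals on the tensor product; interpolation polynomials
  at the \<open>z\<^sub>i\<close> show that the cyclic vector generates all pure tensors.
\<close>

abbreviation single :: "'k \<Rightarrow> 'b::zero \<Rightarrow> 'k \<Rightarrow>\<^sub>0 'b" where "single \<equiv> Poly_Mapping.single"
abbreviation lookup :: "('k \<Rightarrow>\<^sub>0 'b::zero) \<Rightarrow> 'k \<Rightarrow> 'b" where "lookup \<equiv> Poly_Mapping.lookup"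
abbreviation keys :: "('k \<Rightarrow>\<^sub>0 'b::zero) \<Rightarrow> 'k set" where "keys \<equiv> Poly_Mapping.keys"

section \<open>Commuting operators with bounded powers\<close>

lemma sum_triangle_swap:
  fixes f :: "nat \<Rightarrow> nat \<Rightarrow> 'v::comm_monoid_add"
  shows "(\<Sum>p\<le>e. \<Sum>q\<le>e-p. f p q) = (\<Sum>q\<le>e. \<Sum>p\<le>e-q. f p q)"
  unfolding sum.Sigma[OF finite_atMost ballI[OF finite_atMost]]
  by (rule sum.reindex_bij_witness[of _ "\<lambda>(q,p). (p,q)" "\<lambda>(p,q). (q,p)"]) auto

text \<open>
  The degree bounds below are sums \<open>\<Sum>x\<in>#M. min x r\<close>: the number of boxes
  in the first \<open>r\<close> columns of the Young diagram with rows \<open>M\<close>.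
\<close>

definition min_sum :: "nat multiset \<Rightarrow> nat \<Rightarrow> nat" where
  "min_sum M r = (\<Sum>x\<in>#M. min x r)"

lemma min_sum_simps [simp]: "min_sum {#} r = 0" "min_sum (add_mset x M) r = min x r + min_sum M r"
  by (simp_all add: min_sum_def)

lemma min_sum_Suc: "min_sum M (Suc r) = min_sum M r + size (filter_mset (\<lambda>x. x > r) M)"
  by (induction M) auto




lemma min_sum_Suc_bound: "min_sum M (Suc r) \<le> min_sum M r + size M"
  unfolding min_sum_Suc using size_filter_mset_lesseq by simp

lemma min_sum_ge: "(\<And>x. x \<in># M ==> x \<ge> r) ==> min_sum M r = r * size M"
  by (induction M) auto

lemma min_sum_le: "min_sum M r \<le> r * size M"
  by (induction M) auto

locale currents = vector_space sc for sc :: "complex \<Rightarrow> 'v::ab_group_add \<Rightarrow> 'v" +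
  fixes y :: "nat \<Rightarrow> 'v \<Rightarrow> 'v"
  assumes y_add: "y p (a + b) = y p a + y p b"
    and y_scale: "y p (sc c a) = sc c (y p a)"
    and y_commute: "y p (y p' a) = y p' (y p a)"
begin

lemma y_zero [simp]: "y p 0 = 0"
  using y_add[of p 0 0] by simp

lemma y_sum: "y p (sum f A) = (\<Sum>x\<in>A. y p (f x))"
  by (induction A rule: infinite_finite_induct) (auto simp: y_add)

text \<open>
  The coefficient of \<open>u^e\<close> in the \<open>r\<close>-th power of the generating
  series \<open>\<Sum>p. y p u^p\<close>.
\<close>

fun power_coeff :: "nat \<Rightarrow> nat \<Rightarrow> 'v \<Rightarrow> 'v" where
  "power_coeff 0 e w = (if e = 0 then w else 0)"
| "power_coeff (Suc r) e w = (\<Sum>p\<le>e. y p (power_coeff r (e - p) w))"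

lemma power_coeff_y: "power_coeff r e (y p w) = y p (power_coeff r e w)"
  by (induction r arbitrary: e) (auto simp: y_sum y_commute[of p])

lemma power_coeff_scale: "power_coeff r e (sc c a) = sc c (power_coeff r e a)"
  by (induction r arbitrary: e) (auto simp: y_scale scale_sum_right)

lemma power_coeff_1: "power_coeff (Suc 0) e w = y e w"
proof -
  have "power_coeff (Suc 0) e w = (\<Sum>p\<le>e. if p = e then y e w else 0)"
    unfolding power_coeff.simps by (rule sum.cong) auto
  then show ?thesis by simp
qed

text \<open>
  The coefficient of \<open>u^e\<close> in \<open>u (Y^(r+1))' = (r + 1) Y^r (u Y')\<close>,
  where \<open>Y\<close> is the generating series.
\<close>

lemma power_coeff_euler:
  "sc (of_nat e) (power_coeff (Suc r) e w) =
   sc (of_nat (Suc r)) (\<Sum>p\<le>e. sc (of_nat p) (y p (power_coeff r (e - p) w)))"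
proof (induction r arbitrary: e)
  case 0
  have "(\<Sum>p\<le>e. sc (of_nat p) (y p (power_coeff 0 (e - p) w))) = (\<Sum>p\<le>e. if p = e then sc (of_nat e) (y e w) else 0)"
    by (rule sum.cong) auto
  then show ?case by (simp add: power_coeff_1 del: power_coeff.simps)
next
  case (Suc r)
  let ?c = "power_coeff (Suc r)"
  have s: "sc (of_nat e) (y p (?c (e - p) w)) = sc (of_nat p) (y p (?c (e - p) w)) + y p (sc (of_nat (e - p)) (?c (e - p) w))"
    if "p \<le> e" for p
    using that by (simp add: y_scale[symmetric] y_add[symmetric] scale_left_distrib[symmetric] of_nat_diff del: power_coeff.simps)
  have "sc (of_nat e) (power_coeff (Suc (Suc r)) e w) = (\<Sum>p\<le>e. sc (of_nat e) (y p (?c (e - p) w)))"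
    by (simp add: scale_sum_right)
  also have "\<dots> = (\<Sum>p\<le>e. sc (of_nat p) (y p (?c (e - p) w))) + (\<Sum>p\<le>e. y p (sc (of_nat (e - p)) (?c (e - p) w)))"
    unfolding sum.distrib[symmetric] using s by (intro sum.cong) auto
  also have "(\<Sum>p\<le>e. y p (sc (of_nat (e - p)) (?c (e - p) w))) =
     (\<Sum>p\<le>e. sc (of_nat (Suc r)) (\<Sum>q\<le>e-p. sc (of_nat q) (y q (y p (power_coeff r (e - p - q) w)))))"
    unfolding Suc.IH by (simp add: y_scale y_sum y_commute del: power_coeff.simps of_nat_Suc)
  also have "\<dots> = sc (of_nat (Suc r)) (\<Sum>p\<le>e. \<Sum>q\<le>e-p. sc (of_nat q) (y q (y p (power_coeff r (e - q - p) w))))"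
    by (simp add: scale_sum_right add.commute del: of_nat_Suc)
  also have "\<dots> = sc (of_nat (Suc r)) (\<Sum>q\<le>e. \<Sum>p\<le>e-q. sc (of_nat q) (y q (y p (power_coeff r (e - q - p) w))))"
    by (subst sum_triangle_swap) (rule refl)
  also have "\<dots> = sc (of_nat (Suc r)) (\<Sum>q\<le>e. sc (of_nat q) (y q (?c (e - q) w)))"
    by (simp add: y_sum scale_sum_right del: of_nat_Suc)
  finally show ?case
    by (simp only: of_nat_Suc[of "Suc r"] scale_left_distrib scale_one)
qed

inductive_set mon :: "'v \<Rightarrow> 'v set" for w where
  mon_base: "w \<in> mon w"
| mon_step: "a \<in> mon w ==> y p a \<in> mon w"

definition y_stable :: "'v set \<Rightarrow> bool" where
  "y_stable N \<longleftrightarrow> subspace N \<and> (\<forall>p. \<forall>a\<in>N. y p a \<in> N)"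

lemma y_stableD: "y_stable N ==> subspace N" "y_stable N ==> a \<in> N ==> y p a \<in> N"
  by (auto simp: y_stable_def)

lemma y_stable_span: "(\<And>a p. a \<in> S ==> y p a \<in> span S) ==> y_stable (span S)"
proof -
  assume S: "\<And>a p. a \<in> S ==> y p a \<in> span S"
  have "y p a \<in> span S" if "a \<in> span S" for a p
    using that by (induction rule: span_induct_alt) (auto simp: y_add y_scale span_add span_scale S span_zero)
  then show ?thesis by (simp add: y_stable_def)
qed

lemma y_stable_span_mon: "y_stable N ==> y_stable (span (N \<union> mon w))"
  by (rule y_stable_span) (auto intro: span_base dest: y_stableD(2) mon_step)

lemma mon_subset: "y_stable N ==> w \<in> N ==> mon w \<subseteq> N"
proof
  fix a assume "y_stable N" "w \<in> N" "a \<in> mon w"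
  from this(3) show "a \<in> N" by induction (use \<open>y_stable N\<close> \<open>w \<in> N\<close> in \<open>auto dest: y_stableD\<close>)
qed

lemma mon_trans: "a \<in> mon b ==> b \<in> mon w ==> a \<in> mon w"
  by (induction rule: mon.induct) (auto intro: mon.intros)

lemma power_coeff_in: "y_stable N ==> w \<in> N ==> power_coeff r e w \<in> N"
  by (induction r arbitrary: e) (auto simp: y_stableD subspace_0 intro!: subspace_sum)

text \<open>
  With \<open>N = 0\<close>, a vector \<open>w\<close> with these relations behaves like the
  cyclic vector of a fusion product of the \<open>sl(2)\<close>-modules of highest weights
  \<open>x \<in># M\<close>. Relations modulo a subspace \<open>N\<close> make it possible to
  treat successive quotients without forming them.
\<close>

definition degree_bounded :: "'v set \<Rightarrow> nat multiset \<Rightarrow> 'v \<Rightarrow> bool" where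
  "degree_bounded N M w \<longleftrightarrow> (\<forall>r e. min_sum M r < r + e \<longrightarrow> power_coeff r e w \<in> N)"

lemma sum_rest_in:
  assumes "subspace N" "finite A" "B \<subseteq> A" "sum f A \<in> N" "\<And>p. p \<in> A - B ==> f p \<in> N"
  shows "sum f B \<in> N"
proof -
  have "sum f A = sum f (A - B) + sum f B" using assms sum.subset_diff by blast
  then show ?thesis using assms(1,4) subspace_sum[OF assms(1), of "A - B" f] assms(5)
    by (metis add_diff_cancel_left' subspace_diff)
qed

lemma
  assumes N: "y_stable N" and top: "\<And>p. p > n ==> y p w \<in> N"
    and high: "\<And>e'. e' > e ==> power_coeff r e' w \<in> N"
  shows top_coeff: "power_coeff (Suc r) (e + n) w \<in> N ==> y n (power_coeff r e w) \<in> N"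
proof -
  assume S: "power_coeff (Suc r) (e + n) w \<in> N"
  have "sum (\<lambda>p. y p (power_coeff r (e + n - p) w)) {n} \<in> N"
  proof (rule sum_rest_in[of N "{..e+n}"])
    show "sum (\<lambda>p. y p (power_coeff r (e + n - p) w)) {..e + n} \<in> N" using S by simp
    fix p assume "p \<in> {..e + n} - {n}"
    then consider "p > n" | "p < n" by fastforce
    then show "y p (power_coeff r (e + n - p) w) \<in> N"
    proof cases
      case 1 then show ?thesis using top N by (metis power_coeff_y power_coeff_in)
    next
      case 2 then show ?thesis by (intro y_stableD(2)[OF N] high) auto
    qed
  qed (use N in \<open>auto simp: y_stableD\<close>)
  then show ?thesis by simp
qed

text \<open>
  The two leading contributions to one coefficient, weighted by \<open>1\<close> in the first
  relation and by their index in the second (the Euler identity). The two relations are linearly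
  independent, so that the contributions can be separated.
\<close>

lemma two_top_coeffs:
  assumes N: "y_stable N" and top: "\<And>p. p > Suc n ==> y p w \<in> N"
    and high: "\<And>e'. e' > Suc e ==> power_coeff r e' w \<in> N"
  defines "A \<equiv> y (Suc n) (power_coeff r e w)" and "B \<equiv> y n (power_coeff r (Suc e) w)"
  defines "C \<equiv> power_coeff (Suc r) (Suc (e + n)) w"
  shows "C - (A + B) \<in> N"
    and "sc (of_nat (Suc (e + n))) C - sc (of_nat (Suc r)) (sc (of_nat (Suc n)) A + sc (of_nat n) B) \<in> N"
proof -
  let ?f = "\<lambda>p. y p (power_coeff r (Suc (e + n) - p) w)"
  have sub: "{n, Suc n} \<subseteq> {..Suc (e + n)}" by auto
  have rest: "?f p \<in> N" if "p \<in> {..Suc (e + n)} - {n, Suc n}" for p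
  proof -
    from that consider "p > Suc n" | "p < n" by fastforce
    then show ?thesis
    proof cases
      case 1 then show ?thesis using top N by (metis power_coeff_y power_coeff_in)
    next
      case 2 then show ?thesis by (intro y_stableD(2)[OF N] high) auto
    qed
  qed
  have fin: "finite {..Suc (e + n)}" by simp
  have *: "(\<Sum>p\<le>Suc (e + n). g p) = (\<Sum>p\<in>{..Suc (e + n)} - {n, Suc n}. g p) + (g (Suc n) + g n)" for g :: "nat \<Rightarrow> 'v"
    unfolding sum.subset_diff[OF sub fin] by (simp add: add.commute)
  have "C - (A + B) = (\<Sum>p\<in>{..Suc (e + n)} - {n, Suc n}. ?f p)"
    unfolding C_def power_coeff.simps A_def B_def by (subst *) (simp add: Suc_diff_le)
  moreover have "(\<Sum>p\<in>{..Suc (e + n)} - {n, Suc n}. ?f p) \<in> N"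
    by (rule subspace_sum[OF y_stableD(1)[OF N]]) (rule rest)
  ultimately show "C - (A + B) \<in> N" by simp
  define S where "S = (\<Sum>p\<in>{..Suc (e + n)} - {n, Suc n}. sc (of_nat p) (?f p))"
  have "sc (of_nat (Suc (e + n))) C = sc (of_nat (Suc r)) (\<Sum>p\<le>Suc (e + n). sc (of_nat p) (?f p))"
    unfolding C_def by (rule power_coeff_euler)
  also have "(\<Sum>p\<le>Suc (e + n). sc (of_nat p) (?f p)) = S + (sc (of_nat (Suc n)) A + sc (of_nat n) B)"
    unfolding S_def A_def B_def by (subst *) (simp add: Suc_diff_le del: of_nat_Suc)
  finally have "sc (of_nat (Suc (e + n))) C - sc (of_nat (Suc r)) (sc (of_nat (Suc n)) A + sc (of_nat n) B) = sc (of_nat (Suc r)) S"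
    by (simp add: scale_right_distrib del: of_nat_Suc)
  moreover have "S \<in> N"
    unfolding S_def by (intro subspace_sum[OF y_stableD(1)[OF N]] subspace_scale[OF y_stableD(1)[OF N]] rest)
  ultimately show "sc (of_nat (Suc (e + n))) C - sc (of_nat (Suc r)) (sc (of_nat (Suc n)) A + sc (of_nat n) B) \<in> N"
    using subspace_scale[OF y_stableD(1)[OF N]] by simp
qed

text \<open>
  Multiplied by the top operator, a coefficient becomes a leading contribution to a coefficient
  of the next power, which is known to vanish; this lowers two parts at once.
\<close>

lemma drop_two_parts:
  assumes N: "y_stable N" and top: "\<And>p. p > Suc n ==> y p w \<in> N"
    and bd: "degree_bounded N (add_mset (Suc b) (add_mset (Suc a) M)) w"
    and M: "size M = n" "b \<le> a"
  shows "degree_bounded N (add_mset b (add_mset a M)) (y (Suc n) w)"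
  unfolding degree_bounded_def
proof (intro allI impI)
  fix r e assume e: "min_sum (add_mset b (add_mset a M)) r < r + e"
  let ?M = "add_mset (Suc b) (add_mset (Suc a) M)"
  have bd: "power_coeff r e w \<in> N" if "min_sum ?M r < r + e" for r e
    using bd that unfolding degree_bounded_def by blast
  have sN: "subspace N" using N y_stableD by blast
  have le: "min_sum M (Suc r) \<le> min_sum M r + n" using min_sum_Suc_bound[of M r] M by simp
  show "power_coeff r e (y (Suc n) w) \<in> N"
  proof (cases "min_sum ?M r < r + e")
    case True
    then show ?thesis unfolding power_coeff_y using bd N y_stableD by blast
  next
    case False
    then have r: "b < r" using e M(2) by (auto simp: min_def split: if_splits)
    show ?thesis
    proof (cases "min_sum ?M r = r + e")
      case True
      have "power_coeff (Suc r) (e + Suc n) w \<in> N"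
        by (rule bd) (use True r le in auto)
      then show ?thesis unfolding power_coeff_y
        by (intro top_coeff[OF N top]) (use True bd in auto)
    next
      case neq: False
      then have r2: "a < r" "min_sum ?M r = Suc (r + e)" using e False M(2) by (auto simp: min_def split: if_splits)
      have C: "power_coeff (Suc r) (Suc (e + n)) w \<in> N"
        by (rule bd) (use r2 r M(2) le in auto)
      have high: "power_coeff r e' w \<in> N" if "e' > Suc e" for e'
        by (rule bd) (use that r2 in auto)
      define A B where "A = y (Suc n) (power_coeff r e w)" and "B = y n (power_coeff r (Suc e) w)"
      note tt = two_top_coeffs[of N n w e r, OF N top high, folded A_def B_def]
      have AB: "A + B \<in> N" using subspace_diff[OF sN C tt(1)] by (simp add: add.commute)
      have "sc (of_nat (Suc r)) (sc (of_nat (Suc n)) A + sc (of_nat n) B) \<in> N"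
        using subspace_diff[OF sN subspace_scale[OF sN C, of "of_nat (Suc (e + n))"] tt(2)] by (simp del: of_nat_Suc)
      from subspace_scale[OF sN this, of "1 / of_nat (Suc r)"]
      have "sc (of_nat (Suc n)) A + sc (of_nat n) B \<in> N" by (simp del: of_nat_Suc)
      from subspace_diff[OF sN this subspace_scale[OF sN AB, of "of_nat n"]]
      have "A \<in> N" by (simp add: algebra_simps)
      then show ?thesis unfolding A_def power_coeff_y .
    qed
  qed
qed

lemma power_coeff_max:
  assumes N: "y_stable N" and top: "\<And>p. p > n ==> y p w \<in> N"
  shows "power_coeff r (r * n) w - (y n ^^ r) w \<in> N" and "e > r * n ==> power_coeff r e w \<in> N"
proof (induction r arbitrary: e)
  case 0
  { case 1 then show ?case using N by (simp add: subspace_0 y_stableD) }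
  { case 2 then show ?case using N by (simp add: subspace_0 y_stableD) }
next
  case (Suc r)
  have rest: "y p (power_coeff r (e - p) w) \<in> N" if "e \<ge> Suc r * n" "p \<noteq> n \<or> e > Suc r * n" for p e
  proof (cases "p > n")
    case True then show ?thesis using top N by (metis power_coeff_y power_coeff_in)
  next
    case False
    then have "r * n < e - p" using that by auto
    then show ?thesis using Suc y_stableD[OF N] by blast
  qed
  have sN: "subspace N" using N y_stableD by blast
  { case 1
    have "power_coeff (Suc r) (Suc r * n) w = (\<Sum>p\<in>{..Suc r * n}-{n}. y p (power_coeff r (Suc r * n - p) w)) + y n (power_coeff r (r * n) w)"
      unfolding power_coeff.simps by (subst sum.remove[of _ n]) (auto simp: add.commute)
    moreover have "(\<Sum>p\<in>{..Suc r * n}-{n}. y p (power_coeff r (Suc r * n - p) w)) \<in> N"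
      by (rule subspace_sum[OF sN]) (use rest in auto)
    moreover have "y n (power_coeff r (r * n) w) - (y n ^^ Suc r) w \<in> N"
      using y_stableD(2)[OF N Suc(1), of n] y_add[of n "power_coeff r (r * n) w - (y n ^^ r) w" "(y n ^^ r) w"]
      by (simp add: algebra_simps)
    ultimately show ?case by (metis (no_types, lifting) add_diff_eq subspace_add[OF sN]) }
  { case 2 then show ?case using rest by (auto intro!: subspace_sum[OF sN]) }
qed

text \<open>
  Once a power of the top operator is divided out, the smallest part drops by one and the next
  one grows by one: the only coefficients that have to vanish in addition are the top ones for
  the powers from \<open>b + 1\<close> to \<open>a\<close>, and modulo \<open>N\<close> these
  lie in the submodule generated by that power.
\<close>

lemma lower_top_coeff:
  assumes N: "y_stable N" and top: "\<And>p. p > Suc n ==> y p w \<in> N"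
    and bd: "degree_bounded N (add_mset (Suc b) (add_mset a M)) w"
    and M: "size M = n" "Suc b \<le> a" "\<And>x. x \<in># M ==> a \<le> x"
    and N': "y_stable N'" "N \<subseteq> N'" "(y (Suc n) ^^ (Suc b)) w \<in> N'"
  shows "degree_bounded N' (add_mset b (add_mset (Suc a) M)) w"
proof -
  let ?M = "add_mset (Suc b) (add_mset a M)"
  have bd: "power_coeff r e w \<in> N" if "min_sum ?M r < r + e" for r e
    using bd that unfolding degree_bounded_def by blast
  have sN: "subspace N'" using N' y_stableD by blast
  have coeff: "power_coeff r e w \<in> N'" if "Suc b \<le> r" "r \<le> a" "min_sum ?M r = r + e" for r e
    using that
  proof (induction r arbitrary: e rule: dec_induct)
    case base
    have "min_sum M (Suc b) = Suc b * n" using M by (subst min_sum_ge) force+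
    then have "e = Suc b * Suc n" using base M by simp
    then have "power_coeff (Suc b) e w - (y (Suc n) ^^ (Suc b)) w \<in> N'"
      using power_coeff_max(1)[OF N top] N' by blast
    from subspace_add[OF sN this N'(3)] show ?case by simp
  next
    case (step r)
    have "r \<le> x \<and> Suc r \<le> x" if "x \<in># M" for x using M(3)[OF that] step by linarith
    then have "min_sum M r = r * size M" "min_sum M (Suc r) = Suc r * size M" by (intro min_sum_ge; blast)+
    then have ms: "min_sum ?M r = Suc b + r * Suc n" "min_sum ?M (Suc r) = Suc b + Suc r * Suc n"
      using step M by auto
    define e' where "e' = b + r * n"
    have e: "min_sum ?M r = r + Suc e'" "e = Suc (e' + n)" using ms step unfolding e'_def by auto
    have high: "power_coeff r e'' w \<in> N" if "e'' > Suc e'" for e'' by (rule bd) (use that e in auto)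
    define A B C where "A = y (Suc n) (power_coeff r e' w)" and "B = y n (power_coeff r (Suc e') w)"
      and "C = power_coeff (Suc r) (Suc (e' + n)) w"
    note tt = two_top_coeffs[of N n w e' r, OF N top high, folded A_def B_def C_def]
    have B: "B \<in> N'" unfolding B_def using step.IH[of "Suc e'"] e step y_stableD[OF N'(1)] by auto
    have CA: "C - A \<in> N'" using subspace_add[OF sN subsetD[OF N'(2) tt(1)] B] by (simp add: algebra_simps)
    define k where "k = (of_nat (Suc r) * of_nat (Suc n) :: complex)"
    have "sc (of_nat (Suc (e' + n))) C - sc k A \<in> N'"
      using subspace_add[OF sN subsetD[OF N'(2) tt(2)] subspace_scale[OF sN B, of "of_nat (Suc r) * of_nat n"]]
      unfolding k_def by (simp add: scale_right_distrib del: of_nat_Suc)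
    from subspace_diff[OF sN this subspace_scale[OF sN CA, of k]]
    have "sc (of_nat (Suc (e' + n)) - k) C \<in> N'" by (simp add: algebra_simps)
    moreover have "of_nat (Suc (e' + n)) - k \<noteq> 0"
    proof -
      have "Suc (e' + n) < Suc r * Suc n" using step unfolding e'_def by simp
      then show ?thesis unfolding k_def of_nat_mult[symmetric] by (metis eq_iff_diff_eq_0 of_nat_eq_iff nat_neq_iff)
    qed
    ultimately have "C \<in> N'" using subspace_scale[OF sN, of _ "1 / (of_nat (Suc (e' + n)) - k)"] by fastforce
    then show ?case unfolding C_def e .
  qed
  show ?thesis
    unfolding degree_bounded_def
  proof (intro allI impI)
    fix r e assume e: "min_sum (add_mset b (add_mset (Suc a) M)) r < r + e"
    show "power_coeff r e w \<in> N'"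
    proof (cases "min_sum ?M r < r + e")
      case True
      then show ?thesis using bd N'(2) by blast
    next
      case False
      then have "Suc b \<le> r \<and> r \<le> a \<and> min_sum ?M r = r + e"
        using e M(2) by (auto simp: min_def split: if_splits)
      then show ?thesis using coeff by blast
    qed
  qed
qed

lemma drop_zero_part:
  assumes "degree_bounded N (add_mset 0 M) w" "size M = n"
  shows "degree_bounded N M w" "y n w \<in> N"
proof -
  show bd: "degree_bounded N M w" using assms unfolding degree_bounded_def by simp
  have "min_sum M 1 \<le> n" using min_sum_le[of M 1] assms by simp
  then have "power_coeff (Suc 0) n w \<in> N"
    using bd[unfolded degree_bounded_def, rule_format, of "Suc 0" n] by (simp del: power_coeff.simps)
  then show "y n w \<in> N" by (simp only: power_coeff_1)
qed

lemma funpow_y_in: "y_stable N ==> w \<in> N ==> (y p ^^ k) w \<in> N"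
  by (induction k) (auto dest: y_stableD)

lemma y_funpow_commute: "y p ((y p' ^^ k) w) = (y p' ^^ k) (y p w)"
  by (induction k) (simp_all add: y_commute[of p])

lemma funpow_y_in_mon: "(y p ^^ k) w \<in> mon w"
  by (induction k) (auto intro: mon.intros)

lemma drop_two_parts_power:
  assumes N: "y_stable N" and top: "\<And>p. p > Suc n ==> y p w \<in> N"
    and M: "size M = n" "b \<le> a"
    and bd: "degree_bounded N (add_mset b (add_mset a M)) w"
  shows "i \<le> b ==> degree_bounded N (add_mset (b - i) (add_mset (a - i) M)) ((y (Suc n) ^^ i) w)"
proof (induction i)
  case 0 then show ?case using bd by simp
next
  case (Suc i)
  have "degree_bounded N (add_mset (b - Suc i) (add_mset (a - Suc i) M)) (y (Suc n) ((y (Suc n) ^^ i) w))"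
  proof (rule drop_two_parts[OF N])
    show "y p ((y (Suc n) ^^ i) w) \<in> N" if "p > Suc n" for p
      unfolding y_funpow_commute using funpow_y_in[OF N] top that by blast
    show "degree_bounded N (add_mset (Suc (b - Suc i)) (add_mset (Suc (a - Suc i)) M)) ((y (Suc n) ^^ i) w)"
      using Suc M by (simp add: Suc_diff_Suc)
  qed (use M Suc in auto)
  then show ?case by simp
qed

lemma degree_bounded_empty:
  assumes "y_stable N" "\<And>p. y p w \<in> N"
  shows "degree_bounded N {#} w"
  unfolding degree_bounded_def
proof (intro allI impI)
  fix r e assume "min_sum {#} r < r + e"
  then show "power_coeff r e w \<in> N"
    using power_coeff_max(2)[of N 0 w] assms power_coeff_y[of _ _ 0 w]
  proof (cases r)
    case 0
    then show ?thesis using \<open>min_sum {#} r < r + e\<close> assms(1) by (simp add: subspace_0 y_stableD)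
  next
    case (Suc r')
    have "y p (power_coeff r' (e - p) w) \<in> N" for p
      using power_coeff_in[OF assms(1) assms(2)] by (metis power_coeff_y)
    then show ?thesis using Suc y_stableD(1)[OF assms(1)] by (auto intro: subspace_sum)
  qed
qed

text \<open>
  Induction on the number of parts and then on the smallest part \<open>b\<close>, with
  \<open>a\<close> the next one. If \<open>b = 0\<close>, the top operator acts by zero and the
  part can be dropped. Otherwise the span is filtered by the vector \<open>y\<^sub>n ^ b
  w\<close>, where \<open>y\<^sub>n\<close> is the top operator: the submodule has the parts
  \<open>{a - b}\<close> in place of \<open>{a, b}\<close>, and the quotient has \<open>{b - 1,
  a + 1}\<close>. The products of the numbers \<open>x + 1\<close> add up, as \<open>(a - b + 1)
  + b (a + 2) = (a + 1) (b + 1)\<close>.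
\<close>

lemma span_mon_bound:
  assumes "y_stable N" "\<And>p. p \<ge> size M ==> y p w \<in> N" "degree_bounded N M w"
  shows "\<exists>F. finite F \<and> card F \<le> (\<Prod>x\<in>#M. x + 1) \<and> F \<subseteq> mon w \<and> mon w \<subseteq> span (N \<union> F)"
  using assms
proof (induction "size M" arbitrary: M N w rule: less_induct)
  case less
  show ?case
  proof (cases "M = {#}")
    case True
    have "y_stable (span (insert w N))"
      by (rule y_stable_span) (use less.prems True in \<open>auto intro: span_base dest: y_stableD\<close>)
    then have "mon w \<subseteq> span (N \<union> {w})" by (intro mon_subset) (auto intro: span_base)
    then show ?thesis using True by (intro exI[of _ "{w}"]) (auto intro: mon_base)
  next
    case False
    define b where "b = Min_mset M"
    have bM: "b \<in># M" "\<And>x. x \<in># M ==> b \<le> x" using False unfolding b_def by auto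
    then obtain M' where M: "M = add_mset b M'" by (metis mset_add)
    have bM': "\<And>x. x \<in># M' ==> b \<le> x" using bM M by simp
    from less.prems(1,2) less.prems(3) bM' less.hyps show ?thesis unfolding M
    proof (induction b arbitrary: N M')
      case 0
      note IH = 0(5)
      have z: "degree_bounded N M' w" "y (size M') w \<in> N" using drop_zero_part[OF 0(3)] by auto
      have "y p w \<in> N" if "p \<ge> size M'" for p using z(2) 0(2)[of p] that by (cases "p = size M'") auto
      from IH[OF _ 0(1) this z(1)] show ?case by auto
    next
      case (Suc b)
      note hyp = Suc.prems(5)
      let ?n = "size M'"
      let ?P = "\<lambda>K v N. \<exists>F. finite F \<and> card F \<le> (\<Prod>x\<in>#K. x + 1) \<and> F \<subseteq> mon v \<and> mon v \<subseteq> span (N \<union> F)"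
      define g where "g = (y ?n ^^ Suc b) w"
      define N' where "N' = span (N \<union> mon g)"
      have N: "y_stable N" and top: "\<And>p. p > ?n ==> y p w \<in> N" using Suc.prems by auto
      have N': "y_stable N'" "N \<subseteq> N'" "g \<in> N'"
        unfolding N'_def using y_stable_span_mon[OF N] span_superset by (auto intro: mon_base span_base)
      have topg: "y p g \<in> N" if "p > ?n" for p
        unfolding g_def y_funpow_commute using funpow_y_in[OF N top[OF that]] .
      have "\<exists>K K'. size K = ?n \<and> ?P K g N \<and> ?P K' w N' \<and>
        (\<Prod>x\<in>#K. x + 1) + (\<Prod>x\<in>#K'. x + 1) = (\<Prod>x\<in>#add_mset (Suc b) M'. x + 1)"
      proof (cases "M' = {#}")
        case True
        have c0: "power_coeff r 0 v = (y 0 ^^ r) v" for r v by (induction r) auto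
        have "power_coeff (Suc (Suc b)) 0 w \<in> N"
          using Suc.prems(3)[unfolded degree_bounded_def, rule_format, of "Suc (Suc b)" 0] True
          by (simp del: power_coeff.simps)
        then have "y 0 g \<in> N" unfolding c0 g_def using True by simp
        then have yg: "y p g \<in> N" for p using topg True by (cases "p = 0") auto
        have 1: "?P {#} g N" by (rule hyp[OF _ N yg degree_bounded_empty[OF N yg]]) simp
        have "degree_bounded N' {#b#} w"
          unfolding degree_bounded_def
        proof (intro allI impI)
          fix r e assume e: "min_sum {#b#} r < r + e"
          show "power_coeff r e w \<in> N'"
          proof (cases "min (Suc b) r < r + e")
            case True
            then have "power_coeff r e w \<in> N" using Suc.prems(3) \<open>M' = {#}\<close> unfolding degree_bounded_def by auto
            then show ?thesis using N' by auto
          next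
            case False
            then have "r = Suc b" "e = 0" using e by (auto simp: min_def split: if_splits)
            then show ?thesis using c0 N' True unfolding g_def by simp
          qed
        qed
        moreover have "y p w \<in> N'" if "size {#b#} \<le> p" for p
          using that Suc.prems(2)[of p] N'(2) True by auto
        ultimately have "?P {#b#} w N'"
          using Suc.IH[OF N'(1), of "{#}"] hyp True by simp
        with 1 show ?thesis using True by (intro exI[of _ "{#}"] exI[of _ "{#b#}"]) auto
      next
        case False
        define a where "a = Min_mset M'"
        have aM: "a \<in># M'" "\<And>x. x \<in># M' ==> a \<le> x" using False unfolding a_def by auto
        then obtain M'' where M'': "M' = add_mset a M''" by (metis mset_add)
        have ba: "Suc b \<le> a" using Suc.prems(4) aM by auto
        have aM'': "\<And>x. x \<in># M'' ==> a \<le> x" using aM M'' by simp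
        have n: "?n = Suc (size M'')" using M'' by simp
        have top': "\<And>p. p > Suc (size M'') ==> y p w \<in> N" using top n by simp
        have bd: "degree_bounded N (add_mset (Suc b) (add_mset a M'')) w" using Suc.prems(3) M'' by simp
        define K where "K = add_mset (a - Suc b) M''"
        have "degree_bounded N (add_mset 0 K) g"
          using drop_two_parts_power[OF N top' refl ba bd, of "Suc b"] unfolding g_def n K_def by simp
        from drop_zero_part[OF this refl] have Kg: "degree_bounded N K g" "y (size K) g \<in> N" by auto
        have "y p g \<in> N" if "p \<ge> size K" for p
          using that Kg(2) topg[of p] by (cases "p = size K") (auto simp: n K_def)
        then have 1: "?P K g N" by (intro hyp[OF _ N _ Kg(1)]) (auto simp: n K_def)
        have bd': "degree_bounded N' (add_mset b (add_mset (Suc a) M'')) w"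
          by (rule lower_top_coeff[OF N top' bd refl ba aM'' N'(1,2)]) (use N'(3) in \<open>auto simp: g_def n\<close>)
        have 2: "?P (add_mset b (add_mset (Suc a) M'')) w N'"
        proof (rule Suc.IH[OF N'(1) _ bd'])
          show "y p w \<in> N'" if "size (add_mset b (add_mset (Suc a) M'')) \<le> p" for p
            using that Suc.prems(2)[of p] N'(2) M'' by auto
          show "b \<le> x" if "x \<in># add_mset (Suc a) M''" for x
            using that aM''[of x] ba by auto
        qed (use hyp M'' in auto)
        have "size K = ?n" using n K_def by simp
        moreover have "(\<Prod>x\<in>#K. x + 1) + (\<Prod>x\<in>#add_mset b (add_mset (Suc a) M''). x + 1) = (\<Prod>x\<in>#add_mset (Suc b) M'. x + 1)"
        proof -
          obtain k where k: "a = Suc b + k" using ba le_Suc_ex by blast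
          show ?thesis unfolding K_def M'' k by (simp add: algebra_simps)
        qed
        ultimately show ?thesis using 1 2 by blast
      qed
      then obtain K K' F1 F2 where F: "finite F1" "finite F2" "F1 \<subseteq> mon g" "F2 \<subseteq> mon w"
          "mon g \<subseteq> span (N \<union> F1)" "mon w \<subseteq> span (N' \<union> F2)"
        and card: "card F1 + card F2 \<le> (\<Prod>x\<in>#add_mset (Suc b) M'. x + 1)"
        using add_mono by metis
      have gw: "mon g \<subseteq> mon w" using mon_trans funpow_y_in_mon unfolding g_def by blast
      have "N' \<subseteq> span (N \<union> (F1 \<union> F2))"
        unfolding N'_def
        by (rule span_minimal) (use F(5) span_mono[of "N \<union> F1" "N \<union> (F1 \<union> F2)"] in \<open>auto intro: span_base\<close>)
      then have "span (N' \<union> F2) \<subseteq> span (N \<union> (F1 \<union> F2))"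
        by (intro span_minimal) (auto intro: span_base)
      then have "mon w \<subseteq> span (N \<union> (F1 \<union> F2))" using F(6) by blast
      moreover have "F1 \<union> F2 \<subseteq> mon w" using F(3,4) gw by blast
      moreover have "card (F1 \<union> F2) \<le> (\<Prod>x\<in>#add_mset (Suc b) M'. x + 1)"
        using card card_Un_le[of F1 F2] by linarith
      ultimately show ?case using F(1,2) by blast
    qed
  qed
qed

end

section \<open>Anticommuting operators\<close>

text \<open>
  The operators \<open>od p\<close> are the images of the \<open>y p\<close> under the odd
  derivation \<open>D\<close>, so that relations among the \<open>y p\<close> can be
  differentiated.
\<close>

locale odd_currents = currents sc y for sc :: "complex \<Rightarrow> 'v::ab_group_add \<Rightarrow> 'v" and y +
  fixes od :: "nat \<Rightarrow> 'v \<Rightarrow> 'v" and D :: "'v \<Rightarrow> 'v" and \<epsilon> :: complex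
  assumes od_add: "od p (a + b) = od p a + od p b"
    and od_scale: "od p (sc c a) = sc c (od p a)"
    and D_add: "D (a + b) = D a + D b"
    and D_scale: "D (sc c a) = sc c (D a)"
    and od_y: "od p (y p' a) = y p' (od p a)"
    and od_anti: "od p (od p' a) = - od p' (od p a)"
    and D_y: "D (y p a) = y p (D a) + sc \<epsilon> (od p a)"
    and D_od: "D (od p a) = - od p (D a)"
    and \<epsilon>: "\<epsilon> \<noteq> 0"
begin

lemma od_zero [simp]: "od p 0 = 0" and D_zero [simp]: "D 0 = 0"
  using od_add[of p 0 0] D_add[of 0 0] by simp_all

lemma od_sum: "od p (sum f A) = (\<Sum>x\<in>A. od p (f x))" and D_sum: "D (sum f A) = (\<Sum>x\<in>A. D (f x))"
  by (induction A rule: infinite_finite_induct) (auto simp: od_add D_add)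

lemma od_uminus: "od p (- a) = - od p a"
  using od_add[of p a "- a"] by (simp add: eq_neg_iff_add_eq_0 add.commute)

lemma od_square: "od p (od p a) = 0"
proof -
  have "sc 2 (od p (od p a)) = od p (od p a) + od p (od p a)" by (metis one_add_one scale_left_distrib scale_one)
  also have "\<dots> = 0" using od_anti[of p p a] by (metis add.right_inverse)
  finally show ?thesis by simp
qed

lemma power_coeff_od: "power_coeff r e (od p w) = od p (power_coeff r e w)"
  by (induction r arbitrary: e) (auto simp: od_sum od_y)

lemma D_power_coeff:
  "D (power_coeff (Suc r) e w) =
   power_coeff (Suc r) e (D w) + sc (of_nat (Suc r) * \<epsilon>) (\<Sum>p\<le>e. od p (power_coeff r (e - p) w))"
proof (induction r arbitrary: e)
  case 0
  have "(\<Sum>p\<le>e. od p (power_coeff 0 (e - p) w)) = (\<Sum>p\<le>e. if p = e then od e w else 0)"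
    by (rule sum.cong) auto
  then show ?case by (simp add: power_coeff_1 D_y del: power_coeff.simps(2))
next
  case (Suc r)
  let ?c = "power_coeff (Suc r)"
  let ?s = "\<Sum>p\<le>e. od p (?c (e - p) w)"
  have "D (power_coeff (Suc (Suc r)) e w) = (\<Sum>p\<le>e. y p (D (?c (e - p) w)) + sc \<epsilon> (od p (?c (e - p) w)))"
    unfolding power_coeff.simps(2)[of "Suc r"] by (simp only: D_sum D_y)
  also have "\<dots> = (\<Sum>p\<le>e. y p (?c (e - p) (D w))) +
      sc (of_nat (Suc r) * \<epsilon>) (\<Sum>p\<le>e. \<Sum>q\<le>e-p. y p (od q (power_coeff r (e - p - q) w))) + sc \<epsilon> ?s"
    unfolding Suc.IH by (simp only: sum.distrib y_add y_scale y_sum scale_sum_right)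
  also have "(\<Sum>p\<le>e. \<Sum>q\<le>e-p. y p (od q (power_coeff r (e - p - q) w))) = (\<Sum>q\<le>e. \<Sum>p\<le>e-q. y p (od q (power_coeff r (e - p - q) w)))"
    by (rule sum_triangle_swap)
  also have "\<dots> = ?s" by (simp add: od_sum od_y add.commute)
  also have "(\<Sum>p\<le>e. y p (?c (e - p) (D w))) = power_coeff (Suc (Suc r)) e (D w)" by simp
  finally show ?case
    by (simp only: of_nat_Suc[of "Suc r"] distrib_right mult_1_left scale_left_distrib add.assoc add.commute[of "sc \<epsilon> ?s"])
qed

text \<open>
  Differentiating a relation for \<open>Y^(r+1)\<close> gives a relation for \<open>Y^r\<close>
  multiplied by the odd series, whose top term is \<open>od n\<close>.
\<close>

lemma odd_drop:
  assumes N1: "\<And>p a. a \<in> N1 ==> od p a \<in> N2" "\<And>a. a \<in> N1 ==> D a \<in> N2" and N2: "y_stable N2"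
    and w: "D w \<in> N2" "\<And>p. p > n ==> od p w \<in> N2" and bd: "degree_bounded N1 M w"
    and M: "min_sum M (Suc r) \<le> min_sum M r + n" "min_sum M r \<le> r + e"
  shows "power_coeff r e (od n w) \<in> N2"
proof (cases "min_sum M r < r + e")
  case True
  then show ?thesis unfolding power_coeff_od using bd N1 unfolding degree_bounded_def by blast
next
  case False
  then have e: "min_sum M r = r + e" using M by simp
  have s2: "subspace N2" using N2 y_stableD by blast
  have in1: "power_coeff r' e' w \<in> N1" if "min_sum M r' < r' + e'" for r' e'
    using bd that unfolding degree_bounded_def by blast
  define S where "S = (\<Sum>p\<le>e + n. od p (power_coeff r (e + n - p) w))"
  have "power_coeff (Suc r) (e + n) w \<in> N1" by (rule in1) (use M e in simp)
  from N1(2)[OF this] have "sc (of_nat (Suc r) * \<epsilon>) S \<in> N2"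
    unfolding D_power_coeff S_def using power_coeff_in[OF N2 w(1), of "Suc r" "e + n"] subspace_diff[OF s2]
    by (metis add_diff_cancel_left')
  from subspace_scale[OF s2 this, of "inverse (of_nat (Suc r) * \<epsilon>)"] have "S \<in> N2"
    using \<epsilon> by (simp add: field_simps del: of_nat_Suc)
  then have "sum (\<lambda>p. od p (power_coeff r (e + n - p) w)) {n} \<in> N2"
    unfolding S_def
  proof (rule sum_rest_in[OF s2, rotated 2])
    fix p assume "p \<in> {..e + n} - {n}"
    then consider "p > n" | "p < n" by fastforce
    then show "od p (power_coeff r (e + n - p) w) \<in> N2"
    proof cases
      case 1 then show ?thesis using w N2 by (metis power_coeff_od power_coeff_in)
    next
      case 2 then show ?thesis by (intro N1(1) in1) (use e in auto)
    qed
  qed auto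
  then show ?thesis by (simp add: power_coeff_od)
qed

inductive_set words :: "'v \<Rightarrow> 'v set" for w where
  words_base: "w \<in> words w"
| words_y: "a \<in> words w ==> y p a \<in> words w"
| words_o: "a \<in> words w ==> od p a \<in> words w"

definition stable :: "'v set \<Rightarrow> bool" where
  "stable N \<longleftrightarrow> y_stable N \<and> (\<forall>a\<in>N. D a \<in> N \<and> (\<forall>p. od p a \<in> N))"

lemma stableD: "stable N ==> y_stable N" "stable N ==> a \<in> N ==> D a \<in> N" "stable N ==> a \<in> N ==> od p a \<in> N"
  by (auto simp: stable_def)

lemma stable_span:
  assumes "\<And>a p. a \<in> S ==> y p a \<in> span S" "\<And>a p. a \<in> S ==> od p a \<in> span S" "\<And>a. a \<in> S ==> D a \<in> span S"
  shows "stable (span S)"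
proof -
  have "od p a \<in> span S" if "a \<in> span S" for a p
    using that by (induction rule: span_induct_alt) (auto simp: od_add od_scale span_add span_scale assms span_zero)
  moreover have "D a \<in> span S" if "a \<in> span S" for a
    using that by (induction rule: span_induct_alt) (auto simp: D_add D_scale span_add span_scale assms span_zero)
  ultimately show ?thesis using y_stable_span assms(1) by (simp add: stable_def)
qed

lemma words_subset: "stable N ==> w \<in> N ==> words w \<subseteq> N"
proof
  fix a assume "stable N" "w \<in> N" "a \<in> words w"
  from this(3) show "a \<in> N" by induction (use \<open>stable N\<close> \<open>w \<in> N\<close> in \<open>auto dest: stableD y_stableD\<close>)
qed

lemma words_trans: "a \<in> words b ==> b \<in> words w ==> a \<in> words w"
  by (induction rule: words.induct) (auto intro: words.intros)

lemma mon_words: "mon w \<subseteq> words w"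
proof
  fix a assume "a \<in> mon w" then show "a \<in> words w" by induction (auto intro: words.intros)
qed

lemma stable_span_words:
  assumes "stable N" "D w \<in> span (N \<union> words w)"
  shows "stable (span (N \<union> words w))"
proof (rule stable_span)
  have "D a \<in> span (N \<union> words w)" if "a \<in> words w" for a
  proof -
    have yo: "y p b \<in> span (N \<union> words w) \<and> od p b \<in> span (N \<union> words w)" if "b \<in> span (N \<union> words w)" for b p
      using that
    proof (induction rule: span_induct_alt)
      case (step c x z)
      then have "y p x \<in> span (N \<union> words w)" "od p x \<in> span (N \<union> words w)"
        using stableD[OF assms(1)] y_stableD by (auto intro!: span_base words.intros)
      then show ?case using step by (simp add: y_add od_add y_scale od_scale span_add span_scale)
    qed (simp add: span_zero)
    from that show ?thesis
      by induction (use assms(2) yo in \<open>auto simp: D_y D_od intro!: span_add span_neg span_scale intro: span_base words.intros\<close>)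
  qed
  then show "D a \<in> span (N \<union> words w)" if "a \<in> N \<union> words w" for a
    using that stableD[OF assms(1)] by (auto intro: span_base)
qed (use stableD[OF assms(1)] y_stableD in \<open>auto intro!: span_base intro: words.intros\<close>)

text \<open>
  The span is filtered by \<open>od n w\<close> with \<open>n\<close> the top index. In the
  submodule generated by that vector the smallest part of \<open>P\<close> is lowered by one and
  moves to \<open>Q\<close>; in the quotient it moves to \<open>Q\<close> unchanged, since
  \<open>od n\<close> acts by zero. The bounds add up because \<open>2 x + 1\<close> is the sum
  of \<open>(x - 1) + 1\<close> and \<open>x + 1\<close>.
\<close>

lemma span_words_bound:
  assumes "stable N" "D w \<in> N" "\<And>p. p \<ge> size (P + Q) ==> y p w \<in> N" "\<And>p. p \<ge> size P ==> od p w \<in> N"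
    and "degree_bounded N (P + Q) w" "\<And>x z. x \<in># P ==> z \<in># Q ==> z \<le> x"
  shows "\<exists>F. finite F \<and> card F \<le> (\<Prod>x\<in>#P. 2 * x + 1) * (\<Prod>x\<in>#Q. x + 1) \<and> F \<subseteq> words w \<and> words w \<subseteq> span (N \<union> F)"
  using assms
proof (induction "size P" arbitrary: P Q N w)
  case 0
  then have P: "P = {#}" by simp
  have N: "y_stable N" using 0 stableD by blast
  obtain F where F: "finite F" "card F \<le> (\<Prod>x\<in>#Q. x + 1)" "F \<subseteq> mon w" "mon w \<subseteq> span (N \<union> F)"
    using span_mon_bound[OF N, of Q w] 0 P by auto
  have "a \<in> mon w \<or> a \<in> N" if "a \<in> words w" for a
    using that
  proof induction
    case (words_o a p)
    have "od p b \<in> N" if "b \<in> mon w" for b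
      using that by induction (use 0 P N y_stableD in \<open>auto simp: od_y\<close>)
    then show ?case using words_o stableD[OF 0(2)] by auto
  qed (use N y_stableD in \<open>auto intro: mon.intros\<close>)
  then have "words w \<subseteq> span (N \<union> F)" using F(4) by (auto intro: span_base)
  moreover have "F \<subseteq> words w" using F(3) mon_words by blast
  ultimately show ?case using F(1,2) P by auto
next
  case (Suc n)
  define a where "a = Min_mset P"
  have "P \<noteq> {#}" using Suc by auto
  then have aM: "a \<in># P" "\<And>x. x \<in># P ==> a \<le> x" unfolding a_def by auto
  then obtain P' where P: "P = add_mset a P'" by (metis mset_add)
  have n: "size P' = n" using Suc P by simp
  note N = Suc.prems(1)
  have Ny: "y_stable N" "subspace N" using stableD[OF N] y_stableD by auto
  define v where "v = od n w"
  have drop: "power_coeff r e v \<in> N" if "a \<le> r" "min_sum (P + Q) r \<le> r + e" for r e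
    unfolding v_def
  proof (rule odd_drop[OF _ _ Ny(1) Suc.prems(2) _ Suc.prems(5) _ that(2)])
    have "filter_mset (\<lambda>x. x > r) (P + Q) = filter_mset (\<lambda>x. x > r) P'"
    proof -
      have "z \<le> r" if "z \<in># Q" for z using Suc.prems(6)[OF aM(1) that] \<open>a \<le> r\<close> by simp
      then have "filter_mset (\<lambda>x. x > r) Q = {#}" by (simp add: leD)
      then show ?thesis using P \<open>a \<le> r\<close> by simp
    qed
    then show "min_sum (P + Q) (Suc r) \<le> min_sum (P + Q) r + n"
      unfolding min_sum_Suc using size_filter_mset_lesseq[of _ P'] n by simp
  qed (use stableD[OF N] Suc.prems(4) P n in auto)
  have Dv: "D v \<in> N" using Suc.prems(2) stableD(3)[OF N] subspace_neg[OF Ny(2)] unfolding v_def D_od by blast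
  have yv: "y p v \<in> N" if "p \<ge> size (P + Q)" for p
    unfolding v_def od_y[symmetric] using stableD[OF N] Suc.prems(3)[OF that] by blast
  have ov: "od p v \<in> N" if "p \<ge> n" for p
  proof (cases "p = n")
    case True then show ?thesis unfolding v_def by (simp add: od_square subspace_0[OF Ny(2)])
  next
    case False
    then have "od p w \<in> N" using Suc.prems(4)[of p] P n that by auto
    then show ?thesis unfolding v_def by (metis od_anti subspace_neg[OF Ny(2)] stableD(3)[OF N])
  qed
  let ?R = "\<lambda>P Q N w k. \<exists>F. finite F \<and> card F \<le> k \<and> F \<subseteq> words w \<and> words w \<subseteq> span (N \<union> F)"
  define c where "c = (\<Prod>x\<in>#P'. 2 * x + 1) * (\<Prod>x\<in>#Q. x + 1)"
  have 1: "?R P' Q N v (a * c)"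
  proof (cases "a = 0")
    case True
    have "power_coeff 0 0 v \<in> N" by (rule drop) (simp_all add: True min_sum_def)
    then have "words v \<subseteq> N" using words_subset[OF N] by simp
    then show ?thesis using span_superset[of N] by (intro exI[of _ "{}"]) auto
  next
    case False
    have "degree_bounded N (P' + add_mset (a - 1) Q) v"
      unfolding degree_bounded_def
    proof (intro allI impI)
      fix r e assume e: "min_sum (P' + add_mset (a - 1) Q) r < r + e"
      have ms: "min_sum (P + Q) r = min_sum P' r + min_sum Q r + min a r"
        "min_sum (P' + add_mset (a - 1) Q) r = min_sum P' r + min_sum Q r + min (a - 1) r"
        unfolding P min_sum_def by simp_all
      show "power_coeff r e v \<in> N"
      proof (cases "a \<le> r")
        case True
        then show ?thesis using e ms False by (intro drop) auto
      next
        case False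
        then have "power_coeff r e w \<in> N" using Suc.prems(5) e ms unfolding degree_bounded_def by auto
        then show ?thesis unfolding v_def power_coeff_od by (rule stableD(3)[OF N])
      qed
    qed
    then have "?R P' (add_mset (a - 1) Q) N v ((\<Prod>x\<in>#P'. 2 * x + 1) * (\<Prod>x\<in>#add_mset (a - 1) Q. x + 1))"
    proof (intro Suc.hyps(1)[OF n[symmetric] N Dv])
      show "z \<le> x" if "x \<in># P'" "z \<in># add_mset (a - 1) Q" for x z
        using that aM(2)[of x] Suc.prems(6)[of x z] P by auto
    qed (use yv ov n P in auto)
    then show ?thesis unfolding c_def using False by (simp add: mult_ac)
  qed
  define N1 where "N1 = span (N \<union> words v)"
  have N1: "stable N1" "N \<subseteq> N1" "v \<in> N1"
    unfolding N1_def using stable_span_words[OF N] Dv span_superset by (auto intro: span_base words.intros)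
  have 2: "?R P' (add_mset a Q) N1 w ((\<Prod>x\<in>#P'. 2 * x + 1) * (\<Prod>x\<in>#add_mset a Q. x + 1))"
  proof (rule Suc.hyps(1)[OF n[symmetric] N1(1)])
    show "D w \<in> N1" using Suc.prems(2) N1 by auto
    show "y p w \<in> N1" if "size (P' + add_mset a Q) \<le> p" for p
      using that Suc.prems(3)[of p] P N1 by auto
    show "od p w \<in> N1" if "size P' \<le> p" for p
      using that Suc.prems(4)[of p] P N1(2,3) n unfolding v_def by (cases "p = n") auto
    show "degree_bounded N1 (P' + add_mset a Q) w"
      using Suc.prems(5) N1(2) P unfolding degree_bounded_def by auto
    show "z \<le> x" if "x \<in># P'" "z \<in># add_mset a Q" for x z
      using that aM(2)[of x] Suc.prems(6)[of x z] P by auto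
  qed
  have c': "(\<Prod>x\<in>#P'. 2 * x + 1) * (\<Prod>x\<in>#add_mset a Q. x + 1) = (a + 1) * c"
    unfolding c_def by (simp add: algebra_simps)
  obtain F1 F2 where F: "finite F1" "finite F2" "F1 \<subseteq> words v" "F2 \<subseteq> words w"
      "words v \<subseteq> span (N \<union> F1)" "words w \<subseteq> span (N1 \<union> F2)"
      and card: "card F1 \<le> a * c" "card F2 \<le> (a + 1) * c"
    using 1 2 unfolding c' by auto
  have vw: "words v \<subseteq> words w" using words_trans words_o[OF words_base] unfolding v_def by blast
  have "N1 \<subseteq> span (N \<union> (F1 \<union> F2))"
    unfolding N1_def
    by (rule span_minimal) (use F(5) span_mono[of "N \<union> F1" "N \<union> (F1 \<union> F2)"] in \<open>auto intro: span_base\<close>)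
  then have "span (N1 \<union> F2) \<subseteq> span (N \<union> (F1 \<union> F2))"
    by (intro span_minimal) (auto intro: span_base)
  moreover have "card (F1 \<union> F2) \<le> (2 * a + 1) * c"
    using card card_Un_le[of F1 F2] by (simp add: algebra_simps)
  ultimately show ?case
    using F vw unfolding P c_def by (intro exI[of _ "F1 \<union> F2"]) (auto simp: mult_ac)
qed

definition odd_word :: "nat set \<Rightarrow> 'v \<Rightarrow> 'v" where
  "odd_word A w = foldr od (sorted_list_of_set A) w"

lemma odd_word_empty [simp]: "odd_word {} w = w"
  by (simp add: odd_word_def)

lemma odd_word_insert_min: "finite A ==> \<forall>a\<in>A. b < a ==> odd_word (insert b A) w = od b (odd_word A w)"
  unfolding odd_word_def using insort_is_Cons[of "sorted_list_of_set A" "\<lambda>x. x" b]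
  by (subst sorted_list_of_set_insert) (auto simp: less_imp_le)

lemma foldr_od_zero: "od p w = 0 ==> od p (foldr od as w) = 0"
  by (induction as) (auto simp: od_anti[of p])

lemma foldr_D_zero: "D w = 0 ==> D (foldr od as w) = 0"
  by (induction as) (auto simp: D_od)

lemma od_odd_word:
  assumes "finite A"
  shows "(p \<in> A \<longrightarrow> od p (odd_word A w) = 0) \<and>
    (p \<notin> A \<longrightarrow> od p (odd_word A w) = odd_word (insert p A) w \<or> od p (odd_word A w) = - odd_word (insert p A) w)"
  using assms
proof (induction A rule: finite_linorder_min_induct)
  case empty
  then show ?case by (simp add: odd_word_def)
next
  case (insert b A)
  note b = odd_word_insert_min[OF insert(1,2)]
  consider "p = b" | "p < b" | "p > b" by linarith
  then show ?case
  proof cases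
    case 1 then show ?thesis by (simp add: b od_square)
  next
    case 2
    then have "odd_word (insert p (insert b A)) w = od p (odd_word (insert b A) w)"
      by (intro odd_word_insert_min) (use insert in auto)
    moreover have "p \<notin> insert b A" using 2 insert by auto
    ultimately show ?thesis by simp
  next
    case 3
    have *: "od p (odd_word (insert b A) w) = - od b (od p (odd_word A w))"
      unfolding b by (rule od_anti)
    show ?thesis
    proof (cases "p \<in> A")
      case True then show ?thesis using * insert by simp
    next
      case False
      then have "odd_word (insert b (insert p A)) w = od b (odd_word (insert p A) w)"
        by (intro odd_word_insert_min) (use insert 3 in auto)
      then show ?thesis using * insert.IH False 3 by (auto simp: od_uminus insert_commute)
    qed
  qed
qed

end

text \<open>
  The order of the sets by their largest differing element; it makes the products of odd
  operators into a filtration.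
\<close>

definition precedes :: "nat set \<Rightarrow> nat set \<Rightarrow> bool" where
  "precedes B A \<longleftrightarrow> card B = card A \<and> (\<exists>m. m \<in> B \<and> m \<notin> A \<and> (\<forall>k>m. k \<in> B \<longleftrightarrow> k \<in> A))"

lemma precedes_insert_insert:
  assumes "finite A" "finite B" "\<forall>a\<in>A. b < a" "precedes B A" "p \<notin> B"
  shows "precedes (insert p B) (insert b A)"
proof -
  obtain m where m: "card B = card A" "m \<in> B" "m \<notin> A" "\<forall>k>m. k \<in> B \<longleftrightarrow> k \<in> A"
    using assms(4) unfolding precedes_def by blast
  have "b \<notin> A" using assms(3) by blast
  then have card: "card (insert p B) = card (insert b A)" using assms m by simp
  have "m > b"
  proof (rule ccontr)
    assume "\<not> m > b"
    then have "insert m A \<subseteq> B" using m assms(3) by force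
    then have "card (insert m A) \<le> card B" using assms(2) card_mono by blast
    then show False using m assms(1) by simp
  qed
  show ?thesis
  proof (cases "p > m")
    case True
    then show ?thesis unfolding precedes_def using card m \<open>m > b\<close> assms(5)
      by (intro conjI exI[of _ p]) auto
  next
    case False
    then show ?thesis unfolding precedes_def using card m \<open>m > b\<close> by (intro conjI exI[of _ m]) auto
  qed
qed

lemma precedes_insert: "finite A ==> \<forall>a\<in>A. b < a ==> b < p ==> p \<notin> A ==> precedes (insert p A) (insert b A)"
  unfolding precedes_def by (intro conjI exI[of _ p]) (auto simp: card_insert_if)

lemma precedes_sum_less:
  assumes "finite A" "finite B" "precedes B A"
  shows "(\<Sum>a\<in>A. 2 ^ a) < (\<Sum>b\<in>B. 2 ^ b :: nat)"
proof -
  obtain m where m: "m \<in> B" "m \<notin> A" "\<forall>k>m. k \<in> B \<longleftrightarrow> k \<in> A"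
    using assms(3) unfolding precedes_def by blast
  define C where "C = {a \<in> A. a > m}"
  have "(\<Sum>a\<in>A. 2 ^ a) \<le> (\<Sum>a\<in>C \<union> {..<m}. 2 ^ a :: nat)"
    by (rule sum_mono2) (use m assms(1) in \<open>auto simp: C_def not_less_iff_gr_or_eq\<close>)
  also have "\<dots> = (\<Sum>a\<in>C. 2 ^ a) + (\<Sum>a<m. 2 ^ a)"
    by (rule sum.union_disjoint) (use assms(1) in \<open>auto simp: C_def\<close>)
  also have "(\<Sum>a<m. 2 ^ a) < (2 ^ m :: nat)" using sum_power2[of m] by (simp add: atLeast0LessThan)
  also have "(\<Sum>a\<in>C. 2 ^ a) + 2 ^ m = (\<Sum>a\<in>insert m C. 2 ^ a :: nat)"
    using assms(1) by (subst sum.insert) (auto simp: C_def)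
  also have "\<dots> \<le> (\<Sum>b\<in>B. 2 ^ b)"
    by (rule sum_mono2) (use m assms(2) in \<open>auto simp: C_def\<close>)
  finally show ?thesis by simp
qed

definition lowered_parts :: "nat \<Rightarrow> (nat \<Rightarrow> nat) \<Rightarrow> nat set \<Rightarrow> nat multiset" where
  "lowered_parts q \<xi> A = image_mset (\<lambda>i. if i \<in> A then \<xi> i - 1 else \<xi> i) (mset_set {..<q})"

lemma size_lowered_parts [simp]: "size (lowered_parts q \<xi> A) = q"
  by (simp add: lowered_parts_def)

lemma min_sum_lowered_parts: "min_sum (lowered_parts q \<xi> A) r = (\<Sum>i<q. min (if i \<in> A then \<xi> i - 1 else \<xi> i) r)"
  by (simp add: min_sum_def lowered_parts_def sum_unfold_sum_mset image_mset.compositionality o_def)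

context odd_currents
begin

definition preceding_span :: "nat \<Rightarrow> 'v \<Rightarrow> nat set \<Rightarrow> 'v set" where
  "preceding_span q w A = span (\<Union>B\<in>{B. B \<subseteq> {..<q} \<and> precedes B A}. mon (odd_word B w))"

text \<open>
  Induction on \<open>A\<close>, adding its minimum. In the relation of \<open>odd_drop\<close>,
  a term with an index larger than the minimum produces a product over a set that precedes
  \<open>A\<close>.
\<close>

lemma odd_word_degree_bounded:
  assumes w: "D w = 0" "\<And>p. p \<ge> q ==> od p w = 0" "degree_bounded {0} (lowered_parts q \<xi> {}) w"
    and \<xi>: "\<And>i j. i \<le> j ==> j < q ==> \<xi> j \<le> \<xi> i"
    and A: "A \<subseteq> {..<q}"
  shows "degree_bounded (preceding_span q w A) (lowered_parts q \<xi> A) (odd_word A w)"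
proof -
  have "finite A" using A finite_subset by blast
  then show ?thesis using A
  proof (induction A rule: finite_linorder_min_induct)
    case empty
    then show ?case using w(3) by (auto simp: degree_bounded_def preceding_span_def span_zero)
  next
    case (insert b A)
    let ?N1 = "preceding_span q w A" and ?N2 = "preceding_span q w (insert b A)" and ?w = "odd_word A w"
    let ?M1 = "lowered_parts q \<xi> A" and ?M2 = "lowered_parts q \<xi> (insert b A)"
    have bq: "b < q" "A \<subseteq> {..<q}" using insert by auto
    have bA: "b \<notin> A" using insert by auto
    have N2: "y_stable ?N2" "subspace ?N2"
      unfolding preceding_span_def by (auto intro!: y_stable_span span_base intro: mon_step)
    have in2: "odd_word B w \<in> ?N2" if "B \<subseteq> {..<q}" "precedes B (insert b A)" for B
      unfolding preceding_span_def using that by (auto intro!: span_base mon_base)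
    have step: "od p (odd_word B w) \<in> ?N2"
      if "B \<subseteq> {..<q}" "\<And>p. p \<notin> B ==> p < q ==> P p ==> precedes (insert p B) (insert b A)" "P p" for B p P
    proof (cases "p < q \<and> p \<notin> B")
      case True
      then have "odd_word (insert p B) w \<in> ?N2" using that by (intro in2) auto
      then show ?thesis using od_odd_word[of B p w] True that(1) finite_subset N2(2)
        by (metis finite_lessThan subspace_neg)
    next
      case False
      then have "od p (odd_word B w) = 0"
        using od_odd_word[of B p w] that(1) finite_subset w(2)[of p] foldr_od_zero[of p w]
        unfolding odd_word_def by (metis finite_lessThan not_less)
      then show ?thesis using N2(2) by (simp add: subspace_0)
    qed
    have o12: "od p a \<in> ?N2" and D12: "D a \<in> ?N2" if "a \<in> ?N1" for a p
    proof -
      have gen: "(\<forall>p. od p a \<in> ?N2) \<and> D a \<in> ?N2"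
        if "a \<in> mon (odd_word B w)" "B \<subseteq> {..<q}" "precedes B A" for a B
        using that(1)
      proof induction
        case mon_base
        have "od p (odd_word B w) \<in> ?N2" for p
          by (rule step[where P="\<lambda>_. True", OF that(2)])
            (use precedes_insert_insert[OF insert(1) finite_subset[OF that(2)] insert(2) that(3)] in auto)
        moreover have "D (odd_word B w) = 0" unfolding odd_word_def by (rule foldr_D_zero[OF w(1)])
        ultimately show ?case using N2(2) by (simp add: subspace_0)
      next
        case (mon_step a p)
        then show ?case using N2 y_stableD(2)[OF N2(1)] by (auto simp: od_y D_y intro!: subspace_add subspace_scale)
      qed
      have "(\<forall>p. od p a \<in> ?N2) \<and> D a \<in> ?N2"
        using that unfolding preceding_span_def[of q w A]
      proof (induction rule: span_induct_alt)
        case base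
        then show ?case using N2(2) by (simp add: subspace_0)
      next
        case (step c x z)
        then show ?case using gen N2(2) by (auto simp: od_add D_add od_scale D_scale intro!: subspace_add subspace_scale)
      qed
      then show "od p a \<in> ?N2" "D a \<in> ?N2" by auto
    qed
    have IH: "degree_bounded ?N1 ?M1 ?w" using insert by simp
    have drop: "power_coeff r e (od b ?w) \<in> ?N2" if "\<xi> b \<le> r" "min_sum ?M1 r \<le> r + e" for r e
    proof (rule odd_drop[OF o12 D12 N2(1) _ _ IH _ that(2)])
      show "D ?w \<in> ?N2" using foldr_D_zero[OF w(1)] N2(2) unfolding odd_word_def by (simp add: subspace_0)
      show "od p ?w \<in> ?N2" if "b < p" for p
        by (rule step[where P="\<lambda>p. b < p", OF bq(2) precedes_insert]) (use that insert in auto)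
      have "size (filter_mset (\<lambda>x. x > r) ?M1) = card {i \<in> {..<q}. (if i \<in> A then \<xi> i - 1 else \<xi> i) > r}"
        unfolding lowered_parts_def filter_mset_image_mset by (simp add: filter_mset_mset_set[symmetric])
      also have "\<dots> \<le> card {..<b}"
      proof (rule card_mono)
        show "{i \<in> {..<q}. (if i \<in> A then \<xi> i - 1 else \<xi> i) > r} \<subseteq> {..<b}"
        proof
          fix i assume "i \<in> {i \<in> {..<q}. (if i \<in> A then \<xi> i - 1 else \<xi> i) > r}"
          then have "i < q" "\<xi> i > r" by (auto split: if_splits)
          then show "i \<in> {..<b}" using \<xi>[of b i] \<open>\<xi> b \<le> r\<close> by (auto simp: not_less[symmetric])
        qed
      qed simp
      finally show "min_sum ?M1 (Suc r) \<le> min_sum ?M1 r + b" unfolding min_sum_Suc by simp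
    qed
    have ms: "min_sum ?M1 r \<le> min_sum ?M2 r + of_bool (\<xi> b \<le> r)" for r
    proof -
      have "min_sum ?M2 r = min (\<xi> b - 1) r + (\<Sum>i\<in>{..<q}-{b}. min (if i \<in> insert b A then \<xi> i - 1 else \<xi> i) r)"
        unfolding min_sum_lowered_parts using bq by (subst sum.remove[of _ b]) auto
      also have "(\<Sum>i\<in>{..<q}-{b}. min (if i \<in> insert b A then \<xi> i - 1 else \<xi> i) r)
          = (\<Sum>i\<in>{..<q}-{b}. min (if i \<in> A then \<xi> i - 1 else \<xi> i) r)" by (rule sum.cong) auto
      finally have 2: "min_sum ?M2 r = min (\<xi> b - 1) r + (\<Sum>i\<in>{..<q}-{b}. min (if i \<in> A then \<xi> i - 1 else \<xi> i) r)" .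
      have "min_sum ?M1 r = min (\<xi> b) r + (\<Sum>i\<in>{..<q}-{b}. min (if i \<in> A then \<xi> i - 1 else \<xi> i) r)"
        unfolding min_sum_lowered_parts using bq bA by (subst sum.remove[of _ b]) auto
      then show ?thesis unfolding 2 by (auto simp: min_def)
    qed
    show ?case
      unfolding degree_bounded_def odd_word_insert_min[OF insert(1,2)]
    proof (intro allI impI)
      fix r e assume e: "min_sum ?M2 r < r + e"
      show "power_coeff r e (od b ?w) \<in> ?N2"
      proof (cases "\<xi> b \<le> r")
        case True
        then show ?thesis using drop ms[of r] e by auto
      next
        case False
        then have "power_coeff r e ?w \<in> ?N1" using IH ms[of r] e unfolding degree_bounded_def by auto
        then show ?thesis unfolding power_coeff_od by (rule o12)
      qed
    qed
  qed
qed

end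

section \<open>The upper bound in terms of operators\<close>

lemma sum_triangle_diagonal:
  fixes f :: "nat \<Rightarrow> 'v::comm_monoid_add"
  shows "(\<Sum>p\<le>s. \<Sum>q\<le>s-p. f (p + q)) = (\<Sum>t\<le>s. \<Sum>i\<le>t. f t)"
proof -
  have "(\<Sum>p\<le>s. \<Sum>q\<le>s-p. f (p + q)) = (\<Sum>(p, q)\<in>{(p, q). p + q \<le> s}. f (p + q))"
    by (subst sum.Sigma) (auto intro!: sum.cong)
  also have "\<dots> = (\<Sum>t\<le>s. \<Sum>i\<le>t. f (i + (t - i)))"
    by (rule sum.triangle_reindex_eq)
  finally show ?thesis by simp
qed

lemma (in currents) y_uminus: "y p (- a) = - y p a"
  using y_add[of p a "- a"] by (simp add: eq_neg_iff_add_eq_0 add.commute)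

text \<open>
  Here \<open>y\<close>, \<open>x\<close>, \<open>\<eta>\<close>, \<open>h\<^sub>1\<close>,
  \<open>h\<^sub>2\<close> stand for the currents of \<open>E32\<close>, \<open>E12\<close>,
  \<open>E31\<close>, \<open>h1\<close>, \<open>h2\<close>, while \<open>d\<close>,
  \<open>\<delta>\<close>, \<open>X\<close> stand for \<open>E13\<close>, \<open>E21\<close> in
  degree \<open>0\<close> and \<open>E23\<close> in degree \<open>1\<close>.
\<close>

locale sl12_currents = vector_space sc for sc :: "complex \<Rightarrow> 'v::ab_group_add \<Rightarrow> 'v" +
  fixes y x \<eta> h\<^sub>1 h\<^sub>2 :: "nat \<Rightarrow> 'v \<Rightarrow> 'v" and d \<delta> X :: "'v \<Rightarrow> 'v" and v :: 'v and \<kappa> :: complex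
  assumes x_currents: "odd_currents sc y x d 1" and \<eta>_currents: "odd_currents sc y \<eta> \<delta> (-1)"
    and x_\<eta>: "x p (\<eta> p' a) = y (p + p') a - \<eta> p' (x p a)"
    and \<delta>_x: "\<delta> (x p a) = h\<^sub>1 p a - x p (\<delta> a)"
    and h\<^sub>1_x: "h\<^sub>1 p (x p' a) = x p' (h\<^sub>1 p a)"
    and X_add: "X (a + b) = X a + X b"
    and h\<^sub>2_add: "h\<^sub>2 p (a + b) = h\<^sub>2 p a + h\<^sub>2 p b"
    and X_y: "X (y p a) = y p (X a) + h\<^sub>2 (Suc p) a"
    and h\<^sub>2_y: "h\<^sub>2 p (y p' a) = y p' (h\<^sub>2 p a) - sc 2 (y (p + p') a)"
    and v: "d v = 0" "\<delta> v = 0" "X v = 0" "h\<^sub>1 p v = (if p = 0 then sc \<kappa> v else 0)" "h\<^sub>2 (Suc p) v = 0"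
begin

sublocale x: odd_currents sc y x d 1 by (rule x_currents)
sublocale \<eta>: odd_currents sc y \<eta> \<delta> "-1" by (rule \<eta>_currents)

abbreviation "power_coeff \<equiv> x.power_coeff"

lemma h\<^sub>2_power_coeff:
  "h\<^sub>2 (Suc p) (power_coeff (Suc r) e v) = sc (- 2 * of_nat (Suc r)) (\<Sum>q\<le>e. y (Suc p + q) (power_coeff r (e - q) v))"
proof (induction r arbitrary: e)
  case 0
  have "(\<Sum>q\<le>e. y (Suc p + q) (power_coeff 0 (e - q) v)) = (\<Sum>q\<le>e. if q = e then y (Suc p + e) v else 0)"
    by (rule sum.cong) auto
  then show ?case by (simp add: x.power_coeff_1 h\<^sub>2_y v del: x.power_coeff.simps(2))
next
  case (Suc r)
  let ?c = "power_coeff (Suc r)"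
  let ?s = "\<Sum>q\<le>e. y (Suc p + q) (?c (e - q) v)"
  have hs: "h\<^sub>2 p (sum f A) = (\<Sum>i\<in>A. h\<^sub>2 p (f i))" for p A and f :: "nat \<Rightarrow> 'v"
    using h\<^sub>2_add[of p 0 0] by (induction A rule: infinite_finite_induct) (auto simp: h\<^sub>2_add)
  have "h\<^sub>2 (Suc p) (power_coeff (Suc (Suc r)) e v) = (\<Sum>q\<le>e. y q (h\<^sub>2 (Suc p) (?c (e - q) v)) - sc 2 (y (Suc p + q) (?c (e - q) v)))"
    unfolding x.power_coeff.simps(2)[of "Suc r"] by (simp only: hs h\<^sub>2_y)
  also have "\<dots> = sc (- 2 * of_nat (Suc r)) (\<Sum>q\<le>e. \<Sum>i\<le>e-q. y q (y (Suc p + i) (power_coeff r (e - q - i) v))) - sc 2 ?s"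
    unfolding Suc.IH by (simp only: sum_subtractf x.y_scale x.y_sum scale_sum_right)
  also have "(\<Sum>q\<le>e. \<Sum>i\<le>e-q. y q (y (Suc p + i) (power_coeff r (e - q - i) v)))
     = (\<Sum>i\<le>e. \<Sum>q\<le>e-i. y q (y (Suc p + i) (power_coeff r (e - q - i) v)))"
    by (rule sum_triangle_swap)
  also have "\<dots> = (\<Sum>i\<le>e. \<Sum>q\<le>e-i. y (Suc p + i) (y q (power_coeff r (e - i - q) v)))"
    by (intro sum.cong refl) (simp add: x.y_commute[of "Suc _"] add.commute)
  also have "\<dots> = ?s" by (simp add: x.y_sum)
  finally have *: "h\<^sub>2 (Suc p) (power_coeff (Suc (Suc r)) e v) = sc (- 2 * of_nat (Suc r)) ?s - sc 2 ?s" .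
  have k: "(- 2 * of_nat (Suc (Suc r)) :: complex) = - 2 * of_nat (Suc r) - 2" by simp
  show ?case unfolding * k scale_left_diff_distrib ..
qed

text \<open>
  Garland's identity in the form needed here: up to a nonzero scalar, \<open>X\<close> lowers
  the power and raises the degree by one, so that the vanishing of \<open>y 0 ^ (n+1) v\<close>
  propagates to coefficients of lower powers.
\<close>

lemma X_power_coeff:
  "X (power_coeff (Suc r) s v) = sc (- of_nat (Suc r) * of_nat (Suc s)) (power_coeff r (Suc s) v)"
proof (induction r arbitrary: s)
  case 0
  show ?case by (simp add: x.power_coeff_1 X_y v del: x.power_coeff.simps(2))
next
  case (Suc r)
  let ?c = "power_coeff (Suc r)"
  have Xs: "X (sum f A) = (\<Sum>i\<in>A. X (f i))" for A and f :: "nat \<Rightarrow> 'v"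
    using X_add[of 0 0] by (induction A rule: infinite_finite_induct) (auto simp: X_add)
  let ?a = "\<lambda>p. y p (power_coeff r (Suc s - p) v)"
  have "X (power_coeff (Suc (Suc r)) s v) = (\<Sum>p\<le>s. y p (X (?c (s - p) v)) + h\<^sub>2 (Suc p) (?c (s - p) v))"
    unfolding x.power_coeff.simps(2)[of "Suc r"] by (simp only: Xs X_y)
  also have "\<dots> = (\<Sum>p\<le>s. y p (X (?c (s - p) v))) + (\<Sum>p\<le>s. h\<^sub>2 (Suc p) (?c (s - p) v))"
    by (rule sum.distrib)
  also have "(\<Sum>p\<le>s. y p (X (?c (s - p) v))) = sc (- of_nat (Suc r)) (\<Sum>p\<le>s. sc (of_nat (Suc s - p)) (?a p))"
    unfolding Suc.IH scale_sum_right by (rule sum.cong) (auto simp: x.y_scale x.y_uminus Suc_diff_le simp del: of_nat_Suc)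
  also have "(\<Sum>p\<le>s. sc (of_nat (Suc s - p)) (?a p)) = (\<Sum>p\<le>Suc s. sc (of_nat (Suc s - p)) (?a p))"
    by simp
  also have "(\<Sum>p\<le>s. h\<^sub>2 (Suc p) (?c (s - p) v)) =
     sc (- 2 * of_nat (Suc r)) (\<Sum>p\<le>s. \<Sum>q\<le>s-p. y (Suc (p + q)) (power_coeff r (s - (p + q)) v))"
    unfolding h\<^sub>2_power_coeff scale_sum_right by simp
  also have "(\<Sum>p\<le>s. \<Sum>q\<le>s-p. y (Suc (p + q)) (power_coeff r (s - (p + q)) v)) =
      (\<Sum>t\<le>s. \<Sum>i\<le>t. y (Suc t) (power_coeff r (s - t) v))"
    by (rule sum_triangle_diagonal)
  also have "\<dots> = (\<Sum>t\<le>s. sc (of_nat (Suc t)) (?a (Suc t)))"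
    by (simp add: sum_constant_scale del: of_nat_Suc)
  also have "\<dots> = (\<Sum>t\<le>Suc s. sc (of_nat t) (?a t))"
    unfolding sum.atMost_Suc_shift by simp
  finally have X: "X (power_coeff (Suc (Suc r)) s v) =
     sc (- of_nat (Suc r)) (\<Sum>p\<le>Suc s. sc (of_nat (Suc s - p)) (?a p)) + sc (- 2 * of_nat (Suc r)) (\<Sum>t\<le>Suc s. sc (of_nat t) (?a t))" .
  have "(\<Sum>p\<le>Suc s. sc (of_nat (Suc s - p)) (?a p)) + (\<Sum>t\<le>Suc s. sc (of_nat t) (?a t)) = (\<Sum>p\<le>Suc s. sc (of_nat (Suc s)) (?a p))"
    unfolding sum.distrib[symmetric] by (rule sum.cong) (auto simp: scale_left_distrib[symmetric] of_nat_diff)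
  also have "\<dots> = sc (of_nat (Suc s)) (?c (Suc s) v)" by (simp add: scale_sum_right del: of_nat_Suc sum.atMost_Suc)
  finally have 1: "(\<Sum>p\<le>Suc s. sc (of_nat (Suc s - p)) (?a p)) = sc (of_nat (Suc s)) (?c (Suc s) v) - (\<Sum>t\<le>Suc s. sc (of_nat t) (?a t))"
    by (simp add: algebra_simps)
  have 2: "sc (of_nat (Suc r)) (\<Sum>t\<le>Suc s. sc (of_nat t) (?a t)) = sc (of_nat (Suc s)) (?c (Suc s) v)"
    using x.power_coeff_euler[of "Suc s" r v] by simp
  have "X (power_coeff (Suc (Suc r)) s v) =
     - sc (of_nat (Suc r)) (sc (of_nat (Suc s)) (?c (Suc s) v)) - sc (of_nat (Suc r)) (\<Sum>t\<le>Suc s. sc (of_nat t) (?a t))"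
  proof -
    have "sc (- a) (B - S) + sc (- 2 * a) S = - sc a B - sc a S" for a B S
    proof -
      have "sc (- 2 * a) S = - sc a S - sc a S"
      proof -
        have e: "- 2 * a = - a - a" by simp
        show ?thesis unfolding e scale_left_diff_distrib scale_minus_left ..
      qed
      then show ?thesis by (simp add: scale_right_diff_distrib)
    qed
    then show ?thesis unfolding X 1 .
  qed
  moreover have "- of_nat (Suc (Suc r)) * of_nat (Suc s) = (- (of_nat (Suc r) * of_nat (Suc s)) - of_nat (Suc s) :: complex)"
    by (simp add: algebra_simps)
  ultimately show ?case unfolding 2 by (simp only: scale_left_diff_distrib scale_minus_left scale_scale)
qed

lemma power_coeff_garland:
  assumes "(y 0 ^^ Suc n) v = 0" "r + s > n"
  shows "power_coeff r s v = 0"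
  using assms(2)
proof (induction s arbitrary: r)
  case 0
  have c0: "power_coeff r 0 w = (y 0 ^^ r) w" for r w by (induction r) auto
  have "(y 0 ^^ (k + Suc n)) v = 0" for k
    unfolding funpow_add by (simp del: funpow.simps add: assms(1)) (induction k; simp)
  from this[of "r - Suc n"] 0 show ?case unfolding c0 by simp
next
  case (Suc s)
  have "power_coeff (Suc r) s v = 0" using Suc.IH[of "Suc r"] Suc.prems by (simp del: x.power_coeff.simps)
  moreover have "X 0 = 0" using X_add[of 0 0] by simp
  ultimately have "sc (- of_nat (Suc r) * of_nat (Suc s)) (power_coeff r (Suc s) v) = 0"
    using X_power_coeff[of r s] by (simp del: x.power_coeff.simps of_nat_Suc)
  then show ?case by (simp del: of_nat_Suc)
qed

lemma power_coeff_top_nilpotent: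
  assumes "\<And>p. p > k ==> y p w = 0" "(y k ^^ s) w = 0" "e + r \<ge> k * r + s"
  shows "power_coeff r e w = 0"
  using assms
proof (induction r arbitrary: s e w)
  case 0
  then show ?case by auto
next
  case (Suc r)
  have z: "power_coeff r e 0 = 0" for r e using x.power_coeff_scale[of r e 0 0] by simp
  have "y p (power_coeff r (e - p) w) = 0" if "p \<le> e" for p
  proof -
    consider "p > k" | "p = k" | "p < k" by linarith
    then show ?thesis
    proof cases
      case 1 then show ?thesis using Suc.prems(1)[OF 1] z by (metis x.power_coeff_y)
    next
      case 2
      show ?thesis
      proof (cases s)
        case 0 then show ?thesis using Suc.prems z by simp
      next
        case (Suc s')
        have "power_coeff r (e - k) (y k w) = 0"
        proof (rule Suc.IH[of _ s'])
          show "y p (y k w) = 0" if "k < p" for p using Suc.prems(1)[OF that] x.y_commute[of p k w] by simp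
          show "(y k ^^ s') (y k w) = 0" using Suc.prems(2) Suc by (simp add: funpow_swap1)
          show "k * r + s' \<le> e - k + r" using Suc.prems(3) Suc 2 that by simp
        qed
        then show ?thesis using 2 by (simp add: x.power_coeff_y)
      qed
    next
      case 3
      have "power_coeff r (e - p) w = 0"
        by (rule Suc.IH[OF Suc.prems(1,2)]) (use Suc.prems(3) 3 that in auto)
      then show ?thesis by simp
    qed
  qed
  then show ?case by simp
qed

text \<open>
  For \<open>r \<ge> l\<close> the bound follows from the power of \<open>y 0\<close> by
  Garland's identity; for \<open>r \<le> l\<close> it follows from the power of the top operator
  \<open>y k\<close>.
\<close>

lemma degree_bounded_rectangle:
  assumes "(y 0 ^^ Suc (k * l + m)) v = 0" "(y k ^^ Suc m) v = 0" "\<And>p. p > k ==> y p v = 0" "m \<le> l"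
  shows "x.degree_bounded {0} (lowered_parts (Suc k) (\<lambda>i. if i < k then l else m) {}) v"
  unfolding x.degree_bounded_def
proof (intro allI impI)
  fix r e assume "min_sum (lowered_parts (Suc k) (\<lambda>i. if i < k then l else m) {}) r < r + e"
  then have "k * min l r + min m r < r + e"
    unfolding min_sum_lowered_parts by simp
  moreover have "power_coeff r e v = 0" if "l \<le> r" "k * l + m < r + e"
    using power_coeff_garland[OF assms(1)] that by simp
  moreover have "power_coeff r e v = 0" if "m < r" "k * r + m < r + e"
    by (rule power_coeff_top_nilpotent[OF assms(3,2)]) (use that in auto)
  moreover have "power_coeff r e v = 0" if "r * k < e"
    using x.power_coeff_max(2)[of "{0}" k v] assms(3) that by (simp add: x.y_stable_def)
  ultimately show "power_coeff r e v \<in> {0}" using assms(4)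
    by (cases "l \<le> r"; cases "m < r") (auto simp: min_def mult.commute split: if_splits)
qed

inductive_set all_words :: "'v set" where
  "v \<in> all_words"
| "a \<in> all_words ==> y p a \<in> all_words"
| "a \<in> all_words ==> x p a \<in> all_words"
| "a \<in> all_words ==> \<eta> p a \<in> all_words"

lemma \<delta>_odd_word:
  assumes "finite A"
  shows "(0 \<notin> A \<longrightarrow> \<delta> (x.odd_word A v) = 0) \<and> (0 \<in> A \<longrightarrow> \<delta> (x.odd_word A v) = sc \<kappa> (x.odd_word (A - {0}) v))"
  using assms
proof (induction A rule: finite_linorder_min_induct)
  case empty
  then show ?case by (simp add: v)
next
  case (insert b A)
  have A0: "0 \<notin> A" using insert by auto
  have h1: "h\<^sub>1 b (x.odd_word A v) = (if b = 0 then sc \<kappa> (x.odd_word A v) else 0)"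
  proof -
    have "h\<^sub>1 b (foldr x as v) = (if b = 0 then sc \<kappa> (foldr x as v) else 0)" for as
      by (induction as) (auto simp: v h\<^sub>1_x x.od_scale)
    then show ?thesis unfolding x.odd_word_def .
  qed
  have "\<delta> (x.odd_word (insert b A) v) = (if b = 0 then sc \<kappa> (x.odd_word A v) else 0)"
    unfolding x.odd_word_insert_min[OF insert(1,2)] \<delta>_x h1 using insert A0 by simp
  then show ?case using A0 by auto
qed

text \<open>
  Filter by the products of the \<open>x p\<close> over sets \<open>A\<close>, ordered by
  cardinality and then by \<open>precedes\<close>; \<open>\<delta>\<close> maps such a product
  to a scalar multiple of a shorter one. On each layer the number of words in \<open>y\<close>
  and \<open>\<eta>\<close> is bounded by \<open>span_words_bound\<close> with the parts in
  \<open>A\<close> lowered by one, and the bounds sum to \<open>\<Prod>4 \<xi>\<^sub>i\<close>.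
\<close>

lemma all_words_bound:
  assumes \<xi>: "\<And>i j. i \<le> j ==> j < q ==> \<xi> j \<le> \<xi> i" "\<And>i. i < q ==> \<xi> i \<ge> 1"
    and q: "\<And>p. p \<ge> q ==> y p v = 0 \<and> x p v = 0 \<and> \<eta> p v = 0"
    and bd: "x.degree_bounded {0} (lowered_parts q \<xi> {}) v"
  shows "\<exists>F. finite F \<and> card F \<le> (\<Prod>i<q. 4 * \<xi> i) \<and> F \<subseteq> all_words \<and> all_words \<subseteq> span F"
proof -
  define code where "code A = card A * 2 ^ q + (2 ^ q - 1 - (\<Sum>a\<in>A. 2 ^ a))" for A :: "nat set"
  define S where "S \<A> = span (\<Union>A\<in>\<A>. \<eta>.words (x.odd_word A v))" for \<A>
  have finA: "finite A" if "A \<subseteq> {..<q}" for A using that finite_subset by blast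
  have key: "(\<Sum>a\<in>A. 2 ^ a) < (2 ^ q :: nat)" if "A \<subseteq> {..<q}" for A
  proof -
    have "(\<Sum>a\<in>A. 2 ^ a) \<le> (\<Sum>a<q. 2 ^ a :: nat)" by (rule sum_mono2) (use that in auto)
    also have "\<dots> < 2 ^ q" using sum_power2[of q] by (simp add: atLeast0LessThan)
    finally show ?thesis .
  qed
  have code_card: "code B < code A" if "A \<subseteq> {..<q}" "B \<subseteq> {..<q}" "card B < card A" for A B
  proof -
    have "code B < Suc (card B) * 2 ^ q" unfolding code_def using key[OF that(2)] by simp
    also have "\<dots> \<le> card A * 2 ^ q" using that by (intro mult_right_mono) auto
    also have "\<dots> \<le> code A" unfolding code_def by simp
    finally show ?thesis .
  qed
  have code_prec: "code B < code A" if "A \<subseteq> {..<q}" "B \<subseteq> {..<q}" "precedes B A" for A B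
    using precedes_sum_less[OF finA finA that(3)] key[OF that(1)] key[OF that(2)] that
    unfolding code_def precedes_def by auto
  have in_S: "a \<in> S \<A>" if "A \<in> \<A>" "a \<in> \<eta>.words (x.odd_word A v)" for a A \<A>
    unfolding S_def using that by (auto intro: span_base)
  have stable_S: "\<eta>.stable (S \<A>)" if S\<delta>: "\<And>A. A \<in> \<A> ==> \<delta> (x.odd_word A v) \<in> S \<A>" for \<A>
    unfolding S_def
  proof (rule \<eta>.stable_span)
    note sS = subspace_span[of "\<Union>A\<in>\<A>. \<eta>.words (x.odd_word A v)", folded S_def]
    have yo: "y p a \<in> S \<A> \<and> \<eta> p a \<in> S \<A>" if "a \<in> S \<A>" for a p
      using that unfolding S_def
    proof (induction rule: span_induct_alt)
      case (step c b z)
      then have "y p b \<in> S \<A>" "\<eta> p b \<in> S \<A>" by (auto intro: in_S \<eta>.words.intros)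
      then show ?case using step unfolding S_def
        by (simp add: x.y_add \<eta>.od_add x.y_scale \<eta>.od_scale span_add span_scale)
    qed (simp add: span_zero)
    have "\<delta> a \<in> S \<A>" if "A \<in> \<A>" "a \<in> \<eta>.words (x.odd_word A v)" for a A
      using that(2)
    proof induction
      case words_base show ?case by (rule S\<delta>[OF that(1)])
    next
      case (words_y a p)
      then show ?case using yo in_S[OF that(1) words_y(1)] unfolding \<eta>.D_y
        by (intro subspace_add[OF sS] subspace_scale[OF sS]) auto
    next
      case (words_o a p)
      then show ?case using yo unfolding \<eta>.D_od by (intro subspace_neg[OF sS]) auto
    qed
    then show "\<delta> a \<in> span (\<Union>A\<in>\<A>. \<eta>.words (x.odd_word A v))" if "a \<in> (\<Union>A\<in>\<A>. \<eta>.words (x.odd_word A v))" for a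
      using that unfolding S_def by auto
  qed (auto intro!: span_base intro: \<eta>.words.intros)
  define Q where "Q A F \<longleftrightarrow> finite F \<and> card F \<le> (\<Prod>z\<in>#lowered_parts q \<xi> A. 2 * z + 1) \<and> F \<subseteq> \<eta>.words (x.odd_word A v) \<and>
      \<eta>.words (x.odd_word A v) \<subseteq> span (S {B. B \<subseteq> {..<q} \<and> code B < code A} \<union> F)" for A F
  have ex: "\<exists>F. Q A F" if A: "A \<subseteq> {..<q}" for A
  proof -
    let ?w = "x.odd_word A v" and ?B = "{B. B \<subseteq> {..<q} \<and> code B < code A}"
    have \<delta>: "\<delta> (x.odd_word B v) \<in> S ?B" if "B \<subseteq> {..<q}" "code B \<le> code A" for B
    proof (cases "0 \<in> B")
      case True
      have "card (B - {0}) < card B" using True finA[OF that(1)] by (intro psubset_card_mono) auto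
      then have "code (B - {0}) < code B" using that by (intro code_card) auto
      then have "x.odd_word (B - {0}) v \<in> S ?B" using that by (intro in_S[of "B - {0}"] \<eta>.words_base) auto
      then show ?thesis using \<delta>_odd_word[OF finA[OF that(1)]] True unfolding S_def by (simp add: span_scale)
    next
      case False
      then show ?thesis using \<delta>_odd_word[OF finA[OF that(1)]] unfolding S_def by (simp add: span_zero)
    qed
    have N: "\<eta>.stable (S ?B)" by (rule stable_S) (use \<delta> in auto)
    have "\<exists>F. finite F \<and> card F \<le> (\<Prod>z\<in>#lowered_parts q \<xi> A. 2 * z + 1) * (\<Prod>z\<in>#{#}. z + 1) \<and> F \<subseteq> \<eta>.words ?w \<and>
      \<eta>.words ?w \<subseteq> span (S ?B \<union> F)"
    proof (rule \<eta>.span_words_bound[OF N])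
      show "\<delta> ?w \<in> S ?B" using \<delta> A by simp
      show "y p ?w \<in> S ?B" if "size (lowered_parts q \<xi> A + {#}) \<le> p" for p
      proof -
        have "y p (foldr x as v) = 0" for as using q[of p] that by (induction as) (auto simp: x.od_y[symmetric])
        then show ?thesis unfolding x.odd_word_def S_def by (simp add: span_zero)
      qed
      show "\<eta> p ?w \<in> S ?B" if "size (lowered_parts q \<xi> A) \<le> p" for p
      proof -
        have y0: "y p' (foldr x as v) = 0" if "p' \<ge> q" for as p' using q[OF that] by (induction as) (auto simp: x.od_y[symmetric])
        have "\<eta> p (foldr x as v) = 0" for as
        proof (induction as)
          case (Cons a as)
          have "\<eta> p (x a (foldr x as v)) = y (a + p) (foldr x as v) - x a (\<eta> p (foldr x as v))"
            unfolding x_\<eta> by simp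
          then show ?case using Cons y0[of "a + p"] that by simp
        qed (use q that in simp)
        then show ?thesis unfolding x.odd_word_def S_def by (simp add: span_zero)
      qed
      have "x.degree_bounded (x.preceding_span q v A) (lowered_parts q \<xi> A) ?w"
        by (rule x.odd_word_degree_bounded[OF v(1) _ bd \<xi>(1) A]) (use q in auto)
      moreover have "x.preceding_span q v A \<subseteq> S ?B"
        unfolding x.preceding_span_def S_def
        by (rule span_mono) (use \<eta>.mon_words code_prec[OF A] in blast)
      ultimately show "x.degree_bounded (S ?B) (lowered_parts q \<xi> A + {#}) ?w"
        unfolding x.degree_bounded_def by auto
    qed auto
    then show ?thesis by (simp add: Q_def)
  qed
  then have "\<forall>A\<in>Pow {..<q}. \<exists>F. Q A F" by simp
  from bchoice[OF this] obtain F where "\<forall>A\<in>Pow {..<q}. Q A (F A)" by blast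
  then have F: "\<And>A. A \<subseteq> {..<q} ==> finite (F A) \<and> card (F A) \<le> (\<Prod>z\<in>#lowered_parts q \<xi> A. 2 * z + 1) \<and>
      F A \<subseteq> \<eta>.words (x.odd_word A v) \<and> \<eta>.words (x.odd_word A v) \<subseteq> span (S {B. B \<subseteq> {..<q} \<and> code B < code A} \<union> F A)"
    unfolding Q_def by blast
  define G where "G = (\<Union>A\<in>Pow {..<q}. F A)"
  have words_G: "\<eta>.words (x.odd_word A v) \<subseteq> span G" if "A \<subseteq> {..<q}" for A
    using that
  proof (induction "code A" arbitrary: A rule: less_induct)
    case less
    have "S {B. B \<subseteq> {..<q} \<and> code B < code A} \<subseteq> span G"
      unfolding S_def by (rule span_minimal) (use less.hyps in auto)
    moreover have "F A \<subseteq> span G" unfolding G_def using less.prems by (auto intro: span_base)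
    ultimately have "span (S {B. B \<subseteq> {..<q} \<and> code B < code A} \<union> F A) \<subseteq> span G" by (intro span_minimal) auto
    then show ?case using F[OF less.prems] by blast
  qed
  have "finite G" unfolding G_def using F by auto
  have "card G \<le> (\<Sum>A\<in>Pow {..<q}. card (F A))" unfolding G_def by (rule card_UN_le) simp
  also have "\<dots> \<le> (\<Sum>A\<in>Pow {..<q}. (\<Prod>i\<in>A. 2 * \<xi> i - 1) * (\<Prod>i\<in>{..<q}-A. 2 * \<xi> i + 1))"
  proof (rule sum_mono)
    fix A assume "A \<in> Pow {..<q}"
    then have A: "A \<subseteq> {..<q}" by simp
    have "(\<Prod>z\<in>#lowered_parts q \<xi> A. 2 * z + 1) = (\<Prod>i<q. 2 * (if i \<in> A then \<xi> i - 1 else \<xi> i) + 1)"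
      unfolding lowered_parts_def image_mset.compositionality comp_def by (simp add: prod_unfold_prod_mset)
    also have "\<dots> = (\<Prod>i\<in>A. 2 * (if i \<in> A then \<xi> i - 1 else \<xi> i) + 1) * (\<Prod>i\<in>{..<q}-A. 2 * (if i \<in> A then \<xi> i - 1 else \<xi> i) + 1)"
      unfolding prod.subset_diff[OF A finite_lessThan] by (rule mult.commute)
    also have "(\<Prod>i\<in>A. 2 * (if i \<in> A then \<xi> i - 1 else \<xi> i) + 1) = (\<Prod>i\<in>A. 2 * \<xi> i - 1)"
    proof (rule prod.cong)
      fix i assume "i \<in> A"
      then have "i < q" using A by auto
      then show "2 * (if i \<in> A then \<xi> i - 1 else \<xi> i) + 1 = 2 * \<xi> i - 1" using \<open>i \<in> A\<close> \<xi>(2)[of i] by simp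
    qed simp
    finally show "card (F A) \<le> (\<Prod>i\<in>A. 2 * \<xi> i - 1) * (\<Prod>i\<in>{..<q}-A. 2 * \<xi> i + 1)" using F[OF A] by simp
  qed
  also have "\<dots> = (\<Prod>i<q. (2 * \<xi> i - 1) + (2 * \<xi> i + 1))" by (rule prod_add[symmetric]) simp
  also have "\<dots> = (\<Prod>i<q. 4 * \<xi> i)" by (rule prod.cong) (use \<xi>(2) in force)+
  finally have card: "card G \<le> (\<Prod>i<q. 4 * \<xi> i)" .
  have ow: "foldr x as v \<in> all_words" for as by (induction as) (auto intro: all_words.intros)
  have "\<eta>.words (x.odd_word A v) \<subseteq> all_words" for A
  proof
    fix a assume "a \<in> \<eta>.words (x.odd_word A v)"
    then show "a \<in> all_words" by induction (auto intro: all_words.intros ow simp: x.odd_word_def)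
  qed
  then have GW: "G \<subseteq> all_words" unfolding G_def using F by blast
  let ?T = "S (Pow {..<q})"
  have T_\<delta>: "\<eta>.stable ?T"
  proof (rule stable_S)
    fix A assume "A \<in> Pow {..<q}"
    then have A: "A \<subseteq> {..<q}" by simp
    have "x.odd_word (A - {0}) v \<in> ?T" using A by (intro in_S[of "A - {0}"] \<eta>.words_base) auto
    then show "\<delta> (x.odd_word A v) \<in> ?T" using \<delta>_odd_word[OF finA[OF A]] unfolding S_def
      by (cases "0 \<in> A") (simp_all add: span_scale span_zero)
  qed
  have sT: "subspace ?T" unfolding S_def by simp
  have T_y: "y p a \<in> ?T" and T_\<eta>: "\<eta> p a \<in> ?T" if "a \<in> ?T" for a p
    using \<eta>.stableD[OF T_\<delta>] that x.y_stableD by blast+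
  have T_x: "x p a \<in> ?T" if "a \<in> ?T" for a p
    using that unfolding S_def
  proof (induction rule: span_induct_alt)
    case base then show ?case by (simp add: span_zero)
  next
    case (step c b z)
    from step(1) obtain A where A: "A \<subseteq> {..<q}" "b \<in> \<eta>.words (x.odd_word A v)" by auto
    from A(2) have "x p b \<in> ?T"
    proof induction
      case words_base
      show ?case
      proof (cases "p < q \<and> p \<notin> A")
        case True
        then have "x.odd_word (insert p A) v \<in> ?T" using A by (intro in_S[of "insert p A"] \<eta>.words_base) auto
        then show ?thesis using x.od_odd_word[OF finA[OF A(1)], of p v] True subspace_neg[OF sT] by metis
      next
        case False
        then have "x p (x.odd_word A v) = 0"
          using x.od_odd_word[OF finA[OF A(1)], of p v] q[of p] x.foldr_od_zero[of p v]
          unfolding x.odd_word_def by (metis not_less)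
        then show ?thesis using subspace_0[OF sT] by simp
      qed
    next
      case (words_y a p')
      then show ?case by (simp add: x.od_y T_y)
    next
      case (words_o a p')
      then show ?case unfolding x_\<eta>
        using A in_S[of A "Pow {..<q}" a] by (intro subspace_diff[OF sT] T_y T_\<eta>) auto
    qed
    then show ?case using step(2) unfolding S_def by (simp add: x.od_add x.od_scale span_add span_scale)
  qed
  have "all_words \<subseteq> ?T"
  proof
    fix a assume "a \<in> all_words"
    then show "a \<in> ?T"
    proof induction
      case 1
      show ?case by (rule in_S[of "{}"]) (auto intro: \<eta>.words_base)
    qed (auto intro: T_x T_y T_\<eta>)
  qed
  also have "?T \<subseteq> span G" unfolding S_def by (rule span_minimal) (use words_G in auto)
  finally show ?thesis using \<open>finite G\<close> card GW by blast
qed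

end

section \<open>Linear algebra of formal sums, representations, and presentations of records\<close>

definition pscale :: "complex \<Rightarrow> ('k \<Rightarrow>\<^sub>0 complex) \<Rightarrow> 'k \<Rightarrow>\<^sub>0 complex" where
  "pscale c = Poly_Mapping.map ((*) c)"

lemma lookup_pscale [simp]: "lookup (pscale c p) k = c * lookup p k"
  by (simp add: pscale_def Poly_Mapping.map.rep_eq when_def)

lemma pscale_vector_space: "vector_space pscale"
  by (unfold_locales) (auto intro!: poly_mapping_eqI simp: lookup_add algebra_simps)

interpretation pscale: vector_space pscale by (rule pscale_vector_space)

lemma pscale_single [simp]: "pscale c (single k a) = single k (c * a)"
  by (rule poly_mapping_eqI) (simp add: lookup_single when_def)

lemma keys_pscale: "keys (pscale c p) \<subseteq> keys p"
  by (auto simp: in_keys_iff)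

lemma keys_uminus: "keys (- p) = keys (p :: 'k \<Rightarrow>\<^sub>0 complex)"
  by (auto simp: in_keys_iff)

lemma keys_subset_subspace: "pscale.subspace {p :: 'k \<Rightarrow>\<^sub>0 complex. keys p \<subseteq> A}"
  unfolding pscale.subspace_def
proof (intro conjI ballI allI; clarify)
  fix p q :: "'k \<Rightarrow>\<^sub>0 complex" and k assume "keys p \<subseteq> A" "keys q \<subseteq> A" "k \<in> keys (p + q)"
  then show "k \<in> A" using keys_add[of p q] by blast
next
  fix c and p :: "'k \<Rightarrow>\<^sub>0 complex" and k assume "keys p \<subseteq> A" "k \<in> keys (pscale c p)"
  then show "k \<in> A" using keys_pscale[of c p] by blast
qed simp

lemma sum_singles: "(\<Sum>k\<in>keys p. single k (lookup p k)) = p"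
  for p :: "'k \<Rightarrow>\<^sub>0 'b::comm_monoid_add"
proof (rule poly_mapping_eqI)
  fix k
  have "(\<Sum>i\<in>keys p. lookup p i when i = k) = (\<Sum>i\<in>keys p. if i = k then lookup p k else 0)"
    by (rule sum.cong) (auto simp: when_def)
  then show "lookup (\<Sum>k\<in>keys p. single k (lookup p k)) k = lookup p k"
    by (simp add: lookup_sum lookup_single in_keys_iff)
qed

abbreviation "gen k \<equiv> single k (1::complex)"

lemma sum_pscale_singles: "(\<Sum>k\<in>keys p. pscale (lookup p k) (gen k)) = p"
  using sum_singles[of p] by simp

text \<open>
  Linearity on whole types. All vector spaces below are realized as types, or as subspaces of
  types, since the modules of the theorem are records whose operations are meaningful only on
  their carriers.
\<close>

definition linmap :: "(complex \<Rightarrow> 'u::ab_group_add \<Rightarrow> 'u) \<Rightarrow> (complex \<Rightarrow> 'v::ab_group_add \<Rightarrow> 'v) \<Rightarrow> ('u \<Rightarrow> 'v) \<Rightarrow> bool" where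
  "linmap s1 s2 f \<longleftrightarrow> (\<forall>a b. f (a + b) = f a + f b) \<and> (\<forall>c a. f (s1 c a) = s2 c (f a))"

lemma linmapI: "(\<And>a b. f (a + b) = f a + f b) ==> (\<And>c a. f (s1 c a) = s2 c (f a)) ==> linmap s1 s2 f"
  by (simp add: linmap_def)

lemma linmap_add: "linmap s1 s2 f ==> f (a + b) = f a + f b"
  and linmap_scale: "linmap s1 s2 f ==> f (s1 c a) = s2 c (f a)"
  by (simp_all add: linmap_def)

lemma linmap_zero: "linmap s1 s2 f ==> f 0 = 0"
  using linmap_add[of s1 s2 f 0 0] by simp

lemma linmap_diff: "linmap s1 s2 f ==> f (a - b) = f a - f b"
  using linmap_add[of s1 s2 f "a - b" b] by (simp add: eq_diff_eq)

lemma linmap_uminus: "linmap s1 s2 f ==> f (- b) = - f b"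
  using linmap_diff[of s1 s2 f 0 b] by (simp add: linmap_zero)

lemma linmap_sum: "linmap s1 s2 f ==> f (sum g A) = (\<Sum>a\<in>A. f (g a))"
  by (induction A rule: infinite_finite_induct) (auto simp: linmap_add linmap_zero)

lemma linmap_comp: "linmap s1 s2 f ==> linmap s2 s3 g ==> linmap s1 s3 (\<lambda>a. g (f a))"
  by (simp add: linmap_def)

lemma linmap_pm_eqI:
  assumes "linmap pscale sc f" "linmap pscale sc g"
    and "\<And>k. k \<in> keys p ==> f (gen k) = g (gen k)"
  shows "f p = g p"
proof -
  have "f (\<Sum>k\<in>keys p. pscale (lookup p k) (gen k)) = g (\<Sum>k\<in>keys p. pscale (lookup p k) (gen k))"
    unfolding linmap_sum[OF assms(1)] linmap_sum[OF assms(2)] linmap_scale[OF assms(1)] linmap_scale[OF assms(2)]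
    using assms(3) by simp
  then show ?thesis unfolding sum_pscale_singles .
qed

locale cspace = vector_space sc for sc :: "complex \<Rightarrow> 'v::ab_group_add \<Rightarrow> 'v"
begin

definition lift :: "('k \<Rightarrow> 'v) \<Rightarrow> ('k \<Rightarrow>\<^sub>0 complex) \<Rightarrow> 'v" where
  "lift f p = (\<Sum>k\<in>keys p. sc (lookup p k) (f k))"

lemma lift_superset: "finite A ==> keys p \<subseteq> A ==> lift f p = (\<Sum>k\<in>A. sc (lookup p k) (f k))"
  unfolding lift_def by (rule sum.mono_neutral_left) (auto simp: in_keys_iff)

lemma lift_single [simp]: "lift f (single k c) = sc c (f k)"
  by (simp add: lift_def)

lemma linmap_lift: "linmap pscale sc (lift f)"
proof (rule linmapI)
  show "lift f (p + q) = lift f p + lift f q" for p q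
    unfolding lift_def by (rule setsum_keys_plus_distrib) (auto simp: scale_left_distrib)
  show "lift f (pscale c p) = sc c (lift f p)" for c p
    using lift_superset[OF finite_keys keys_pscale] by (simp add: lift_def[of f p] scale_sum_right)
qed

lemmas lift_add = linmap_add[OF linmap_lift]
  and lift_scale = linmap_scale[OF linmap_lift]
  and lift_diff = linmap_diff[OF linmap_lift]
  and lift_zero [simp] = linmap_zero[OF linmap_lift]
  and lift_sum = linmap_sum[OF linmap_lift]

lemma lift_cong: "(\<And>k. k \<in> keys p ==> f k = g k) ==> lift f p = lift g p"
  unfolding lift_def by (rule sum.cong) auto

lemma lift_fun_add: "lift (\<lambda>k. f k + g k) p = lift f p + lift g p"
  and lift_fun_diff: "lift (\<lambda>k. f k - g k) p = lift f p - lift g p"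
  and lift_fun_scale: "lift (\<lambda>k. sc c (f k)) p = sc c (lift f p)"
  by (simp_all add: lift_def scale_right_distrib scale_right_diff_distrib sum.distrib sum_subtractf scale_sum_right mult.commute)

lemma linmap_lift_outside: "linmap sc sc h ==> h (lift f p) = lift (\<lambda>k. h (f k)) p"
  unfolding lift_def by (simp add: linmap_sum linmap_scale)

lemma lift_in_subspace: "subspace S ==> (\<And>k. k \<in> keys p ==> f k \<in> S) ==> lift f p \<in> S"
  unfolding lift_def by (intro subspace_sum subspace_scale) auto

text \<open>
  A quotient is realized inside the space itself as the image of an idempotent with the
  prescribed kernel; this keeps all quotients in one type.
\<close>

lemma projection_with_kernel:
  assumes J: "subspace J"
  obtains \<pi> where "linmap sc sc \<pi>" "\<And>a. \<pi> a = 0 \<longleftrightarrow> a \<in> J" "\<And>a. \<pi> (\<pi> a) = \<pi> a"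
proof -
  interpret vector_space_pair sc sc ..
  obtain B where B: "B \<subseteq> J" "independent B" "J \<subseteq> span B" using maximal_independent_subset by blast
  obtain C where C: "B \<subseteq> C" "independent C" "UNIV \<subseteq> span C" using maximal_independent_subset_extend[of B UNIV] B by auto
  obtain g where g: "Vector_Spaces.linear sc sc g" "\<And>b. b \<in> C ==> g b = (if b \<in> B then 0 else b)"
    using linear_independent_extend[OF C(2), of "\<lambda>b. if b \<in> B then 0 else b"] by blast
  interpret g: Vector_Spaces.linear sc sc g by fact
  have gJ: "g a = 0" if "a \<in> span B" for a
    using that by (induction rule: span_induct_alt) (use g C(1) in \<open>auto simp: g.add g.scale\<close>)
  have gK: "g a = a" if "a \<in> span (C - B)" for a
    using that by (induction rule: span_induct_alt) (use g in \<open>auto simp: g.add g.scale\<close>)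
  have split: "\<exists>u w. u \<in> span B \<and> w \<in> span (C - B) \<and> a = u + w" for a
  proof -
    have "a \<in> span (B \<union> (C - B))" using C by (simp add: Un_absorb1 subset_iff)
    then show ?thesis unfolding span_Un by auto
  qed
  have spB: "span B = J" using B span_minimal[OF B(1) J] by blast
  show thesis
  proof
    show "linmap sc sc g" by (rule linmapI) (rule g.add g.scale)+
    show "g a = 0 \<longleftrightarrow> a \<in> J" for a
    proof
      assume "g a = 0"
      obtain u w where uw: "u \<in> span B" "w \<in> span (C - B)" "a = u + w" using split by blast
      have "w = 0" using \<open>g a = 0\<close> unfolding uw(3) g.add gJ[OF uw(1)] gK[OF uw(2)] by simp
      then show "a \<in> J" using uw spB by simp
    next
      assume "a \<in> J"
      then show "g a = 0" using gJ spB by simp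
    qed
    show "g (g a) = g a" for a
    proof -
      obtain u w where uw: "u \<in> span B" "w \<in> span (C - B)" "a = u + w" using split by blast
      then show ?thesis using gJ gK by (simp add: g.add)
    qed
  qed
qed

end

interpretation pc: cspace pscale by unfold_locales

abbreviation fa :: "'x lie_superalgebra \<Rightarrow> ('x list \<Rightarrow>\<^sub>0 complex) set" where
  "fa L \<equiv> {p. keys p \<subseteq> lists (carrier L)}"

lemma word_mult_lift: "word_mult p q = pc.lift (\<lambda>u. pc.lift (\<lambda>w. gen (u @ w)) q) p"
  unfolding word_mult_def pc.lift_def pscale.scale_sum_right by (simp add: mult.commute)

lemma word_mult_add_left: "word_mult (p + p') q = word_mult p q + word_mult p' q"
  and word_mult_scale_left: "word_mult (pscale c p) q = pscale c (word_mult p q)"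
  and word_mult_diff_left: "word_mult (p - p') q = word_mult p q - word_mult p' q"
  unfolding word_mult_lift by (rule pc.lift_add pc.lift_scale pc.lift_diff)+

lemma word_mult_add_right: "word_mult p (q + q') = word_mult p q + word_mult p q'"
  and word_mult_scale_right: "word_mult p (pscale c q) = pscale c (word_mult p q)"
  and word_mult_diff_right: "word_mult p (q - q') = word_mult p q - word_mult p q'"
  unfolding word_mult_lift pc.lift_add pc.lift_scale pc.lift_diff
  by (rule pc.lift_fun_add pc.lift_fun_scale pc.lift_fun_diff)+

lemma word_mult_single [simp]: "word_mult (single u a) (single w b) = single (u @ w) (a * b)"
  by (simp add: word_mult_lift)

lemma linmap_word_mult_right: "linmap pscale pscale (word_mult p)"
  by (simp add: linmap_def word_mult_add_right word_mult_scale_right)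

lemma linmap_word_mult_left: "linmap pscale pscale (\<lambda>p. word_mult p q)"
  by (simp add: linmap_def word_mult_add_left word_mult_scale_left)

lemma word_mult_assoc: "word_mult (word_mult p q) r = word_mult p (word_mult q r)"
proof -
  note comp = linmap_comp[OF linmap_word_mult_right linmap_word_mult_right]
    linmap_comp[OF linmap_word_mult_right linmap_word_mult_left]
    linmap_comp[OF linmap_word_mult_left linmap_word_mult_left]
    linmap_comp[OF linmap_word_mult_left linmap_word_mult_right]
  have 1: "word_mult (word_mult (gen u) (gen w)) r = word_mult (gen u) (word_mult (gen w) r)" for u w
    by (rule linmap_pm_eqI[OF linmap_word_mult_right comp(1)]) simp
  have 2: "word_mult (word_mult (gen u) q) r = word_mult (gen u) (word_mult q r)" for u
    by (rule linmap_pm_eqI[OF comp(2) comp(4)]) (rule 1)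
  show ?thesis
    by (rule linmap_pm_eqI[OF comp(3) linmap_word_mult_left]) (rule 2)
qed

lemma linmap_ident: "linmap s s (\<lambda>a. a)"
  by (simp add: linmap_def)

lemma word_mult_one_left [simp]: "word_mult (gen []) p = p"
  by (rule linmap_pm_eqI[OF linmap_word_mult_right linmap_ident]) simp

lemma word_mult_one_right [simp]: "word_mult p (gen []) = p"
  by (rule linmap_pm_eqI[OF linmap_word_mult_left linmap_ident]) simp

lemma word_mult_scalar: "word_mult (single [] c) p = pscale c p"
  using word_mult_scale_left[of c "gen []" p] by simp

lemma fa_subspace: "pscale.subspace (fa L)"
  by (rule keys_subset_subspace)

lemma fa_word_mult: "p \<in> fa L ==> q \<in> fa L ==> word_mult p q \<in> fa L"
  unfolding word_mult_lift
  by (intro pc.lift_in_subspace[OF fa_subspace]) auto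

lemma ring_free_algebra: "ring (free_algebra L)"
proof -
  note sub = fa_subspace[of L, unfolded pscale.subspace_def]
  have "abelian_group (free_algebra L)"
  proof (rule abelian_groupI)
    fix p assume "p \<in> carrier (free_algebra L)"
    then show "\<exists>q\<in>carrier (free_algebra L). q \<oplus>\<^bsub>free_algebra L\<^esub> p = \<zero>\<^bsub>free_algebra L\<^esub>"
      using keys_uminus[of p] by (intro bexI[of _ "- p"]) (auto simp: free_algebra_def)
  qed (use sub in \<open>auto simp: free_algebra_def add.assoc add.commute\<close>)
  then show ?thesis
    by (intro ringI monoidI)
      (use fa_word_mult[of _ L] in \<open>auto simp: free_algebra_def word_mult_assoc word_mult_add_left word_mult_add_right\<close>)
qed

locale lie_closed =
  fixes L :: "'x lie_superalgebra"
  assumes part_carrier: "part L d \<subseteq> carrier L"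
    and add_closed: "x \<in> carrier L ==> x' \<in> carrier L ==> x \<oplus>\<^bsub>L\<^esub> x' \<in> carrier L"
    and smult_closed: "x \<in> carrier L ==> c \<odot>\<^bsub>L\<^esub> x \<in> carrier L"
    and bracket_closed: "x \<in> part L d ==> x' \<in> part L e ==> bracket L x x' \<in> carrier L"
begin

lemma UEA_relations_subset: "UEA_relations L \<subseteq> fa L"
proof -
  define A where "A = fa L"
  have m: "single w c \<in> A" if "w \<in> lists (carrier L)" for w c
    using that by (cases "c = 0") (auto simp: A_def)
  have d: "p - q \<in> A" if "p \<in> A" "q \<in> A" for p q
    using pscale.subspace_diff[OF fa_subspace[of L]] that unfolding A_def .
  show ?thesis
    unfolding UEA_relations_def A_def[symmetric]
    using add_closed smult_closed bracket_closed part_carrier[THEN subsetD] by (auto intro!: d m)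
qed

lemma UEA_ideal_ideal: "ideal (UEA_ideal L) (free_algebra L)"
  unfolding UEA_ideal_def
  by (rule ring.genideal_ideal[OF ring_free_algebra]) (use UEA_relations_subset in \<open>simp add: free_algebra_def\<close>)

lemma UEA_relations_ideal: "UEA_relations L \<subseteq> UEA_ideal L"
  unfolding UEA_ideal_def
  by (rule ring.genideal_self[OF ring_free_algebra]) (use UEA_relations_subset in \<open>simp add: free_algebra_def\<close>)

lemma UEA_ideal_subset: "UEA_ideal L \<subseteq> fa L"
  using ideal.Icarr[OF UEA_ideal_ideal] by (auto simp: free_algebra_def)

lemma UEA_ideal_mult:
  assumes "p \<in> UEA_ideal L" "q \<in> fa L"
  shows "word_mult q p \<in> UEA_ideal L" "word_mult p q \<in> UEA_ideal L"
  using ideal.I_l_closed[OF UEA_ideal_ideal assms(1)] ideal.I_r_closed[OF UEA_ideal_ideal assms(1)] assms(2)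
  by (auto simp: free_algebra_def)

lemma UEA_ideal_subspace: "pscale.subspace (UEA_ideal L)"
proof -
  interpret additive_subgroup "UEA_ideal L" "free_algebra L" by (rule ideal.axioms(1)[OF UEA_ideal_ideal])
  have "pscale c p \<in> UEA_ideal L" if "p \<in> UEA_ideal L" for c p
    using UEA_ideal_mult(1)[OF that, of "single [] c"] by (simp add: word_mult_scalar)
  moreover have "0 \<in> UEA_ideal L" using zero_closed by (simp add: free_algebra_def)
  moreover have "p + q \<in> UEA_ideal L" if "p \<in> UEA_ideal L" "q \<in> UEA_ideal L" for p q
    using a_closed[OF that] by (simp add: free_algebra_def)
  ultimately show ?thesis unfolding pscale.subspace_def by blast
qed

end

definition is_rep :: "'x lie_superalgebra \<Rightarrow> (complex \<Rightarrow> 'v::ab_group_add \<Rightarrow> 'v) \<Rightarrow> ('x \<Rightarrow> 'v \<Rightarrow> 'v) \<Rightarrow> bool" where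
  "is_rep L sc T \<longleftrightarrow>
    (\<forall>x\<in>carrier L. linmap sc sc (T x)) \<and>
    (\<forall>x\<in>carrier L. \<forall>x'\<in>carrier L. \<forall>a. T (x \<oplus>\<^bsub>L\<^esub> x') a = T x a + T x' a) \<and>
    (\<forall>c. \<forall>x\<in>carrier L. \<forall>a. T (c \<odot>\<^bsub>L\<^esub> x) a = sc c (T x a)) \<and>
    (\<forall>d e. \<forall>x\<in>part L d. \<forall>x'\<in>part L e. \<forall>a.
      T (bracket L x x') a = T x (T x' a) - sc (koszul_sign d e) (T x' (T x a)))"

lemma is_repD:
  assumes "is_rep L sc T"
  shows "x \<in> carrier L ==> linmap sc sc (T x)"
    and "x \<in> carrier L ==> x' \<in> carrier L ==> T (x \<oplus>\<^bsub>L\<^esub> x') a = T x a + T x' a"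
    and "x \<in> carrier L ==> T (c \<odot>\<^bsub>L\<^esub> x) a = sc c (T x a)"
    and "x \<in> part L d ==> x' \<in> part L e ==> T (bracket L x x') a = T x (T x' a) - sc (koszul_sign d e) (T x' (T x a))"
  using assms by (auto simp: is_rep_def)

context cspace
begin

definition action :: "('x \<Rightarrow> 'v \<Rightarrow> 'v) \<Rightarrow> ('x list \<Rightarrow>\<^sub>0 complex) \<Rightarrow> 'v \<Rightarrow> 'v" where
  "action T p v = lift (\<lambda>w. foldr T w v) p"

lemma action_single [simp]: "action T (single w c) v = sc c (foldr T w v)"
  by (simp add: action_def)

lemma linmap_action: "linmap pscale sc (\<lambda>p. action T p v)"
  unfolding action_def by (rule linmap_lift)

lemma linmap_foldr: "is_rep L sc T ==> w \<in> lists (carrier L) ==> linmap sc sc (foldr T w)"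
  by (induction w) (auto simp: linmap_def is_rep_def)

lemma linmap_action_right:
  assumes "is_rep L sc T" "p \<in> fa L"
  shows "linmap sc sc (action T p)"
proof (rule linmapI)
  have l: "linmap sc sc (foldr T w)" if "w \<in> keys p" for w
    using linmap_foldr[OF assms(1)] assms(2) that by auto
  show "action T p (a + b) = action T p a + action T p b" for a b
    unfolding action_def lift_fun_add[symmetric] by (rule lift_cong) (rule linmap_add[OF l])
  show "action T p (sc c a) = sc c (action T p a)" for c a
    unfolding action_def lift_fun_scale[symmetric] by (rule lift_cong) (rule linmap_scale[OF l])
qed

lemma action_word_mult:
  assumes "is_rep L sc T" "p \<in> fa L" "q \<in> fa L"
  shows "action T (word_mult p q) v = action T p (action T q v)"
proof (rule linmap_pm_eqI[OF linmap_comp[OF linmap_word_mult_left linmap_action] linmap_action])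
  fix u assume "u \<in> keys p"
  then have u: "u \<in> lists (carrier L)" using assms by auto
  show "action T (word_mult (gen u) q) v = action T (gen u) (action T q v)"
    unfolding action_single scale_one
    by (rule linmap_pm_eqI[OF linmap_comp[OF linmap_word_mult_right linmap_action]
          linmap_comp[OF linmap_action linmap_foldr[OF assms(1) u]]]) simp
qed

text \<open>
  The elements of the free algebra that act by zero on every vector form a two-sided ideal.
\<close>

lemma action_UEA_ideal:
  assumes "lie_closed L" "is_rep L sc T" "p \<in> UEA_ideal L"
  shows "action T p v = 0"
proof -
  define I where "I = {p \<in> fa L. \<forall>v. action T p v = 0}"
  interpret ring "free_algebra L" by (rule ring_free_algebra)
  have "ideal I (free_algebra L)"
  proof (rule idealI)
    show "subgroup I (add_monoid (free_algebra L))"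
    proof (rule group.subgroupI[OF abelian_group.a_group])
      show "abelian_group (free_algebra L)" ..
      show "I \<subseteq> carrier (add_monoid (free_algebra L))" unfolding I_def by (auto simp: free_algebra_def)
      have "0 \<in> I" unfolding I_def by (simp add: action_def)
      then show "I \<noteq> {}" by blast
      fix a assume a: "a \<in> I"
      have ac: "a \<in> carrier (free_algebra L)" using a unfolding I_def by (auto simp: free_algebra_def)
      have "\<ominus>\<^bsub>free_algebra L\<^esub> a = - a"
        by (rule minus_equality) (use ac keys_uminus[of a] in \<open>auto simp: free_algebra_def\<close>)
      then show "inv\<^bsub>add_monoid (free_algebra L)\<^esub> a \<in> I"
        using a keys_uminus[of a] unfolding a_inv_def I_def by (auto simp: linmap_uminus[OF linmap_action])
      fix b assume b: "b \<in> I"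
      show "a \<otimes>\<^bsub>add_monoid (free_algebra L)\<^esub> b \<in> I"
        using a b pscale.subspace_add[OF fa_subspace, of a L b] unfolding I_def by (auto simp: free_algebra_def linmap_add[OF linmap_action])
    qed
    fix a q assume a: "a \<in> I" "q \<in> carrier (free_algebra L)"
    then have q: "q \<in> fa L" by (simp add: free_algebra_def)
    have "action T (word_mult q a) v = 0" "action T (word_mult a q) v = 0" for v
      using a q linmap_zero[OF linmap_action_right[OF assms(2) q]]
      by (auto simp: I_def action_word_mult[OF assms(2)])
    moreover have "a \<in> fa L" using a unfolding I_def by blast
    then have "word_mult q a \<in> fa L" "word_mult a q \<in> fa L" by (rule fa_word_mult[OF q] fa_word_mult[OF _ q])+
    ultimately show "q \<otimes>\<^bsub>free_algebra L\<^esub> a \<in> I" "a \<otimes>\<^bsub>free_algebra L\<^esub> q \<in> I"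
      unfolding I_def by (auto simp: free_algebra_def)
  qed unfold_locales
  moreover have "UEA_relations L \<subseteq> I"
  proof
    fix p assume p: "p \<in> UEA_relations L"
    then have "p \<in> fa L" using lie_closed.UEA_relations_subset[OF assms(1)] by blast
    moreover have "action T p v = 0" for v
    proof -
      note ad = linmap_diff[OF linmap_action]
      have pc: "x \<in> part L d ==> x \<in> carrier L" for x d using lie_closed.part_carrier[OF assms(1)] by blast
      from p consider
          (1) x x' where "x \<in> carrier L" "x' \<in> carrier L" "p = gen [x \<oplus>\<^bsub>L\<^esub> x'] - gen [x] - gen [x']"
        | (2) c x where "x \<in> carrier L" "p = gen [c \<odot>\<^bsub>L\<^esub> x] - single [x] c"
        | (3) x x' d e where "x \<in> part L d" "x' \<in> part L e"
            "p = gen [x, x'] - single [x', x] (koszul_sign d e) - gen [bracket L x x']"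
        unfolding UEA_relations_def by blast
      then show ?thesis
        by cases (simp_all add: ad is_repD[OF assms(2)])
    qed
    ultimately show "p \<in> I" unfolding I_def by blast
  qed
  ultimately have "UEA_ideal L \<subseteq> I" unfolding UEA_ideal_def by (rule genideal_minimal)
  then show ?thesis using assms(3) unfolding I_def by blast
qed

text \<open>
  Operators that satisfy the relations only modulo \<open>J\<close>, and only on
  \<open>C\<close>, become a representation on the whole type after projecting onto
  \<open>C\<close> and then along \<open>J\<close>.
\<close>

lemma representation_on_quotient:
  fixes t :: "'x \<Rightarrow> 'v \<Rightarrow> 'v"
  assumes L: "lie_closed L" and C: "subspace C" and J: "subspace J" "J \<subseteq> C"
    and lin: "\<And>x. x \<in> carrier L ==> linmap sc sc (t x)"
    and tC: "\<And>x a. x \<in> carrier L ==> a \<in> C ==> t x a \<in> C"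
    and tJ: "\<And>x a. x \<in> carrier L ==> a \<in> J ==> t x a \<in> J"
    and add: "\<And>x x' a. x \<in> carrier L ==> x' \<in> carrier L ==> a \<in> C ==> t (x \<oplus>\<^bsub>L\<^esub> x') a - t x a - t x' a \<in> J"
    and scale: "\<And>c x a. x \<in> carrier L ==> a \<in> C ==> t (c \<odot>\<^bsub>L\<^esub> x) a - sc c (t x a) \<in> J"
    and bracket: "\<And>x x' d e a. x \<in> part L d ==> x' \<in> part L e ==> a \<in> C ==>
       t x (t x' a) - sc (koszul_sign d e) (t x' (t x a)) - t (bracket L x x') a \<in> J"
  obtains \<pi> T where "linmap sc sc \<pi>" "\<And>a. \<pi> a = 0 \<longleftrightarrow> a \<in> J" "is_rep L sc T"
    "\<And>x a. x \<in> carrier L ==> a \<in> C ==> T x (\<pi> a) = \<pi> (t x a)"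
proof -
  obtain \<pi> where \<pi>: "linmap sc sc \<pi>" "\<And>a. \<pi> a = 0 \<longleftrightarrow> a \<in> J" "\<And>a. \<pi> (\<pi> a) = \<pi> a"
    by (rule projection_with_kernel[OF J(1)]) blast
  obtain \<gamma> where \<gamma>: "linmap sc sc \<gamma>" "\<And>a. \<gamma> a = 0 \<longleftrightarrow> a \<in> C" "\<And>a. \<gamma> (\<gamma> a) = \<gamma> a"
    by (rule projection_with_kernel[OF C]) blast
  define P where "P a = a - \<gamma> a" for a
  have P: "linmap sc sc P" "P a \<in> C" "a \<in> C ==> P a = a" for a
    using \<gamma>(2)[of "P a"] \<gamma>(2)[of a] unfolding P_def
    by (auto simp: linmap_def linmap_diff[OF \<gamma>(1)] \<gamma>(3) linmap_add[OF \<gamma>(1)] linmap_scale[OF \<gamma>(1)] scale_right_diff_distrib)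
  define T where "T x a = \<pi> (t x (P a))" for x a
  have \<pi>J: "\<pi> a - a \<in> J" for a using \<pi>(2)[of "\<pi> a - a"] by (simp add: linmap_diff[OF \<pi>(1)] \<pi>(3))
  have \<pi>C: "\<pi> a \<in> C" if "a \<in> C" for a
    using subspace_add[OF C subsetD[OF J(2) \<pi>J[of a]] that] by simp
  have \<pi>eq: "\<pi> a = \<pi> b" if "a - b \<in> J" for a b
    using \<pi>(2)[of "a - b"] that by (simp add: linmap_diff[OF \<pi>(1)])
  have T\<pi>: "T x (\<pi> a) = \<pi> (t x a)" if "x \<in> carrier L" "a \<in> C" for x a
    unfolding T_def P(3)[OF \<pi>C[OF that(2)]]
    by (rule \<pi>eq) (use tJ[OF that(1) \<pi>J[of a]] linmap_diff[OF lin[OF that(1)]] in simp)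
  have TT: "T x (T x' a) = \<pi> (t x (t x' (P a)))" if "x \<in> carrier L" "x' \<in> carrier L" for x x' a
    unfolding T_def[of x'] by (rule T\<pi>[OF that(1) tC[OF that(2) P(2)]])
  have pc: "x \<in> part L d ==> x \<in> carrier L" for x d using lie_closed.part_carrier[OF L] by blast
  have "is_rep L sc T"
    unfolding is_rep_def
  proof (intro conjI ballI allI)
    show "linmap sc sc (T x)" if "x \<in> carrier L" for x
      unfolding T_def by (rule linmap_comp[OF P(1) linmap_comp[OF lin[OF that] \<pi>(1)]])
    show "T (x \<oplus>\<^bsub>L\<^esub> x') a = T x a + T x' a" if "x \<in> carrier L" "x' \<in> carrier L" for x x' a
      unfolding T_def linmap_add[OF \<pi>(1), symmetric]
      by (rule \<pi>eq) (use add[OF that P(2)[of a]] in \<open>simp add: diff_diff_add\<close>)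
    show "T (c \<odot>\<^bsub>L\<^esub> x) a = sc c (T x a)" if "x \<in> carrier L" for c x a
      unfolding T_def linmap_scale[OF \<pi>(1), symmetric] by (rule \<pi>eq) (rule scale[OF that P(2)])
    show "T (bracket L x x') a = T x (T x' a) - sc (koszul_sign d e) (T x' (T x a))"
      if "x \<in> part L d" "x' \<in> part L e" for d e x x' a
      unfolding TT[OF pc pc, OF that] TT[OF pc pc, OF that(2,1)] linmap_scale[OF \<pi>(1), symmetric] linmap_diff[OF \<pi>(1), symmetric]
      unfolding T_def by (rule \<pi>eq[symmetric]) (rule bracket[OF that P(2)])
  qed
  then show thesis using that \<pi>(1,2) T\<pi> by blast
qed

text \<open>
  The record \<open>W\<close> is the quotient of the subspace \<open>C\<close> by
  \<open>J\<close>, with \<open>\<phi>\<close> as the quotient map. All record-level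
  constructions are computed through such presentations.
\<close>

definition presents :: "('x, 'a) super_module \<Rightarrow> 'v set \<Rightarrow> ('v \<Rightarrow> 'a) \<Rightarrow> 'v set \<Rightarrow> bool" where
  "presents W C \<phi> J \<longleftrightarrow> subspace C \<and> subspace J \<and> J \<subseteq> C \<and> carrier W = \<phi> ` C \<and> \<zero>\<^bsub>W\<^esub> = \<phi> 0 \<and>
    (\<forall>a\<in>C. \<forall>b\<in>C. \<phi> a \<oplus>\<^bsub>W\<^esub> \<phi> b = \<phi> (a + b)) \<and> (\<forall>c. \<forall>a\<in>C. c \<odot>\<^bsub>W\<^esub> \<phi> a = \<phi> (sc c a)) \<and>
    (\<forall>a\<in>C. \<forall>b\<in>C. \<phi> a = \<phi> b \<longleftrightarrow> a - b \<in> J)"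

lemma presentsD:
  assumes "presents W C \<phi> J"
  shows "subspace C" "subspace J" "J \<subseteq> C" "carrier W = \<phi> ` C" "\<zero>\<^bsub>W\<^esub> = \<phi> 0"
    "a \<in> C ==> b \<in> C ==> \<phi> a \<oplus>\<^bsub>W\<^esub> \<phi> b = \<phi> (a + b)" "a \<in> C ==> c \<odot>\<^bsub>W\<^esub> \<phi> a = \<phi> (sc c a)"
    "a \<in> C ==> b \<in> C ==> \<phi> a = \<phi> b \<longleftrightarrow> a - b \<in> J"
  using assms unfolding presents_def by blast+

lemma presents_abelian_group:
  assumes "presents W C \<phi> J"
  shows "abelian_group W"
proof -
  note p = presentsD[OF assms]
  note C = subspace_add[OF p(1)] subspace_0[OF p(1)] subspace_neg[OF p(1)]
  show ?thesis
  proof (rule abelian_groupI)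
    fix x assume "x \<in> carrier W"
    then obtain a where "x = \<phi> a" "a \<in> C" using p(4) by blast
    then show "\<exists>y\<in>carrier W. y \<oplus>\<^bsub>W\<^esub> x = \<zero>\<^bsub>W\<^esub>"
      using C p(4,5,6) by (intro bexI[of _ "\<phi> (- a)"]) auto
  qed (use C p(4,5,6) in \<open>auto simp: ac_simps\<close>)
qed

lemma presents_finsum:
  assumes "presents W C \<phi> J" "finite A" "\<And>i. i \<in> A ==> g i \<in> C"
  shows "(\<Oplus>\<^bsub>W\<^esub>i\<in>A. \<phi> (g i)) = \<phi> (\<Sum>i\<in>A. g i)"
proof -
  note p = presentsD[OF assms(1)]
  interpret abelian_group W by (rule presents_abelian_group[OF assms(1)])
  show ?thesis using assms(2,3)
  proof (induction A rule: finite_induct)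
    case empty then show ?case by (simp add: p(5))
  next
    case (insert i A)
    then have "sum g A \<in> C" by (intro subspace_sum[OF p(1)]) auto
    then show ?case using insert p(4) by (simp add: finsum_insert p(6) Pi_def)
  qed
qed

lemma presents_minus:
  assumes "presents W C \<phi> J" "a \<in> C" "b \<in> C"
  shows "\<phi> a \<ominus>\<^bsub>W\<^esub> \<phi> b = \<phi> (a - b)"
proof -
  note p = presentsD[OF assms(1)]
  interpret abelian_group W by (rule presents_abelian_group[OF assms(1)])
  have "\<ominus>\<^bsub>W\<^esub> \<phi> b = \<phi> (- b)"
    by (rule minus_equality) (use assms p subspace_neg[OF p(1)] in auto)
  then show ?thesis using assms(2,3) subspace_neg[OF p(1)] by (simp add: a_minus_def p(6))
qed

lemma presents_additive_subgroup:
  assumes "presents W C \<phi> J" "subspace Q" "Q \<subseteq> C"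
  shows "additive_subgroup (\<phi> ` Q) W"
proof -
  note p = presentsD[OF assms(1)]
  interpret abelian_group W by (rule presents_abelian_group[OF assms(1)])
  show ?thesis
  proof (rule additive_subgroup.intro, rule group.subgroupI[OF a_group])
    show "\<phi> ` Q \<subseteq> carrier (add_monoid W)" using assms p(4) by auto
    show "\<phi> ` Q \<noteq> {}" using subspace_0[OF assms(2)] by blast
    fix x assume "x \<in> \<phi> ` Q"
    then obtain a where a: "x = \<phi> a" "a \<in> Q" by blast
    have "\<ominus>\<^bsub>W\<^esub> \<phi> a = \<phi> (- a)"
      by (rule minus_equality) (use a assms p subspace_neg[OF p(1)] in auto)
    then show "inv\<^bsub>add_monoid W\<^esub> x \<in> \<phi> ` Q" unfolding a(1) a_inv_def using subspace_neg[OF assms(2) a(2)] by simp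
    fix z assume "z \<in> \<phi> ` Q"
    then obtain b where b: "z = \<phi> b" "b \<in> Q" by blast
    then show "x \<otimes>\<^bsub>add_monoid W\<^esub> z \<in> \<phi> ` Q"
      using a assms(3) p(6)[of a b] subspace_add[OF assms(2) a(2) b(2)] by auto
  qed
qed

lemma coset_image:
  assumes "presents W C \<phi> J" "Q \<subseteq> C" "a \<in> C"
  shows "\<phi> ` Q +>\<^bsub>W\<^esub> \<phi> a = \<phi> ` ((\<lambda>k. k + a) ` Q)"
  using presentsD(6)[OF assms(1)] assms(2,3) by (force simp: a_r_coset_def r_coset_def)

lemma coset_image_eq_iff:
  assumes "presents W C \<phi> J" "subspace Q" "J \<subseteq> Q" "Q \<subseteq> C" "a \<in> C" "b \<in> C"
  shows "\<phi> ` Q +>\<^bsub>W\<^esub> \<phi> a = \<phi> ` Q +>\<^bsub>W\<^esub> \<phi> b \<longleftrightarrow> a - b \<in> Q"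
proof
  note p = presentsD[OF assms(1)]
  have KC: "k + a \<in> C" if "k \<in> Q" "a \<in> C" for k a using that assms(4) subspace_add[OF p(1)] by blast
  assume "\<phi> ` Q +>\<^bsub>W\<^esub> \<phi> a = \<phi> ` Q +>\<^bsub>W\<^esub> \<phi> b"
  then have "\<phi> (0 + a) \<in> \<phi> ` ((\<lambda>k. k + b) ` Q)"
    using assms subspace_0[OF assms(2)] by (metis coset_image imageI)
  then obtain k where k: "k \<in> Q" "\<phi> a = \<phi> (k + b)" by auto
  then have "a - (k + b) \<in> Q" using p(8)[OF assms(5) KC[OF k(1) assms(6)]] assms(3) by blast
  from subspace_add[OF assms(2) this k(1)] show "a - b \<in> Q" by simp
next
  assume ab: "a - b \<in> Q"
  have "(\<lambda>k. k + a) ` Q = (\<lambda>k. k + b) ` Q"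
  proof (intro equalityI subsetI)
    fix x assume "x \<in> (\<lambda>k. k + a) ` Q"
    then obtain k where "k \<in> Q" "x = k + a" by blast
    then show "x \<in> (\<lambda>k. k + b) ` Q" using subspace_add[OF assms(2) _ ab, of k] by (intro image_eqI[of _ _ "k + (a - b)"]) auto
  next
    fix x assume "x \<in> (\<lambda>k. k + b) ` Q"
    then obtain k where "k \<in> Q" "x = k + b" by blast
    then show "x \<in> (\<lambda>k. k + a) ` Q" using subspace_diff[OF assms(2) _ ab, of k] by (intro image_eqI[of _ _ "k - (a - b)"]) auto
  qed
  then show "\<phi> ` Q +>\<^bsub>W\<^esub> \<phi> a = \<phi> ` Q +>\<^bsub>W\<^esub> \<phi> b"
    using assms by (simp add: coset_image)
qed

lemma coset_map_eq:
  assumes W: "presents W C \<phi> J" and K1: "subspace K1" "K1 \<subseteq> C" and K2: "subspace K2" "J \<subseteq> K2" "K2 \<subseteq> C"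
    and f: "\<And>a. a \<in> C ==> f (\<phi> a) = \<phi> (t a)" "\<And>a. a \<in> C ==> t a \<in> C"
    and t: "\<And>k. k \<in> K1 ==> t (k + a) - t a \<in> K2" and a: "a \<in> C"
  shows "coset_map W (\<phi> ` K2) f (\<phi> ` K1 +>\<^bsub>W\<^esub> \<phi> a) = \<phi> ` K2 +>\<^bsub>W\<^esub> \<phi> (t a)"
proof -
  have "\<phi> ` K2 +>\<^bsub>W\<^esub> f (\<phi> (k + a)) = \<phi> ` K2 +>\<^bsub>W\<^esub> \<phi> (t a)" if "k \<in> K1" for k
  proof -
    have "k + a \<in> C" using that K1 a subspace_add[OF presentsD(1)[OF W]] by blast
    then show ?thesis using f a t[OF that] by (simp add: coset_image_eq_iff[OF W K2])
  qed
  then show ?thesis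
    unfolding coset_map_def coset_image[OF W K1(2) a] using subspace_0[OF K1(1)] by auto
qed

lemma presents_quotient:
  assumes W: "presents W C \<phi> J" and Q: "subspace Q" "J \<subseteq> Q" "Q \<subseteq> C"
  shows "presents (quotient W (\<phi> ` Q)) C (\<lambda>a. \<phi> ` Q +>\<^bsub>W\<^esub> \<phi> a) Q"
proof -
  note p = presentsD[OF W]
  interpret abelian_group W by (rule presents_abelian_group[OF W])
  interpret additive_subgroup "\<phi> ` Q" W by (rule presents_additive_subgroup[OF W Q(1,3)])
  interpret abelian_subgroup "\<phi> ` Q" W by (rule abelian_subgroupI3) unfold_locales
  have "carrier (quotient W (\<phi> ` Q)) = (\<lambda>a. \<phi> ` Q +>\<^bsub>W\<^esub> \<phi> a) ` C"
    unfolding quotient_def A_RCOSETS_def RCOSETS_def using p(4) by (auto simp: a_r_coset_def)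
  moreover have "\<zero>\<^bsub>quotient W (\<phi> ` Q)\<^esub> = \<phi> ` Q +>\<^bsub>W\<^esub> \<phi> 0"
    unfolding coset_image[OF W Q(3) subspace_0[OF p(1)]] by (simp add: quotient_def)
  moreover have "(\<phi> ` Q +>\<^bsub>W\<^esub> \<phi> a) \<oplus>\<^bsub>quotient W (\<phi> ` Q)\<^esub> (\<phi> ` Q +>\<^bsub>W\<^esub> \<phi> b) = \<phi> ` Q +>\<^bsub>W\<^esub> \<phi> (a + b)" if "a \<in> C" "b \<in> C" for a b
    using a_rcos_sum[of "\<phi> a" "\<phi> b"] that p(4,6) by (simp add: quotient_def)
  moreover have "c \<odot>\<^bsub>quotient W (\<phi> ` Q)\<^esub> (\<phi> ` Q +>\<^bsub>W\<^esub> \<phi> a) = \<phi> ` Q +>\<^bsub>W\<^esub> \<phi> (sc c a)" if "a \<in> C" for a c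
    using coset_map_eq[OF W Q(1,3) Q, of "module.smult W c" "sc c" a] that p(7)[of _ c] subspace_scale[OF p(1)] subspace_scale[OF Q(1)]
    by (simp add: quotient_def scale_right_distrib)
  ultimately show ?thesis
    unfolding presents_def using p Q coset_image_eq_iff[OF W Q] by simp
qed

lemma act_quotient:
  assumes W: "presents W C \<phi> J" and Q: "subspace Q" "J \<subseteq> Q" "Q \<subseteq> C"
    and t: "\<And>a. a \<in> C ==> act W x (\<phi> a) = \<phi> (t a)" "\<And>a. a \<in> C ==> t a \<in> C" "linmap sc sc t" "\<And>a. a \<in> Q ==> t a \<in> Q"
    and a: "a \<in> C"
  shows "act (quotient W (\<phi> ` Q)) x (\<phi> ` Q +>\<^bsub>W\<^esub> \<phi> a) = \<phi> ` Q +>\<^bsub>W\<^esub> \<phi> (t a)"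
  using coset_map_eq[OF W Q(1,3) Q, of "act W x" t a] t a by (simp add: quotient_def linmap_add)

end

section \<open>Enveloping algebras and cyclic modules\<close>

definition ucls :: "'x lie_superalgebra \<Rightarrow> ('x list \<Rightarrow>\<^sub>0 complex) \<Rightarrow> ('x list \<Rightarrow>\<^sub>0 complex) set" where
  "ucls L p = UEA_ideal L +>\<^bsub>free_algebra L\<^esub> p"

lemma presents_free_algebra: "pc.presents (free_algebra L) (fa L) (\<lambda>p. p) {0}"
  unfolding pc.presents_def using fa_subspace[of L]
  by (auto simp: free_algebra_def pscale_def[symmetric] pscale.subspace_def)

context lie_closed
begin

lemma presents_UEA: "pc.presents (UEA L) (fa L) (ucls L) (UEA_ideal L)"
  using pc.presents_quotient[OF presents_free_algebra UEA_ideal_subspace _ UEA_ideal_subset] pscale.subspace_0[OF UEA_ideal_subspace]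
  unfolding UEA_def ucls_def by simp

lemma UEA_mult:
  assumes "p \<in> fa L" "q \<in> fa L"
  shows "ucls L p \<otimes>\<^bsub>UEA L\<^esub> ucls L q = ucls L (word_mult p q)"
  using ideal.rcoset_mult_add[OF UEA_ideal_ideal, of p q] assms
  by (simp add: UEA_def quotient_def ucls_def free_algebra_def)

lemma UEA_one: "\<one>\<^bsub>UEA L\<^esub> = ucls L (gen [])"
  by (simp add: UEA_def quotient_def ucls_def free_algebra_def)

lemma UEA_incl_ucls: "UEA_incl L x = ucls L (gen [x])"
  by (simp add: UEA_incl_def ucls_def)

lemma UEA_pow:
  assumes "x \<in> carrier L"
  shows "UEA_incl L x [^]\<^bsub>UEA L\<^esub> (n::nat) = ucls L (gen (replicate n x))"
proof (induction n)
  case 0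
  then show ?case by (simp add: nat_pow_def UEA_one)
next
  case (Suc n)
  then have "UEA_incl L x [^]\<^bsub>UEA L\<^esub> Suc n = ucls L (gen (replicate n x)) \<otimes>\<^bsub>UEA L\<^esub> ucls L (gen [x])"
    by (simp add: nat_pow_def UEA_incl_ucls)
  also have "\<dots> = ucls L (gen (replicate n x @ [x]))"
    using assms by (subst UEA_mult) (auto simp: in_lists_conv_set)
  finally show ?case by (simp add: replicate_append_same)
qed

lemma UEA_act:
  assumes "x \<in> carrier L" "p \<in> fa L"
  shows "act (UEA L) x (ucls L p) = ucls L (word_mult (gen [x]) p)"
proof -
  have x: "gen [x] \<in> fa L" using assms by simp
  have "act (quotient (free_algebra L) ((\<lambda>p. p) ` UEA_ideal L)) x ((\<lambda>p. p) ` UEA_ideal L +>\<^bsub>free_algebra L\<^esub> p) =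
      (\<lambda>p. p) ` UEA_ideal L +>\<^bsub>free_algebra L\<^esub> (word_mult (gen [x]) p)"
  proof (rule pc.act_quotient[OF presents_free_algebra UEA_ideal_subspace _ UEA_ideal_subset, where t = "word_mult (gen [x])"])
    show "{0} \<subseteq> UEA_ideal L" using pscale.subspace_0[OF UEA_ideal_subspace] by simp
    show "act (free_algebra L) x a = word_mult (gen [x]) a" for a by (simp add: free_algebra_def)
    show "word_mult (gen [x]) a \<in> fa L" if "a \<in> fa L" for a by (rule fa_word_mult[OF x that])
    show "word_mult (gen [x]) a \<in> UEA_ideal L" if "a \<in> UEA_ideal L" for a by (rule UEA_ideal_mult(1)[OF that x])
  qed (rule linmap_word_mult_right assms(2))+
  then show ?thesis unfolding UEA_def ucls_def image_ident .
qed

text \<open>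
  The preimage in the free algebra of the left ideal of the enveloping algebra that is generated
  by the classes of \<open>P\<close>.
\<close>

definition lgen :: "('x list \<Rightarrow>\<^sub>0 complex) set \<Rightarrow> ('x list \<Rightarrow>\<^sub>0 complex) set" where
  "lgen P = {p \<in> fa L. ucls L p \<in> generated_left_ideal (UEA L) (ucls L ` P)}"

lemma left_ideal_carrier: "left_ideal (UEA L) (carrier (UEA L))"
  unfolding left_ideal_def
proof (intro conjI ballI)
  note p = pc.presentsD[OF presents_UEA]
  show "additive_subgroup (carrier (UEA L)) (UEA L)"
    unfolding p(4) using pc.presents_additive_subgroup[OF presents_UEA fa_subspace] by blast
  show "a \<otimes>\<^bsub>UEA L\<^esub> u \<in> carrier (UEA L)" 
    if a: "a \<in> carrier (UEA L)" and u: "u \<in> carrier (UEA L)" for a u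
  proof -
    obtain b where b: "a = ucls L b" "b \<in> fa L" using a unfolding p(4) by blast
    obtain w where w: "u = ucls L w" "w \<in> fa L" using u unfolding p(4) by blast
    show ?thesis unfolding p(4) b(1) w(1) UEA_mult[OF b(2) w(2)] by (intro imageI fa_word_mult b w)
  qed
qed

lemma lgen_eq:
  assumes "P \<subseteq> fa L"
  shows "generated_left_ideal (UEA L) (ucls L ` P) = ucls L ` lgen P"
proof -
  have "generated_left_ideal (UEA L) (ucls L ` P) \<subseteq> ucls L ` fa L"
    unfolding generated_left_ideal_def
    by (rule Inter_lower) (use left_ideal_carrier assms pc.presentsD(4)[OF presents_UEA] in \<open>auto simp del: mem_Collect_eq\<close>)
  then show ?thesis unfolding lgen_def by auto
qed

lemma lgen_iff: "p \<in> lgen P \<longleftrightarrow> p \<in> fa L \<and> (\<forall>I. left_ideal (UEA L) I \<and> ucls L ` P \<subseteq> I \<longrightarrow> ucls L p \<in> I)"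
  unfolding lgen_def generated_left_ideal_def by auto

lemma lgen_word_mult:
  assumes "q \<in> fa L" "p \<in> lgen P"
  shows "word_mult q p \<in> lgen P"
proof -
  have p: "p \<in> fa L" using assms unfolding lgen_iff by blast
  show ?thesis
    unfolding lgen_iff
  proof (intro conjI allI impI)
    show "word_mult q p \<in> fa L" by (rule fa_word_mult[OF assms(1) p])
    fix I assume I: "left_ideal (UEA L) I \<and> ucls L ` P \<subseteq> I"
    then have "ucls L p \<in> I" using assms(2) unfolding lgen_iff by blast
    moreover have "ucls L q \<in> carrier (UEA L)" using assms(1) pc.presentsD(4)[OF presents_UEA] by blast
    ultimately have "ucls L q \<otimes>\<^bsub>UEA L\<^esub> ucls L p \<in> I" using I unfolding left_ideal_def by blast
    then show "ucls L (word_mult q p) \<in> I" by (simp only: UEA_mult[OF assms(1) p])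
  qed
qed

lemma UEA_ideal_lgen: "UEA_ideal L \<subseteq> lgen P"
proof
  note pU = pc.presentsD[OF presents_UEA]
  fix p assume p: "p \<in> UEA_ideal L"
  then have "ucls L p = \<zero>\<^bsub>UEA L\<^esub>" using pU(8)[of p 0] pU(3,5) by auto
  then show "p \<in> lgen P" using p UEA_ideal_subset
    unfolding lgen_iff left_ideal_def by (auto dest: additive_subgroup.zero_closed simp del: mem_Collect_eq)
qed

lemma lgen_subspace: "pscale.subspace (lgen P)"
  unfolding pscale.subspace_def
proof (intro conjI ballI allI)
  note pU = pc.presentsD[OF presents_UEA]
  show "0 \<in> lgen P" using UEA_ideal_lgen pscale.subspace_0[OF UEA_ideal_subspace] by blast
  fix p assume p: "p \<in> lgen P"
  then have pfa: "p \<in> fa L" unfolding lgen_iff by blast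
  show "pscale c p \<in> lgen P" for c
    using lgen_word_mult[of "single [] c", OF _ p] by (simp add: word_mult_scalar)
  fix q assume q: "q \<in> lgen P"
  then have qfa: "q \<in> fa L" unfolding lgen_iff by blast
  show "p + q \<in> lgen P"
    unfolding lgen_iff
  proof (intro conjI allI impI)
    show "p + q \<in> fa L" by (rule pscale.subspace_add[OF fa_subspace pfa qfa])
    fix I assume I: "left_ideal (UEA L) I \<and> ucls L ` P \<subseteq> I"
    then have "ucls L p \<oplus>\<^bsub>UEA L\<^esub> ucls L q \<in> I"
      using p q unfolding lgen_iff left_ideal_def by (blast intro: additive_subgroup.a_closed)
    then show "ucls L (p + q) \<in> I" by (simp only: pU(6)[OF pfa qfa])
  qed
qed

lemma lgen_superset: "P \<subseteq> fa L ==> P \<subseteq> lgen P"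
  unfolding lgen_iff subset_iff by blast

lemma lgen_subset: "lgen P \<subseteq> fa L"
  unfolding lgen_def by blast

text \<open>
  The elements that annihilate \<open>v\<close> form a left ideal; this is the universal
  property of cyclic modules.
\<close>

lemma lgen_minimal:
  assumes "cspace sc" "is_rep L sc T" "\<And>p. p \<in> P ==> cspace.action sc T p v = 0" "P \<subseteq> fa L" "p \<in> lgen P"
  shows "cspace.action sc T p v = 0"
proof -
  interpret cspace sc by fact
  note pU = pc.presentsD[OF presents_UEA]
  define N where "N = {p \<in> fa L. action T p v = 0}"
  have N: "pscale.subspace N" "N \<subseteq> fa L"
    unfolding N_def pscale.subspace_def
    using pscale.subspace_add[OF fa_subspace[of L]] pscale.subspace_scale[OF fa_subspace[of L]]
    by (auto simp: linmap_add[OF linmap_action] linmap_scale[OF linmap_action] linmap_zero[OF linmap_action])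
  have "left_ideal (UEA L) (ucls L ` N)"
    unfolding left_ideal_def
  proof (intro conjI ballI)
    show "additive_subgroup (ucls L ` N) (UEA L)" by (rule pc.presents_additive_subgroup[OF presents_UEA N])
    fix a u assume "a \<in> carrier (UEA L)" "u \<in> ucls L ` N"
    then obtain q n where q: "a = ucls L q" "q \<in> fa L" and n: "u = ucls L n" "n \<in> N" using pU(4) by auto
    have "word_mult q n \<in> N"
      using n q N(2) fa_word_mult[OF q(2), of n] linmap_zero[OF linmap_action_right[OF assms(2) q(2)]]
      unfolding N_def by (auto simp: action_word_mult[OF assms(2)])
    moreover have "n \<in> fa L" using n N by blast
    ultimately show "a \<otimes>\<^bsub>UEA L\<^esub> u \<in> ucls L ` N" using UEA_mult[OF q(2)] q n by auto
  qed
  moreover have "ucls L ` P \<subseteq> ucls L ` N" using assms(3,4) unfolding N_def by blast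
  ultimately have "ucls L p \<in> ucls L ` N" and pfa: "p \<in> fa L" using assms(5) unfolding lgen_iff by blast+
  then obtain n where n: "n \<in> N" "ucls L p = ucls L n" by auto
  then have "p - n \<in> UEA_ideal L" using pU(8)[OF pfa] N by blast
  then have "action T (p - n) v = 0" by (rule action_UEA_ideal[OF lie_closed_axioms assms(2)])
  then show ?thesis using n unfolding N_def by (simp add: linmap_diff[OF linmap_action])
qed

definition cyc :: "('x list \<Rightarrow>\<^sub>0 complex) set \<Rightarrow> ('x, ('x list \<Rightarrow>\<^sub>0 complex) set set) super_module" where
  "cyc P = quotient (UEA L) (generated_left_ideal (UEA L) (ucls L ` P))"

definition ccls :: "('x list \<Rightarrow>\<^sub>0 complex) set \<Rightarrow> ('x list \<Rightarrow>\<^sub>0 complex) \<Rightarrow> ('x list \<Rightarrow>\<^sub>0 complex) set set" where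
  "ccls P p = generated_left_ideal (UEA L) (ucls L ` P) +>\<^bsub>UEA L\<^esub> ucls L p"

lemma presents_cyc:
  assumes "P \<subseteq> fa L"
  shows "pc.presents (cyc P) (fa L) (ccls P) (lgen P)"
  using pc.presents_quotient[OF presents_UEA lgen_subspace UEA_ideal_lgen lgen_subset]
  unfolding cyc_def ccls_def lgen_eq[OF assms] .

lemma act_cyc:
  assumes "P \<subseteq> fa L" "x \<in> carrier L" "p \<in> fa L"
  shows "act (cyc P) x (ccls P p) = ccls P (word_mult (gen [x]) p)"
proof -
  have x: "gen [x] \<in> fa L" using assms by simp
  show ?thesis
    unfolding cyc_def ccls_def lgen_eq[OF assms(1)]
  proof (rule pc.act_quotient[OF presents_UEA lgen_subspace UEA_ideal_lgen lgen_subset, where t = "word_mult (gen [x])"])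
    show "act (UEA L) x (ucls L a) = ucls L (word_mult (gen [x]) a)" if "a \<in> fa L" for a by (rule UEA_act[OF assms(2) that])
    show "word_mult (gen [x]) a \<in> fa L" if "a \<in> fa L" for a by (rule fa_word_mult[OF x that])
    show "word_mult (gen [x]) a \<in> lgen P" if "a \<in> lgen P" for a by (rule lgen_word_mult[OF x that])
  qed (rule linmap_word_mult_right assms(3))+
qed

text \<open>
  Left multiplication on the free algebra modulo \<open>J\<close>; the image of the empty word
  is a cyclic vector with annihilator \<open>J\<close>.
\<close>

lemma cyclic_representation:
  assumes J: "pscale.subspace J" "UEA_ideal L \<subseteq> J" "J \<subseteq> fa L" "\<And>q p. q \<in> fa L ==> p \<in> J ==> word_mult q p \<in> J"
  shows "\<exists>\<pi> (T :: 'x \<Rightarrow> ('x list \<Rightarrow>\<^sub>0 complex) \<Rightarrow> ('x list \<Rightarrow>\<^sub>0 complex)).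
    linmap pscale pscale \<pi> \<and> (\<forall>a. \<pi> a = 0 \<longleftrightarrow> a \<in> J) \<and> is_rep L pscale T \<and>
    (\<forall>p\<in>fa L. pc.action T p (\<pi> (gen [])) = \<pi> p)"
proof -
  have g: "gen [x] \<in> fa L" if "x \<in> carrier L" for x using that by simp
  have rel: "word_mult r a \<in> J" if "r \<in> UEA_relations L" "a \<in> fa L" for r a
    using UEA_ideal_mult(2)[OF subsetD[OF UEA_relations_ideal that(1)] that(2)] J(2) by blast
  have assoc2: "word_mult (gen [x]) (word_mult (gen [x']) a) = word_mult (gen [x, x']) a" for x x' :: 'x and a
    by (simp add: word_mult_assoc[symmetric])
  have 1: "word_mult (gen [x \<oplus>\<^bsub>L\<^esub> x']) a - word_mult (gen [x]) a - word_mult (gen [x']) a \<in> J"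
      if "x \<in> carrier L" "x' \<in> carrier L" "a \<in> fa L" for x x' a
      unfolding word_mult_diff_left[symmetric]
      by (rule rel[OF _ that(3)]) (use that in \<open>unfold UEA_relations_def, blast\<close>)
  have 2: "word_mult (gen [c \<odot>\<^bsub>L\<^esub> x]) a - pscale c (word_mult (gen [x]) a) \<in> J"
      if "x \<in> carrier L" "a \<in> fa L" for c x a
    proof -
      have "gen [c \<odot>\<^bsub>L\<^esub> x] - single [x] c \<in> UEA_relations L" using that unfolding UEA_relations_def by blast
      from rel[OF this that(2)] show ?thesis
        unfolding word_mult_diff_left word_mult_scale_left[symmetric] by simp
    qed
  have 3: "word_mult (gen [x]) (word_mult (gen [x']) a) - pscale (koszul_sign d e) (word_mult (gen [x']) (word_mult (gen [x]) a))
       - word_mult (gen [bracket L x x']) a \<in> J" if "x \<in> part L d" "x' \<in> part L e" "a \<in> fa L" for x x' d e a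
    proof -
      have "gen [x, x'] - single [x', x] (koszul_sign d e) - gen [bracket L x x'] \<in> UEA_relations L"
        using that unfolding UEA_relations_def by blast
      from rel[OF this that(3)] show ?thesis
        unfolding word_mult_diff_left assoc2 word_mult_scale_left[symmetric] by simp
    qed
  define t :: "'x \<Rightarrow> ('x list \<Rightarrow>\<^sub>0 complex) \<Rightarrow> ('x list \<Rightarrow>\<^sub>0 complex)" where "t x a = word_mult (gen [x]) a" for x a
  have tx: "t x = word_mult (gen [x])" for x by (rule ext) (rule t_def)
  have "\<exists>\<pi> (T :: 'x \<Rightarrow> ('x list \<Rightarrow>\<^sub>0 complex) \<Rightarrow> ('x list \<Rightarrow>\<^sub>0 complex)). linmap pscale pscale \<pi> \<and> (\<forall>a. \<pi> a = 0 \<longleftrightarrow> a \<in> J) \<and> is_rep L pscale T \<and>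
    (\<forall>x\<in>carrier L. \<forall>a\<in>fa L. T x (\<pi> a) = \<pi> (t x a))"
  proof (rule pc.representation_on_quotient[of L "fa L" J t])
    show "lie_closed L" by (rule lie_closed_axioms)
    show "pscale.subspace (fa L)" by (rule fa_subspace)
    show "linmap pscale pscale (t x)" for x unfolding tx by (rule linmap_word_mult_right)
    show "t x a \<in> fa L" if "x \<in> carrier L" "a \<in> fa L" for x a unfolding t_def by (rule fa_word_mult[OF g[OF that(1)] that(2)])
    show "t x a \<in> J" if "x \<in> carrier L" "a \<in> J" for x a unfolding t_def by (rule J(4)[OF g[OF that(1)] that(2)])
    show "t (x \<oplus>\<^bsub>L\<^esub> x') a - t x a - t x' a \<in> J" if "x \<in> carrier L" "x' \<in> carrier L" "a \<in> fa L" for x x' a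
      unfolding t_def by (rule 1[OF that])
    show "t (c \<odot>\<^bsub>L\<^esub> x) a - pscale c (t x a) \<in> J" if "x \<in> carrier L" "a \<in> fa L" for c x a
      unfolding t_def by (rule 2[OF that])
    show "t x (t x' a) - pscale (koszul_sign d e) (t x' (t x a)) - t (bracket L x x') a \<in> J"
      if "x \<in> part L d" "x' \<in> part L e" "a \<in> fa L" for x x' d e a
      unfolding t_def by (rule 3[OF that])
    fix \<pi> and T :: "'x \<Rightarrow> ('x list \<Rightarrow>\<^sub>0 complex) \<Rightarrow> ('x list \<Rightarrow>\<^sub>0 complex)"
    assume "linmap pscale pscale \<pi>" "\<And>a. \<pi> a = 0 \<longleftrightarrow> a \<in> J" "is_rep L pscale T"
      "\<And>x a. x \<in> carrier L ==> a \<in> fa L ==> T x (\<pi> a) = \<pi> (t x a)"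
    then show ?thesis by blast
  qed (rule J)+
  then obtain \<pi> and T :: "'x \<Rightarrow> ('x list \<Rightarrow>\<^sub>0 complex) \<Rightarrow> ('x list \<Rightarrow>\<^sub>0 complex)"
    where \<pi>: "linmap pscale pscale \<pi> \<and> (\<forall>a. \<pi> a = 0 \<longleftrightarrow> a \<in> J) \<and> is_rep L pscale T \<and>
      (\<forall>x\<in>carrier L. \<forall>a\<in>fa L. T x (\<pi> a) = \<pi> (t x a))"
    by (elim exE)
  then have lin: "linmap pscale pscale \<pi>" and T: "\<And>x a. x \<in> carrier L ==> a \<in> fa L ==> T x (\<pi> a) = \<pi> (word_mult (gen [x]) a)"
    unfolding t_def by simp_all
  have "foldr T w (\<pi> (gen [])) = \<pi> (gen w)" if "w \<in> lists (carrier L)" for w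
    using that
  proof (induction w)
    case (Cons x w)
    then have "T x (\<pi> (gen w)) = \<pi> (word_mult (gen [x]) (gen w))" by (intro T) auto
    then show ?case using Cons by simp
  qed simp
  then have act: "pc.action T p (\<pi> (gen [])) = \<pi> p" if "p \<in> fa L" for p
    using linmap_pm_eqI[where f = "\<lambda>p. pc.action T p (\<pi> (gen []))" and g = \<pi> and p = p, OF pc.linmap_action lin] that
    by fastforce
  show ?thesis using \<pi> act by blast
qed

end

section \<open>The Lie superalgebras\<close>

lemma UNIV_bit: "UNIV = {0, 1 :: bit}"
  by (auto simp: bit_not_zero_iff)

lemma bit_exhaust: obtains "d = (0::bit)" | "d = 1"
  by (cases "d = 0") auto

lemma three_distinct [simp]: "(1::3) \<noteq> 2" "(2::3) \<noteq> 1" "(1::3) \<noteq> 3" "(3::3) \<noteq> 1" "(2::3) \<noteq> 3" "(3::3) \<noteq> 2"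
  by simp_all

lemma block_nth: "block d A $ i $ j = (if (d = 0) = ((i = 1) = (j = 1)) then A $ i $ j else 0)"
  by (simp add: block_def)

lemma mscale_nth [simp]: "(c *\<^sub>M A) $ i $ j = c * A $ i $ j"
  by (simp add: mscale_def)

lemma E_nth: "E i j $ a $ b = (if a = i \<and> b = j then 1 else 0)"
  by (simp add: E_def)

lemma mult_nth: "((A :: mat3) ** B) $ i $ j = A $ i $ 1 * B $ 1 $ j + A $ i $ 2 * B $ 2 $ j + A $ i $ 3 * B $ 3 $ j"
  by (simp add: matrix_matrix_mult_def sum_3)

lemma mat3_eq_iff: "(A :: mat3) = B \<longleftrightarrow> (A$1$1 = B$1$1 \<and> A$1$2 = B$1$2 \<and> A$1$3 = B$1$3) \<and>
    (A$2$1 = B$2$1 \<and> A$2$2 = B$2$2 \<and> A$2$3 = B$2$3) \<and> (A$3$1 = B$3$1 \<and> A$3$2 = B$3$2 \<and> A$3$3 = B$3$3)"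
  by (simp add: vec_eq_iff forall_3)

lemma carrier_sl12: "A \<in> carrier sl12 \<longleftrightarrow> A$1$1 = A$2$2 + A$3$3"
  by (auto simp: sl12_def Let_def algebra_simps)

lemma part_sl12: "A \<in> part sl12 d \<longleftrightarrow> A \<in> carrier sl12 \<and> block d A = A"
  by (simp add: sl12_def Let_def)

lemma part_sl12_0: "A \<in> part sl12 0 \<longleftrightarrow> A$1$1 = A$2$2 + A$3$3 \<and> A$1$2 = 0 \<and> A$1$3 = 0 \<and> A$2$1 = 0 \<and> A$3$1 = 0"
  by (auto simp: part_sl12 carrier_sl12 mat3_eq_iff block_nth)

lemma part_sl12_1: "A \<in> part sl12 1 \<longleftrightarrow> A$1$1 = 0 \<and> A$2$2 = 0 \<and> A$3$3 = 0 \<and> A$2$3 = 0 \<and> A$3$2 = 0"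
  by (auto simp: part_sl12 carrier_sl12 mat3_eq_iff block_nth)

lemma block_other: "d \<noteq> e ==> block e (block d A) = 0"
  by (cases d rule: bit_exhaust; cases e rule: bit_exhaust) (auto simp: mat3_eq_iff block_nth)

lemma super_commutator_homogeneous:
  assumes "block d A = A" "block e B = B"
  shows "super_commutator A B = A ** B - koszul_sign d e *\<^sub>M (B ** A)"
proof -
  have A: "block d' A = (if d' = d then A else 0)" for d' using block_other[of d d' A] assms by auto
  have B: "block e' B = (if e' = e then B else 0)" for e' using block_other[of e e' B] assms by auto
  have z: "(0::mat3) ** C = 0" "C ** (0::mat3) = 0" "c *\<^sub>M (0::mat3) = 0" for C c
    by (auto simp: mat3_eq_iff mult_nth)
  show ?thesis
    unfolding super_commutator_def A B UNIV_bit
    by (cases d rule: bit_exhaust; cases e rule: bit_exhaust) (auto simp: z)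
qed

lemma bracket_sl12: "x \<in> part sl12 d ==> y \<in> part sl12 e ==> bracket sl12 x y = x ** y - koszul_sign d e *\<^sub>M (y ** x)"
  using super_commutator_homogeneous by (simp add: part_sl12 sl12_def Let_def)

lemma add_sl12 [simp]: "A \<oplus>\<^bsub>sl12\<^esub> B = A + B"
  and smult_sl12 [simp]: "c \<odot>\<^bsub>sl12\<^esub> A = c *\<^sub>M A"
  by (simp_all add: sl12_def Let_def)

lemma bracket_sl12_closed:
  assumes "x \<in> part sl12 d" "y \<in> part sl12 e"
  shows "bracket sl12 x y \<in> part sl12 (d + e)"
  using assms unfolding bracket_sl12[OF assms]
  by (cases d rule: bit_exhaust; cases e rule: bit_exhaust)
    (auto simp: part_sl12_0 part_sl12_1 mult_nth koszul_sign_def algebra_simps)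

lemma carrier_sl12_closed: "0 \<in> carrier sl12" "A \<in> carrier sl12 ==> B \<in> carrier sl12 ==> A + B \<in> carrier sl12"
    "A \<in> carrier sl12 ==> c *\<^sub>M A \<in> carrier sl12"
  by (auto simp: carrier_sl12 algebra_simps)

lemma part_sl12_closed: "0 \<in> part sl12 d" "A \<in> part sl12 d ==> B \<in> part sl12 d ==> A + B \<in> part sl12 d"
  by (cases d rule: bit_exhaust; auto simp: part_sl12_0 part_sl12_1)+

lemma part_carrier_sl12: "A \<in> part sl12 d ==> A \<in> carrier sl12"
  by (simp add: part_sl12)

lemma lie_closed_sl12: "lie_closed sl12"
proof
  show "bracket sl12 x x' \<in> carrier sl12" if "x \<in> part sl12 d" "x' \<in> part sl12 e" for x x' d e
    using part_carrier_sl12 bracket_sl12_closed[OF that] .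
qed (use carrier_sl12_closed part_carrier_sl12 in auto)

lemma block_part: "A \<in> carrier sl12 ==> block d A \<in> part sl12 d"
  by (cases d rule: bit_exhaust) (auto simp: part_sl12_0 part_sl12_1 carrier_sl12 block_nth)

lemma block_sum: "block 0 A + block 1 A = A"
  by (simp add: mat3_eq_iff block_nth)

lemma mscale_mscale: "c *\<^sub>M (0::mat3) = 0"
  by (simp add: mat3_eq_iff)

lemma carrier_sl12_t: "p \<in> carrier sl12_t \<longleftrightarrow> (\<forall>m. lookup p m \<in> carrier sl12)"
  and part_sl12_t: "p \<in> part sl12_t d \<longleftrightarrow> (\<forall>m. lookup p m \<in> part sl12 d)"
  and add_sl12_t [simp]: "p \<oplus>\<^bsub>sl12_t\<^esub> p' = p + p'"
  and smult_sl12_t: "c \<odot>\<^bsub>sl12_t\<^esub> p = Poly_Mapping.map ((*\<^sub>M) c) p"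
  by (simp_all add: sl12_t_def)

lemma lookup_smult_sl12_t [simp]: "lookup (c \<odot>\<^bsub>sl12_t\<^esub> p) m = c *\<^sub>M lookup p m"
  by (simp add: smult_sl12_t Poly_Mapping.map.rep_eq when_def mscale_mscale)

lemma bracket_sl12_t_part:
  assumes "p \<in> part sl12_t d" "p' \<in> part sl12_t e"
  shows "bracket sl12_t p p' \<in> part sl12_t (d + e)"
proof -
  have sum: "sum f A \<in> part sl12 c" if "\<And>i. i \<in> A ==> f i \<in> part sl12 c" for f :: "nat \<Rightarrow> mat3" and A c
    using that by (induction A rule: infinite_finite_induct) (auto intro: part_sl12_closed)
  define c where "c = d + e"
  have b: "bracket sl12 (lookup p i) (lookup p' j) \<in> part sl12 c" for i j
    unfolding c_def using assms unfolding part_sl12_t by (blast intro: bracket_sl12_closed)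
  show ?thesis
    unfolding part_sl12_t c_def[symmetric]
    by (auto simp: sl12_t_def lookup_sum lookup_single when_def intro!: sum b part_sl12_closed)
qed

lemma part_carrier_sl12_t: "p \<in> part sl12_t d ==> p \<in> carrier sl12_t"
  unfolding part_sl12_t carrier_sl12_t using part_carrier_sl12 by blast

lemma lie_closed_sl12_t: "lie_closed sl12_t"
proof
  show "bracket sl12_t x x' \<in> carrier sl12_t" if "x \<in> part sl12_t d" "x' \<in> part sl12_t e" for x x' d e
    using part_carrier_sl12_t bracket_sl12_t_part[OF that] .
qed (use part_carrier_sl12_t in \<open>auto simp: carrier_sl12_t lookup_add carrier_sl12_closed\<close>)

lemma bracket_zero: "bracket sl12 0 x = 0" "bracket sl12 x 0 = 0"
proof -
  have z: "(0::mat3) ** C = 0" "C ** (0::mat3) = 0" "c *\<^sub>M (0::mat3) = 0" "block d 0 = 0" for C c d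
    by (auto simp: mat3_eq_iff mult_nth block_nth)
  show "bracket sl12 0 x = 0" "bracket sl12 x 0 = 0"
    by (simp_all add: sl12_def Let_def super_commutator_def z)
qed

lemma bracket_single: "bracket sl12_t (single m x) (single n x') = single (m + n) (bracket sl12 x x')"
  by (cases "x = 0"; cases "x' = 0") (auto simp: sl12_t_def bracket_zero)

lemma single_carrier: "x \<in> carrier sl12 ==> single m x \<in> carrier sl12_t"
  by (auto simp: carrier_sl12_t lookup_single when_def carrier_sl12_closed)

lemma single_part: "x \<in> part sl12 d ==> single m x \<in> part sl12_t d"
  by (auto simp: part_sl12_t lookup_single when_def part_sl12_closed)

lemma E_part: "E 3 2 \<in> part sl12 0" "E 2 3 \<in> part sl12 0" "h1 \<in> part sl12 0" "h2 \<in> part sl12 0"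
  "E 1 2 \<in> part sl12 1" "E 1 3 \<in> part sl12 1" "E 2 1 \<in> part sl12 1" "E 3 1 \<in> part sl12 1"
  by (auto simp: part_sl12_0 part_sl12_1 E_nth h1_def h2_def)

lemma bracket_E:
  "bracket sl12 (E 1 2) (E 3 1) = E 3 2" "bracket sl12 (E 2 1) (E 1 2) = h1" "bracket sl12 (E 2 3) (E 3 2) = h2"
  "bracket sl12 h1 (E 1 2) = 0" "bracket sl12 h2 (E 3 2) = (-2) *\<^sub>M E 3 2"
  "bracket sl12 (E 3 2) (E 3 2) = 0" "bracket sl12 (E 1 2) (E 3 2) = 0" "bracket sl12 (E 3 1) (E 3 2) = 0"
  "bracket sl12 (E 1 2) (E 1 2) = 0" "bracket sl12 (E 3 1) (E 3 1) = 0"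
  "bracket sl12 (E 1 3) (E 3 2) = E 1 2" "bracket sl12 (E 2 1) (E 3 2) = (-1) *\<^sub>M E 3 1"
  "bracket sl12 (E 1 3) (E 1 2) = 0" "bracket sl12 (E 2 1) (E 3 1) = 0"
  unfolding E_part(1-8)[THEN bracket_sl12, OF E_part(1)] E_part(1-8)[THEN bracket_sl12, OF E_part(2)]
    E_part(1-8)[THEN bracket_sl12, OF E_part(5)] E_part(1-8)[THEN bracket_sl12, OF E_part(8)]
  by (simp_all add: mat3_eq_iff mult_nth E_nth h1_def h2_def koszul_sign_def)

context cspace
begin

lemma rep_zero:
  assumes "is_rep sl12_t sc T"
  shows "T 0 a = 0"
proof -
  have "(0 :: nat \<Rightarrow>\<^sub>0 mat3) = 0 \<odot>\<^bsub>sl12_t\<^esub> 0" by (rule poly_mapping_eqI) (simp add: mscale_mscale)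
  moreover have "(0 :: nat \<Rightarrow>\<^sub>0 mat3) \<in> carrier sl12_t" by (simp add: carrier_sl12_t carrier_sl12_closed)
  ultimately show ?thesis using is_repD(3)[OF assms, of 0 0 a] by simp
qed

lemma rep_single_linear:
  assumes "is_rep sl12_t sc T" "A \<in> carrier sl12"
  shows "B \<in> carrier sl12 ==> T (single m (A + B)) a = T (single m A) a + T (single m B) a"
    and "T (single m (c *\<^sub>M A)) a = sc c (T (single m A) a)"
proof -
  show "T (single m (A + B)) a = T (single m A) a + T (single m B) a" if "B \<in> carrier sl12"
    using is_repD(2)[OF assms(1) single_carrier[OF assms(2)] single_carrier[OF that], of m m a] by (simp add: single_add)
  have "single m (c *\<^sub>M A) = c \<odot>\<^bsub>sl12_t\<^esub> single m A"
    by (rule poly_mapping_eqI) (auto simp: lookup_single when_def mscale_mscale)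
  then show "T (single m (c *\<^sub>M A)) a = sc c (T (single m A) a)"
    using is_repD(3)[OF assms(1) single_carrier[OF assms(2)], of c m a] by simp
qed

lemma rep_bracket:
  assumes "is_rep sl12_t sc T" "A \<in> part sl12 d" "B \<in> part sl12 e"
  shows "T (single m A) (T (single n B) a) =
    sc (koszul_sign d e) (T (single n B) (T (single m A) a)) + T (single (m + n) (bracket sl12 A B)) a"
  using is_repD(4)[OF assms(1) single_part[OF assms(2)] single_part[OF assms(3)], of m n a]
  unfolding bracket_single by simp

lemma rep_sum_singles:
  assumes "is_rep sl12_t sc T" "g \<in> carrier sl12_t"
  shows "T g a = (\<Sum>m\<in>keys g. T (single m (lookup g m)) a)"
proof -
  have c: "single m (lookup g m) \<in> carrier sl12_t" for m
    using assms(2) by (intro single_carrier) (simp add: carrier_sl12_t)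
  have "T (\<Sum>m\<in>A. single m (lookup g m)) a = (\<Sum>m\<in>A. T (single m (lookup g m)) a)
      \<and> (\<Sum>m\<in>A. single m (lookup g m)) \<in> carrier sl12_t" if "finite A" for A
    using that
  proof induction
    case empty
    then show ?case using rep_zero[OF assms(1)] by (simp add: carrier_sl12_t carrier_sl12_closed)
  next
    case (insert m A)
    then show ?case using is_repD(2)[OF assms(1) c, of "\<Sum>m\<in>A. single m (lookup g m)" m a]
        lie_closed.add_closed[OF lie_closed_sl12_t c] by simp
  qed
  from this[OF finite_keys[of g]] have "T (\<Sum>m\<in>keys g. single m (lookup g m)) a =
     (\<Sum>m\<in>keys g. T (single m (lookup g m)) a)" by blast
  then show ?thesis unfolding sum_singles .
qed

end

type_synonym poly4 = "complex poly \<times> complex poly \<times> complex poly \<times> complex poly"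

section \<open>An explicit model of the Kac modules\<close>

definition C :: "complex \<Rightarrow> complex poly" where "C c = [:c:]"
definition tt :: "complex poly" where "tt = [:0, 1:]"

lemma C_simps: "C (a + b) = C a + C b" "C (a - b) = C a - C b" "C (- a) = - C a" "C (a * b) = C a * C b" "C 0 = 0" "C 1 = 1"
  by (simp_all add: C_def one_pCons)

lemma pderiv_C [simp]: "pderiv (C a) = 0" and pderiv_tt [simp]: "pderiv tt = 1"
  by (simp_all add: C_def tt_def pderiv_pCons one_pCons)

definition pscale4 :: "complex \<Rightarrow> poly4 \<Rightarrow> poly4" where
  "pscale4 c = (\<lambda>(f, g, e, z). (C c * f, C c * g, C c * e, C c * z))"

lemma pscale4_cspace: "cspace pscale4"
  unfolding cspace_def
  by unfold_locales (auto simp: pscale4_def C_simps algebra_simps)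

text \<open>
  The four components are polynomials in one variable of degrees at most \<open>N\<close>,
  \<open>N - 1\<close>, \<open>N - 1\<close>, \<open>N - 2\<close> if \<open>N\<close> is a
  natural number: the summands of the Kac module over the even part, in which binary forms are
  written in inhomogeneous coordinates. The parameter \<open>\<gamma>\<close> is the first
  weight divided by \<open>N\<close>.
\<close>

definition kac :: "complex \<Rightarrow> complex \<Rightarrow> mat3 \<Rightarrow> poly4 \<Rightarrow> poly4" where
  "kac N \<gamma> A = (\<lambda>(f, g, e, z).
    (C (A$1$1) * (C (N * \<gamma>) * f - tt * pderiv f) - C (A$3$3) * (C N * f - 2 * tt * pderiv f)
      + C (A$2$3) * pderiv f + C (A$3$2) * tt * (C N * f - tt * pderiv f)
      + C (A$1$2) * C (\<gamma> - 1) * tt * e - C (A$1$3) * C (\<gamma> - 1) * e + C (A$2$1) * C \<gamma> * g + C (A$3$1) * C \<gamma> * tt * g,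
     C (A$1$1) * (C (N * \<gamma>) * g - tt * pderiv g) - C (A$3$3) * (C (N - 1) * g - 2 * tt * pderiv g)
      + C (A$2$3) * pderiv g + C (A$3$2) * tt * (C (N - 1) * g - tt * pderiv g)
      + C (A$1$2) * (C N * f - tt * pderiv f + C (1 - \<gamma>) * tt * z) + C (A$1$3) * (pderiv f - C (1 - \<gamma>) * z),
     C (A$1$1) * (C (N * \<gamma> - 1) * e - tt * pderiv e) - C (A$3$3) * (C (N - 1) * e - 2 * tt * pderiv e)
      + C (A$2$3) * pderiv e + C (A$3$2) * tt * (C (N - 1) * e - tt * pderiv e)
      + C (A$2$1) * (pderiv f + C \<gamma> * z) + C (A$3$1) * (tt * pderiv f - C N * f + C \<gamma> * tt * z),
     C (A$1$1) * (C (N * \<gamma> - 1) * z - tt * pderiv z) - C (A$3$3) * (C (N - 2) * z - 2 * tt * pderiv z)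
      + C (A$2$3) * pderiv z + C (A$3$2) * tt * (C (N - 2) * z - tt * pderiv z)
      + C (A$1$2) * (C (N - 1) * e - tt * pderiv e) + C (A$1$3) * pderiv e
      - C (A$2$1) * pderiv g + C (A$3$1) * (C (N - 1) * g - tt * pderiv g)))"

lemma C_2: "C 2 = 2"
  by (simp add: C_def numeral_poly)

lemma kac_linear: "linmap pscale4 pscale4 (kac N \<gamma> A)"
  by (rule linmapI)
    (auto simp: kac_def pscale4_def pderiv_add pderiv_mult algebra_simps)

lemma kac_add: "kac N \<gamma> (A + B) v = kac N \<gamma> A v + kac N \<gamma> B v"
  by (cases v) (simp add: kac_def C_simps algebra_simps)

lemma kac_scale: "kac N \<gamma> (c *\<^sub>M A) v = pscale4 c (kac N \<gamma> A v)"
  by (cases v) (simp add: kac_def pscale4_def C_simps algebra_simps)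

definition kac_even :: "complex \<Rightarrow> complex \<Rightarrow> mat3 \<Rightarrow> complex poly \<Rightarrow> complex poly" where
  "kac_even h k A f = C (A$1$1) * (C h * f - tt * pderiv f) - C (A$3$3) * (C k * f - 2 * tt * pderiv f)
      + C (A$2$3) * pderiv f + C (A$3$2) * tt * (C k * f - tt * pderiv f)"

lemma kac_part_0:
  assumes "A \<in> part sl12 0"
  shows "kac N \<gamma> A (f, g, e, z) = (kac_even (N * \<gamma>) N A f, kac_even (N * \<gamma>) (N - 1) A g,
    kac_even (N * \<gamma> - 1) (N - 1) A e, kac_even (N * \<gamma> - 1) (N - 2) A z)"
  using assms[unfolded part_sl12_0] by (simp add: kac_def kac_even_def C_simps(5))

text \<open>
  The bracket relation of first-order differential operators, stated over an arbitrary
  derivation so that the polynomial arithmetic stays small.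
\<close>

lemma kac_even_aux:
  fixes h k t f a\<^sub>1 a\<^sub>2 a\<^sub>3 a\<^sub>4 b\<^sub>1 b\<^sub>2 b\<^sub>3 b\<^sub>4 :: "complex poly" and D :: "complex poly \<Rightarrow> complex poly"
  assumes D: "\<And>p q. D (p + q) = D p + D q" "\<And>p q. D (p - q) = D p - D q" "\<And>p q. D (p * q) = p * D q + q * D p"
    and c: "D h = 0" "D k = 0" "D t = 1" "D a\<^sub>1 = 0" "D a\<^sub>2 = 0" "D a\<^sub>3 = 0" "D a\<^sub>4 = 0" "D b\<^sub>1 = 0" "D b\<^sub>2 = 0" "D b\<^sub>3 = 0" "D b\<^sub>4 = 0"
  defines "e \<equiv> \<lambda>a\<^sub>1 a\<^sub>2 a\<^sub>3 a\<^sub>4 f. a\<^sub>1 * (h * f - t * D f) - a\<^sub>2 * (k * f - 2 * t * D f) + a\<^sub>3 * D f + a\<^sub>4 * t * (k * f - t * D f)"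
  shows "e a\<^sub>1 a\<^sub>2 a\<^sub>3 a\<^sub>4 (e b\<^sub>1 b\<^sub>2 b\<^sub>3 b\<^sub>4 f) - e b\<^sub>1 b\<^sub>2 b\<^sub>3 b\<^sub>4 (e a\<^sub>1 a\<^sub>2 a\<^sub>3 a\<^sub>4 f)
    = e 0 (a\<^sub>4 * b\<^sub>3 - b\<^sub>4 * a\<^sub>3) ((a\<^sub>1 - 2 * a\<^sub>2) * b\<^sub>3 - (b\<^sub>1 - 2 * b\<^sub>2) * a\<^sub>3) ((b\<^sub>1 - 2 * b\<^sub>2) * a\<^sub>4 - (a\<^sub>1 - 2 * a\<^sub>2) * b\<^sub>4) f"
proof -
  have D1: "D 1 = 0" using D(3)[of 1 1] by simp
  have D2: "D 2 = 0" using D(1)[of 1 1] unfolding one_add_one D1 by simp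
  define H X Y where "H f = k * f - 2 * t * D f" and "X f = D f" and "Y f = t * (k * f - t * D f)" for f
  define Z where "Z f = h * f - t * D f" for f
  have lin: "e a\<^sub>1 a\<^sub>2 a\<^sub>3 a\<^sub>4 f = a\<^sub>1 * Z f - a\<^sub>2 * H f + a\<^sub>3 * X f + a\<^sub>4 * Y f" for a\<^sub>1 a\<^sub>2 a\<^sub>3 a\<^sub>4 f
    unfolding e_def Z_def H_def X_def Y_def by (simp add: mult.assoc)
  have sum: "H (b\<^sub>1 * p - b\<^sub>2 * q + b\<^sub>3 * r + b\<^sub>4 * s) = b\<^sub>1 * H p - b\<^sub>2 * H q + b\<^sub>3 * H r + b\<^sub>4 * H s"
    "X (b\<^sub>1 * p - b\<^sub>2 * q + b\<^sub>3 * r + b\<^sub>4 * s) = b\<^sub>1 * X p - b\<^sub>2 * X q + b\<^sub>3 * X r + b\<^sub>4 * X s"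
    "Y (b\<^sub>1 * p - b\<^sub>2 * q + b\<^sub>3 * r + b\<^sub>4 * s) = b\<^sub>1 * Y p - b\<^sub>2 * Y q + b\<^sub>3 * Y r + b\<^sub>4 * Y s"
    "Z (b\<^sub>1 * p - b\<^sub>2 * q + b\<^sub>3 * r + b\<^sub>4 * s) = b\<^sub>1 * Z p - b\<^sub>2 * Z q + b\<^sub>3 * Z r + b\<^sub>4 * Z s"
    if "D b\<^sub>1 = 0" "D b\<^sub>2 = 0" "D b\<^sub>3 = 0" "D b\<^sub>4 = 0" for b\<^sub>1 b\<^sub>2 b\<^sub>3 b\<^sub>4 p q r s
    unfolding H_def X_def Y_def Z_def by (simp_all add: D that algebra_simps)
  have HX: "H (X f) = X (H f) + 2 * X f" and HY: "H (Y f) = Y (H f) - 2 * Y f" and XY: "X (Y f) = Y (X f) + H f"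
    and ZX: "Z (X f) = X (Z f) + X f" and ZY: "Z (Y f) = Y (Z f) - Y f" and ZH: "Z (H f) = H (Z f)" for f
    unfolding H_def X_def Y_def Z_def by (simp_all add: D c D2 algebra_simps)
  define f\<^sub>a f\<^sub>b where "f\<^sub>a = e a\<^sub>1 a\<^sub>2 a\<^sub>3 a\<^sub>4 f" and "f\<^sub>b = e b\<^sub>1 b\<^sub>2 b\<^sub>3 b\<^sub>4 f"
  note sa = sum[OF c(4,5,6,7), of "Z f" "H f" "X f" "Y f", folded lin f\<^sub>a_def]
    and sb = sum[OF c(8,9,10,11), of "Z f" "H f" "X f" "Y f", folded lin f\<^sub>b_def]
  show ?thesis
    unfolding f\<^sub>a_def[symmetric] f\<^sub>b_def[symmetric]
    unfolding lin sa sb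
    unfolding HX HY XY ZX ZY ZH by (simp add: algebra_simps)
qed

lemma kac_even_bracket:
  assumes "A \<in> part sl12 0" "B \<in> part sl12 0"
  shows "kac_even h k (bracket sl12 A B) f = kac_even h k A (kac_even h k B f) - kac_even h k B (kac_even h k A f)"
proof -
  note A = assms[unfolded part_sl12_0]
  have b: "C (bracket sl12 A B $ 1 $ 1) = 0" "C (bracket sl12 A B $ 3 $ 3) = C (A$3$2) * C (B$2$3) - C (B$3$2) * C (A$2$3)"
    "C (bracket sl12 A B $ 2 $ 3) = (C (A$1$1) - 2 * C (A$3$3)) * C (B$2$3) - (C (B$1$1) - 2 * C (B$3$3)) * C (A$2$3)"
    "C (bracket sl12 A B $ 3 $ 2) = (C (B$1$1) - 2 * C (B$3$3)) * C (A$3$2) - (C (A$1$1) - 2 * C (A$3$3)) * C (B$3$2)"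
    unfolding bracket_sl12[OF assms]
    by (simp_all add: A mult_nth koszul_sign_def C_simps algebra_simps)
  show ?thesis
    unfolding kac_even_def b
    by (rule kac_even_aux[symmetric]) (simp_all add: pderiv_add pderiv_diff pderiv_mult)
qed

lemma kac_bracket_00:
  assumes "A \<in> part sl12 0" "B \<in> part sl12 0"
  shows "kac N \<gamma> (bracket sl12 A B) v = kac N \<gamma> A (kac N \<gamma> B v) - pscale4 (koszul_sign 0 0) (kac N \<gamma> B (kac N \<gamma> A v))"
proof -
  obtain f g e z where v: "v = (f, g, e, z)" by (cases v)
  have br: "bracket sl12 A B \<in> part sl12 0" using bracket_sl12_closed[OF assms] by simp
  show ?thesis
    unfolding v kac_part_0[OF br] kac_part_0[OF assms(1)] kac_part_0[OF assms(2)] kac_even_bracket[OF assms]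
    by (simp add: koszul_sign_def pscale4_def C_simps)
qed

lemma kac_bracket_01:
  assumes "A \<in> part sl12 0" "B \<in> part sl12 1"
  shows "kac N \<gamma> (bracket sl12 A B) v = kac N \<gamma> A (kac N \<gamma> B v) - pscale4 (koszul_sign 0 1) (kac N \<gamma> B (kac N \<gamma> A v))"
proof -
  obtain f g e z where v: "v = (f, g, e, z)" by (cases v)
  note A = assms(1)[unfolded part_sl12_0] assms(2)[unfolded part_sl12_1]
  show ?thesis
    unfolding bracket_sl12[OF assms] v
    by (simp add: A kac_def pscale4_def koszul_sign_def mult_nth C_simps C_2 pderiv_add pderiv_diff pderiv_mult)
      (simp add: algebra_simps)
qed

lemma pscale4_minus_one: "pscale4 (-1) w = - w"
  by (cases w) (simp add: pscale4_def C_simps uminus_prod_def)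

lemma cspace_one: "pscale4 1 w = w"
  by (cases w) (simp add: pscale4_def C_simps)

lemma kac_bracket_10:
  assumes "A \<in> part sl12 1" "B \<in> part sl12 0"
  shows "kac N \<gamma> (bracket sl12 A B) v = kac N \<gamma> A (kac N \<gamma> B v) - pscale4 (koszul_sign 1 0) (kac N \<gamma> B (kac N \<gamma> A v))"
proof -
  have "bracket sl12 A B = (-1) *\<^sub>M bracket sl12 B A"
    unfolding bracket_sl12[OF assms] bracket_sl12[OF assms(2,1)]
    by (simp add: mat3_eq_iff koszul_sign_def)
  then show ?thesis
    using kac_bracket_01[OF assms(2,1), of N \<gamma> v] by (simp add: kac_scale koszul_sign_def pscale4_minus_one cspace_one)
qed

lemma kac_bracket_11:
  assumes "A \<in> part sl12 1" "B \<in> part sl12 1"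
  shows "kac N \<gamma> (bracket sl12 A B) v = kac N \<gamma> A (kac N \<gamma> B v) - pscale4 (koszul_sign 1 1) (kac N \<gamma> B (kac N \<gamma> A v))"
  using assms unfolding bracket_sl12[OF assms]
  by (cases v) (simp add: part_sl12_1 kac_def pscale4_def koszul_sign_def mult_nth C_simps C_2 pderiv_add pderiv_diff pderiv_mult algebra_simps)

lemma kac_rep: "is_rep sl12 pscale4 (kac N \<gamma>)"
  unfolding is_rep_def
proof (intro conjI ballI allI)
  fix d e A B v assume "A \<in> part sl12 d" "B \<in> part sl12 e"
  then show "kac N \<gamma> (bracket sl12 A B) v = kac N \<gamma> A (kac N \<gamma> B v) - pscale4 (koszul_sign d e) (kac N \<gamma> B (kac N \<gamma> A v))"
    using kac_bracket_00 kac_bracket_01 kac_bracket_10 kac_bracket_11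
    by (cases d rule: bit_exhaust; cases e rule: bit_exhaust) auto
qed (simp_all add: kac_linear kac_add kac_scale)

definition kac_index :: "nat \<Rightarrow> (nat \<times> nat) set" where
  "kac_index n = {0} \<times> {..n} \<union> {1, 2} \<times> {..<n} \<union> {3} \<times> {..<n-1}"

lemma card_kac_index: "n \<ge> 1 ==> finite (kac_index n) \<and> card (kac_index n) = 4 * n"
  unfolding kac_index_def
  by (subst card_Un_disjoint; (subst card_Un_disjoint)?) (auto simp: card_cartesian_product)

definition kac_coord :: "nat \<times> nat \<Rightarrow> poly4 \<Rightarrow> complex" where
  "kac_coord = (\<lambda>(j, i) (f, g, e, z). coeff (if j = 0 then f else if j = 1 then g else if j = 2 then e else z) i)"

definition kac_vec :: "nat \<times> nat \<Rightarrow> poly4" where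
  "kac_vec = (\<lambda>(j, i). (if j = 0 then tt ^ i else 0, if j = 1 then tt ^ i else 0, if j = 2 then tt ^ i else 0, if j = 3 then tt ^ i else 0))"

lemma tt_power: "tt ^ i = monom 1 i"
  by (simp add: tt_def monom_altdef)

lemma kac_coord_vec: "b \<in> kac_index n ==> b' \<in> kac_index n ==> kac_coord b (kac_vec b') = (if b = b' then 1 else 0)"
  by (auto simp: kac_index_def kac_coord_def kac_vec_def tt_power split: if_splits)

lemma kac_coord_linear: "kac_coord b (v + w) = kac_coord b v + kac_coord b w" "kac_coord b (pscale4 c v) = c * kac_coord b v"
  by (cases b; cases v; cases w; auto simp: kac_coord_def pscale4_def C_def)+

lemma kac_highest:
  "kac N \<gamma> (E 2 1) (1, 0, 0, 0) = 0" "kac N \<gamma> (E 2 3) (1, 0, 0, 0) = 0" "kac N \<gamma> (E 1 3) (1, 0, 0, 0) = 0"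
  "kac N \<gamma> (a *\<^sub>M h1 + b *\<^sub>M h2) (1, 0, 0, 0) = pscale4 (a * (N * \<gamma>) + b * N) (1, 0, 0, 0)"
  by (simp_all add: kac_def E_nth h1_def h2_def pscale4_def C_simps zero_prod_def)

lemma pderiv_tt_power: "tt * pderiv (tt ^ i) = C (of_nat i) * tt ^ i"
proof (induction i)
  case (Suc i)
  have "tt * pderiv (tt ^ Suc i) = tt * (tt * pderiv (tt ^ i)) + tt * tt ^ i"
    by (simp add: pderiv_mult algebra_simps)
  then show ?case unfolding Suc.IH by (simp add: C_simps algebra_simps)
qed (simp add: C_simps)

lemma kac_lower:
  "kac N \<gamma> (E 3 2) (kac_vec (0, i)) = pscale4 (N - of_nat i) (kac_vec (0, Suc i))"
  "kac N \<gamma> (E 3 2) (kac_vec (1, i)) = pscale4 (N - 1 - of_nat i) (kac_vec (1, Suc i))"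
  "kac N \<gamma> (E 3 2) (kac_vec (2, i)) = pscale4 (N - 1 - of_nat i) (kac_vec (2, Suc i))"
  "kac N \<gamma> (E 3 2) (kac_vec (3, i)) = pscale4 (N - 2 - of_nat i) (kac_vec (3, Suc i))"
  by (simp_all add: kac_def kac_vec_def E_nth pscale4_def C_simps pderiv_tt_power algebra_simps)

interpretation p4: cspace pscale4 by (rule pscale4_cspace)

text \<open>
  The even lowering operator reaches the first component. The model is cyclic for every
  \<open>\<gamma>\<close>, also where it is reducible; the odd lowering operators lead to the
  other components.
\<close>

lemma kac_vec_generated:
  assumes n: "n \<ge> 1" and b: "b \<in> kac_index n"
  shows "\<exists>p\<in>fa sl12. p4.action (kac (of_nat n) \<gamma>) p (1, 0, 0, 0) = kac_vec b"
proof -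
  let ?T = "kac (of_nat n) \<gamma>"
  define R where "R = {v. \<exists>p\<in>fa sl12. p4.action ?T p (1, 0, 0, 0) = v}"
  note sub = fa_subspace[of sl12]
  have add: "v + w \<in> R" if vw: "v \<in> R" "w \<in> R" for v w
  proof -
    obtain p p' where "p \<in> fa sl12" "p4.action ?T p (1, 0, 0, 0) = v" "p' \<in> fa sl12" "p4.action ?T p' (1, 0, 0, 0) = w"
      using vw unfolding R_def by blast
    then show ?thesis unfolding R_def using pscale.subspace_add[OF sub, of p p'] linmap_add[OF p4.linmap_action, of ?T p p' "(1, 0, 0, 0)"] by blast
  qed
  have scale: "pscale4 c v \<in> R" if vw: "v \<in> R" for v c
  proof -
    obtain p where "p \<in> fa sl12" "p4.action ?T p (1, 0, 0, 0) = v" using vw unfolding R_def by blast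
    then show ?thesis unfolding R_def using pscale.subspace_scale[OF sub, of p c] linmap_scale[OF p4.linmap_action, of ?T c p "(1, 0, 0, 0)"] by blast
  qed
  have unscale: "v \<in> R" if "pscale4 c v \<in> R" "c \<noteq> 0" for v c
    using scale[OF that(1), of "1 / c"] that(2) by simp
  have act: "?T A v \<in> R" if A: "A \<in> carrier sl12" and v: "v \<in> R" for A v
  proof -
    obtain p where p: "p \<in> fa sl12" "p4.action ?T p (1, 0, 0, 0) = v" using v unfolding R_def by blast
    have g: "gen [A] \<in> fa sl12" using A by simp
    have "p4.action ?T (word_mult (gen [A]) p) (1, 0, 0, 0) = ?T A v"
      using p4.action_word_mult[OF kac_rep g p(1)] p(2) by simp
    then show ?thesis unfolding R_def using fa_word_mult[OF g p(1)] by blast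
  qed
  note Ec = E_part[THEN part_carrier_sl12]
  have "gen [] \<in> fa sl12" "p4.action ?T (gen []) (1, 0, 0, 0) = (1, 0, 0, 0)" by simp_all
  then have "(1, 0, 0, 0) \<in> R" unfolding R_def by blast
  then have z0: "kac_vec (0, 0) \<in> R" by (simp add: kac_vec_def)
  have v0: "kac_vec (0, i) \<in> R" if "i \<le> n" for i
    using that
  proof (induction i)
    case (Suc i)
    then have "pscale4 (of_nat n - of_nat i) (kac_vec (0, Suc i)) \<in> R" using act[OF Ec(1)] by (metis kac_lower(1) Suc_leD)
    then show ?case by (rule unscale) (use Suc in \<open>simp add: of_nat_diff[symmetric] del: of_nat_diff\<close>)
  qed (rule z0)
  have chain: "kac_vec (j, i) \<in> R" if "kac_vec (j, 0) \<in> R" "\<And>i. ?T (E 3 2) (kac_vec (j, i)) = pscale4 (of_nat n - of_nat c - of_nat i) (kac_vec (j, Suc i))"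
      "i + c \<le> n" for i j c
    using that(3)
  proof (induction i)
    case (Suc i)
    then have "pscale4 (of_nat n - of_nat c - of_nat i) (kac_vec (j, Suc i)) \<in> R" using act[OF Ec(1)] that(2) by (metis add_Suc Suc_leD)
    moreover have "of_nat n - of_nat c - of_nat i \<noteq> (0 :: complex)"
    proof -
      have "of_nat n \<noteq> (of_nat (c + i) :: complex)" using Suc.prems by (subst of_nat_eq_iff) simp
      then show ?thesis by (simp add: algebra_simps)
    qed
    ultimately show ?case by (rule unscale)
  qed (rule that(1))
  have n0: "of_nat n \<noteq> (0 :: complex)" using n by simp
  have "?T (E 1 2) (kac_vec (0, 0)) = pscale4 (of_nat n) (kac_vec (1, 0))"
    by (simp add: kac_def kac_vec_def E_nth pscale4_def C_simps)
  then have v1: "kac_vec (1, 0) \<in> R" using act[OF Ec(5) z0] unscale n0 by metis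
  have "?T (E 3 1) (kac_vec (0, 0)) = pscale4 (- of_nat n) (kac_vec (2, 0))"
    by (simp add: kac_def kac_vec_def E_nth pscale4_def C_simps)
  then have v2: "kac_vec (2, 0) \<in> R" using act[OF Ec(8) z0] unscale[of "- of_nat n"] n0 by (metis neg_equal_0_iff_equal)
  have v3: "kac_vec (3, 0) \<in> R" if n2: "n \<ge> 2"
  proof -
    have "?T (E 1 2) (kac_vec (2, 0)) = pscale4 (of_nat n - 1) (kac_vec (3, 0)) + pscale4 (\<gamma> - 1) (kac_vec (0, 1))"
      by (simp add: kac_def kac_vec_def E_nth pscale4_def C_simps)
    then have "pscale4 (of_nat n - 1) (kac_vec (3, 0)) = ?T (E 1 2) (kac_vec (2, 0)) + pscale4 (1 - \<gamma>) (kac_vec (0, 1))"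
      by (simp add: kac_vec_def pscale4_def C_simps algebra_simps)
    then have "pscale4 (of_nat n - 1) (kac_vec (3, 0)) \<in> R" using add act[OF Ec(5) v2] scale v0[OF n] by metis
    moreover have "of_nat n - 1 \<noteq> (0 :: complex)" using n2 by (metis One_nat_def Suc_1 eq_iff_diff_eq_0 not_less_eq_eq of_nat_1_eq_iff order_refl)
    ultimately show ?thesis by (rule unscale)
  qed
  have "kac_vec b \<in> R"
  proof -
    obtain j i where ji: "b = (j, i)" by (cases b)
    then consider "j = 0" "i \<le> n" | "j = 1" "i + 1 \<le> n" | "j = 2" "i + 1 \<le> n" | "j = 3" "i + 2 \<le> n"
      using b unfolding kac_index_def by force
    then show ?thesis
    proof cases
      case 1 then show ?thesis using v0 ji by simp
    next
      case 2 then show ?thesis using chain[OF v1, of 1 i] kac_lower(2) ji by simp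
    next
      case 3 then show ?thesis using chain[OF v2, of 1 i] kac_lower(3) ji by simp
    next
      case 4 then show ?thesis using chain[OF v3, of 2 i] kac_lower(4) ji by simp
    qed
  qed
  then show ?thesis unfolding R_def by blast
qed

lemma kac_lower_power: "(kac N \<gamma> (E 3 2) ^^ i) (1, 0, 0, 0) = pscale4 (\<Prod>j<i. N - of_nat j) (kac_vec (0, i))"
proof (induction i)
  case 0
  then show ?case by (simp add: kac_vec_def)
next
  case (Suc i)
  then show ?case by (simp add: linmap_scale[OF kac_linear] kac_lower mult.commute)
qed

lemma kac_lower_nilpotent: "(kac (of_nat n) \<gamma> (E 3 2) ^^ Suc n) (1, 0, 0, 0) = 0"
  unfolding kac_lower_power by (subst prod_zero) auto

section \<open>The upper bound for highest weight modules\<close>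

context cspace
begin

definition homogeneous_orbit :: "((nat \<Rightarrow>\<^sub>0 mat3) \<Rightarrow> 'v \<Rightarrow> 'v) \<Rightarrow> 'v \<Rightarrow> 'v set" where
  "homogeneous_orbit T v = {foldr T (map (\<lambda>(m, x). single m x) ps) v | ps. snd ` set ps \<subseteq> carrier sl12}"

lemma homogeneous_orbit_base: "v \<in> homogeneous_orbit T v"
  unfolding homogeneous_orbit_def by (auto intro: exI[of _ "[]"])

lemma homogeneous_orbit_step:
  assumes "x \<in> carrier sl12" "a \<in> homogeneous_orbit T v"
  shows "T (single m x) a \<in> homogeneous_orbit T v"
proof -
  from assms(2) obtain ps where "a = foldr T (map (\<lambda>(m, x). single m x) ps) v" "snd ` set ps \<subseteq> carrier sl12"
    unfolding homogeneous_orbit_def by blast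
  then have "T (single m x) a = foldr T (map (\<lambda>(m, x). single m x) ((m, x) # ps)) v"
    "snd ` set ((m, x) # ps) \<subseteq> carrier sl12" using assms(1) by auto
  then show ?thesis unfolding homogeneous_orbit_def by blast
qed

lemma foldr_replicate: "foldr T (replicate k g) v = (T g ^^ k) v"
  by (induction k) auto

lemma linmap_span_subset:
  assumes "linmap sc sc f" "\<And>a. a \<in> S ==> f a \<in> span S'" "b \<in> span S"
  shows "f b \<in> span S'"
  using assms(3)
  by (induction rule: span_induct_alt) (use assms in \<open>auto simp: linmap_zero linmap_add linmap_scale span_zero intro!: span_add span_scale\<close>)

text \<open>
  The currents of \<open>sl(1|2)\<close> satisfy the operator relations of the upper bound, and
  the span of all words in the lowering currents is stable under the whole algebra.
\<close>

lemma highest_weight_span_bound: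
  fixes n l q m :: nat and c\<^sub>1 c\<^sub>2 :: complex
  assumes rep: "is_rep sl12_t sc T"
    and hw: "\<And>r A. A \<in> n_plus ==> T (single r A) v = 0"
    and wt: "\<And>r a b. T (single r (a *\<^sub>M h1 + b *\<^sub>M h2)) v = sc (if r = 0 then a * c\<^sub>1 + b * c\<^sub>2 else 0) v"
    and low: "\<And>r. foldr T (replicate (nat (max 0 (int n - int l * int r)) + 1) (single r y2)) v = 0"
    and q: "q = 0 \<and> n = 0 \<or> (\<exists>k. q = Suc k \<and> n = k * l + m)" and m: "0 < m" "m \<le> l"
  shows "\<exists>F. finite F \<and> card F \<le> (\<Prod>i<q. 4 * (if Suc i < q then l else m)) \<and> F \<subseteq> homogeneous_orbit T v \<and>
    (\<forall>w\<in>lists (carrier sl12_t). foldr T w v \<in> span F)"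
proof -
  note c = single_carrier[OF part_carrier_sl12]
  have lin: "linmap sc sc (T (single p A))" if "A \<in> part sl12 d" for p A d
    by (rule is_repD(1)[OF rep c[OF that]])
  note l = lin[OF E_part(1)] lin[OF E_part(2)] lin[OF E_part(3)] lin[OF E_part(4)] lin[OF E_part(5)] lin[OF E_part(6)] lin[OF E_part(7)] lin[OF E_part(8)]
  note z = rep_zero[OF rep]
  have ms: "T (single p (k *\<^sub>M A)) a = sc k (T (single p A) a)" if "A \<in> part sl12 d" for p k A a d
    by (rule rep_single_linear(2)[OF rep part_carrier_sl12[OF that]])
  define y x \<eta> H1 H2 where "y p = T (single p (E 3 2))" and "x p = T (single p (E 1 2))"
    and "\<eta> p = T (single p (E 3 1))" and "H1 p = T (single p h1)"
    and "H2 p = T (single p h2)" for p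
  define d \<delta> X where "d = T (single 0 (E 1 3))" and "\<delta> = T (single 0 (E 2 1))"
    and "X = T (single 1 (E 2 3))"
  note defs = y_def x_def \<eta>_def H1_def H2_def d_def \<delta>_def X_def
  note lins = linmap_add[OF l(1)] linmap_add[OF l(2)] linmap_add[OF l(3)] linmap_add[OF l(4)] linmap_add[OF l(5)]
    linmap_add[OF l(6)] linmap_add[OF l(7)] linmap_add[OF l(8)]
    linmap_scale[OF l(1)] linmap_scale[OF l(2)] linmap_scale[OF l(3)] linmap_scale[OF l(4)] linmap_scale[OF l(5)]
    linmap_scale[OF l(6)] linmap_scale[OF l(7)] linmap_scale[OF l(8)]
  note rb = rep_bracket[OF rep]
  have k: "koszul_sign 0 e = 1" "koszul_sign e 0 = 1" "koszul_sign 1 1 = -1" for e by (simp_all add: koszul_sign_def)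
  have np: "E 2 1 \<in> n_plus" "E 2 3 \<in> n_plus" "E 1 3 \<in> n_plus"
    unfolding n_plus_def
    by (auto simp: mat3_eq_iff E_nth intro: exI[of _ 1] exI[of _ 0])
  note norm = bracket_E k z single_zero scale_one add_0_right scale_minus_left minus_add_distrib add.inverse_neutral
  have yy: "y p (y p' a) = y p' (y p a)" for p p' a
    using rb[OF E_part(1) E_part(1), of p p' a] unfolding norm y_def[symmetric] .
  have xy: "x p (y p' a) = y p' (x p a)" for p p' a
    using rb[OF E_part(5) E_part(1), of p p' a] unfolding norm y_def[symmetric] x_def[symmetric] .
  have ey: "\<eta> p (y p' a) = y p' (\<eta> p a)" for p p' a
    using rb[OF E_part(8) E_part(1), of p p' a] unfolding norm y_def[symmetric] \<eta>_def[symmetric] .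
  have xx: "x p (x p' a) = - x p' (x p a)" for p p' a
    using rb[OF E_part(5) E_part(5), of p p' a] unfolding norm x_def[symmetric] .
  have ee: "\<eta> p (\<eta> p' a) = - \<eta> p' (\<eta> p a)" for p p' a
    using rb[OF E_part(8) E_part(8), of p p' a] unfolding norm \<eta>_def[symmetric] .
  have dy: "d (y p a) = y p (d a) + sc 1 (x p a)" for p a
    using rb[OF E_part(6) E_part(1), of 0 p a] unfolding norm add_0_left defs .
  have dx: "d (x p a) = - x p (d a)" for p a
    using rb[OF E_part(6) E_part(5), of 0 p a] unfolding norm defs .
  have ry: "\<delta> (y p a) = y p (\<delta> a) + sc (- 1) (\<eta> p a)" for p a
    using rb[OF E_part(7) E_part(1), of 0 p a] unfolding bracket_E k scale_one add_0_left defs ms[OF E_part(8)] .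
  have re: "\<delta> (\<eta> p a) = - \<eta> p (\<delta> a)" for p a
    using rb[OF E_part(7) E_part(8), of 0 p a] unfolding norm defs .
  have cur: "currents sc y"
    by (intro currents.intro currents_axioms.intro yy) (unfold_locales, simp_all only: y_def lins)
  have xo: "odd_currents sc y x d 1"
    by (intro odd_currents.intro odd_currents_axioms.intro cur xy xx dy dx) (simp_all only: x_def d_def lins, simp)
  have eo: "odd_currents sc y \<eta> \<delta> (-1)"
    by (intro odd_currents.intro odd_currents_axioms.intro cur ey ee ry re) (simp_all only: \<eta>_def \<delta>_def lins, simp)
  have h1v: "H1 p v = (if p = 0 then sc c\<^sub>1 v else 0)" for p
  proof -
    have "1 *\<^sub>M h1 + 0 *\<^sub>M h2 = h1" by (simp add: mat3_eq_iff)
    then show ?thesis using wt[of p 1 0] unfolding H1_def by auto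
  qed
  have h2v: "H2 (Suc p) v = 0" for p
  proof -
    have "0 *\<^sub>M h1 + 1 *\<^sub>M h2 = h2" by (simp add: mat3_eq_iff)
    then show ?thesis using wt[of "Suc p" 0 1] unfolding H2_def by auto
  qed
  interpret S: sl12_currents sc y x \<eta> H1 H2 d \<delta> X v c\<^sub>1
  proof (intro sl12_currents.intro sl12_currents_axioms.intro)
    show "vector_space sc" by unfold_locales
    show "odd_currents sc y x d 1" by (rule xo)
    show "odd_currents sc y \<eta> \<delta> (- 1)" by (rule eo)
    show "x p (\<eta> p' a) = y (p + p') a - \<eta> p' (x p a)" for p p' a
      using rb[OF E_part(5) E_part(8), of p p' a] by (simp add: defs bracket_E k)
    show "\<delta> (x p a) = H1 p a - x p (\<delta> a)" for p a
      using rb[OF E_part(7) E_part(5), of 0 p a] by (simp add: defs bracket_E k)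
    show "H1 p (x p' a) = x p' (H1 p a)" for p p' a
      using rb[OF E_part(3) E_part(5), of p p' a] by (simp add: defs bracket_E k z)
    show "X (a + b) = X a + X b" "H2 p (a + b) = H2 p a + H2 p b" for a b p by (simp_all add: defs lins)
    show "X (y p a) = y p (X a) + H2 (Suc p) a" for p a
      using rb[OF E_part(2) E_part(1), of 1 p a] by (simp add: defs bracket_E k)
    show "H2 p (y p' a) = y p' (H2 p a) - sc 2 (y (p + p') a)" for p p' a
      using rb[OF E_part(4) E_part(1), of p p' a] by (simp add: defs bracket_E k ms[OF E_part(1)])
    show "d v = 0" "\<delta> v = 0" "X v = 0" unfolding defs by (rule hw[OF np(3)] hw[OF np(1)] hw[OF np(2)])+
  qed (rule h1v h2v)+
  have ypow: "(y r ^^ Suc (nat (max 0 (int n - int l * int r)))) v = 0" for r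
    using low[of r] unfolding foldr_replicate y_def y2_def by simp
  have y_top: "y p v = 0" if "p \<ge> q" for p
  proof -
    have "n \<le> l * p"
    proof (cases "q = 0")
      case False
      then obtain k where "q = Suc k" "n = k * l + m" using q by auto
      then have "n \<le> l * q" using m by simp
      also have "l * q \<le> l * p" using that by simp
      finally show ?thesis .
    qed (use q in auto)
    then have "nat (max 0 (int n - int l * int p)) = 0" by (simp add: of_nat_mult[symmetric] del: of_nat_mult)
    then show ?thesis using ypow[of p] by simp
  qed
  have top: "y p v = 0 \<and> x p v = 0 \<and> \<eta> p v = 0" if "p \<ge> q" for p
  proof -
    have "d (y p v) = y p (d v) + sc 1 (x p v)" by (rule S.x.D_y)
    moreover have "\<delta> (y p v) = y p (\<delta> v) + sc (-1) (\<eta> p v)" by (rule S.\<eta>.D_y)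
    ultimately show ?thesis using y_top[OF that] S.v by (simp add: S.x.D_zero S.\<eta>.D_zero)
  qed
  define \<xi> where "\<xi> i = (if Suc i < q then l else m)" for i
  have bd: "S.x.degree_bounded {0} (lowered_parts q \<xi> {}) v"
  proof (cases "q = 0")
    case True
    then have "lowered_parts q \<xi> {} = {#}" by (simp add: lowered_parts_def)
    then show ?thesis using S.x.degree_bounded_empty[of "{0}" v] y_top True by (simp add: S.x.y_stable_def)
  next
    case False
    then obtain k where kq: "q = Suc k" "n = k * l + m" using q by auto
    have e: "nat (max 0 (int n - int l * int 0)) = k * l + m" "nat (max 0 (int n - int l * int k)) = m"
      unfolding kq(2) by (simp_all add: nat_add_distrib nat_mult_distrib)
    have "(y 0 ^^ Suc (k * l + m)) v = 0" using ypow[of 0] unfolding e .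
    moreover have "(y k ^^ Suc m) v = 0" using ypow[of k] unfolding e .
    moreover have "\<xi> = (\<lambda>i. if i < k then l else m)" unfolding \<xi>_def kq by auto
    ultimately show ?thesis
      using S.degree_bounded_rectangle[of k l m] y_top kq m by simp
  qed
  obtain F where F: "finite F" "card F \<le> (\<Prod>i<q. 4 * \<xi> i)" "F \<subseteq> S.all_words" "S.all_words \<subseteq> span F"
  proof -
    have "\<xi> j \<le> \<xi> i" if "i \<le> j" "j < q" for i j using that m unfolding \<xi>_def by auto
    moreover have "1 \<le> \<xi> i" for i using m unfolding \<xi>_def by auto
    ultimately have "\<exists>F. finite F \<and> card F \<le> (\<Prod>i<q. 4 * \<xi> i) \<and> F \<subseteq> S.all_words \<and> S.all_words \<subseteq> span F"
      by (intro S.all_words_bound[OF _ _ top bd]) auto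
    then show thesis using that by blast
  qed
  have orbit: "S.all_words \<subseteq> homogeneous_orbit T v"
  proof
    fix a assume "a \<in> S.all_words"
    then show "a \<in> homogeneous_orbit T v"
      by induction
        (auto simp: defs intro!: homogeneous_orbit_base homogeneous_orbit_step part_carrier_sl12[OF E_part(1)]
          part_carrier_sl12[OF E_part(5)] part_carrier_sl12[OF E_part(8)])
  qed
  let ?S = "span S.all_words"
  have letters: "T (single p B) a \<in> ?S" if "a \<in> ?S" "B \<in> {E 3 2, E 1 2, E 3 1}" for p B a
  proof -
    have "linmap sc sc (T (single p B))" using that(2) l by auto
    then show ?thesis
    proof (rule linmap_span_subset[OF _ _ that(1)])
      show "T (single p B) b \<in> ?S" if "b \<in> S.all_words" for b
        using \<open>B \<in> _\<close> S.all_words.intros(2-4)[OF that] by (auto simp: defs intro!: span_base)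
    qed
  qed
  have base: "T (single p A) v \<in> ?S" if "A \<in> carrier sl12" for p A
  proof -
    define A' where "A' = A$1$2 *\<^sub>M E 1 2 + (A$3$2 *\<^sub>M E 3 2 + A$3$1 *\<^sub>M E 3 1)"
    define B where "B = A$2$1 *\<^sub>M E 2 1 + A$2$3 *\<^sub>M E 2 3 + A$1$3 *\<^sub>M E 1 3"
    define Ch where "Ch = A$1$1 *\<^sub>M h1 + (- A$3$3) *\<^sub>M h2"
    have A: "A = A' + (B + Ch)"
      using that by (simp add: A'_def B_def Ch_def mat3_eq_iff E_nth h1_def h2_def carrier_sl12)
    have cs: "A' \<in> carrier sl12" "B \<in> carrier sl12" "Ch \<in> carrier sl12"
      by (simp_all add: A'_def B_def Ch_def carrier_sl12 E_nth h1_def h2_def)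
    have vS: "v \<in> ?S" by (rule span_base) (rule S.all_words.intros)
    have "B \<in> n_plus" unfolding n_plus_def B_def by blast
    then have "T (single p B) v = 0" by (rule hw)
    moreover have "T (single p Ch) v \<in> ?S" unfolding Ch_def wt using vS by (rule span_scale)
    moreover have "T (single p A') v \<in> ?S"
    proof -
      have "T (single p A') v = sc (A$1$2) (x p v) + (sc (A$3$2) (y p v) + sc (A$3$1) (\<eta> p v))"
        unfolding A'_def defs
        using carrier_sl12_closed E_part[THEN part_carrier_sl12]
        by (simp add: rep_single_linear[OF rep])
      moreover have "x p v \<in> ?S" "y p v \<in> ?S" "\<eta> p v \<in> ?S" by (auto intro!: span_base S.all_words.intros)
      ultimately show ?thesis by (simp add: span_add span_scale)
    qed
    ultimately show ?thesis
      unfolding A using cs carrier_sl12_closed by (simp add: rep_single_linear(1)[OF rep] span_add)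
  qed
    have step: "T (single p A) (T (single p' B) a) \<in> ?S"
      if B: "B \<in> {E 3 2, E 1 2, E 3 1}" "B \<in> part sl12 e" and IH: "\<And>p A. A \<in> carrier sl12 ==> T (single p A) a \<in> ?S"
        and A: "A \<in> carrier sl12" for p A p' B a e
    proof -
      have hom: "T (single p A') (T (single p' B) a) \<in> ?S" if "A' \<in> part sl12 c" for A' c
        unfolding rb[OF that B(2)]
        by (intro span_add span_scale letters[OF _ B(1)] IH part_carrier_sl12[OF that] part_carrier_sl12[OF bracket_sl12_closed[OF that B(2)]])
      have "T (single p A) b = T (single p (block 0 A)) b + T (single p (block 1 A)) b" for b
        using rep_single_linear(1)[OF rep block_part[THEN part_carrier_sl12] block_part[THEN part_carrier_sl12], OF A A, of p 0 1 b]
        unfolding block_sum .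
      then show ?thesis using hom[OF block_part[OF A]] by (simp add: span_add)
    qed
  have closed: "T (single p A) a \<in> ?S" if "a \<in> S.all_words" "A \<in> carrier sl12" for p A a
    using that
  proof (induction arbitrary: p A)
    case 1
    then show ?case by (rule base)
  next
    case (2 a p')
      have e: "y p' a = T (single p' (E 3 2)) a" by (simp add: y_def)
      show ?case unfolding e
      proof (rule step[of "E 3 2" 0 a A p p'] )
        show "E 3 2 \<in> {E 3 2, E 1 2, E 3 1}" by simp
        show "T (single p A) a \<in> ?S" if "A \<in> carrier sl12" for p A by (rule "2.IH"[OF that])
      qed (rule E_part(1) "2.prems")+
  next
    case (3 a p')
      have e: "x p' a = T (single p' (E 1 2)) a" by (simp add: x_def)
      show ?case unfolding e
      proof (rule step[of "E 1 2" 1 a A p p'] )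
        show "E 1 2 \<in> {E 3 2, E 1 2, E 3 1}" by simp
        show "T (single p A) a \<in> ?S" if "A \<in> carrier sl12" for p A by (rule "3.IH"[OF that])
      qed (rule E_part(5) "3.prems")+
  next
    case (4 a p')
      have e: "\<eta> p' a = T (single p' (E 3 1)) a" by (simp add: \<eta>_def)
      show ?case unfolding e
      proof (rule step[of "E 3 1" 1 a A p p'] )
        show "E 3 1 \<in> {E 3 2, E 1 2, E 3 1}" by simp
        show "T (single p A) a \<in> ?S" if "A \<in> carrier sl12" for p A by (rule "4.IH"[OF that])
      qed (rule E_part(8) "4.prems")+
  qed
  have T_S: "T g a \<in> ?S" if "g \<in> carrier sl12_t" "a \<in> ?S" for g a
    unfolding rep_sum_singles[OF rep that(1)]
  proof (rule span_sum)
    fix p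
    have A: "lookup g p \<in> carrier sl12" using that(1) by (simp add: carrier_sl12_t)
    show "T (single p (lookup g p)) a \<in> ?S"
      by (rule linmap_span_subset[OF is_repD(1)[OF rep single_carrier[OF A]] closed[OF _ A] that(2)])
  qed
  have "foldr T w v \<in> ?S" if "w \<in> lists (carrier sl12_t)" for w
    using that by (induction w) (auto intro: T_S span_base S.all_words.intros)
  moreover have "?S \<subseteq> span F" by (rule span_minimal[OF F(4)]) simp
  ultimately show ?thesis using F orbit unfolding \<xi>_def by blast
qed

end

section \<open>Tensor products of representations\<close>

lemma listset_iff: "w \<in> listset As \<longleftrightarrow> length w = length As \<and> (\<forall>i<length As. w ! i \<in> As ! i)"
proof (induction As arbitrary: w)
  case (Cons A As)
  show ?case
  proof (cases w)
    case (Cons a u)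
    then show ?thesis using Cons.IH[of u] by (auto simp: set_Cons_def nth_Cons less_Suc_eq_0_disj split: nat.splits)
  qed (simp add: set_Cons_def)
qed simp

lemma koszul_sign_sym: "koszul_sign d e = koszul_sign e d" and koszul_sign_square: "koszul_sign d e * koszul_sign d e = 1"
  by (auto simp: koszul_sign_def)

locale graded_lie = lie_closed L for L :: "'x lie_superalgebra" +
  assumes comp_part: "x \<in> carrier L ==> component L d x \<in> part L d"
    and comp_add: "x \<in> carrier L ==> x' \<in> carrier L ==> component L d (x \<oplus>\<^bsub>L\<^esub> x') = component L d x \<oplus>\<^bsub>L\<^esub> component L d x'"
    and comp_smult: "x \<in> carrier L ==> component L d (c \<odot>\<^bsub>L\<^esub> x) = c \<odot>\<^bsub>L\<^esub> component L d x"
    and comp_homogeneous: "x \<in> part L e ==> component L d x = (if d = e then x else 0 \<odot>\<^bsub>L\<^esub> x)"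
    and bracket_part: "x \<in> part L d ==> x' \<in> part L e ==> bracket L x x' \<in> part L (d + e)"
begin

lemma comp_carrier: "x \<in> carrier L ==> component L d x \<in> carrier L"
  using comp_part part_carrier by blast

end

text \<open>
  A graded module at the level of records, with the sign operator \<open>parity_twist\<close> in
  place of the grading.
\<close>

locale super_rep =
  fixes L :: "'x lie_superalgebra" and V :: "('x, 'a) super_module"
  assumes add_closed: "u \<in> carrier V ==> v \<in> carrier V ==> u \<oplus>\<^bsub>V\<^esub> v \<in> carrier V"
    and smult_closed: "u \<in> carrier V ==> c \<odot>\<^bsub>V\<^esub> u \<in> carrier V"
    and act_closed: "x \<in> carrier L ==> u \<in> carrier V ==> act V x u \<in> carrier V"
    and twist_closed: "u \<in> carrier V ==> parity_twist V d u \<in> carrier V"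
    and act_add: "x \<in> carrier L ==> u \<in> carrier V ==> v \<in> carrier V ==> act V x (u \<oplus>\<^bsub>V\<^esub> v) = act V x u \<oplus>\<^bsub>V\<^esub> act V x v"
    and act_smult: "x \<in> carrier L ==> u \<in> carrier V ==> act V x (c \<odot>\<^bsub>V\<^esub> u) = c \<odot>\<^bsub>V\<^esub> act V x u"
    and twist_add: "u \<in> carrier V ==> v \<in> carrier V ==> parity_twist V d (u \<oplus>\<^bsub>V\<^esub> v) = parity_twist V d u \<oplus>\<^bsub>V\<^esub> parity_twist V d v"
    and twist_smult: "u \<in> carrier V ==> parity_twist V d (c \<odot>\<^bsub>V\<^esub> u) = c \<odot>\<^bsub>V\<^esub> parity_twist V d u"
    and add_act: "x \<in> carrier L ==> x' \<in> carrier L ==> u \<in> carrier V ==> act V (x \<oplus>\<^bsub>L\<^esub> x') u = act V x u \<oplus>\<^bsub>V\<^esub> act V x' u"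
    and smult_act: "x \<in> carrier L ==> u \<in> carrier V ==> act V (c \<odot>\<^bsub>L\<^esub> x) u = c \<odot>\<^bsub>V\<^esub> act V x u"
    and act_act: "x \<in> part L d ==> x' \<in> part L e ==> u \<in> carrier V ==>
      act V x (act V x' u) = (koszul_sign d e \<odot>\<^bsub>V\<^esub> act V x' (act V x u)) \<oplus>\<^bsub>V\<^esub> act V (bracket L x x') u"
    and twist_act: "x \<in> part L e ==> u \<in> carrier V ==> parity_twist V d (act V x u) = koszul_sign d e \<odot>\<^bsub>V\<^esub> act V x (parity_twist V d u)"
    and twist_twist: "u \<in> carrier V ==> parity_twist V d (parity_twist V e u) = parity_twist V (d + e) u"

lemmas super_repD = super_rep.add_closed super_rep.smult_closed super_rep.act_closed super_rep.twist_closed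
  super_rep.act_add super_rep.act_smult super_rep.twist_add super_rep.twist_smult super_rep.add_act
  super_rep.smult_act super_rep.act_act super_rep.twist_act super_rep.twist_twist

locale tensor_reps = graded_lie L for L :: "'x lie_superalgebra" +
  fixes Vs :: "('x, 'a) super_module list"
  assumes super_reps: "i < length Vs ==> super_rep L (Vs ! i)"
begin

abbreviation "tup \<equiv> listset (map carrier Vs)"
abbreviation "ft \<equiv> {p :: 'a list \<Rightarrow>\<^sub>0 complex. keys p \<subseteq> tup}"

lemmas sr = super_repD[OF super_reps]

lemma tup_iff: "w \<in> tup \<longleftrightarrow> length w = length Vs \<and> (\<forall>i<length Vs. w ! i \<in> carrier (Vs ! i))"
  unfolding listset_iff by auto

lemma tup_update: "w \<in> tup ==> i < length Vs ==> a \<in> carrier (Vs ! i) ==> w[i := a] \<in> tup"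
  unfolding tup_iff by (auto simp: nth_list_update)

lemma ft_subspace: "pscale.subspace ft"
  by (rule keys_subset_subspace)

lemma presents_free_tensor: "pc.presents (free_tensor L Vs) ft (\<lambda>p. p) {0}"
  unfolding pc.presents_def using ft_subspace
  by (auto simp: free_tensor_def pscale_def[symmetric] pscale.subspace_def)

lemma gen_ft: "w \<in> tup ==> single w c \<in> ft"
  by (cases "c = 0") auto

lemma multilinear_relations_subset: "multilinear_relations Vs \<subseteq> ft"
proof -
  define A where "A = ft"
  have m: "single w c \<in> A" if "w \<in> tup" for w c using gen_ft[OF that] unfolding A_def .
  have d: "p - q \<in> A" if "p \<in> A" "q \<in> A" for p q
    using pscale.subspace_diff[OF ft_subspace] that unfolding A_def .
  show ?thesis
    unfolding A_def[symmetric]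
  proof
    fix r assume "r \<in> multilinear_relations Vs"
    then consider w i a b where "w \<in> tup" "i < length Vs" "a \<in> carrier (Vs ! i)" "b \<in> carrier (Vs ! i)"
        "r = gen (w[i := a \<oplus>\<^bsub>Vs ! i\<^esub> b]) - gen (w[i := a]) - gen (w[i := b])"
      | w i a c where "w \<in> tup" "i < length Vs" "a \<in> carrier (Vs ! i)"
        "r = gen (w[i := c \<odot>\<^bsub>Vs ! i\<^esub> a]) - single (w[i := a]) c"
      unfolding multilinear_relations_def by blast
    then show "r \<in> A"
    proof cases
      case 1
      show ?thesis unfolding 1(5) by (intro d m tup_update 1 sr(1)[OF 1(2)])
    next
      case 2
      show ?thesis unfolding 2(4) by (intro d m tup_update 2 sr(2)[OF 2(2)])
    qed
  qed
qed

lemma tensor_kernel_span: "tensor_kernel L Vs = pscale.span (multilinear_relations Vs)"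
proof
  have sub: "pscale.subspace (pscale.span (multilinear_relations Vs))" "pscale.span (multilinear_relations Vs) \<subseteq> ft"
    using pscale.span_minimal[OF multilinear_relations_subset ft_subspace] by simp_all
  have "submodule (pscale.span (multilinear_relations Vs)) complex_ring (free_tensor L Vs)"
  proof (intro submodule.intro submodule_axioms.intro)
    show "subgroup (pscale.span (multilinear_relations Vs)) (add_monoid (free_tensor L Vs))"
      using pc.presents_additive_subgroup[OF presents_free_tensor sub]
      by (simp add: additive_subgroup_def)
    show "c \<odot>\<^bsub>free_tensor L Vs\<^esub> p \<in> pscale.span (multilinear_relations Vs)"
      if "p \<in> pscale.span (multilinear_relations Vs)" for c p
      using pscale.span_scale[OF that] by (simp add: free_tensor_def pscale_def)
  qed
  then show "tensor_kernel L Vs \<subseteq> pscale.span (multilinear_relations Vs)"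
    unfolding tensor_kernel_def generated_submodule_def by (intro Inter_lower) (auto intro: pscale.span_base)
  show "pscale.span (multilinear_relations Vs) \<subseteq> tensor_kernel L Vs"
    unfolding tensor_kernel_def generated_submodule_def
  proof (rule Inter_greatest)
    fix N assume "N \<in> {N. submodule N complex_ring (free_tensor L Vs) \<and> multilinear_relations Vs \<subseteq> N}"
    then have N: "submodule N complex_ring (free_tensor L Vs)" "multilinear_relations Vs \<subseteq> N" by auto
    interpret submodule N complex_ring "free_tensor L Vs" by (rule N(1))
    have "pscale.subspace N"
      unfolding pscale.subspace_def
    proof (intro conjI ballI allI)
      show "0 \<in> N" using one_closed by (simp add: free_tensor_def)
      show "p + q \<in> N" if "p \<in> N" "q \<in> N" for p q using m_closed[OF that] by (simp add: free_tensor_def)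
      show "pscale c p \<in> N" if "p \<in> N" for c p
        using smult_closed[of c p] that by (simp add: free_tensor_def pscale_def complex_ring_def)
    qed
    then show "pscale.span (multilinear_relations Vs) \<subseteq> N" by (intro pscale.span_minimal N)
  qed
qed

lemma tensor_kernel_subspace: "pscale.subspace (tensor_kernel L Vs)"
  unfolding tensor_kernel_span by (rule pscale.subspace_span)

lemma tensor_kernel_subset: "tensor_kernel L Vs \<subseteq> ft"
  unfolding tensor_kernel_span by (rule pscale.span_minimal[OF multilinear_relations_subset ft_subspace])

definition tproj :: "('a list \<Rightarrow>\<^sub>0 complex) \<Rightarrow> ('a list \<Rightarrow>\<^sub>0 complex)" where
  "tproj = (SOME \<pi>. linmap pscale pscale \<pi> \<and> (\<forall>a. \<pi> a = 0 \<longleftrightarrow> a \<in> tensor_kernel L Vs))"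

lemma tproj: "linmap pscale pscale tproj" "tproj a = 0 \<longleftrightarrow> a \<in> tensor_kernel L Vs"
proof -
  obtain \<pi> :: "('a list \<Rightarrow>\<^sub>0 complex) \<Rightarrow> ('a list \<Rightarrow>\<^sub>0 complex)"
    where "linmap pscale pscale \<pi>" "\<And>a. \<pi> a = 0 \<longleftrightarrow> a \<in> tensor_kernel L Vs"
  proof (rule pc.projection_with_kernel[OF tensor_kernel_subspace])
    fix \<pi> :: "('a list \<Rightarrow>\<^sub>0 complex) \<Rightarrow> ('a list \<Rightarrow>\<^sub>0 complex)"
    assume "linmap pscale pscale \<pi>" "\<And>a. \<pi> a = 0 \<longleftrightarrow> a \<in> tensor_kernel L Vs"
    then show thesis by (rule that)
  qed
  then have "linmap pscale pscale \<pi> \<and> (\<forall>a. \<pi> a = 0 \<longleftrightarrow> a \<in> tensor_kernel L Vs)" by simp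
  then have "linmap pscale pscale tproj \<and> (\<forall>a. tproj a = 0 \<longleftrightarrow> a \<in> tensor_kernel L Vs)"
    unfolding tproj_def by (rule someI[where P = "\<lambda>\<pi>. linmap pscale pscale \<pi> \<and> (\<forall>a. \<pi> a = 0 \<longleftrightarrow> a \<in> tensor_kernel L Vs)" and x = \<pi>])
  then show "linmap pscale pscale tproj" "tproj a = 0 \<longleftrightarrow> a \<in> tensor_kernel L Vs" by simp_all
qed

definition \<tau> :: "'a list \<Rightarrow> 'a list \<Rightarrow>\<^sub>0 complex" where "\<tau> w = tproj (gen w)"

lemma \<tau>_add:
  assumes "w \<in> tup" "i < length Vs" "a \<in> carrier (Vs ! i)" "b \<in> carrier (Vs ! i)"
  shows "\<tau> (w[i := a \<oplus>\<^bsub>Vs ! i\<^esub> b]) = \<tau> (w[i := a]) + \<tau> (w[i := b])"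
proof -
  have "gen (w[i := a \<oplus>\<^bsub>Vs ! i\<^esub> b]) - gen (w[i := a]) - gen (w[i := b]) \<in> multilinear_relations Vs"
    unfolding multilinear_relations_def
    by (intro UnI1 CollectI exI[of _ w] exI[of _ i] exI[of _ a] exI[of _ b] conjI refl assms)
  then have "tproj (gen (w[i := a \<oplus>\<^bsub>Vs ! i\<^esub> b]) - gen (w[i := a]) - gen (w[i := b])) = 0"
    unfolding tproj(2) tensor_kernel_span by (rule pscale.span_base)
  then show ?thesis unfolding \<tau>_def linmap_diff[OF tproj(1)] by (simp add: algebra_simps)
qed

lemma \<tau>_smult:
  assumes "w \<in> tup" "i < length Vs" "a \<in> carrier (Vs ! i)"
  shows "\<tau> (w[i := c \<odot>\<^bsub>Vs ! i\<^esub> a]) = pscale c (\<tau> (w[i := a]))"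
proof -
  have "gen (w[i := c \<odot>\<^bsub>Vs ! i\<^esub> a]) - single (w[i := a]) c \<in> multilinear_relations Vs"
    unfolding multilinear_relations_def
    by (intro UnI2 CollectI exI[of _ w] exI[of _ i] exI[of _ c] exI[of _ a] conjI refl assms)
  then have "tproj (gen (w[i := c \<odot>\<^bsub>Vs ! i\<^esub> a]) - single (w[i := a]) c) = 0"
    unfolding tproj(2) tensor_kernel_span by (rule pscale.span_base)
  moreover have "single (w[i := a]) c = pscale c (gen (w[i := a]))" by simp
  ultimately show ?thesis unfolding \<tau>_def by (simp only: linmap_diff[OF tproj(1)] linmap_scale[OF tproj(1)]) simp
qed

definition slot :: "bit \<Rightarrow> nat \<Rightarrow> 'x \<Rightarrow> 'a list \<Rightarrow> 'a list" where
  "slot d i x w = map2 (\<lambda>V v. parity_twist V d v) (take i Vs) (take i w) @ [act (Vs ! i) x (w ! i)] @ drop (Suc i) w"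

lemma length_slot [simp]: "i < length Vs ==> length w = length Vs ==> length (slot d i x w) = length Vs"
  by (simp add: slot_def)

lemma slot_nth:
  assumes "i < length Vs" "length w = length Vs" "k < length Vs"
  shows "slot d i x w ! k = (if k < i then parity_twist (Vs ! k) d (w ! k) else if k = i then act (Vs ! k) x (w ! k) else w ! k)"
proof -
  consider "k < i" | "k = i" | "k > i" by linarith
  then show ?thesis
  proof cases
    case 3
    then obtain j where "k = Suc (i + j)" using less_imp_Suc_add by blast
    then show ?thesis using assms by (simp add: slot_def nth_append)
  qed (use assms in \<open>simp_all add: slot_def nth_append\<close>)
qed

lemma slot_tup: "x \<in> carrier L ==> w \<in> tup ==> i < length Vs ==> slot d i x w \<in> tup"
  unfolding tup_iff by (auto simp: slot_nth intro: sr(3) sr(4))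

lemma slot_update:
  assumes "i < length Vs" "length w = length Vs" "k < length Vs"
  shows "slot d i x (w[k := a]) = (slot d i x w)[k := if k < i then parity_twist (Vs ! k) d a else if k = i then act (Vs ! k) x a else a]"
  by (rule nth_equalityI) (use assms in \<open>auto simp: slot_nth nth_list_update\<close>)

lemma \<tau>_slot_add:
  assumes "w \<in> tup" "k < length Vs" "a \<in> carrier (Vs ! k)" "b \<in> carrier (Vs ! k)" "x \<in> carrier L" "i < length Vs"
  shows "\<tau> (slot d i x (w[k := a \<oplus>\<^bsub>Vs ! k\<^esub> b])) = \<tau> (slot d i x (w[k := a])) + \<tau> (slot d i x (w[k := b]))"
proof -
  have l: "length w = length Vs" using assms tup_iff by blast
  note s = slot_tup[OF assms(5,1,6), of d]
  show ?thesis
    unfolding slot_update[OF assms(6) l assms(2)]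
    using \<tau>_add[OF s assms(2)] assms sr(3,4,5,7) by auto
qed

lemma \<tau>_slot_smult:
  assumes "w \<in> tup" "k < length Vs" "a \<in> carrier (Vs ! k)" "x \<in> carrier L" "i < length Vs"
  shows "\<tau> (slot d i x (w[k := c \<odot>\<^bsub>Vs ! k\<^esub> a])) = pscale c (\<tau> (slot d i x (w[k := a])))"
proof -
  have l: "length w = length Vs" using assms tup_iff by blast
  note s = slot_tup[OF assms(4,1,5), of d]
  show ?thesis
    unfolding slot_update[OF assms(5) l assms(2)]
    using \<tau>_smult[OF s assms(2)] assms sr(3,4,6,8) by auto
qed

lemma \<tau>_slot_add_left:
  assumes "w \<in> tup" "x \<in> carrier L" "x' \<in> carrier L" "i < length Vs"
  shows "\<tau> (slot d i (x \<oplus>\<^bsub>L\<^esub> x') w) = \<tau> (slot d i x w) + \<tau> (slot d i x' w)"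
    and "\<tau> (slot d i (c \<odot>\<^bsub>L\<^esub> x) w) = pscale c (\<tau> (slot d i x w))"
proof -
  have l: "length w = length Vs" and wi: "w ! i \<in> carrier (Vs ! i)" using assms tup_iff by blast+
  have sl: "slot d i z w = (slot d i x w)[i := act (Vs ! i) z (w ! i)]" for z
    by (rule nth_equalityI) (use assms l in \<open>auto simp: slot_nth nth_list_update\<close>)
  note s = slot_tup[OF assms(2,1,4), of d]
  show "\<tau> (slot d i (x \<oplus>\<^bsub>L\<^esub> x') w) = \<tau> (slot d i x w) + \<tau> (slot d i x' w)"
    unfolding sl[of "x \<oplus>\<^bsub>L\<^esub> x'"] sr(9)[OF assms(4,2,3) wi] \<tau>_add[OF s assms(4) sr(3)[OF assms(4,2) wi] sr(3)[OF assms(4,3) wi]]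
    unfolding sl[symmetric] ..
  show "\<tau> (slot d i (c \<odot>\<^bsub>L\<^esub> x) w) = pscale c (\<tau> (slot d i x w))"
    unfolding sl[of "c \<odot>\<^bsub>L\<^esub> x"] sr(10)[OF assms(4,2) wi] \<tau>_smult[OF s assms(4) sr(3)[OF assms(4,2) wi]]
    unfolding sl[symmetric] ..
qed

definition A :: "'x \<Rightarrow> 'a list \<Rightarrow> 'a list \<Rightarrow>\<^sub>0 complex" where
  "A x w = (\<Sum>d\<in>UNIV. \<Sum>i<length Vs. \<tau> (slot d i (component L d x) w))"

lemma tensor_act_lift:
  "tensor_act L Vs x p = pc.lift (\<lambda>w. \<Sum>d\<in>UNIV. \<Sum>i<length Vs. gen (slot d i (component L d x) w)) p"
  unfolding tensor_act_def pc.lift_def slot_def pscale.scale_sum_right by simp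

lemma linmap_tensor_act: "linmap pscale pscale (tensor_act L Vs x)"
  unfolding tensor_act_lift[abs_def] by (rule pc.linmap_lift)

lemma tproj_tensor_act: "tproj (tensor_act L Vs x p) = pc.lift (A x) p"
  unfolding tensor_act_lift pc.linmap_lift_outside[OF tproj(1)] A_def \<tau>_def linmap_sum[OF tproj(1)] ..

lemma tensor_act_ft:
  assumes "x \<in> carrier L" "p \<in> ft"
  shows "tensor_act L Vs x p \<in> ft"
  unfolding tensor_act_lift
proof (rule pc.lift_in_subspace[OF ft_subspace])
  fix w assume "w \<in> keys p"
  then have "w \<in> tup" using assms by auto
  then show "(\<Sum>d\<in>UNIV. \<Sum>i<length Vs. gen (slot d i (component L d x) w)) \<in> ft"
    by (intro pscale.subspace_sum[OF ft_subspace] gen_ft slot_tup comp_carrier[OF assms(1)]) auto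
qed

lemma tensor_act_kernel:
  assumes x: "x \<in> carrier L" and p: "p \<in> tensor_kernel L Vs"
  shows "tensor_act L Vs x p \<in> tensor_kernel L Vs"
proof -
  have 1: "A x (w[k := a \<oplus>\<^bsub>Vs ! k\<^esub> b]) = A x (w[k := a]) + A x (w[k := b])"
    if "w \<in> tup" "k < length Vs" "a \<in> carrier (Vs ! k)" "b \<in> carrier (Vs ! k)" for w k a b
    unfolding A_def sum.distrib[symmetric] using that comp_carrier[OF x] by (intro sum.cong refl \<tau>_slot_add) auto
  have 2: "A x (w[k := c \<odot>\<^bsub>Vs ! k\<^esub> a]) = pscale c (A x (w[k := a]))"
    if "w \<in> tup" "k < length Vs" "a \<in> carrier (Vs ! k)" for w k a c
    unfolding A_def pscale.scale_sum_right using that comp_carrier[OF x] by (intro sum.cong refl \<tau>_slot_smult) auto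
  have "pc.lift (A x) r = 0" if "r \<in> multilinear_relations Vs" for r
    using that unfolding multilinear_relations_def
    by (auto simp: pc.lift_diff 1 2)
  note r = this
  have "p \<in> pscale.span (multilinear_relations Vs)" using p unfolding tensor_kernel_span .
  then have "pc.lift (A x) p = 0"
    by (induction rule: pscale.span_induct_alt) (simp_all add: pc.lift_add pc.lift_scale r)
  then show ?thesis unfolding tproj(2)[symmetric] tproj_tensor_act .
qed

lemma A_homogeneous:
  assumes "x \<in> part L d" "w \<in> tup"
  shows "A x w = (\<Sum>i<length Vs. \<tau> (slot d i x w))"
proof -
  have x: "x \<in> carrier L" using assms part_carrier by blast
  have "(\<Sum>i<length Vs. \<tau> (slot e i (component L e x) w)) = (if e = d then \<Sum>i<length Vs. \<tau> (slot d i x w) else 0)" for e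
    using \<tau>_slot_add_left(2)[OF assms(2) x x, of _ e 0] comp_homogeneous[OF assms(1), of e] by auto
  then show ?thesis unfolding A_def by (cases d rule: bit_exhaust) (auto simp: UNIV_bit)
qed

text \<open>
  Operators in different slots supercommute: the one in the slot on the left picks up the sign
  when it passes the twist of the other.
\<close>

lemma \<tau>_slot_commute:
  assumes "x \<in> part L d" "x' \<in> part L e" "w \<in> tup" "i < length Vs" "j < length Vs" "i < j"
  shows "\<tau> (slot d i x (slot e j x' w)) = pscale (koszul_sign d e) (\<tau> (slot e j x' (slot d i x w)))"
proof -
  have x: "x \<in> carrier L" "x' \<in> carrier L" using assms part_carrier by blast+
  have l: "length w = length Vs" and wi: "w ! i \<in> carrier (Vs ! i)" using assms tup_iff by blast+
  define W where "W = slot d i x (slot e j x' w)"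
  have W: "W \<in> tup" unfolding W_def by (intro slot_tup x assms)
  have tt: "parity_twist (Vs ! k) e (parity_twist (Vs ! k) d (w ! k)) = parity_twist (Vs ! k) d (parity_twist (Vs ! k) e (w ! k))"
    if "k < length Vs" for k
  proof -
    have wk: "w ! k \<in> carrier (Vs ! k)" using that assms(3) unfolding tup_iff by blast
    show ?thesis unfolding sr(13)[OF that wk] by (simp only: add.commute)
  qed
  have eq: "slot e j x' (slot d i x w) = W[i := koszul_sign e d \<odot>\<^bsub>Vs ! i\<^esub> act (Vs ! i) x (parity_twist (Vs ! i) e (w ! i))]"
    unfolding W_def
    by (rule nth_equalityI)
      (use assms l x wi tt in \<open>auto simp: slot_nth nth_list_update sr(12)[OF assms(4) assms(1) wi]\<close>)
  have W': "W = W[i := act (Vs ! i) x (parity_twist (Vs ! i) e (w ! i))]"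
    unfolding W_def by (rule nth_equalityI) (use assms l in \<open>auto simp: slot_nth nth_list_update\<close>)
  have "\<tau> (slot e j x' (slot d i x w)) = pscale (koszul_sign e d) (\<tau> (W[i := act (Vs ! i) x (parity_twist (Vs ! i) e (w ! i))]))"
    unfolding eq by (rule \<tau>_smult[OF W assms(4)]) (intro sr(3) sr(4) assms x wi)
  then have "\<tau> (slot e j x' (slot d i x w)) = pscale (koszul_sign d e) (\<tau> W)" using W' koszul_sign_sym[of e d] by simp
  then show ?thesis unfolding W_def by (simp add: koszul_sign_square)
qed

lemma \<tau>_slot_bracket:
  assumes "x \<in> part L d" "x' \<in> part L e" "w \<in> tup" "i < length Vs"
  shows "\<tau> (slot d i x (slot e i x' w)) = pscale (koszul_sign d e) (\<tau> (slot e i x' (slot d i x w))) + \<tau> (slot (d + e) i (bracket L x x') w)"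
proof -
  have x: "x \<in> carrier L" "x' \<in> carrier L" "bracket L x x' \<in> carrier L"
    using assms part_carrier bracket_closed by blast+
  have l: "length w = length Vs" and wi: "w ! i \<in> carrier (Vs ! i)" using assms tup_iff by blast+
  define W where "W = slot (d + e) i (bracket L x x') w"
  have W: "W \<in> tup" unfolding W_def by (intro slot_tup x assms)
  have tt: "parity_twist (Vs ! k) d (parity_twist (Vs ! k) e (w ! k)) = parity_twist (Vs ! k) (d + e) (w ! k)"
      "parity_twist (Vs ! k) e (parity_twist (Vs ! k) d (w ! k)) = parity_twist (Vs ! k) (d + e) (w ! k)"
    if "k < length Vs" for k
    using that assms(3) sr(13)[OF that] unfolding tup_iff by (metis, metis add.commute)
  have 1: "slot d i x (slot e i x' w) = W[i := act (Vs ! i) x (act (Vs ! i) x' (w ! i))]"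
    and 2: "slot e i x' (slot d i x w) = W[i := act (Vs ! i) x' (act (Vs ! i) x (w ! i))]"
    and 3: "W = W[i := act (Vs ! i) (bracket L x x') (w ! i)]"
    unfolding W_def by (rule nth_equalityI; use assms l tt in \<open>simp add: slot_nth nth_list_update del: add_bit_eq_xor\<close>)+
  have c: "act (Vs ! i) x' (act (Vs ! i) x (w ! i)) \<in> carrier (Vs ! i)" "act (Vs ! i) (bracket L x x') (w ! i) \<in> carrier (Vs ! i)"
    by (intro sr(3) assms x wi)+
  have "\<tau> (slot d i x (slot e i x' w)) =
      pscale (koszul_sign d e) (\<tau> (slot e i x' (slot d i x w))) + \<tau> (W[i := act (Vs ! i) (bracket L x x') (w ! i)])"
    unfolding 1 2 sr(11)[OF assms(4,1,2) wi] \<tau>_add[OF W assms(4) sr(2)[OF assms(4) c(1)] c(2)] \<tau>_smult[OF W assms(4) c(1)] ..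
  then show ?thesis unfolding 3[symmetric] unfolding W_def .
qed

lemma A_bracket:
  assumes "x \<in> part L d" "x' \<in> part L e" "w \<in> tup"
  shows "(\<Sum>j<length Vs. \<Sum>i<length Vs. \<tau> (slot d i x (slot e j x' w))) =
    pscale (koszul_sign d e) (\<Sum>j<length Vs. \<Sum>i<length Vs. \<tau> (slot e i x' (slot d j x w))) +
    (\<Sum>i<length Vs. \<tau> (slot (d + e) i (bracket L x x') w))"
proof -
  have *: "\<tau> (slot d i x (slot e j x' w)) = pscale (koszul_sign d e) (\<tau> (slot e j x' (slot d i x w))) +
      (if i = j then \<tau> (slot (d + e) i (bracket L x x') w) else 0)" if "i < length Vs" "j < length Vs" for i j
  proof -
    consider "i < j" | "i = j" | "j < i" by linarith
    then show ?thesis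
    proof cases
      case 1 then show ?thesis using \<tau>_slot_commute[OF assms that 1] by simp
    next
      case 2 then show ?thesis using \<tau>_slot_bracket[OF assms that(1)] by simp
    next
      case 3
      show ?thesis using \<tau>_slot_commute[OF assms(2,1,3) that(2,1) 3] 3 koszul_sign_sym[of e d]
        by (simp add: koszul_sign_square)
    qed
  qed
  have "(\<Sum>j<length Vs. \<Sum>i<length Vs. \<tau> (slot d i x (slot e j x' w))) =
     (\<Sum>j<length Vs. \<Sum>i<length Vs. pscale (koszul_sign d e) (\<tau> (slot e j x' (slot d i x w))) +
      (if i = j then \<tau> (slot (d + e) i (bracket L x x') w) else 0))"
    by (intro sum.cong refl *) auto
  also have "\<dots> = pscale (koszul_sign d e) (\<Sum>j<length Vs. \<Sum>i<length Vs. \<tau> (slot e j x' (slot d i x w))) +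
      (\<Sum>j<length Vs. \<tau> (slot (d + e) j (bracket L x x') w))"
    by (simp only: sum.distrib pscale.scale_sum_right) (simp del: add_bit_eq_xor)
  also have "(\<Sum>j<length Vs. \<Sum>i<length Vs. \<tau> (slot e j x' (slot d i x w))) = (\<Sum>j<length Vs. \<Sum>i<length Vs. \<tau> (slot e i x' (slot d j x w)))"
    by (rule sum.swap)
  finally show ?thesis .
qed

lemma tproj_act_act:
  assumes "x \<in> part L d" "x' \<in> part L e" "w \<in> tup"
  shows "tproj (tensor_act L Vs x (tensor_act L Vs x' (gen w))) = (\<Sum>j<length Vs. \<Sum>i<length Vs. \<tau> (slot d i x (slot e j x' w)))"
proof -
  have x: "x \<in> carrier L" "x' \<in> carrier L" using assms part_carrier by blast+
  have "tensor_act L Vs x' (gen w) - (\<Sum>j<length Vs. gen (slot e j x' w)) \<in> tensor_kernel L Vs"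
    unfolding tproj(2)[symmetric] linmap_diff[OF tproj(1)] tproj_tensor_act
    using A_homogeneous[OF assms(2,3)] by (simp add: linmap_sum[OF tproj(1)] \<tau>_def)
  from tensor_act_kernel[OF x(1) this]
  have "tproj (tensor_act L Vs x (tensor_act L Vs x' (gen w))) = tproj (tensor_act L Vs x (\<Sum>j<length Vs. gen (slot e j x' w)))"
    unfolding tproj(2)[symmetric] linmap_diff[OF linmap_tensor_act] linmap_diff[OF tproj(1)] by simp
  also have "\<dots> = (\<Sum>j<length Vs. A x (slot e j x' w))"
    unfolding tproj_tensor_act by (simp add: pc.lift_sum)
  also have "\<dots> = (\<Sum>j<length Vs. \<Sum>i<length Vs. \<tau> (slot d i x (slot e j x' w)))"
    by (intro sum.cong refl A_homogeneous assms slot_tup x) auto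
  finally show ?thesis .
qed

text \<open>
  The signs make the sum of the slot operators compatible with the superbracket; the tensor
  product is realized on the free vector space on tuples.
\<close>

lemma tensor_representation:
  "\<exists>\<pi> (T :: 'x \<Rightarrow> ('a list \<Rightarrow>\<^sub>0 complex) \<Rightarrow> ('a list \<Rightarrow>\<^sub>0 complex)).
    linmap pscale pscale \<pi> \<and> (\<forall>a. \<pi> a = 0 \<longleftrightarrow> a \<in> tensor_kernel L Vs) \<and> is_rep L pscale T \<and>
    (\<forall>x\<in>carrier L. \<forall>p\<in>ft. T x (\<pi> p) = \<pi> (tensor_act L Vs x p))"
proof (rule pc.representation_on_quotient[of L ft "tensor_kernel L Vs" "tensor_act L Vs"])
  show "lie_closed L" by (rule lie_closed_axioms)
  show "pscale.subspace ft" by (rule ft_subspace)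
  show "pscale.subspace (tensor_kernel L Vs)" by (rule tensor_kernel_subspace)
  show "tensor_kernel L Vs \<subseteq> ft" by (rule tensor_kernel_subset)
  show "linmap pscale pscale (tensor_act L Vs x)" for x by (rule linmap_tensor_act)
  show "tensor_act L Vs x a \<in> ft" if "x \<in> carrier L" "a \<in> ft" for x a by (rule tensor_act_ft[OF that])
  show "tensor_act L Vs x a \<in> tensor_kernel L Vs" if "x \<in> carrier L" "a \<in> tensor_kernel L Vs" for x a
    by (rule tensor_act_kernel[OF that])
  show "tensor_act L Vs (x \<oplus>\<^bsub>L\<^esub> x') a - tensor_act L Vs x a - tensor_act L Vs x' a \<in> tensor_kernel L Vs"
    if "x \<in> carrier L" "x' \<in> carrier L" "a \<in> ft" for x x' a
  proof -
    have "A (x \<oplus>\<^bsub>L\<^esub> x') w = A x w + A x' w" if "w \<in> keys a" for w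
      unfolding A_def sum.distrib[symmetric] comp_add[OF \<open>x \<in> _\<close> \<open>x' \<in> _\<close>]
      by (intro sum.cong refl \<tau>_slot_add_left comp_carrier \<open>x \<in> _\<close> \<open>x' \<in> _\<close>) (use that \<open>a \<in> ft\<close> in auto)
    then have "pc.lift (A (x \<oplus>\<^bsub>L\<^esub> x')) a = pc.lift (\<lambda>w. A x w + A x' w) a" by (rule pc.lift_cong)
    then show ?thesis
      unfolding tproj(2)[symmetric] linmap_diff[OF tproj(1)] tproj_tensor_act by (simp add: pc.lift_fun_add)
  qed
  show "tensor_act L Vs (c \<odot>\<^bsub>L\<^esub> x) a - pscale c (tensor_act L Vs x a) \<in> tensor_kernel L Vs"
    if "x \<in> carrier L" "a \<in> ft" for c x a
  proof -
    have "A (c \<odot>\<^bsub>L\<^esub> x) w = pscale c (A x w)" if "w \<in> keys a" for w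
      unfolding A_def pscale.scale_sum_right comp_smult[OF \<open>x \<in> _\<close>]
      by (intro sum.cong refl \<tau>_slot_add_left(2)[OF _ comp_carrier[OF \<open>x \<in> _\<close>] comp_carrier[OF \<open>x \<in> _\<close>]]) (use that \<open>a \<in> ft\<close> in auto)
    then have "pc.lift (A (c \<odot>\<^bsub>L\<^esub> x)) a = pc.lift (\<lambda>w. pscale c (A x w)) a" by (rule pc.lift_cong)
    then show ?thesis
      unfolding tproj(2)[symmetric] linmap_diff[OF tproj(1)] linmap_scale[OF tproj(1)] tproj_tensor_act by (simp add: pc.lift_fun_scale)
  qed
  show "tensor_act L Vs x (tensor_act L Vs x' a) - pscale (koszul_sign d e) (tensor_act L Vs x' (tensor_act L Vs x a))
      - tensor_act L Vs (bracket L x x') a \<in> tensor_kernel L Vs"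
    if "x \<in> part L d" "x' \<in> part L e" "a \<in> ft" for x x' d e a
  proof -
    let ?t = "tensor_act L Vs"
    define f where "f p = tproj (?t x (?t x' p) - pscale (koszul_sign d e) (?t x' (?t x p)) - ?t (bracket L x x') p)" for p
    have lin: "linmap pscale pscale f"
      unfolding f_def
      by (rule linmapI)
        (simp_all add: linmap_add[OF tproj(1)] linmap_diff[OF tproj(1)] linmap_scale[OF tproj(1)] linmap_add[OF linmap_tensor_act]
          linmap_scale[OF linmap_tensor_act] pscale.scale_right_distrib pscale.scale_right_diff_distrib mult.commute)
    have z: "linmap pscale pscale (\<lambda>p :: 'a list \<Rightarrow>\<^sub>0 complex. 0 :: 'a list \<Rightarrow>\<^sub>0 complex)" by (simp add: linmap_def)
    have "f (gen w) = 0" if "w \<in> tup" for w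
    proof -
      have "tproj (?t (bracket L x x') (gen w)) = (\<Sum>i<length Vs. \<tau> (slot (d + e) i (bracket L x x') w))"
        unfolding tproj_tensor_act pc.lift_single pscale.scale_one
        by (rule A_homogeneous[OF bracket_part[OF \<open>x \<in> _\<close> \<open>x' \<in> _\<close>] that])
      then show ?thesis
        unfolding f_def linmap_diff[OF tproj(1)] linmap_scale[OF tproj(1)]
          tproj_act_act[OF \<open>x \<in> _\<close> \<open>x' \<in> _\<close> \<open>w \<in> tup\<close>] tproj_act_act[OF \<open>x' \<in> _\<close> \<open>x \<in> _\<close> \<open>w \<in> tup\<close>]
          A_bracket[OF \<open>x \<in> _\<close> \<open>x' \<in> _\<close> \<open>w \<in> tup\<close>] by simp
    qed
    note f0 = this
    have "f k = (\<lambda>p. 0) k" if k: "k = a" for k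
    proof (rule linmap_pm_eqI[where f = f and g = "\<lambda>p. 0" and sc = pscale])
      show "f (gen w) = 0" if "w \<in> keys k" for w
        using that k \<open>a \<in> ft\<close> by (intro f0) auto
    qed (rule lin z)+
    then have "f a = 0" by blast
    then show ?thesis unfolding f_def tproj(2) .
  qed
  fix \<pi> and T :: "'x \<Rightarrow> ('a list \<Rightarrow>\<^sub>0 complex) \<Rightarrow> ('a list \<Rightarrow>\<^sub>0 complex)"
  assume "linmap pscale pscale \<pi>" "\<And>a. \<pi> a = 0 \<longleftrightarrow> a \<in> tensor_kernel L Vs" "is_rep L pscale T"
    "\<And>x a. x \<in> carrier L ==> a \<in> ft ==> T x (\<pi> a) = \<pi> (tensor_act L Vs x a)"
  then show ?thesis by (intro exI[of _ \<pi>] exI[of _ T] conjI allI ballI)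
qed

definition tcls :: "('a list \<Rightarrow>\<^sub>0 complex) \<Rightarrow> ('a list \<Rightarrow>\<^sub>0 complex) set" where
  "tcls p = tensor_kernel L Vs +>\<^bsub>free_tensor L Vs\<^esub> p"

lemma presents_tensor: "pc.presents (tensor_product L Vs) ft tcls (tensor_kernel L Vs)"
  using pc.presents_quotient[OF presents_free_tensor tensor_kernel_subspace _ tensor_kernel_subset] pscale.subspace_0[OF tensor_kernel_subspace]
  unfolding tensor_product_def tcls_def[abs_def] by simp

lemma act_tensor:
  assumes "x \<in> carrier L" "p \<in> ft"
  shows "act (tensor_product L Vs) x (tcls p) = tcls (tensor_act L Vs x p)"
proof -
  have "act (quotient (free_tensor L Vs) ((\<lambda>p. p) ` tensor_kernel L Vs)) x ((\<lambda>p. p) ` tensor_kernel L Vs +>\<^bsub>free_tensor L Vs\<^esub> p) =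
      (\<lambda>p. p) ` tensor_kernel L Vs +>\<^bsub>free_tensor L Vs\<^esub> (tensor_act L Vs x p)"
  proof (rule pc.act_quotient[OF presents_free_tensor tensor_kernel_subspace _ tensor_kernel_subset, where t = "tensor_act L Vs x"])
    show "{0} \<subseteq> tensor_kernel L Vs" using pscale.subspace_0[OF tensor_kernel_subspace] by simp
    show "act (free_tensor L Vs) x a = tensor_act L Vs x a" for a by (simp add: free_tensor_def)
    show "tensor_act L Vs x a \<in> ft" if "a \<in> ft" for a by (rule tensor_act_ft[OF assms(1) that])
    show "tensor_act L Vs x a \<in> tensor_kernel L Vs" if "a \<in> tensor_kernel L Vs" for a by (rule tensor_act_kernel[OF assms(1) that])
  qed (rule linmap_tensor_act assms(2))+
  then show ?thesis unfolding tensor_product_def tcls_def image_ident .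
qed

lemma tcls_pure: "tcls (gen vs) = pure_tensor L Vs vs"
  by (simp add: tcls_def pure_tensor_def)

end

section \<open>Parity on the Kac modules\<close>

interpretation sl: lie_closed sl12 by (rule lie_closed_sl12)
interpretation slt: lie_closed sl12_t by (rule lie_closed_sl12_t)

lemma fa_induct [consumes 1, case_names zero add]:
  assumes "p \<in> fa L" and "Q 0"
    and "\<And>c w p. w \<in> lists (carrier L) ==> p \<in> fa L ==> Q p ==> Q (pscale c (gen w) + p)"
  shows "Q p"
proof -
  define f where "f k = pscale (lookup p k) (gen k)" for k
  have "sum f A \<in> fa L \<and> Q (sum f A)" if "finite A" "A \<subseteq> keys p" for A
    using that
  proof (induction A)
    case empty
    then show ?case using assms(2) by simp
  next
    case (insert k A)
    then have k: "k \<in> lists (carrier L)" using assms(1) by blast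
    have A: "sum f A \<in> fa L" "Q (sum f A)" using insert by auto
    have "f k \<in> fa L" unfolding f_def by (rule pscale.subspace_scale[OF fa_subspace]) (use k in simp)
    then have "f k + sum f A \<in> fa L" by (rule pscale.subspace_add[OF fa_subspace _ A(1)])
    moreover have "Q (f k + sum f A)" unfolding f_def[of k] by (rule assms(3)[OF k A])
    ultimately show ?case using insert by simp
  qed
  from this[OF finite_keys[of p] subset_refl] show ?thesis unfolding f_def sum_pscale_singles by blast
qed

lemma block_add: "block d (A + B) = block d A + block d B" and block_zero [simp]: "block d 0 = 0"
  and block_scale: "block d (c *\<^sub>M A) = c *\<^sub>M block d A"
  by (simp_all add: mat3_eq_iff block_nth)

lemma bit_succ_neq: "d + 1 \<noteq> (d :: bit)"
  by (cases d rule: bit_exhaust) auto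

lemma lookup_map_block: "lookup (Poly_Mapping.map (block d) x) m = block d (lookup x m)"
  by (simp add: Poly_Mapping.map.rep_eq when_def)

lemma block_sum_succ: "block d A + block (d + 1) A = A"
  by (cases d rule: bit_exhaust) (simp_all add: block_sum add.commute[of "block 1 A"])

lemma block_part_other: "A \<in> part sl12 (d + 1) ==> block d A = 0"
  using block_other[of "d + 1" d A] bit_succ_neq[of d] unfolding part_sl12 by simp

lemma component_sl12_t:
  assumes "x \<in> carrier sl12_t"
  shows "component sl12_t d x = Poly_Mapping.map (block d) x"
  unfolding component_def
proof (rule the_equality)
  have x: "lookup x m \<in> carrier sl12" for m using assms unfolding carrier_sl12_t by blast
  have "Poly_Mapping.map (block e) x \<in> part sl12_t e" for e
    unfolding part_sl12_t lookup_map_block by (intro allI block_part x)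
  moreover have "x = Poly_Mapping.map (block d) x + Poly_Mapping.map (block (d + 1)) x"
    by (rule poly_mapping_eqI) (simp only: lookup_add lookup_map_block block_sum_succ)
  ultimately show "Poly_Mapping.map (block d) x \<in> part sl12_t d \<and>
      (\<exists>b\<in>part sl12_t (d + 1). x = Poly_Mapping.map (block d) x \<oplus>\<^bsub>sl12_t\<^esub> b)"
    unfolding add_sl12_t by blast
  fix a assume "a \<in> part sl12_t d \<and> (\<exists>b\<in>part sl12_t (d + 1). x = a \<oplus>\<^bsub>sl12_t\<^esub> b)"
  then obtain b where a: "a \<in> part sl12_t d" and b: "b \<in> part sl12_t (d + 1)" and xab: "x = a + b"
    unfolding add_sl12_t by blast
  show "a = Poly_Mapping.map (block d) x"
  proof (rule poly_mapping_eqI)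
    fix m
    have "block d (lookup a m) = lookup a m" using a unfolding part_sl12_t part_sl12 by blast
    moreover have "block d (lookup b m) = 0" using b block_part_other unfolding part_sl12_t by blast
    ultimately show "lookup a m = lookup (Poly_Mapping.map (block d) x) m"
      unfolding lookup_map_block xab lookup_add block_add by simp
  qed
qed

lemma graded_lie_sl12_t: "graded_lie sl12_t"
proof (intro graded_lie.intro graded_lie_axioms.intro)
  show "lie_closed sl12_t" by (rule lie_closed_sl12_t)
  show "bracket sl12_t x x' \<in> part sl12_t (d + e)" if "x \<in> part sl12_t d" "x' \<in> part sl12_t e" for x x' d e
    by (rule bracket_sl12_t_part[OF that])
  fix x x' :: "nat \<Rightarrow>\<^sub>0 mat3" and d e :: bit and c :: complex
  show "component sl12_t d x = (if d = e then x else 0 \<odot>\<^bsub>sl12_t\<^esub> x)" if "x \<in> part sl12_t e"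
  proof (rule poly_mapping_eqI)
    fix m
    have m: "block e (lookup x m) = lookup x m" using that unfolding part_sl12_t part_sl12 by blast
    then have "block d (lookup x m) = 0" if "d \<noteq> e" using block_other[of e d "lookup x m"] that by simp
    moreover have "0 *\<^sub>M lookup x m = 0" by (simp add: mat3_eq_iff)
    ultimately show "lookup (component sl12_t d x) m = lookup (if d = e then x else 0 \<odot>\<^bsub>sl12_t\<^esub> x) m"
      unfolding component_sl12_t[OF part_carrier_sl12_t[OF that]] lookup_map_block using m by auto
  qed
  assume x: "x \<in> carrier sl12_t"
  show "component sl12_t d x \<in> part sl12_t d"
    using x unfolding component_sl12_t[OF x] part_sl12_t carrier_sl12_t lookup_map_block by (intro allI block_part) blast
  show "component sl12_t d (c \<odot>\<^bsub>sl12_t\<^esub> x) = c \<odot>\<^bsub>sl12_t\<^esub> component sl12_t d x"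
    unfolding component_sl12_t[OF x] component_sl12_t[OF slt.smult_closed[OF x]]
    by (rule poly_mapping_eqI) (simp add: lookup_map_block block_scale)
  assume x': "x' \<in> carrier sl12_t"
  show "component sl12_t d (x \<oplus>\<^bsub>sl12_t\<^esub> x') = component sl12_t d x \<oplus>\<^bsub>sl12_t\<^esub> component sl12_t d x'"
    unfolding component_sl12_t[OF x] component_sl12_t[OF x'] component_sl12_t[OF slt.add_closed[OF x x']]
    by (rule poly_mapping_eqI) (simp add: lookup_map_block block_add lookup_add)
qed

text \<open>
  The parity automorphism.
\<close>

definition flip :: "mat3 \<Rightarrow> mat3" where "flip A = block 0 A - block 1 A"

lemma flip_add: "flip (A + B) = flip A + flip B" and flip_scale: "flip (c *\<^sub>M A) = c *\<^sub>M flip A"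
  and flip_flip [simp]: "flip (flip A) = A" and flip_carrier: "A \<in> carrier sl12 ==> flip A \<in> carrier sl12"
  by (simp_all add: flip_def mat3_eq_iff block_nth carrier_sl12)

lemma flip_part: "A \<in> part sl12 d ==> flip A = koszul_sign 1 d *\<^sub>M A"
  by (cases d rule: bit_exhaust) (simp_all add: flip_def mat3_eq_iff block_nth part_sl12_0 part_sl12_1 koszul_sign_def)

lemma koszul_sign_add: "koszul_sign c (d + e) = koszul_sign c d * koszul_sign c e"
  by (cases d rule: bit_exhaust; cases e rule: bit_exhaust) (simp_all add: koszul_sign_def)

definition flip_words :: "(mat3 list \<Rightarrow>\<^sub>0 complex) \<Rightarrow> mat3 list \<Rightarrow>\<^sub>0 complex" where
  "flip_words p = pc.lift (\<lambda>w. gen (map flip w)) p"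

lemma linmap_flip_words: "linmap pscale pscale flip_words"
  unfolding flip_words_def[abs_def] by (rule pc.linmap_lift)

lemma flip_words_gen [simp]: "flip_words (single w c) = single (map flip w) c"
  by (simp add: flip_words_def)

lemma flip_words_fa:
  assumes "p \<in> fa sl12"
  shows "flip_words p \<in> fa sl12"
  unfolding flip_words_def
proof (rule pc.lift_in_subspace[OF fa_subspace])
  fix w assume "w \<in> keys p"
  then have "set w \<subseteq> carrier sl12" using assms by auto
  then show "gen (map flip w) \<in> fa sl12" by (auto intro!: flip_carrier)
qed

lemma flip_words_twice: "flip_words (flip_words p) = p"
proof (rule linmap_pm_eqI[where f = "\<lambda>p. flip_words (flip_words p)" and g = "\<lambda>p. p" and sc = pscale])
  show "linmap pscale pscale (\<lambda>p. flip_words (flip_words p))" by (rule linmap_comp[OF linmap_flip_words linmap_flip_words])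
qed (simp_all add: linmap_ident comp_def)

lemma flip_words_mult: "flip_words (word_mult (gen u) p) = word_mult (gen (map flip u)) (flip_words p)"
proof (rule linmap_pm_eqI[where f = "\<lambda>p. flip_words (word_mult (gen u) p)" and g = "\<lambda>p. word_mult (gen (map flip u)) (flip_words p)" and sc = pscale])
  show "linmap pscale pscale (\<lambda>p. flip_words (word_mult (gen u) p))" by (rule linmap_comp[OF linmap_word_mult_right linmap_flip_words])
  show "linmap pscale pscale (\<lambda>p. word_mult (gen (map flip u)) (flip_words p))" by (rule linmap_comp[OF linmap_flip_words linmap_word_mult_right])
qed simp

lemma homogeneous_Nil: "[] \<in> homogeneous_words L 0"
proof -
  have "list_all2 (\<lambda>x e. x \<in> part L e) [] [] \<and> sum_list [] = (0 :: bit)" by simp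
  then show ?thesis unfolding homogeneous_words_def by blast
qed

lemma homogeneous_Cons: "y \<in> part L e ==> w \<in> homogeneous_words L d ==> y # w \<in> homogeneous_words L (e + d)"
proof -
  assume y: "y \<in> part L e" and "w \<in> homogeneous_words L d"
  then obtain ds where "list_all2 (\<lambda>x e. x \<in> part L e) w ds" "sum_list ds = d" unfolding homogeneous_words_def by blast
  then have "list_all2 (\<lambda>x e. x \<in> part L e) (y # w) (e # ds) \<and> sum_list (e # ds) = e + d" using y by (simp del: add_bit_eq_xor)
  then show "y # w \<in> homogeneous_words L (e + d)" unfolding homogeneous_words_def mem_Collect_eq by (rule exI)
qed

lemma homogeneous_mult:
  assumes "y \<in> part L e" "keys q \<subseteq> homogeneous_words L d"
  shows "keys (word_mult (gen [y]) q) \<subseteq> homogeneous_words L (e + d)"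
proof -
  define S where "S = {p :: 'a list \<Rightarrow>\<^sub>0 complex. keys p \<subseteq> homogeneous_words L (e + d)}"
  have S: "pscale.subspace S" unfolding S_def by (rule keys_subset_subspace)
  have "gen (y # w) \<in> S" if w: "w \<in> keys q" for w
    using homogeneous_Cons[OF assms(1) subsetD[OF assms(2) w]] unfolding S_def by (simp del: add_bit_eq_xor)
  then have "pc.lift (\<lambda>w. gen (y # w)) q \<in> S" by (rule pc.lift_in_subspace[OF S])
  moreover have "word_mult (gen [y]) q = pc.lift (\<lambda>w. gen (y # w)) q" by (simp add: word_mult_lift)
  ultimately show ?thesis unfolding S_def by (simp del: add_bit_eq_xor)
qed

locale flip_stable =
  fixes P :: "(mat3 list \<Rightarrow>\<^sub>0 complex) set"
    and \<pi> :: "(mat3 list \<Rightarrow>\<^sub>0 complex) \<Rightarrow> (mat3 list \<Rightarrow>\<^sub>0 complex)"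
    and T :: "mat3 \<Rightarrow> (mat3 list \<Rightarrow>\<^sub>0 complex) \<Rightarrow> (mat3 list \<Rightarrow>\<^sub>0 complex)"
    and W :: "('x, 'a) super_module" and \<phi> :: "(mat3 list \<Rightarrow>\<^sub>0 complex) \<Rightarrow> 'a"
  assumes P: "P \<subseteq> fa sl12" and P_flip: "\<And>p. p \<in> P ==> flip_words p \<in> sl.lgen P"
    and pi_linear: "linmap pscale pscale \<pi>" and pi_zero: "\<And>a. \<pi> a = 0 \<longleftrightarrow> a \<in> sl.lgen P"
    and rep: "is_rep sl12 pscale T"
    and pi_act: "\<And>p. p \<in> fa sl12 ==> pc.action T p (\<pi> (gen [])) = \<pi> p"
    and W: "pc.presents W (fa sl12) \<phi> (sl.lgen P)"
    and W_part: "\<And>d. part W d = \<phi> ` {p. keys p \<subseteq> homogeneous_words sl12 d}"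
begin

lemmas pi_add = linmap_add[OF pi_linear] and pi_scale = linmap_scale[OF pi_linear] and pi_diff = linmap_diff[OF pi_linear]

lemma \<phi>_eq: "a \<in> fa sl12 ==> b \<in> fa sl12 ==> \<phi> a = \<phi> b \<longleftrightarrow> \<pi> a = \<pi> b"
  unfolding pc.presentsD(8)[OF W] pi_zero[symmetric] pi_diff by simp

lemma pi_word:
  assumes "x \<in> carrier sl12" "p \<in> fa sl12"
  shows "\<pi> (word_mult (gen [x]) p) = T x (\<pi> p)"
proof -
  have x: "gen [x] \<in> fa sl12" using assms by simp
  have "\<pi> (word_mult (gen [x]) p) = pc.action T (word_mult (gen [x]) p) (\<pi> (gen []))"
    using pi_act[OF fa_word_mult[OF x assms(2)]] by simp
  also have "\<dots> = T x (\<pi> p)" unfolding pc.action_word_mult[OF rep x assms(2)] pi_act[OF assms(2)] by simp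
  finally show ?thesis .
qed

text \<open>
  Twisting a representation by the parity automorphism gives a representation; its cyclic vector
  satisfies the same relations, so the automorphism acts on the quotient.
\<close>

lemma pi_flip_kernel:
  assumes "p \<in> sl.lgen P"
  shows "\<pi> (flip_words p) = 0"
proof -
  define T' where "T' x = T (flip x)" for x
  have rep': "is_rep sl12 pscale T'"
    unfolding is_rep_def
  proof (intro conjI ballI allI)
    fix x x' :: mat3 and d e a assume x: "x \<in> part sl12 d" "x' \<in> part sl12 e"
    have sc: "T' u b = pscale (koszul_sign 1 c) (T u b)" if "u \<in> part sl12 c" for u b c
      unfolding T'_def flip_part[OF that] smult_sl12[symmetric] by (rule is_repD(3)[OF rep part_carrier_sl12[OF that]])
    define de where "de = d + e"
    have br: "bracket sl12 x x' \<in> part sl12 de" unfolding de_def by (rule bracket_sl12_closed[OF x])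
    have k: "koszul_sign 1 de = koszul_sign 1 d * koszul_sign 1 e" unfolding de_def by (rule koszul_sign_add)
    note l = linmap_scale[OF is_repD(1)[OF rep part_carrier_sl12[OF x(1)]]] linmap_scale[OF is_repD(1)[OF rep part_carrier_sl12[OF x(2)]]]
    show "T' (bracket sl12 x x') a = T' x (T' x' a) - pscale (koszul_sign d e) (T' x' (T' x a))"
      unfolding sc[OF br] sc[OF x(1)] sc[OF x(2)] is_repD(4)[OF rep x] l k pscale.scale_right_diff_distrib
      by (simp add: mult_ac)
  next
    fix x x' a c assume x: "x \<in> carrier sl12"
    show "linmap pscale pscale (T' x)" unfolding T'_def by (rule is_repD(1)[OF rep flip_carrier[OF x]])
    show "T' (c \<odot>\<^bsub>sl12\<^esub> x) a = pscale c (T' x a)"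
      unfolding T'_def smult_sl12 flip_scale using is_repD(3)[OF rep flip_carrier[OF x]] by simp
    assume x': "x' \<in> carrier sl12"
    show "T' (x \<oplus>\<^bsub>sl12\<^esub> x') a = T' x a + T' x' a"
      unfolding T'_def add_sl12 flip_add using is_repD(2)[OF rep flip_carrier[OF x] flip_carrier[OF x']] by simp
  qed
  have act: "pc.action T' p v = pc.action T (flip_words p) v" for p v
  proof (rule linmap_pm_eqI[where f = "\<lambda>p. pc.action T' p v" and g = "\<lambda>p. pc.action T (flip_words p) v" and sc = pscale])
    show "linmap pscale pscale (\<lambda>p. pc.action T (flip_words p) v)" by (rule linmap_comp[OF linmap_flip_words pc.linmap_action])
    show "pc.action T' (gen k) v = pc.action T (flip_words (gen k)) v" for k
      by (simp add: foldr_map T'_def[abs_def] comp_def)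
  qed (rule pc.linmap_action)
  have "pc.action T' p (\<pi> (gen [])) = 0"
  proof (rule sl.lgen_minimal[OF pc.cspace_axioms rep' _ P assms])
    fix p assume p: "p \<in> P"
    then have "flip_words p \<in> fa sl12" using P flip_words_fa by blast
    then show "pc.action T' p (\<pi> (gen [])) = 0" unfolding act using P_flip[OF p] pi_zero by (simp add: pi_act)
  qed
  moreover have "flip_words p \<in> fa sl12" using assms sl.lgen_subset flip_words_fa by blast
  ultimately show ?thesis unfolding act by (simp add: pi_act)
qed

lemma pi_flip_eq:
  assumes "\<pi> a = \<pi> b"
  shows "\<pi> (flip_words a) = \<pi> (flip_words b)"
proof -
  have "a - b \<in> sl.lgen P" using assms unfolding pi_zero[symmetric] pi_diff by simp
  from pi_flip_kernel[OF this] show ?thesis unfolding linmap_diff[OF linmap_flip_words] pi_diff by simp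
qed

lemma homogeneous_word_flip:
  assumes "list_all2 (\<lambda>x e. x \<in> part sl12 e) w ds"
  shows "w \<in> lists (carrier sl12) \<and> foldr T (map flip w) a = pscale (koszul_sign 1 (sum_list ds)) (foldr T w a)"
  using assms
proof (induction rule: list_all2_induct)
  case Nil
  then show ?case by (simp add: koszul_sign_def)
next
  case (Cons x w e ds)
  then have xc: "x \<in> carrier sl12" using part_carrier_sl12 by blast
  have "T (flip x) b = pscale (koszul_sign 1 e) (T x b)" for b
    unfolding flip_part[OF Cons(1)] smult_sl12[symmetric] by (rule is_repD(3)[OF rep xc])
  then show ?case
    using Cons xc by (simp add: linmap_scale[OF is_repD(1)[OF rep xc]] koszul_sign_add del: add_bit_eq_xor)
qed

lemma homogeneous_flip:
  assumes "keys p \<subseteq> homogeneous_words sl12 d"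
  shows "p \<in> fa sl12" "\<pi> (flip_words p) = pscale (koszul_sign 1 d) (\<pi> p)"
proof -
  have w: "w \<in> lists (carrier sl12)" "\<And>a. foldr T (map flip w) a = pscale (koszul_sign 1 d) (foldr T w a)"
    if wp: "w \<in> keys p" for w
  proof -
    obtain ds where ds: "list_all2 (\<lambda>x e. x \<in> part sl12 e) w ds" "sum_list ds = d"
      using assms wp unfolding homogeneous_words_def by blast
    from homogeneous_word_flip[OF ds(1)] ds(2)
    show "w \<in> lists (carrier sl12)" "\<And>a. foldr T (map flip w) a = pscale (koszul_sign 1 d) (foldr T w a)" by blast+
  qed
  show p: "p \<in> fa sl12" using w(1) by blast
  define v where "v = \<pi> (gen [])"
  have "pc.action T (flip_words p) v = pscale (koszul_sign 1 d) (pc.action T p v)"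
  proof (rule linmap_pm_eqI[where f = "\<lambda>p. pc.action T (flip_words p) v" and g = "\<lambda>p. pscale (koszul_sign 1 d) (pc.action T p v)" and sc = pscale])
    show "linmap pscale pscale (\<lambda>p. pc.action T (flip_words p) v)" by (rule linmap_comp[OF linmap_flip_words pc.linmap_action])
    show "linmap pscale pscale (\<lambda>p. pscale (koszul_sign 1 d) (pc.action T p v))"
      by (rule linmap_comp[OF pc.linmap_action]) (simp add: linmap_def pscale.scale_right_distrib mult.commute)
  qed (simp add: w(2))
  then show "\<pi> (flip_words p) = pscale (koszul_sign 1 d) (\<pi> p)"
    unfolding v_def pi_act[OF p] pi_act[OF flip_words_fa[OF p]] .
qed

text \<open>
  Words with inhomogeneous letters are homogeneous only modulo the linearity relations, so the
  splitting is made letter by letter in the quotient.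
\<close>

lemma homogeneous_split:
  assumes "p \<in> fa sl12"
  shows "\<exists>p'. (\<forall>d. keys (p' d) \<subseteq> homogeneous_words sl12 d) \<and> \<pi> p = \<pi> (p' 0) + \<pi> (p' 1)"
  using assms
proof (induction rule: fa_induct)
  case zero
  have "(\<forall>d. keys (0 :: mat3 list \<Rightarrow>\<^sub>0 complex) \<subseteq> homogeneous_words sl12 d) \<and> \<pi> 0 = \<pi> 0 + \<pi> 0"
    by (simp add: linmap_zero[OF pi_linear])
  then show ?case by (intro exI[of _ "\<lambda>d. 0"])
next
  case (add c w p)
  note sub = pscale.subspace_add[OF keys_subset_subspace] pscale.subspace_scale[OF keys_subset_subspace]
  have word: "\<exists>p'. (\<forall>d. keys (p' d) \<subseteq> homogeneous_words sl12 d) \<and> \<pi> (gen w) = \<pi> (p' 0) + \<pi> (p' 1)"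
    using \<open>w \<in> lists (carrier sl12)\<close>
  proof (induction w)
    case Nil
    have "(\<forall>d. keys ((if d = 0 then gen [] else 0) :: mat3 list \<Rightarrow>\<^sub>0 complex) \<subseteq> homogeneous_words sl12 d)"
      using homogeneous_Nil[of sl12] by simp
    then show ?case by (intro exI[of _ "\<lambda>d. if d = 0 then gen [] else 0"]) (simp add: linmap_zero[OF pi_linear])
  next
    case (Cons x w)
    then obtain u where u: "\<And>d. keys (u d) \<subseteq> homogeneous_words sl12 d" and eq: "\<pi> (gen w) = \<pi> (u 0) + \<pi> (u 1)" by blast
    have x: "x \<in> carrier sl12" and w: "gen w \<in> fa sl12" using Cons by auto
    note b = block_part[OF x]
    note bc = part_carrier_sl12[OF b]
    define u' where "u' d = word_mult (gen [block 0 x]) (u d) + word_mult (gen [block 1 x]) (u (1 + d))" for d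
    have 1: "keys (u' d) \<subseteq> homogeneous_words sl12 d" for d
    proof -
      have "0 + d = d" "1 + (1 + d) = d" by (cases d rule: bit_exhaust; simp)+
      then have "word_mult (gen [block 0 x]) (u d) \<in> {p. keys p \<subseteq> homogeneous_words sl12 d}"
        "word_mult (gen [block 1 x]) (u (1 + d)) \<in> {p. keys p \<subseteq> homogeneous_words sl12 d}"
        using homogeneous_mult[OF b[of 0] u[of d]] homogeneous_mult[OF b[of 1] u[of "1 + d"]] by (simp_all del: add_bit_eq_xor)
      from sub(1)[OF this] show ?thesis unfolding u'_def by simp
    qed
    have "\<pi> (gen (x # w)) = T x (\<pi> (gen w))" using pi_word[OF x w] by simp
    also have "\<dots> = T (block 0 x) (\<pi> (gen w)) + T (block 1 x) (\<pi> (gen w))"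
      using is_repD(2)[OF rep bc[of 0] bc[of 1], of "\<pi> (gen w)"] unfolding add_sl12 block_sum .
    also have "\<dots> = \<pi> (u' 0) + \<pi> (u' 1)"
      unfolding eq u'_def pi_add linmap_add[OF is_repD(1)[OF rep bc]]
      using pi_word[OF bc[of 0] homogeneous_flip(1)[OF u]] pi_word[OF bc[of 1] homogeneous_flip(1)[OF u]]
      by (simp add: add_ac)
    finally show ?case using 1 by blast
  qed
  obtain u where u: "\<And>d. keys (u d) \<subseteq> homogeneous_words sl12 d" "\<pi> (gen w) = \<pi> (u 0) + \<pi> (u 1)" using word by blast
  obtain u' where u': "\<And>d. keys (u' d) \<subseteq> homogeneous_words sl12 d" "\<pi> p = \<pi> (u' 0) + \<pi> (u' 1)" using add(3) by blast
  have "keys (pscale c (u d) + u' d) \<subseteq> homogeneous_words sl12 d" for d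
    using sub(1)[OF sub(2)[of "u d" "homogeneous_words sl12 d" c], of "u' d"] u(1)[of d] u'(1)[of d] by simp
  moreover have "\<pi> (single w c) = pscale c (\<pi> (gen w))" using pi_scale[of c "gen w"] by simp
  ultimately show ?case
    by (intro exI[of _ "\<lambda>d. pscale c (u d) + u' d"]) (simp add: pi_add pi_scale u u' pscale.scale_right_distrib add_ac)
qed

text \<open>
  The projections onto the homogeneous components are \<open>(1 \<plusminus> \<sigma>) /
  2\<close> for the parity automorphism \<open>\<sigma>\<close>.
\<close>

lemma component_cls:
  assumes p: "p \<in> fa sl12"
  shows "component W d (\<phi> p) = \<phi> (pscale (1/2) (p + pscale (koszul_sign 1 d) (flip_words p)))"
proof -
  define h where "h = pscale (1/2) (p + pscale (koszul_sign 1 d) (flip_words p))"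
  note fa_sub = pscale.subspace_add[OF fa_subspace] pscale.subspace_scale[OF fa_subspace]
  have h: "h \<in> fa sl12" unfolding h_def by (intro fa_sub p flip_words_fa[OF p])
  note W' = pc.presentsD[OF W]
  have k1: "koszul_sign 1 (d + 1) = - koszul_sign 1 d" by (cases d rule: bit_exhaust) (simp_all add: koszul_sign_def)
  have uniq: "\<phi> a = \<phi> h" if a: "keys a \<subseteq> homogeneous_words sl12 d" and b: "keys b \<subseteq> homogeneous_words sl12 (d + 1)"
    and eq: "\<pi> p = \<pi> (a + b)" for a b
  proof -
    note afa = homogeneous_flip(1)[OF a] and bfa = homogeneous_flip(1)[OF b]
    have "\<pi> (flip_words p) = pscale (koszul_sign 1 d) (\<pi> a) + pscale (koszul_sign 1 (d + 1)) (\<pi> b)"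
      unfolding pi_flip_eq[OF eq] linmap_add[OF linmap_flip_words] pi_add homogeneous_flip(2)[OF a] homogeneous_flip(2)[OF b] ..
    then have "\<pi> h = pscale (1/2) (\<pi> a + \<pi> b + pscale (koszul_sign 1 d) (pscale (koszul_sign 1 d) (\<pi> a) - pscale (koszul_sign 1 d) (\<pi> b)))"
      unfolding h_def k1 by (simp add: pi_scale pi_add eq)
    also have "\<dots> = \<pi> a"
      by (rule poly_mapping_eqI) (simp add: lookup_add lookup_minus koszul_sign_square right_diff_distrib mult.assoc[symmetric])
    finally show ?thesis using \<phi>_eq[OF afa h] by simp
  qed
  obtain u where u: "\<And>d. keys (u d) \<subseteq> homogeneous_words sl12 d" "\<pi> p = \<pi> (u 0) + \<pi> (u 1)" using homogeneous_split[OF p] by blast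
  have u2: "\<pi> p = \<pi> (u d + u (d + 1))" unfolding pi_add using u(2) by (cases d rule: bit_exhaust) (simp_all add: add.commute)
  note ufa = homogeneous_flip(1)[OF u(1)]
  have \<phi>h: "\<phi> (u d) = \<phi> h" by (rule uniq[OF u(1) u(1) u2])
  show ?thesis
    unfolding component_def h_def[symmetric]
  proof (rule the_equality)
    have "\<phi> p = \<phi> h \<oplus>\<^bsub>W\<^esub> \<phi> (u (d + 1))"
      unfolding \<phi>h[symmetric] W'(6)[OF ufa ufa] using \<phi>_eq[OF p fa_sub(1)[OF ufa ufa]] u2 by blast
    moreover have "\<phi> h \<in> part W d" unfolding \<phi>h[symmetric] W_part using u(1) by blast
    moreover have "\<phi> (u (d + 1)) \<in> part W (d + 1)" unfolding W_part using u(1) by blast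
    ultimately show "\<phi> h \<in> part W d \<and> (\<exists>b\<in>part W (d + 1). \<phi> p = \<phi> h \<oplus>\<^bsub>W\<^esub> b)" by blast
    fix a assume "a \<in> part W d \<and> (\<exists>b\<in>part W (d + 1). \<phi> p = a \<oplus>\<^bsub>W\<^esub> b)"
    then obtain a' b' where ab: "keys a' \<subseteq> homogeneous_words sl12 d" "a = \<phi> a'" 
        "keys b' \<subseteq> homogeneous_words sl12 (d + 1)" "\<phi> p = \<phi> a' \<oplus>\<^bsub>W\<^esub> \<phi> b'"
      unfolding W_part by blast
    note fab = homogeneous_flip(1)[OF ab(1)] homogeneous_flip(1)[OF ab(3)]
    have "\<pi> p = \<pi> (a' + b')" using ab(4) unfolding W'(6)[OF fab] \<phi>_eq[OF p fa_sub(1)[OF fab]] .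
    then show "a = \<phi> h" unfolding ab(2) by (rule uniq[OF ab(1,3)])
  qed
qed

lemma twist_cls:
  assumes p: "p \<in> fa sl12"
  shows "parity_twist W d (\<phi> p) = \<phi> (if d = 0 then p else flip_words p)"
proof -
  note fa_sub = pscale.subspace_add[OF fa_subspace] pscale.subspace_scale[OF fa_subspace]
  define g where "g e = pscale (koszul_sign d e) (pscale (1/2) (p + pscale (koszul_sign 1 e) (flip_words p)))" for e
  have g: "g e \<in> fa sl12" for e unfolding g_def by (intro fa_sub p flip_words_fa[OF p])
  have c: "koszul_sign d e \<odot>\<^bsub>W\<^esub> component W e (\<phi> p) = \<phi> (g e)" for e
    unfolding component_cls[OF p] g_def by (rule pc.presentsD(7)[OF W]) (intro fa_sub p flip_words_fa[OF p])
  have "parity_twist W d (\<phi> p) = \<phi> (\<Sum>e\<in>UNIV. g e)"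
    unfolding parity_twist_def c by (rule pc.presents_finsum[OF W _ g]) (simp add: UNIV_bit)
  also have "(\<Sum>e\<in>UNIV. g e) = g 0 + g 1" by (simp add: UNIV_bit)
  also have "\<dots> = (if d = 0 then p else flip_words p)"
    unfolding g_def
    by (rule poly_mapping_eqI; cases d rule: bit_exhaust) (simp_all add: koszul_sign_def lookup_add lookup_minus field_simps)
  finally show ?thesis .
qed

end

section \<open>Evaluation modules\<close>

lemma mscale_zero [simp]: "c *\<^sub>M (0::mat3) = 0" "0 *\<^sub>M A = 0" and mscale_one [simp]: "1 *\<^sub>M A = A"
  and mscale_add_right: "c *\<^sub>M (A + B) = c *\<^sub>M A + c *\<^sub>M B" and mscale_add_left: "(a + b) *\<^sub>M A = a *\<^sub>M A + b *\<^sub>M A"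
  and mscale_assoc: "a *\<^sub>M b *\<^sub>M A = (a * b) *\<^sub>M A"
  by (simp_all add: mat3_eq_iff algebra_simps)

lemma mscale_sum: "c *\<^sub>M sum f I = (\<Sum>i\<in>I. c *\<^sub>M f i)"
  by (induction I rule: infinite_finite_induct) (simp_all add: mscale_add_right)

lemma sum_mscale: "sum c I *\<^sub>M A = (\<Sum>i\<in>I. c i *\<^sub>M A)"
  by (induction I rule: infinite_finite_induct) (simp_all add: mscale_add_left)

lemma mult_sum_left: "sum f I ** (B :: mat3) = (\<Sum>i\<in>I. f i ** B)" and mult_sum_right: "(B :: mat3) ** sum f I = (\<Sum>i\<in>I. B ** f i)"
proof -
  have "(A + A') ** B = A ** B + A' ** B" "B ** (A + A') = B ** A + B ** A'" "0 ** B = 0" "B ** 0 = 0" for A A' :: mat3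
    by (simp_all add: mat3_eq_iff mult_nth algebra_simps)
  then show "sum f I ** (B :: mat3) = (\<Sum>i\<in>I. f i ** B)" "(B :: mat3) ** sum f I = (\<Sum>i\<in>I. B ** f i)"
    by (induction I rule: infinite_finite_induct) simp_all
qed

text \<open>
  The homomorphism \<open>t \<mapsto> z\<close>.
\<close>

definition evaluate :: "complex \<Rightarrow> (nat \<Rightarrow>\<^sub>0 mat3) \<Rightarrow> mat3" where
  "evaluate z g = (\<Sum>m\<in>keys g. z ^ m *\<^sub>M lookup g m)"

lemma evaluate_superset: "finite I ==> keys g \<subseteq> I ==> evaluate z g = (\<Sum>m\<in>I. z ^ m *\<^sub>M lookup g m)"
  unfolding evaluate_def by (rule sum.mono_neutral_left) (auto simp: in_keys_iff)

lemma evaluate_add: "evaluate z (g + g') = evaluate z g + evaluate z g'"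
proof -
  define I where "I = keys g \<union> keys g'"
  have I: "finite I" "keys g \<subseteq> I" "keys g' \<subseteq> I" "keys (g + g') \<subseteq> I"
    unfolding I_def using keys_add[of g g'] by auto
  show ?thesis
    unfolding evaluate_superset[OF I(1,2)] evaluate_superset[OF I(1,3)] evaluate_superset[OF I(1,4)] lookup_add mscale_add_right sum.distrib ..
qed

lemma evaluate_zero [simp]: "evaluate z 0 = 0"
  by (simp add: evaluate_def)

lemma evaluate_sum: "evaluate z (sum f I) = (\<Sum>i\<in>I. evaluate z (f i))"
  by (induction I rule: infinite_finite_induct) (simp_all add: evaluate_add)

lemma evaluate_single [simp]: "evaluate z (single m A) = z ^ m *\<^sub>M A"
  by (cases "A = 0") (simp_all add: evaluate_def)

lemma evaluate_smult: "evaluate z (c \<odot>\<^bsub>sl12_t\<^esub> g) = c *\<^sub>M evaluate z g"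
proof -
  have "keys (c \<odot>\<^bsub>sl12_t\<^esub> g) \<subseteq> keys g" by (auto simp: in_keys_iff)
  from evaluate_superset[OF finite_keys this] show ?thesis
    by (simp add: evaluate_def mscale_sum mscale_assoc mult.commute)
qed

lemma sum_part_sl12: "(\<And>i. i \<in> I ==> f i \<in> part sl12 d) ==> sum f I \<in> part sl12 d"
  by (induction I rule: infinite_finite_induct) (auto intro: part_sl12_closed)

lemma scale_part_sl12: "A \<in> part sl12 d ==> c *\<^sub>M A \<in> part sl12 d"
  by (cases d rule: bit_exhaust) (simp_all add: part_sl12_0 part_sl12_1 algebra_simps)

lemma sum_carrier_sl12: "(\<And>i. i \<in> I ==> f i \<in> carrier sl12) ==> sum f I \<in> carrier sl12"
  by (induction I rule: infinite_finite_induct) (auto intro: carrier_sl12_closed)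

lemma evaluate_carrier: "g \<in> carrier sl12_t ==> evaluate z g \<in> carrier sl12"
  unfolding evaluate_def carrier_sl12_t by (intro sum_carrier_sl12 carrier_sl12_closed(3)) blast

lemma evaluate_part: "g \<in> part sl12_t d ==> evaluate z g \<in> part sl12 d"
  unfolding evaluate_def part_sl12_t by (intro sum_part_sl12 scale_part_sl12) blast

lemma evaluate_bracket:
  assumes g: "g \<in> part sl12_t d" and g': "g' \<in> part sl12_t e"
  shows "evaluate z (bracket sl12_t g g') = bracket sl12 (evaluate z g) (evaluate z g')"
proof -
  define a b where "a m = lookup g m" and "b n = lookup g' n" for m n
  have ab: "a m \<in> part sl12 d" "b n \<in> part sl12 e" for m n
    using g g' unfolding a_def b_def part_sl12_t by blast+
  define I J where "I = keys g" and "J = keys g'"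
  have "evaluate z (bracket sl12_t g g') = (\<Sum>m\<in>I. \<Sum>n\<in>J. z ^ (m + n) *\<^sub>M (a m ** b n - koszul_sign d e *\<^sub>M (b n ** a m)))"
    by (simp add: sl12_t_def evaluate_sum bracket_sl12[OF ab] flip: a_def b_def I_def J_def)
  also have "\<dots> = (\<Sum>m\<in>I. \<Sum>n\<in>J. (z ^ m *\<^sub>M a m) ** (z ^ n *\<^sub>M b n)) - koszul_sign d e *\<^sub>M (\<Sum>m\<in>I. \<Sum>n\<in>J. (z ^ n *\<^sub>M b n) ** (z ^ m *\<^sub>M a m))"
    unfolding mscale_sum sum_subtractf[symmetric]
    by (intro sum.cong refl) (simp add: mat3_eq_iff mult_nth power_add algebra_simps)
  also have "(\<Sum>m\<in>I. \<Sum>n\<in>J. (z ^ m *\<^sub>M a m) ** (z ^ n *\<^sub>M b n)) = evaluate z g ** evaluate z g'"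
    unfolding evaluate_def mult_sum_left mult_sum_right a_def b_def I_def J_def by (rule sum.swap)
  also have "(\<Sum>m\<in>I. \<Sum>n\<in>J. (z ^ n *\<^sub>M b n) ** (z ^ m *\<^sub>M a m)) = (\<Sum>n\<in>J. \<Sum>m\<in>I. (z ^ n *\<^sub>M b n) ** (z ^ m *\<^sub>M a m))"
    by (rule sum.swap)
  also have "\<dots> = evaluate z g' ** evaluate z g"
    unfolding evaluate_def mult_sum_left mult_sum_right a_def b_def I_def J_def by (rule sum.swap)
  finally show ?thesis unfolding bracket_sl12[OF evaluate_part[OF g] evaluate_part[OF g']] .
qed

definition K_relations :: "weight \<Rightarrow> (mat3 list \<Rightarrow>\<^sub>0 complex) set" where
  "K_relations \<mu> = (\<lambda>x. gen [x]) ` n_plus \<union>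
    {gen [a *\<^sub>M h1 + b *\<^sub>M h2] - pscale (a * fst \<mu> + b * snd \<mu>) (gen []) | a b. True} \<union>
    {gen (replicate (n + 1) y2) | n::nat. snd \<mu> = of_nat n}"

lemma n_plus_carrier: "x \<in> n_plus ==> x \<in> carrier sl12"
  by (auto simp: n_plus_def carrier_sl12 E_nth)

lemma h_part: "a *\<^sub>M h1 + b *\<^sub>M h2 \<in> part sl12 0"
  by (intro part_sl12_closed scale_part_sl12 E_part)

lemma y2_part: "y2 \<in> part sl12 0"
  unfolding y2_def by (rule E_part)

lemma gen_minus_scalar_fa:
  assumes "w \<in> lists (carrier L)"
  shows "gen w - pscale c (gen []) \<in> fa L"
  by (intro pscale.subspace_diff[OF fa_subspace] pscale.subspace_scale[OF fa_subspace]) (use assms in auto)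

lemma K_relations_fa: "K_relations \<mu> \<subseteq> fa sl12"
proof
  fix p assume "p \<in> K_relations \<mu>"
  then consider x where "x \<in> n_plus" "p = gen [x]"
    | a b where "p = gen [a *\<^sub>M h1 + b *\<^sub>M h2] - pscale (a * fst \<mu> + b * snd \<mu>) (gen [])"
    | n where "p = gen (replicate (n + 1) y2)"
    unfolding K_relations_def by blast
  then show "p \<in> fa sl12"
  proof cases
    case 1 then show ?thesis using n_plus_carrier by simp
  next
    case 2 then show ?thesis using gen_minus_scalar_fa[of "[a *\<^sub>M h1 + b *\<^sub>M h2]" sl12] part_carrier_sl12[OF h_part] by simp
  next
    case 3 then show ?thesis using part_carrier_sl12[OF y2_part] by (auto simp: in_lists_conv_set)
  qed
qed

lemma K_ideal_relations: "K_ideal \<mu> = generated_left_ideal (UEA sl12) (ucls sl12 ` K_relations \<mu>)"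
proof -
  have 1: "UEA_incl sl12 ` n_plus = ucls sl12 ` ((\<lambda>x. gen [x]) ` n_plus)"
    unfolding image_image sl.UEA_incl_ucls ..
  have e2: "UEA_incl sl12 (a *\<^sub>M h1 + b *\<^sub>M h2) \<ominus>\<^bsub>UEA sl12\<^esub> c \<odot>\<^bsub>UEA sl12\<^esub> \<one>\<^bsub>UEA sl12\<^esub> =
      ucls sl12 (gen [a *\<^sub>M h1 + b *\<^sub>M h2] - pscale c (gen []))" for a b c
  proof -
    have one: "gen [] \<in> fa sl12" "gen [a *\<^sub>M h1 + b *\<^sub>M h2] \<in> fa sl12" using part_carrier_sl12[OF h_part] by simp_all
    show ?thesis
      unfolding sl.UEA_incl_ucls sl.UEA_one pc.presentsD(7)[OF sl.presents_UEA one(1)]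
      by (rule pc.presents_minus[OF sl.presents_UEA one(2) pscale.subspace_scale[OF fa_subspace one(1)]])
  qed
  have e3: "UEA_incl sl12 y2 [^]\<^bsub>UEA sl12\<^esub> (k::nat) = ucls sl12 (gen (replicate k y2))" for k
    by (rule sl.UEA_pow[OF part_carrier_sl12[OF y2_part]])
  show ?thesis
    unfolding K_ideal_def Let_def K_relations_def image_Un 1 e2 e3
    by (rule arg_cong[where f = "generated_left_ideal (UEA sl12)"]) (intro arg_cong2[where f = "(\<union>)"] refl; blast)
qed

lemma K_cyc: "K \<mu> = sl.cyc (K_relations \<mu>)" and K_vec_cyc: "K_vec \<mu> = sl.ccls (K_relations \<mu>) (gen [])"
  by (simp_all add: K_def sl.cyc_def K_vec_def sl.ccls_def K_ideal_relations sl.UEA_one)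

lemma K_relations_flip:
  assumes "p \<in> K_relations \<mu>"
  shows "flip_words p \<in> sl.lgen (K_relations \<mu>)"
proof -
  have "flip_words p \<in> K_relations \<mu>"
  proof -
    from assms consider x where "x \<in> n_plus" "p = gen [x]"
      | a b where "p = gen [a *\<^sub>M h1 + b *\<^sub>M h2] - pscale (a * fst \<mu> + b * snd \<mu>) (gen [])"
      | n where "p = gen (replicate (n + 1) y2)"
      unfolding K_relations_def by blast
    then show ?thesis
    proof cases
      case 1
      then obtain a b c where "x = a *\<^sub>M E 2 1 + b *\<^sub>M E 2 3 + c *\<^sub>M E 1 3" unfolding n_plus_def by blast
      then have "flip x = (-a) *\<^sub>M E 2 1 + b *\<^sub>M E 2 3 + (-c) *\<^sub>M E 1 3"
        by (simp add: flip_def mat3_eq_iff block_nth E_nth)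
      then have "flip x \<in> n_plus" unfolding n_plus_def by blast
      then show ?thesis unfolding 1(2) K_relations_def by simp
    next
      case 2
      have "flip (a *\<^sub>M h1 + b *\<^sub>M h2) = a *\<^sub>M h1 + b *\<^sub>M h2" using flip_part[OF h_part] by (simp add: koszul_sign_def)
      then have "flip_words p = p" unfolding 2 by (simp add: linmap_diff[OF linmap_flip_words])
      then show ?thesis using assms by simp
    next
      case 3
      have "flip y2 = y2" using flip_part[OF y2_part] by (simp add: koszul_sign_def)
      then have "flip_words p = p" unfolding 3 by simp
      then show ?thesis using assms by simp
    qed
  qed
  then show ?thesis using sl.lgen_superset[OF K_relations_fa] by blast
qed

lemma presents_eval: "pc.presents (eval_module (K \<mu>) z) (fa sl12) (sl.ccls (K_relations \<mu>)) (sl.lgen (K_relations \<mu>))"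
  using sl.presents_cyc[OF K_relations_fa] unfolding K_cyc[symmetric] pc.presents_def eval_module_def by simp

lemma K_part: "part (eval_module (K \<mu>) z) d = sl.ccls (K_relations \<mu>) ` {p. keys p \<subseteq> homogeneous_words sl12 d}"
  by (simp add: eval_module_def K_cyc sl.cyc_def quotient_def UEA_def free_algebra_def sl.ccls_def ucls_def image_image)

lemma K_flip_stable:
  "\<exists>\<pi> T. flip_stable (K_relations \<mu>) \<pi> T (eval_module (K \<mu>) z) (sl.ccls (K_relations \<mu>))"
proof -
  have ex: "\<exists>\<pi> (T :: mat3 \<Rightarrow> (mat3 list \<Rightarrow>\<^sub>0 complex) \<Rightarrow> (mat3 list \<Rightarrow>\<^sub>0 complex)).
    linmap pscale pscale \<pi> \<and> (\<forall>a. \<pi> a = 0 \<longleftrightarrow> a \<in> sl.lgen (K_relations \<mu>)) \<and> is_rep sl12 pscale T \<and>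
    (\<forall>p\<in>fa sl12. pc.action T p (\<pi> (gen [])) = \<pi> p)"
    by (rule sl.cyclic_representation[OF sl.lgen_subspace sl.UEA_ideal_lgen sl.lgen_subset]) (rule sl.lgen_word_mult)
  obtain \<pi> and T :: "mat3 \<Rightarrow> (mat3 list \<Rightarrow>\<^sub>0 complex) \<Rightarrow> (mat3 list \<Rightarrow>\<^sub>0 complex)" where
    *: "linmap pscale pscale \<pi> \<and> (\<forall>a. \<pi> a = 0 \<longleftrightarrow> a \<in> sl.lgen (K_relations \<mu>)) \<and> is_rep sl12 pscale T \<and>
    (\<forall>p\<in>fa sl12. pc.action T p (\<pi> (gen [])) = \<pi> p)"
    using ex by (elim exE)
  have "flip_stable (K_relations \<mu>) \<pi> T (eval_module (K \<mu>) z) (sl.ccls (K_relations \<mu>))"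
  proof (rule flip_stable.intro)
    show "linmap pscale pscale \<pi>" "is_rep sl12 pscale T" using * by blast+
    show "\<pi> a = 0 \<longleftrightarrow> a \<in> sl.lgen (K_relations \<mu>)" for a using * by blast
    show "pc.action T p (\<pi> (gen [])) = \<pi> p" if "p \<in> fa sl12" for p using * that by blast
  qed (rule K_relations_fa presents_eval K_part | erule K_relations_flip)+
  then show ?thesis by blast
qed

lemma eval_act:
  assumes g: "g \<in> carrier sl12_t" and a: "a \<in> fa sl12"
  shows "act (eval_module (K \<mu>) z) g (sl.ccls (K_relations \<mu>) a) = sl.ccls (K_relations \<mu>) (word_mult (gen [evaluate z g]) a)"
proof -
  obtain \<pi> T where "flip_stable (K_relations \<mu>) \<pi> T (eval_module (K \<mu>) z) (sl.ccls (K_relations \<mu>))" using K_flip_stable by blast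
  then interpret flip_stable "K_relations \<mu>" \<pi> T "eval_module (K \<mu>) z" "sl.ccls (K_relations \<mu>)" .
  note KP = sl.presents_cyc[OF K_relations_fa, of \<mu>, folded K_cyc]
  have gm: "lookup g m \<in> carrier sl12" for m using g unfolding carrier_sl12_t by blast
  have gg: "gen [lookup g m] \<in> fa sl12" for m using gm by simp
  have wm: "word_mult (gen [lookup g m]) a \<in> fa sl12" for m by (rule fa_word_mult[OF gg a])
  define f where "f m = pscale (z ^ m) (word_mult (gen [lookup g m]) a)" for m
  have f: "f m \<in> fa sl12" for m unfolding f_def by (rule pscale.subspace_scale[OF fa_subspace wm])
  have eq: "z ^ m \<odot>\<^bsub>K \<mu>\<^esub> act (K \<mu>) (lookup g m) (sl.ccls (K_relations \<mu>) a) = sl.ccls (K_relations \<mu>) (f m)" for m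
    unfolding f_def
    using sl.act_cyc[OF K_relations_fa gm a, of \<mu>, folded K_cyc] pc.presentsD(7)[OF KP wm] by simp
  have "act (eval_module (K \<mu>) z) g (sl.ccls (K_relations \<mu>) a) = (\<Oplus>\<^bsub>K \<mu>\<^esub>m\<in>keys g. sl.ccls (K_relations \<mu>) (f m))"
    by (simp add: eval_module_def eq)
  also have "\<dots> = sl.ccls (K_relations \<mu>) (\<Sum>m\<in>keys g. f m)"
    by (rule pc.presents_finsum[OF KP finite_keys f])
  also have "\<dots> = sl.ccls (K_relations \<mu>) (word_mult (gen [evaluate z g]) a)"
  proof -
    have e: "evaluate z g \<in> carrier sl12" by (rule evaluate_carrier[OF g])
    have T0: "T 0 b = 0" for b using is_repD(3)[OF rep carrier_sl12_closed(1), of 0 b] by simp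
    have "T (\<Sum>m\<in>I. z ^ m *\<^sub>M lookup g m) b = (\<Sum>m\<in>I. pscale (z ^ m) (T (lookup g m) b))" if "finite I" for I b
      using that
    proof induction
      case (insert m I)
      have c: "z ^ m *\<^sub>M lookup g m \<in> carrier sl12" for m by (rule carrier_sl12_closed(3)[OF gm])
      have "(\<Sum>m\<in>I. z ^ m *\<^sub>M lookup g m) \<in> carrier sl12" by (rule sum_carrier_sl12) (rule c)
      from is_repD(2)[OF rep c this] insert is_repD(3)[OF rep gm] show ?case by simp
    qed (simp add: T0)
    from this[OF finite_keys, of g "\<pi> a"]
    have "\<pi> (\<Sum>m\<in>keys g. f m) = T (evaluate z g) (\<pi> a)"
      unfolding evaluate_def linmap_sum[OF pi_linear] f_def pi_scale pi_word[OF gm a] by simp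
    also have "\<dots> = \<pi> (word_mult (gen [evaluate z g]) a)" by (rule pi_word[OF e a, symmetric])
    finally have eq: "\<pi> (\<Sum>m\<in>keys g. f m) = \<pi> (word_mult (gen [evaluate z g]) a)" .
    have s: "(\<Sum>m\<in>keys g. f m) \<in> fa sl12" by (rule pscale.subspace_sum[OF fa_subspace f])
    have w: "word_mult (gen [evaluate z g]) a \<in> fa sl12" by (rule fa_word_mult[OF _ a]) (use e in simp)
    show ?thesis using \<phi>_eq[OF s w] eq by blast
  qed
  finally show ?thesis .
qed

lemma eval_twist:
  "a \<in> fa sl12 ==> parity_twist (eval_module (K \<mu>) z) d (sl.ccls (K_relations \<mu>) a) = sl.ccls (K_relations \<mu>) (if d = 0 then a else flip_words a)"
  using K_flip_stable[of \<mu> z] flip_stable.twist_cls by blast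

lemma super_rep_eval: "super_rep sl12_t (eval_module (K \<mu>) z)"
proof -
  obtain \<pi> T where "flip_stable (K_relations \<mu>) \<pi> T (eval_module (K \<mu>) z) (sl.ccls (K_relations \<mu>))" using K_flip_stable by blast
  then interpret flip_stable "K_relations \<mu>" \<pi> T "eval_module (K \<mu>) z" "sl.ccls (K_relations \<mu>)" .
  define V where "V = eval_module (K \<mu>) z"
  define \<phi> where "\<phi> = sl.ccls (K_relations \<mu>)"
  define tw where "tw d a = (if d = 0 then a else flip_words a)" for d :: bit and a
  note WD = pc.presentsD[OF W, folded V_def \<phi>_def]
  note cl = pscale.subspace_add[OF fa_subspace[of sl12]] pscale.subspace_scale[OF fa_subspace[of sl12]]
  have act: "act V g (\<phi> a) = \<phi> (word_mult (gen [evaluate z g]) a)" if "g \<in> carrier sl12_t" "a \<in> fa sl12" for g a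
    unfolding V_def \<phi>_def by (rule eval_act[OF that])
  have twist: "parity_twist V d (\<phi> a) = \<phi> (tw d a)" if "a \<in> fa sl12" for d a
    unfolding V_def \<phi>_def tw_def by (rule eval_twist[OF that])
  have tw: "tw d a \<in> fa sl12" if "a \<in> fa sl12" for d a unfolding tw_def using that flip_words_fa[OF that] by simp
  have wm: "word_mult (gen [evaluate z g]) a \<in> fa sl12" if "g \<in> carrier sl12_t" "a \<in> fa sl12" for g a
    by (rule fa_word_mult[OF _ that(2)]) (use evaluate_carrier[OF that(1)] in simp)
  have eqI: "\<phi> a = \<phi> b" if "a \<in> fa sl12" "b \<in> fa sl12" "\<pi> a = \<pi> b" for a b
    using \<phi>_eq[OF that(1,2)] that(3) unfolding \<phi>_def by blast
  have cE: "\<exists>a\<in>fa sl12. u = \<phi> a" if "u \<in> carrier V" for u using that WD(4) by blast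
  have cI: "\<phi> a \<in> carrier V" if "a \<in> fa sl12" for a using that WD(4) by blast
  have ts: "tw d (a + b) = tw d a + tw d b" "tw d (pscale c a) = pscale c (tw d a)" for d a b c
    unfolding tw_def by (simp_all add: linmap_add[OF linmap_flip_words] linmap_scale[OF linmap_flip_words])
  have pw: "\<pi> (word_mult (gen [evaluate z g]) a) = T (evaluate z g) (\<pi> a)" if "g \<in> carrier sl12_t" "a \<in> fa sl12" for g a
    by (rule pi_word[OF evaluate_carrier[OF that(1)] that(2)])
  have "super_rep sl12_t V"
  proof
    fix u v c d e x x' assume "u \<in> carrier V"
    then obtain a where u: "u = \<phi> a" and a: "a \<in> fa sl12" using cE by blast
    show "c \<odot>\<^bsub>V\<^esub> u \<in> carrier V" unfolding u WD(7)[OF a] by (rule cI[OF cl(2)[OF a]])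
    show "parity_twist V d u \<in> carrier V" unfolding u twist[OF a] by (rule cI[OF tw[OF a]])
    show "parity_twist V d (c \<odot>\<^bsub>V\<^esub> u) = c \<odot>\<^bsub>V\<^esub> parity_twist V d u"
      unfolding u WD(7)[OF a] twist[OF a] twist[OF cl(2)[OF a]] WD(7)[OF tw[OF a]] ts ..
    show "parity_twist V d (parity_twist V e u) = parity_twist V (d + e) u"
      unfolding u twist[OF a] twist[OF tw[OF a]]
      by (cases d rule: bit_exhaust; cases e rule: bit_exhaust) (simp_all add: tw_def flip_words_twice)
    { assume "v \<in> carrier V"
      then obtain b where v: "v = \<phi> b" and b: "b \<in> fa sl12" using cE by blast
      show "u \<oplus>\<^bsub>V\<^esub> v \<in> carrier V" unfolding u v WD(6)[OF a b] by (rule cI[OF cl(1)[OF a b]])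
      show "parity_twist V d (u \<oplus>\<^bsub>V\<^esub> v) = parity_twist V d u \<oplus>\<^bsub>V\<^esub> parity_twist V d v"
        unfolding u v WD(6)[OF a b] twist[OF a] twist[OF b] twist[OF cl(1)[OF a b]] WD(6)[OF tw[OF a] tw[OF b]] ts ..
      assume x: "x \<in> carrier sl12_t"
      show "act V x (u \<oplus>\<^bsub>V\<^esub> v) = act V x u \<oplus>\<^bsub>V\<^esub> act V x v"
        unfolding u v WD(6)[OF a b] act[OF x a] act[OF x b] act[OF x cl(1)[OF a b]] WD(6)[OF wm[OF x a] wm[OF x b]] word_mult_add_right .. }
    { assume x: "x \<in> carrier sl12_t"
      note e = evaluate_carrier[OF x, of z]
      show "act V x u \<in> carrier V" unfolding u act[OF x a] by (rule cI[OF wm[OF x a]])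
      show "act V x (c \<odot>\<^bsub>V\<^esub> u) = c \<odot>\<^bsub>V\<^esub> act V x u"
        unfolding u WD(7)[OF a] act[OF x a] act[OF x cl(2)[OF a]] WD(7)[OF wm[OF x a]] word_mult_scale_right ..
      show "act V (c \<odot>\<^bsub>sl12_t\<^esub> x) u = c \<odot>\<^bsub>V\<^esub> act V x u"
        unfolding u act[OF x a] act[OF slt.smult_closed[OF x] a] WD(7)[OF wm[OF x a]]
      proof (rule eqI[OF wm[OF slt.smult_closed[OF x] a] cl(2)[OF wm[OF x a]]])
        show "\<pi> (word_mult (gen [evaluate z (c \<odot>\<^bsub>sl12_t\<^esub> x)]) a) = \<pi> (pscale c (word_mult (gen [evaluate z x]) a))"
          unfolding pw[OF slt.smult_closed[OF x] a] pi_scale pw[OF x a]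
          unfolding evaluate_smult using is_repD(3)[OF rep e] by simp
      qed
      assume x': "x' \<in> carrier sl12_t"
      show "act V (x \<oplus>\<^bsub>sl12_t\<^esub> x') u = act V x u \<oplus>\<^bsub>V\<^esub> act V x' u"
        unfolding u act[OF x a] act[OF x' a] act[OF slt.add_closed[OF x x'] a] WD(6)[OF wm[OF x a] wm[OF x' a]]
      proof (rule eqI[OF wm[OF slt.add_closed[OF x x'] a] cl(1)[OF wm[OF x a] wm[OF x' a]]])
        show "\<pi> (word_mult (gen [evaluate z (x \<oplus>\<^bsub>sl12_t\<^esub> x')]) a) = \<pi> (word_mult (gen [evaluate z x]) a + word_mult (gen [evaluate z x']) a)"
          unfolding pw[OF slt.add_closed[OF x x'] a] pi_add pw[OF x a] pw[OF x' a]
          unfolding add_sl12_t evaluate_add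
          using is_repD(2)[OF rep e evaluate_carrier[OF x', of z]] by simp
      qed }
    { assume x: "x \<in> part sl12_t e"
      note xc = part_carrier_sl12_t[OF x]
      show "parity_twist V d (act V x u) = koszul_sign d e \<odot>\<^bsub>V\<^esub> act V x (parity_twist V d u)"
        unfolding u act[OF xc a] twist[OF a] twist[OF wm[OF xc a]] act[OF xc tw[OF a]] WD(7)[OF wm[OF xc tw[OF a]]]
      proof (rule eqI[OF tw[OF wm[OF xc a]] cl(2)[OF wm[OF xc tw[OF a]]]])
        show "\<pi> (tw d (word_mult (gen [evaluate z x]) a)) = \<pi> (pscale (koszul_sign d e) (word_mult (gen [evaluate z x]) (tw d a)))"
        proof (cases d rule: bit_exhaust)
          case 1
          then show ?thesis by (simp add: tw_def koszul_sign_def)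
        next
          case 2
          have "\<pi> (flip_words (word_mult (gen [evaluate z x]) a)) = T (flip (evaluate z x)) (\<pi> (flip_words a))"
            unfolding flip_words_mult list.map by (rule pi_word[OF flip_carrier[OF evaluate_carrier[OF xc]] flip_words_fa[OF a]])
          also have "\<dots> = pscale (koszul_sign 1 e) (T (evaluate z x) (\<pi> (flip_words a)))"
            unfolding flip_part[OF evaluate_part[OF x]] smult_sl12[symmetric] by (rule is_repD(3)[OF rep evaluate_carrier[OF xc]])
          finally show ?thesis using 2 by (simp add: tw_def pi_scale pw[OF xc flip_words_fa[OF a]])
        qed
      qed }
    { assume x: "x \<in> part sl12_t d" and x': "x' \<in> part sl12_t e"
      note xc = part_carrier_sl12_t[OF x] and xc' = part_carrier_sl12_t[OF x']
      have br: "bracket sl12_t x x' \<in> carrier sl12_t" by (rule slt.bracket_closed[OF x x'])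
      note w1 = wm[OF xc a] and w2 = wm[OF xc' a] and w3 = wm[OF br a]
      note w4 = wm[OF xc w2] and w5 = wm[OF xc' w1]
      show "act V x (act V x' u) = (koszul_sign d e \<odot>\<^bsub>V\<^esub> act V x' (act V x u)) \<oplus>\<^bsub>V\<^esub> act V (bracket sl12_t x x') u"
        unfolding u act[OF xc a] act[OF xc' a] act[OF br a] act[OF xc w2] act[OF xc' w1] WD(7)[OF w5] WD(6)[OF cl(2)[OF w5] w3]
      proof (rule eqI[OF w4 cl(1)[OF cl(2)[OF w5] w3]])
        show "\<pi> (word_mult (gen [evaluate z x]) (word_mult (gen [evaluate z x']) a)) =
          \<pi> (pscale (koszul_sign d e) (word_mult (gen [evaluate z x']) (word_mult (gen [evaluate z x]) a)) + word_mult (gen [evaluate z (bracket sl12_t x x')]) a)"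
          unfolding pi_add pi_scale pw[OF xc w2] pw[OF xc' w1] pw[OF br a] pw[OF xc a] pw[OF xc' a]
          unfolding evaluate_bracket[OF x x'] is_repD(4)[OF rep evaluate_part[OF x] evaluate_part[OF x']] by simp
      qed }
  qed
  then show ?thesis unfolding V_def .
qed

section \<open>Associated graded modules\<close>

text \<open>
  Words whose letters are monomials in \<open>t\<close>, of total degree \<open>d\<close>.
\<close>

definition graded_words :: "nat \<Rightarrow> (nat \<Rightarrow>\<^sub>0 mat3) list set" where
  "graded_words d = {map (\<lambda>(m, x). single m x) ps | ps.
    snd ` set ps \<subseteq> carrier sl12 \<and> sum_list (map fst ps) = d}"

lemma graded_words_Nil: "[] \<in> graded_words 0"
proof -
  have "snd ` set ([] :: (nat \<times> mat3) list) \<subseteq> carrier sl12 \<and> sum_list (map fst ([] :: (nat \<times> mat3) list)) = 0" by simp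
  then show ?thesis unfolding graded_words_def mem_Collect_eq by (intro exI[of _ "[]"]) simp
qed

lemma graded_words_Cons:
  assumes "x \<in> carrier sl12" "w \<in> graded_words d"
  shows "single m x # w \<in> graded_words (m + d)"
proof -
  obtain ps where "w = map (\<lambda>(m, x). single m x) ps" "snd ` set ps \<subseteq> carrier sl12" "sum_list (map fst ps) = d"
    using assms(2) unfolding graded_words_def by blast
  then show ?thesis using assms(1) unfolding graded_words_def mem_Collect_eq by (intro exI[of _ "(m, x) # ps"]) simp
qed

lemma graded_words_induct [consumes 1, case_names Nil Cons]:
  assumes "w \<in> graded_words d" and "Q [] 0"
    and "\<And>m x w d. x \<in> carrier sl12 ==> w \<in> graded_words d ==> Q w d ==> Q (single m x # w) (m + d)"
  shows "Q w d"
proof -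
  define f where "f = (\<lambda>(m, x :: mat3). single (m::nat) x)"
  obtain ps where ps: "w = map f ps" "snd ` set ps \<subseteq> carrier sl12" "sum_list (map fst ps) = d"
    using assms(1) unfolding graded_words_def f_def by blast
  have "Q (map f ps) (sum_list (map fst ps))" using ps(2)
  proof (induction ps)
    case (Cons a ps)
    have "map f ps \<in> graded_words (sum_list (map fst ps))" using Cons.prems unfolding graded_words_def f_def by auto
    obtain m x where a: "a = (m, x)" by (cases a)
    have fa: "f a = single m x" by (simp add: a f_def)
    have IH: "Q (map f ps) (sum_list (map fst ps))" and x: "x \<in> carrier sl12" using Cons a by auto
    show ?case using assms(3)[OF x \<open>map f ps \<in> _\<close> IH, of m] by (simp add: fa[unfolded a] a)
  qed (simp add: assms(2))
  then show ?thesis using ps by simp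
qed

lemma graded_words_lists: "w \<in> graded_words d ==> w \<in> lists (carrier sl12_t)"
  by (induction rule: graded_words_induct) (auto intro: single_carrier)

lemma UEA_degree_graded_words: "UEA_degree s = ucls sl12_t ` {p. keys p \<subseteq> graded_words s}"
  unfolding UEA_degree_def ucls_def graded_words_def ..

lemma sum_apply: "(sum f I) n = (\<Sum>i\<in>I. f i n)"
  by (induction I rule: infinite_finite_induct) auto

lemma (in cspace) sequence_cspace: "cspace (\<lambda>c (f :: nat \<Rightarrow> 'v) n. sc c (f n))"
  unfolding cspace_def
  by unfold_locales (simp_all add: fun_eq_iff scale_right_distrib scale_left_distrib)

locale sl12_rep = cspace sc for sc :: "complex \<Rightarrow> 'v::ab_group_add \<Rightarrow> 'v" +
  fixes T :: "(nat \<Rightarrow>\<^sub>0 mat3) \<Rightarrow> 'v \<Rightarrow> 'v" and v :: 'v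
  assumes rep: "is_rep sl12_t sc T"
begin

definition seq_scale :: "complex \<Rightarrow> (nat \<Rightarrow> 'v) \<Rightarrow> nat \<Rightarrow> 'v" where "seq_scale c f = (\<lambda>n. sc c (f n))"

lemma seq_cspace: "cspace seq_scale"
  using sequence_cspace unfolding seq_scale_def[abs_def] .

sublocale sq: cspace seq_scale by (rule seq_cspace)

text \<open>
  The representation on sequences of vectors: an element of degree \<open>r\<close> acts by
  \<open>T\<close> and shifts the index by \<open>r\<close>. It separates the degrees that
  \<open>T\<close> alone mixes, and it is an exact representation, whereas the associated graded
  module is one of its subquotients.
\<close>

definition shift :: "(nat \<Rightarrow>\<^sub>0 mat3) \<Rightarrow> (nat \<Rightarrow> 'v) \<Rightarrow> nat \<Rightarrow> 'v" where
  "shift g f = (\<lambda>n. \<Sum>r\<le>n. T (single r (lookup g r)) (f (n - r)))"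

lemma lin: "A \<in> carrier sl12 ==> linmap sc sc (T (single m A))"
  by (rule is_repD(1)[OF rep single_carrier])

lemma coeff_carrier: "g \<in> carrier sl12_t ==> lookup g m \<in> carrier sl12"
  unfolding carrier_sl12_t by blast

lemma shift_linear: "g \<in> carrier sl12_t ==> linmap seq_scale seq_scale (shift g)"
  by (rule linmapI) (simp_all add: shift_def seq_scale_def fun_eq_iff linmap_add[OF lin] linmap_scale[OF lin] coeff_carrier
      sum.distrib scale_sum_right)

lemma shift_single:
  assumes "A \<in> carrier sl12"
  shows "shift (single m A) f n = (if m \<le> n then T (single m A) (f (n - m)) else 0)"
proof -
  have "T (single r (lookup (single m A) r)) (f (n - r)) =
      (if r = m then T (single m A) (f (n - m)) else 0)" for r
    by (simp add: lookup_single when_def rep_zero[OF rep])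
  then show ?thesis unfolding shift_def by simp
qed

lemma shift_add: "g \<in> carrier sl12_t ==> g' \<in> carrier sl12_t ==> shift (g + g') f = shift g f + shift g' f"
  by (simp add: shift_def fun_eq_iff lookup_add rep_single_linear(1)[OF rep] coeff_carrier sum.distrib)

lemma shift_smult: "g \<in> carrier sl12_t ==> shift (c \<odot>\<^bsub>sl12_t\<^esub> g) f = seq_scale c (shift g f)"
  by (simp add: shift_def seq_scale_def fun_eq_iff rep_single_linear(2)[OF rep] coeff_carrier scale_sum_right)

lemma shift_zero: "shift 0 f = 0"
  by (simp add: shift_def fun_eq_iff rep_zero[OF rep])

lemma shift_sum: "(\<And>i. i \<in> I ==> h i \<in> carrier sl12_t) ==> shift (sum h I) f = (\<Sum>i\<in>I. shift (h i) f) \<and> sum h I \<in> carrier sl12_t"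
proof (induction I rule: infinite_finite_induct)
  case (insert i I)
  then show ?case using slt.add_closed[of "h i" "sum h I"] by (simp add: shift_add)
qed (simp_all add: shift_zero carrier_sl12_t carrier_sl12_closed)

lemma shift_bracket_single:
  assumes "A \<in> part sl12 d" "B \<in> part sl12 e"
  shows "shift (single (m + n) (bracket sl12 A B)) f =
    shift (single m A) (shift (single n B) f)
    - seq_scale (koszul_sign d e) (shift (single n B) (shift (single m A) f))"
proof
  fix k
  note c = part_carrier_sl12[OF assms(1)] part_carrier_sl12[OF assms(2)] part_carrier_sl12[OF bracket_sl12_closed[OF assms]]
  have "n \<le> k - m \<longleftrightarrow> m + n \<le> k" "m \<le> k - n \<longleftrightarrow> m + n \<le> k" if "m \<le> k" "n \<le> k" using that by auto
  moreover have "k - m - n = k - (m + n)" "k - n - m = k - (m + n)" by auto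
  moreover have "m + n \<le> k ==> m \<le> k \<and> n \<le> k" "\<not> n \<le> k ==> \<not> n \<le> k - m" "\<not> m \<le> k ==> \<not> m \<le> k - n" by auto
  ultimately show "shift (single (m + n) (bracket sl12 A B)) f k =
    (shift (single m A) (shift (single n B) f)
    - seq_scale (koszul_sign d e) (shift (single n B) (shift (single m A) f))) k"
    unfolding minus_apply seq_scale_def shift_single[OF c(1)] shift_single[OF c(2)] shift_single[OF c(3)]
    using rep_bracket[OF rep assms, of m n "f (k - (m + n))"]
    by (cases "m + n \<le> k"; cases "m \<le> k"; cases "n \<le> k")
      (simp_all add: linmap_zero[OF lin[OF c(1)]] linmap_zero[OF lin[OF c(2)]])
qed

lemma shift_singles: "g \<in> carrier sl12_t ==> shift g f = (\<Sum>m\<in>keys g. shift (single m (lookup g m)) f)"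
  using shift_sum[of "keys g" "\<lambda>m. single m (lookup g m)" f]
  unfolding sum_singles by (simp add: single_carrier coeff_carrier)

lemma shift_bracket:
  assumes g: "g \<in> part sl12_t d" and g': "g' \<in> part sl12_t e"
  shows "shift (bracket sl12_t g g') f = shift g (shift g' f) - seq_scale (koszul_sign d e) (shift g' (shift g f))"
proof -
  define a b where "a m = lookup g m" and "b n = lookup g' n" for m n
  have ab: "a m \<in> part sl12 d" "b n \<in> part sl12 e" for m n
    using g g' unfolding a_def b_def part_sl12_t by blast+
  note ac = ab[THEN part_carrier_sl12]
  define I J where "I = keys g" and "J = keys g'"
  define SA SB where "SA m = shift (single m (a m))" and "SB n = shift (single n (b n))" for m n
  have gs: "shift g h = (\<Sum>m\<in>I. SA m h)" and gs': "shift g' h = (\<Sum>n\<in>J. SB n h)" for h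
    unfolding SA_def SB_def a_def b_def I_def J_def by (rule shift_singles part_carrier_sl12_t g g')+
  have lA: "linmap seq_scale seq_scale (SA m)" and lB: "linmap seq_scale seq_scale (SB n)" for m n
    unfolding SA_def SB_def by (rule shift_linear single_carrier ac)+
  have c: "single (m + n) (bracket sl12 (a m) (b n)) \<in> carrier sl12_t" for m n
    by (rule single_carrier[OF part_carrier_sl12[OF bracket_sl12_closed[OF ab]]])
  have "bracket sl12_t g g' = (\<Sum>m\<in>I. \<Sum>n\<in>J. single (m + n) (bracket sl12 (a m) (b n)))"
    by (simp add: sl12_t_def a_def b_def I_def J_def)
  then have "shift (bracket sl12_t g g') f = (\<Sum>m\<in>I. \<Sum>n\<in>J. shift (single (m + n) (bracket sl12 (a m) (b n))) f)"
    using shift_sum[of J, OF c] shift_sum[of I "\<lambda>m. \<Sum>n\<in>J. single (m + n) (bracket sl12 (a m) (b n))" f] by simp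
  also have "\<dots> = (\<Sum>m\<in>I. \<Sum>n\<in>J. SA m (SB n f)) - seq_scale (koszul_sign d e) (\<Sum>m\<in>I. \<Sum>n\<in>J. SB n (SA m f))"
    unfolding shift_bracket_single[OF ab] SA_def SB_def by (simp only: sum_subtractf sq.scale_sum_right)
  also have "(\<Sum>m\<in>I. \<Sum>n\<in>J. SB n (SA m f)) = (\<Sum>n\<in>J. \<Sum>m\<in>I. SB n (SA m f))" by (rule sum.swap)
  also have "\<dots> = shift g' (shift g f)" unfolding gs gs' linmap_sum[OF lB] ..
  also have "(\<Sum>m\<in>I. \<Sum>n\<in>J. SA m (SB n f)) = shift g (shift g' f)" unfolding gs gs' linmap_sum[OF lA] ..
  finally show ?thesis .
qed

lemma shift_rep: "is_rep sl12_t seq_scale shift"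
  unfolding is_rep_def by (simp add: shift_linear shift_add shift_smult shift_bracket)

definition filt :: "nat \<Rightarrow> 'v set" where "filt n = span {foldr T w v | w d. d \<le> n \<and> w \<in> graded_words d}"

definition filt_pred :: "nat \<Rightarrow> 'v set" where "filt_pred n = (case n of 0 \<Rightarrow> {0} | Suc k \<Rightarrow> filt k)"

text \<open>
  The part of degree \<open>n\<close> of \<open>p\<close>, applied to \<open>v\<close>.
\<close>

definition comps :: "((nat \<Rightarrow>\<^sub>0 mat3) list \<Rightarrow>\<^sub>0 complex) \<Rightarrow> nat \<Rightarrow> 'v" where
  "comps p = sq.action shift p (\<lambda>n. if n = 0 then v else 0)"

lemma filt_subspace: "subspace (filt n)"
  unfolding filt_def by (rule subspace_span)

lemma filt_pred_subspace: "subspace (filt_pred n)"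
  unfolding filt_pred_def by (cases n) (simp_all add: filt_subspace subspace_single_0)

lemma filt_base: "w \<in> graded_words d ==> d \<le> n ==> foldr T w v \<in> filt n"
  unfolding filt_def by (rule span_base) blast

lemma filt_mono: "m \<le> n ==> filt m \<subseteq> filt n"
  unfolding filt_def by (rule span_mono) (use le_trans in blast)

lemma filt_pred_mono: "m < n ==> filt m \<subseteq> filt_pred n"
  unfolding filt_pred_def by (cases n) (simp_all add: filt_mono)

lemma filt_pred_subset: "filt_pred n \<subseteq> filt n"
  unfolding filt_pred_def by (cases n) (simp_all add: filt_mono subspace_0[OF filt_subspace])

lemma filt_step:
  assumes A: "A \<in> carrier sl12" and a: "a \<in> filt n"
  shows "T (single m A) a \<in> filt (m + n)"
  unfolding filt_def
proof (rule linmap_span_subset[OF lin[OF A] _ a[unfolded filt_def]])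
  fix b assume "b \<in> {foldr T w v | w d. d \<le> n \<and> w \<in> graded_words d}"
  then obtain w d where w: "b = foldr T w v" "d \<le> n" "w \<in> graded_words d" by blast
  have "foldr T (single m A # w) v \<in> filt (m + n)"
    by (rule filt_base[OF graded_words_Cons[OF A w(3)]]) (use w(2) in simp)
  then show "T (single m A) b \<in> span {foldr T w v | w d. d \<le> m + n \<and> w \<in> graded_words d}"
    unfolding filt_def w(1) by simp
qed

lemma filt_pred_step:
  assumes A: "A \<in> carrier sl12" and a: "a \<in> filt_pred n"
  shows "T (single m A) a \<in> filt_pred (m + n)"
proof (cases n)
  case 0
  then have "T (single m A) a = 0" using a linmap_zero[OF lin[OF A]] by (simp add: filt_pred_def)
  then show ?thesis using subspace_0[OF filt_pred_subspace] by simp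
next
  case (Suc k)
  then show ?thesis using filt_step[OF A, of a k m] a by (simp add: filt_pred_def)
qed

lemma shift_filt: "g \<in> carrier sl12_t ==> (\<And>n. f n \<in> filt n) ==> shift g f n \<in> filt n"
  unfolding shift_def
proof (rule subspace_sum[OF filt_subspace])
  fix r assume "g \<in> carrier sl12_t" "\<And>n. f n \<in> filt n" "r \<in> {..n}"
  then show "T (single r (lookup g r)) (f (n - r)) \<in> filt n"
    using filt_step[OF coeff_carrier, of g "f (n - r)" "n - r" r r] by simp
qed

lemma shift_filt_pred: "g \<in> carrier sl12_t ==> (\<And>n. f n \<in> filt_pred n) ==> shift g f n \<in> filt_pred n"
  unfolding shift_def
proof (rule subspace_sum[OF filt_pred_subspace])
  fix r assume "g \<in> carrier sl12_t" "\<And>n. f n \<in> filt_pred n" "r \<in> {..n}"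
  then show "T (single r (lookup g r)) (f (n - r)) \<in> filt_pred n"
    using filt_pred_step[OF coeff_carrier, of g "f (n - r)" "n - r" r r] by simp
qed

lemma shift_support:
  assumes "g \<in> carrier sl12_t" "finite {n. f n \<noteq> 0}"
  shows "finite {n. shift g f n \<noteq> 0}"
proof (rule finite_subset)
  show "{n. shift g f n \<noteq> 0} \<subseteq> (\<Union>r\<in>keys g. (+) r ` {n. f n \<noteq> 0})"
  proof (rule subsetI, rule ccontr)
    fix n assume n: "n \<in> {n. shift g f n \<noteq> 0}" "n \<notin> (\<Union>r\<in>keys g. (+) r ` {n. f n \<noteq> 0})"
    have "T (single r (lookup g r)) (f (n - r)) = 0" if "r \<le> n" for r
    proof (cases "r \<in> keys g")
      case True
      have "f (n - r) = 0"
      proof (rule ccontr)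
        assume "f (n - r) \<noteq> 0"
        then have "r + (n - r) \<in> (+) r ` {n. f n \<noteq> 0}" by blast
        then show False using True n(2) that by auto
      qed
      then show ?thesis using linmap_zero[OF lin[OF coeff_carrier[OF assms(1)]]] by simp
    next
      case False
      then show ?thesis using rep_zero[OF rep] by (simp add: in_keys_iff)
    qed
    then have "shift g f n = 0" unfolding shift_def by simp
    then show False using n(1) by simp
  qed
qed (use assms(2) in simp)

lemma linmap_comps: "linmap pscale seq_scale comps"
  unfolding comps_def[abs_def] by (rule sq.linmap_action)

lemma comps_add: "comps (p + q) n = comps p n + comps q n" and comps_scale: "comps (pscale c p) n = sc c (comps p n)"
  and comps_diff: "comps (p - q) n = comps p n - comps q n" and comps_zero: "comps 0 n = 0"
  and comps_sum: "comps (sum h I) n = (\<Sum>i\<in>I. comps (h i) n)"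
  using linmap_add[OF linmap_comps, of p q] linmap_scale[OF linmap_comps, of c p] linmap_diff[OF linmap_comps, of p q]
    linmap_zero[OF linmap_comps] linmap_sum[OF linmap_comps, of h I]
  by (simp_all add: seq_scale_def sum_apply)

lemma comps_gen: "comps (gen w) = foldr shift w (\<lambda>n. if n = 0 then v else 0)"
  unfolding comps_def sq.action_single by simp

lemma comps_word: "w \<in> graded_words d ==> comps (gen w) n = (if n = d then foldr T w v else 0)"
proof (induction arbitrary: n rule: graded_words_induct)
  case Nil
  then show ?case by (simp add: comps_gen)
next
  case (Cons m x w d)
  have "comps (gen (single m x # w)) n = shift (single m x) (comps (gen w)) n"
    by (simp add: comps_gen)
  then show ?case unfolding shift_single[OF Cons(1)] using Cons(3) linmap_zero[OF lin[OF Cons(1)]] by auto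
qed

lemma comps_mult:
  assumes "g \<in> carrier sl12_t" "p \<in> fa sl12_t"
  shows "comps (word_mult (gen [g]) p) = shift g (comps p)"
proof -
  have g: "gen [g] \<in> fa sl12_t" using assms by simp
  show ?thesis unfolding comps_def sq.action_word_mult[OF shift_rep g assms(2)] sq.action_single by simp
qed

lemma comps_filt:
  assumes "p \<in> fa sl12_t"
  shows "(\<forall>n. comps p n \<in> filt n) \<and> finite {n. comps p n \<noteq> 0}"
  using assms
proof (induction rule: fa_induct)
  case zero
  then show ?case by (simp add: comps_zero subspace_0[OF filt_subspace])
next
  case (add c w p)
  have "(\<forall>n. comps (gen w) n \<in> filt n) \<and> finite {n. comps (gen w) n \<noteq> 0}" using add(1)
  proof (induction w)
    case Nil
    have "v \<in> filt 0" using filt_base[OF graded_words_Nil, of 0] by simp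
    moreover have "{n. comps (gen []) n \<noteq> 0} \<subseteq> {0}" by (auto simp: comps_gen)
    ultimately show ?case using finite_subset subspace_0[OF filt_subspace] by (auto simp: comps_gen)
  next
    case (Cons g w)
    then have "comps (gen (g # w)) = shift g (comps (gen w))" by (simp add: comps_gen)
    then show ?case using Cons shift_filt[of g "comps (gen w)"] shift_support[of g "comps (gen w)"] by auto
  qed
  moreover have "{n. comps (pscale c (gen w) + p) n \<noteq> 0} \<subseteq> {n. comps (gen w) n \<noteq> 0} \<union> {n. comps p n \<noteq> 0}"
    unfolding comps_add comps_scale by auto
  ultimately show ?case
    using add(3) finite_subset[of "{n. comps (pscale c (gen w) + p) n \<noteq> 0}" "{n. comps (gen w) n \<noteq> 0} \<union> {n. comps p n \<noteq> 0}"]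
    unfolding comps_add comps_scale by (simp add: subspace_add[OF filt_subspace] subspace_scale[OF filt_subspace])
qed

lemma words_span:
  assumes "w \<in> lists (carrier sl12_t)"
  shows "foldr T w v \<in> span (\<Union>n. filt n)"
  using assms
proof (induction w)
  case Nil
  have "v \<in> filt 0" using filt_base[OF graded_words_Nil, of 0] by simp
  then show ?case by (auto intro: span_base)
next
  case (Cons g w)
  then have g: "g \<in> carrier sl12_t" by simp
  have "T g (foldr T w v) \<in> span (\<Union>n. filt n)"
    unfolding rep_sum_singles[OF rep g]
  proof (rule span_sum)
    fix m
    show "T (single m (lookup g m)) (foldr T w v) \<in> span (\<Union>n. filt n)"
    proof (rule linmap_span_subset[OF lin[OF coeff_carrier[OF g]]])
      show "foldr T w v \<in> span (\<Union>n. filt n)" using Cons by simp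
      fix a assume "a \<in> (\<Union>n. filt n)"
      then obtain n where "a \<in> filt n" by blast
      from filt_step[OF coeff_carrier[OF g] this, of m m] show "T (single m (lookup g m)) a \<in> span (\<Union>n. filt n)"
        by (intro span_base) blast
    qed
  qed
  then show ?case by simp
qed

text \<open>
  The sequences with terms in \<open>filt_pred\<close> form a submodule of the sequences with
  terms in \<open>filt\<close>; in the quotient the cyclic vector satisfies the relations
  \<open>P\<close>.
\<close>

lemma comps_kernel:
  assumes P: "P \<subseteq> fa sl12_t" and rel: "\<And>p n. p \<in> P ==> comps p n \<in> filt_pred n" and p: "p \<in> slt.lgen P"
  shows "comps p n \<in> filt_pred n"
proof -
  define S where "S = {f :: nat \<Rightarrow> 'v. \<forall>n. f n \<in> filt n}"
  define R where "R = {f :: nat \<Rightarrow> 'v. \<forall>n. f n \<in> filt_pred n}"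
  have S: "sq.subspace S"
    unfolding sq.subspace_def S_def seq_scale_def
    by (simp add: subspace_0[OF filt_subspace] subspace_add[OF filt_subspace] subspace_scale[OF filt_subspace])
  have R: "sq.subspace R" "R \<subseteq> S"
    unfolding sq.subspace_def R_def S_def seq_scale_def
    using filt_pred_subset by (auto simp: subspace_0[OF filt_pred_subspace] subspace_add[OF filt_pred_subspace] subspace_scale[OF filt_pred_subspace])
  note R0 = sq.subspace_0[OF R(1)]
  have shS: "shift x a \<in> S" if "x \<in> carrier sl12_t" "a \<in> S" for x a using shift_filt[OF that(1)] that(2) unfolding S_def by blast
  have shR: "shift x a \<in> R" if "x \<in> carrier sl12_t" "a \<in> R" for x a using shift_filt_pred[OF that(1)] that(2) unfolding R_def by blast
  obtain \<rho> T' where \<rho>: "linmap seq_scale seq_scale \<rho>" "\<And>a. \<rho> a = 0 \<longleftrightarrow> a \<in> R" and T': "is_rep sl12_t seq_scale T'"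
    and eq: "\<And>x a. x \<in> carrier sl12_t ==> a \<in> S ==> T' x (\<rho> a) = \<rho> (shift x a)"
  proof (rule sq.representation_on_quotient[of sl12_t S R shift])
    show "lie_closed sl12_t" by (rule lie_closed_sl12_t)
    show "shift (x \<oplus>\<^bsub>sl12_t\<^esub> x') a - shift x a - shift x' a \<in> R" if "x \<in> carrier sl12_t" "x' \<in> carrier sl12_t" for x x' a
      using R0 by (simp add: shift_add[OF that])
    show "shift (c \<odot>\<^bsub>sl12_t\<^esub> x) a - seq_scale c (shift x a) \<in> R" if "x \<in> carrier sl12_t" for c x a
      using R0 by (simp add: shift_smult[OF that])
    show "shift x (shift x' a) - seq_scale (koszul_sign d e) (shift x' (shift x a)) - shift (bracket sl12_t x x') a \<in> R"
      if "x \<in> part sl12_t d" "x' \<in> part sl12_t e" for x x' d e a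
      using R0 by (simp add: shift_bracket[OF that])
    fix \<rho> :: "(nat \<Rightarrow> 'v) \<Rightarrow> nat \<Rightarrow> 'v" and T'
    assume "linmap seq_scale seq_scale \<rho>" "\<And>a. \<rho> a = 0 \<longleftrightarrow> a \<in> R" "is_rep sl12_t seq_scale T'"
      "\<And>x a. x \<in> carrier sl12_t ==> a \<in> S ==> T' x (\<rho> a) = \<rho> (shift x a)"
    then show thesis by (rule that)
  qed (rule S R shift_linear shS shR; assumption)+
  define s :: "nat \<Rightarrow> 'v" where "s = (\<lambda>n. if n = 0 then v else 0)"
  have s: "s \<in> S" using filt_base[OF graded_words_Nil, of 0] unfolding S_def s_def by (simp add: subspace_0[OF filt_subspace])
  have word: "foldr T' w (\<rho> s) = \<rho> (foldr shift w s) \<and> foldr shift w s \<in> S" if "w \<in> lists (carrier sl12_t)" for w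
    using that by (induction w) (use s eq shS in auto)
  have act: "sq.action T' q (\<rho> s) = \<rho> (comps q)" if "q \<in> fa sl12_t" for q
  proof (rule linmap_pm_eqI[where f = "\<lambda>q. sq.action T' q (\<rho> s)" and g = "\<lambda>q. \<rho> (comps q)" and sc = seq_scale])
    show "linmap pscale seq_scale (\<lambda>q. sq.action T' q (\<rho> s))" by (rule sq.linmap_action)
    show "linmap pscale seq_scale (\<lambda>q. \<rho> (comps q))" by (rule linmap_comp[OF linmap_comps \<rho>(1)])
    fix w assume "w \<in> keys q"
    then have "w \<in> lists (carrier sl12_t)" using that by blast
    then show "sq.action T' (gen w) (\<rho> s) = \<rho> (comps (gen w))" using word unfolding sq.action_single comps_gen s_def by simp
  qed
  have "sq.action T' p (\<rho> s) = 0"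
  proof (rule slt.lgen_minimal[OF seq_cspace T' _ P p])
    fix q assume q: "q \<in> P"
    then have "comps q \<in> R" using rel unfolding R_def by blast
    moreover have "q \<in> fa sl12_t" using q P by blast
    ultimately show "sq.action T' q (\<rho> s) = 0" using act \<rho>(2) by simp
  qed
  moreover have "p \<in> fa sl12_t" using p slt.lgen_subset by blast
  ultimately have "comps p \<in> R" using act \<rho>(2) by simp
  then show ?thesis unfolding R_def by blast
qed

text \<open>
  A set \<open>F\<close> of at most \<open>N\<close> homogeneous words spans the module defined
  by \<open>P\<close>. Its image spans the representation, degree by degree with respect to the
  filtration, so by the lower bound it has \<open>N\<close> elements and is independent. An
  element of the kernel is a combination of \<open>F\<close> modulo the left ideal; its part of
  degree \<open>n\<close> lies in the span of the images of lower degree, so all its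
  coefficients are zero.
\<close>

lemma comps_kernel_converse:
  assumes P: "P \<subseteq> fa sl12_t" and rel: "\<And>p n. p \<in> P ==> comps p n \<in> filt_pred n"
    and upper: "\<And>T' u. is_rep sl12_t pscale T' ==> (\<And>p. p \<in> P ==> pc.action T' p u = 0) ==>
      \<exists>F. finite F \<and> card F \<le> N \<and> F \<subseteq> pc.homogeneous_orbit T' u \<and>
        (\<forall>w\<in>lists (carrier sl12_t). foldr T' w u \<in> pscale.span (F :: ((nat \<Rightarrow>\<^sub>0 mat3) list \<Rightarrow>\<^sub>0 complex) set))"
    and lower: "\<And>F. finite F ==> card F \<le> N ==> (\<forall>w\<in>lists (carrier sl12_t). foldr T w v \<in> span F) ==> N \<le> card F \<and> independent F"
    and p: "p \<in> fa sl12_t" "\<And>n. comps p n \<in> filt_pred n"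
  shows "p \<in> slt.lgen P"
proof -
  have ex: "\<exists>\<pi> (T' :: (nat \<Rightarrow>\<^sub>0 mat3) \<Rightarrow> ((nat \<Rightarrow>\<^sub>0 mat3) list \<Rightarrow>\<^sub>0 complex) \<Rightarrow> ((nat \<Rightarrow>\<^sub>0 mat3) list \<Rightarrow>\<^sub>0 complex)).
    linmap pscale pscale \<pi> \<and> (\<forall>a. \<pi> a = 0 \<longleftrightarrow> a \<in> slt.lgen P) \<and> is_rep sl12_t pscale T' \<and>
    (\<forall>p\<in>fa sl12_t. pc.action T' p (\<pi> (gen [])) = \<pi> p)"
    by (rule slt.cyclic_representation[OF slt.lgen_subspace slt.UEA_ideal_lgen slt.lgen_subset]) (rule slt.lgen_word_mult)
  obtain \<pi> and T' :: "(nat \<Rightarrow>\<^sub>0 mat3) \<Rightarrow> ((nat \<Rightarrow>\<^sub>0 mat3) list \<Rightarrow>\<^sub>0 complex) \<Rightarrow> ((nat \<Rightarrow>\<^sub>0 mat3) list \<Rightarrow>\<^sub>0 complex)"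
    where *: "linmap pscale pscale \<pi> \<and> (\<forall>a. \<pi> a = 0 \<longleftrightarrow> a \<in> slt.lgen P) \<and> is_rep sl12_t pscale T' \<and>
    (\<forall>p\<in>fa sl12_t. pc.action T' p (\<pi> (gen [])) = \<pi> p)" using ex by (elim exE)
  have \<pi>: "linmap pscale pscale \<pi>" and ker: "\<pi> a = 0 \<longleftrightarrow> a \<in> slt.lgen P" and rep': "is_rep sl12_t pscale T'"
    and act: "q \<in> fa sl12_t ==> pc.action T' q (\<pi> (gen [])) = \<pi> q" for a q using * by blast+
  define u where "u = \<pi> (gen [])"
  have "pc.action T' q u = 0" if "q \<in> P" for q
  proof -
    have "\<pi> q = 0" unfolding ker using slt.lgen_superset[OF P] that by blast
    then show ?thesis unfolding u_def using act[of q] P that by auto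
  qed
  from upper[OF rep' this] obtain F where F: "finite F" "card F \<le> N" "F \<subseteq> pc.homogeneous_orbit T' u"
    "\<And>w. w \<in> lists (carrier sl12_t) ==> foldr T' w u \<in> pscale.span F" by blast
  have "\<exists>wd. snd wd = snd wd \<and> f = foldr T' (fst wd) u \<and> fst wd \<in> graded_words (snd wd)" if "f \<in> F" for f
  proof -
    obtain ps where "f = foldr T' (map (\<lambda>(m, x). single m x) ps) u" "snd ` set ps \<subseteq> carrier sl12"
      using F(3) \<open>f \<in> F\<close> unfolding pc.homogeneous_orbit_def by blast
    then show ?thesis
      unfolding graded_words_def
      by (intro exI[of _ "(map (\<lambda>(m, x). single m x) ps, sum_list (map fst ps))"]) auto
  qed
  then obtain wd where wd: "\<And>f. f \<in> F ==> f = foldr T' (fst (wd f)) u \<and> fst (wd f) \<in> graded_words (snd (wd f))" by metis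
  define wf df e where "wf f = fst (wd f)" and "df f = snd (wd f)" and "e f = foldr T (wf f) v" for f
  have wf: "f = foldr T' (wf f) u" "wf f \<in> graded_words (df f)" if "f \<in> F" for f using wd[OF that] unfolding wf_def df_def by blast+
  have wfl: "gen (wf f) \<in> fa sl12_t" if "f \<in> F" for f using graded_words_lists[OF wf(2)[OF that]] by simp
  have \<pi>wf: "\<pi> (gen (wf f)) = f" if "f \<in> F" for f using act[OF wfl[OF that]] wf(1)[OF that] by (simp add: u_def)
  have reduce: "\<exists>c. q - (\<Sum>f\<in>F. pscale (c f) (gen (wf f))) \<in> slt.lgen P \<and>
      (\<forall>n. comps q n - (\<Sum>f\<in>F. if df f = n then sc (c f) (e f) else 0) \<in> filt_pred n)" if q: "q \<in> fa sl12_t" for q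
  proof -
    have "pc.action T' q u \<in> pscale.span F"
      unfolding pc.action_def by (rule pc.lift_in_subspace[OF pscale.subspace_span]) (use F(4) q in blast)
    then have "\<pi> q \<in> pscale.span F" unfolding u_def act[OF q] .
    then obtain c where c: "\<pi> q = (\<Sum>f\<in>F. pscale (c f) f)" unfolding pscale.span_finite[OF F(1)] by blast
    define r where "r = (\<Sum>f\<in>F. pscale (c f) (gen (wf f)))"
    have "\<pi> r = \<pi> q" unfolding c r_def linmap_sum[OF \<pi>] linmap_scale[OF \<pi>] by (rule sum.cong) (simp_all add: \<pi>wf)
    then have d: "q - r \<in> slt.lgen P" unfolding ker[symmetric] linmap_diff[OF \<pi>] by simp
    have "comps r n = (\<Sum>f\<in>F. if df f = n then sc (c f) (e f) else 0)" for n
      unfolding r_def comps_sum comps_scale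
      by (rule sum.cong) (auto simp: comps_word[OF wf(2)] e_def)
    then have "comps q n - (\<Sum>f\<in>F. if df f = n then sc (c f) (e f) else 0) \<in> filt_pred n" for n
      using comps_kernel[OF P rel d, of n] unfolding comps_diff by simp
    then show ?thesis using d unfolding r_def by blast
  qed
  \<comment> \<open>By induction on \<open>n\<close>: a word of degree \<open>n\<close> is reduced modulo the previous step.\<close>
  have filt_e: "filt n \<subseteq> span (e ` {f \<in> F. df f \<le> n})" for n
  proof (induction n rule: less_induct)
    case (less n)
    show ?case unfolding filt_def
    proof (rule span_minimal[OF _ subspace_span], clarify)
      fix w d assume d: "d \<le> n" and w: "w \<in> graded_words d"
      have "gen w \<in> fa sl12_t" using graded_words_lists[OF w] by simp
      from reduce[OF this] obtain c where c: "comps (gen w) d - (\<Sum>f\<in>F. if df f = d then sc (c f) (e f) else 0) \<in> filt_pred d" by blast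
      have "filt_pred d \<subseteq> span (e ` {f \<in> F. df f \<le> n})"
      proof (cases d)
        case 0
        then show ?thesis by (simp add: filt_pred_def span_zero)
      next
        case (Suc k)
        then have "filt_pred d = filt k" by (simp add: filt_pred_def)
        also have "\<dots> \<subseteq> span (e ` {f \<in> F. df f \<le> k})" by (rule less.IH) (use Suc d in simp)
        also have "\<dots> \<subseteq> span (e ` {f \<in> F. df f \<le> n})" by (rule span_mono) (use Suc d in auto)
        finally show ?thesis .
      qed
      moreover have "(\<Sum>f\<in>F. if df f = d then sc (c f) (e f) else 0) \<in> span (e ` {f \<in> F. df f \<le> n})"
        by (rule span_sum) (use d in \<open>auto intro!: span_scale intro: span_base simp: span_zero\<close>)
      ultimately have "comps (gen w) d \<in> span (e ` {f \<in> F. df f \<le> n})" using c span_add[of _ "e ` {f \<in> F. df f \<le> n}"] by fastforce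
      then show "foldr T w v \<in> span (e ` {f \<in> F. df f \<le> n})" by (simp add: comps_word[OF w])
    qed
  qed
  have "(\<Union>n. filt n) \<subseteq> span (e ` F)"
  proof (rule UN_least)
    show "filt n \<subseteq> span (e ` F)" for n using filt_e[of n] span_mono[of "e ` {f \<in> F. df f \<le> n}" "e ` F"] by auto
  qed
  then have sp: "span (\<Union>n. filt n) \<subseteq> span (e ` F)" by (rule span_minimal[OF _ subspace_span])
  have cE: "card (e ` F) \<le> N" using card_image_le[OF F(1), of e] F(2) by simp
  have "N \<le> card (e ` F) \<and> independent (e ` F)"
    by (rule lower[OF _ cE]) (use F(1) words_span sp in auto)
  then have ind: "independent (e ` F)" and "card (e ` F) = card F" using card_image_le[OF F(1), of e] F(2) by auto
  then have inj: "inj_on e F" using eq_card_imp_inj_on[OF F(1)] by blast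
  obtain c where c: "p - (\<Sum>f\<in>F. pscale (c f) (gen (wf f))) \<in> slt.lgen P"
    "\<And>n. comps p n - (\<Sum>f\<in>F. if df f = n then sc (c f) (e f) else 0) \<in> filt_pred n" using reduce[OF p(1)] by blast
  have "c f0 = 0" if f0: "f0 \<in> F" for f0
  proof (rule ccontr)
    assume nz: "c f0 \<noteq> 0"
    define S where "S = span (e ` F - {e f0})"
    define n where "n = df f0"
    have eS: "e f \<in> S" if "f \<in> F" "f \<noteq> f0" for f
      unfolding S_def by (rule span_base) (use that inj f0 in \<open>auto simp: inj_on_def\<close>)
    have "filt_pred n \<subseteq> S"
    proof (cases n)
      case (Suc k)
      then have "f \<noteq> f0" if "df f \<le> k" for f using that unfolding n_def by auto
      then have "e ` {f \<in> F. df f \<le> k} \<subseteq> S" using eS by auto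
      then have "span (e ` {f \<in> F. df f \<le> k}) \<subseteq> S" unfolding S_def by (rule span_minimal[OF _ subspace_span])
      then show ?thesis using filt_e[of k] Suc by (simp add: filt_pred_def)
    qed (simp add: filt_pred_def S_def span_zero)
    moreover have "(\<Sum>f\<in>F. if df f = n then sc (c f) (e f) else 0) \<in> filt_pred n"
      using subspace_diff[OF filt_pred_subspace p(2)[of n] c(2)[of n]] by simp
    ultimately have 1: "(\<Sum>f\<in>F. if df f = n then sc (c f) (e f) else 0) \<in> S" by blast
    have 2: "(\<Sum>f\<in>F - {f0}. if df f = n then sc (c f) (e f) else 0) \<in> S"
      unfolding S_def by (rule span_sum) (use eS in \<open>auto simp: S_def span_zero intro!: span_scale\<close>)
    have "(\<Sum>f\<in>F. if df f = n then sc (c f) (e f) else 0) = sc (c f0) (e f0) + (\<Sum>f\<in>F - {f0}. if df f = n then sc (c f) (e f) else 0)"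
      unfolding sum.remove[OF F(1) f0] by (simp add: n_def)
    then have "sc (c f0) (e f0) \<in> S" using span_diff[OF 1[unfolded S_def] 2[unfolded S_def]] unfolding S_def by simp
    then have "sc (inverse (c f0)) (sc (c f0) (e f0)) \<in> S" unfolding S_def by (rule span_scale)
    then have "e f0 \<in> S" using nz by simp
    then show False using ind f0 unfolding S_def dependent_def by blast
  qed
  then have "(\<Sum>f\<in>F. pscale (c f) (gen (wf f))) = 0" by (simp add: sum.neutral)
  then show ?thesis using c(1) by simp
qed

lemma filt_lift:
  assumes "a \<in> filt n"
  shows "\<exists>p\<in>fa sl12_t. (\<forall>k. k \<noteq> n \<longrightarrow> comps p k = 0) \<and> comps p n - a \<in> filt_pred n"
  using assms unfolding filt_def
proof (induction rule: span_induct_alt)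
  case base
  have "(0 :: (nat \<Rightarrow>\<^sub>0 mat3) list \<Rightarrow>\<^sub>0 complex) \<in> fa sl12_t" by simp
  then show ?case using subspace_0[OF filt_pred_subspace] by (intro bexI[of _ 0]) (simp_all add: comps_zero)
next
  case (step c b a)
  then obtain w d where w: "b = foldr T w v" "d \<le> n" "w \<in> graded_words d" by blast
  obtain p where p: "p \<in> fa sl12_t" "\<And>k. k \<noteq> n ==> comps p k = 0" "comps p n - a \<in> filt_pred n" using step by blast
  show ?case
  proof (cases "d = n")
    case True
    have "pscale c (gen w) + p \<in> fa sl12_t"
      by (intro pscale.subspace_add[OF fa_subspace] pscale.subspace_scale[OF fa_subspace] p(1)) (use graded_words_lists[OF w(3)] in simp)
    then show ?thesis using p(2,3) True w(1)
      by (intro bexI[of _ "pscale c (gen w) + p"]) (simp_all add: comps_add comps_scale comps_word[OF w(3)] del: pscale_single)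
  next
    case False
    then have "b \<in> filt_pred n" using filt_base[OF w(3) order_refl] filt_pred_mono[of d n] w(1,2) by auto
    then have "comps p n - a - sc c b \<in> filt_pred n"
      by (intro subspace_diff[OF filt_pred_subspace] subspace_scale[OF filt_pred_subspace] p(3))
    then show ?thesis using p(1,2) by (intro bexI[of _ p]) (simp_all add: diff_diff_eq add.commute)
  qed
qed

end

locale sl12_module = sl12_rep sc T v for sc :: "complex \<Rightarrow> 'v::ab_group_add \<Rightarrow> 'v" and T v +
  fixes V :: "(nat \<Rightarrow>\<^sub>0 mat3, 'a) super_module" and M :: "'v set" and \<theta> :: "'v \<Rightarrow> 'a"
  assumes V: "presents V M \<theta> {0}"
    and act_V: "g \<in> carrier sl12_t ==> a \<in> M ==> act V g (\<theta> a) = \<theta> (T g a)"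
    and T_M: "g \<in> carrier sl12_t ==> a \<in> M ==> T g a \<in> M"
    and v_M: "v \<in> M"
begin

lemmas VD = presentsD[OF V]

lemma word_M: "w \<in> lists (carrier sl12_t) ==> foldr T w v \<in> M \<and> foldr (act V) w (\<theta> v) = \<theta> (foldr T w v)"
  by (induction w) (auto simp: v_M T_M act_V)

lemma filt_M: "filt n \<subseteq> M"
  unfolding filt_def by (rule span_minimal[OF _ VD(1)]) (use word_M graded_words_lists in blast)

lemma filt_pred_M: "filt_pred n \<subseteq> M"
  using filt_M filt_pred_subset by blast

lemma UEA_act_ucls:
  assumes "p \<in> fa sl12_t"
  shows "UEA_act V (ucls sl12_t p) (\<theta> v) = \<theta> (action T p v)"
proof -
  interpret abelian_group V by (rule presents_abelian_group[OF V])
  have "p \<in> ucls sl12_t p"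
    using pscale.subspace_0[OF slt.UEA_ideal_subspace] unfolding ucls_def
    by (force simp: a_r_coset_def r_coset_def free_algebra_def)
  then have "(SOME q. q \<in> ucls sl12_t p) \<in> ucls sl12_t p" by (rule someI)
  then obtain q k where q: "(SOME q. q \<in> ucls sl12_t p) = q" and k: "k \<in> UEA_ideal sl12_t" "q = k + p"
    unfolding ucls_def by (auto simp: a_r_coset_def r_coset_def free_algebra_def)
  have "k \<in> fa sl12_t" using k(1) slt.UEA_ideal_subset by blast
  then have qfa: "q \<in> fa sl12_t" unfolding k(2) by (rule pscale.subspace_add[OF fa_subspace _ assms])
  have "action T k v = 0" by (rule action_UEA_ideal[OF lie_closed_sl12_t rep k(1)])
  then have qp: "action T q v = action T p v" unfolding k(2) linmap_add[OF linmap_action] by simp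
  define h where "h w = (if w \<in> lists (carrier sl12_t) then sc (lookup q w) (foldr T w v) else 0)" for w
  have h: "h w \<in> M" for w unfolding h_def using word_M subspace_scale[OF VD(1)] subspace_0[OF VD(1)] by auto
  have "(\<Oplus>\<^bsub>V\<^esub>w\<in>keys q. lookup q w \<odot>\<^bsub>V\<^esub> foldr (act V) w (\<theta> v)) = (\<Oplus>\<^bsub>V\<^esub>w\<in>keys q. \<theta> (h w))"
  proof (rule finsum_cong')
    show "(\<lambda>w. \<theta> (h w)) \<in> keys q \<rightarrow> carrier V" using h unfolding VD(4) by blast
    fix w assume "w \<in> keys q"
    then have "w \<in> lists (carrier sl12_t)" using qfa by blast
    then show "lookup q w \<odot>\<^bsub>V\<^esub> foldr (act V) w (\<theta> v) = \<theta> (h w)" using word_M VD(7) unfolding h_def by simp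
  qed simp
  also have "\<dots> = \<theta> (\<Sum>w\<in>keys q. h w)" by (rule presents_finsum[OF V finite_keys h])
  also have "(\<Sum>w\<in>keys q. h w) = action T q v"
    unfolding action_def lift_def h_def by (rule sum.cong) (use qfa in auto)
  finally show ?thesis unfolding UEA_act_def q Let_def qp .
qed

lemma degree_words_fa: "keys p \<subseteq> graded_words i ==> p \<in> fa sl12_t"
  using graded_words_lists by blast

lemma degree_action_filt: "keys p \<subseteq> graded_words i ==> i \<le> n ==> action T p v \<in> filt n"
  unfolding action_def by (rule lift_in_subspace[OF filt_subspace]) (use filt_base in blast)

lemma filtration_eq: "filtration V (\<theta> v) n = \<theta> ` filt n"
proof (intro equalityI subsetI)
  interpret abelian_group V by (rule presents_abelian_group[OF V])
  have fin: "(\<Oplus>\<^bsub>V\<^esub>i\<in>{..n}. UEA_act V (u i) (\<theta> v)) = \<theta> (\<Sum>i\<le>n. action T (p i) v)"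
    if p: "\<And>i. i \<le> n ==> u i = ucls sl12_t (p i)" "\<And>i. keys (p i) \<subseteq> graded_words i" for u p
  proof -
    have m: "action T (p i) v \<in> M" for i using degree_action_filt[OF p(2) order_refl] filt_M by blast
    have "(\<Oplus>\<^bsub>V\<^esub>i\<in>{..n}. UEA_act V (u i) (\<theta> v)) = (\<Oplus>\<^bsub>V\<^esub>i\<in>{..n}. \<theta> (action T (p i) v))"
    proof (rule finsum_cong')
      show "(\<lambda>i. \<theta> (action T (p i) v)) \<in> {..n} \<rightarrow> carrier V" using m unfolding VD(4) by blast
      show "UEA_act V (u i) (\<theta> v) = \<theta> (action T (p i) v)" if "i \<in> {..n}" for i
        using p(1)[of i] that UEA_act_ucls[OF degree_words_fa[OF p(2)]] by simp
    qed simp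
    also have "\<dots> = \<theta> (\<Sum>i\<le>n. action T (p i) v)" by (rule presents_finsum[OF V _ m]) simp
    finally show ?thesis .
  qed
  fix x
  { assume "x \<in> filtration V (\<theta> v) n"
    then obtain u where u: "x = (\<Oplus>\<^bsub>V\<^esub>i\<in>{..n}. UEA_act V (u i) (\<theta> v))" "\<And>i. i \<le> n ==> u i \<in> UEA_degree i"
      unfolding filtration_def by blast
    have "\<exists>p. (i \<le> n \<longrightarrow> u i = ucls sl12_t p) \<and> keys p \<subseteq> graded_words i" for i
    proof (cases "i \<le> n")
      case True
      then show ?thesis using u(2)[OF True] unfolding UEA_degree_graded_words by blast
    next
      case False
      then show ?thesis by (intro exI[of _ 0]) simp
    qed
    then obtain p where p: "\<And>i. i \<le> n ==> u i = ucls sl12_t (p i)" "\<And>i. keys (p i) \<subseteq> graded_words i" by metis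
    have "(\<Sum>i\<le>n. action T (p i) v) \<in> filt n"
      by (rule subspace_sum[OF filt_subspace]) (use degree_action_filt[OF p(2)] in simp)
    moreover have "x = \<theta> (\<Sum>i\<le>n. action T (p i) v)" unfolding u(1)
    proof (rule fin[of u p])
      show "u i = ucls sl12_t (p i)" if "i \<le> n" for i by (rule p(1)[OF that])
      show "keys (p i) \<subseteq> graded_words i" for i by (rule p(2))
    qed
    ultimately show "x \<in> \<theta> ` filt n" by blast }
  assume "x \<in> \<theta> ` filt n"
  then obtain a where a: "x = \<theta> a" "a \<in> filt n" by blast
  have "\<exists>p. (\<forall>i. keys (p i) \<subseteq> graded_words i) \<and> a = (\<Sum>i\<le>n. action T (p i) v)"
    using a(2) unfolding filt_def
  proof (induction rule: span_induct_alt)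
    case base
    have "(\<forall>i. keys (0 :: (nat \<Rightarrow>\<^sub>0 mat3) list \<Rightarrow>\<^sub>0 complex) \<subseteq> graded_words i) \<and> 0 = (\<Sum>i\<le>n. action T 0 v)"
      by (simp add: linmap_zero[OF linmap_action])
    then show ?case by (intro exI[of _ "\<lambda>i. 0"])
  next
    case (step c b a)
    then obtain w d where w: "b = foldr T w v" "d \<le> n" "w \<in> graded_words d" by blast
    obtain p where p: "\<And>i. keys (p i) \<subseteq> graded_words i" "a = (\<Sum>i\<le>n. action T (p i) v)" using step by blast
    define p' where "p' i = p i + (if i = d then pscale c (gen w) else 0)" for i
    have "keys (p' i) \<subseteq> graded_words i" for i
    proof -
      have "keys (if i = d then pscale c (gen w) else 0) \<subseteq> graded_words i" using w(3) by auto
      then show ?thesis using p(1)[of i] keys_add[of "p i" "if i = d then pscale c (gen w) else 0"] unfolding p'_def by blast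
    qed
    moreover have "action T (p' i) v = action T (p i) v + (if i = d then sc c b else 0)" for i
      unfolding p'_def linmap_add[OF linmap_action] w(1) by (simp add: linmap_zero[OF linmap_action])
    then have "sc c b + a = (\<Sum>i\<le>n. action T (p' i) v)" using p(2) w(2) by (simp add: sum.distrib)
    ultimately show ?case by blast
  qed
  then obtain p where p: "\<And>i. keys (p i) \<subseteq> graded_words i" "a = (\<Sum>i\<le>n. action T (p i) v)" by blast
  have "\<forall>i\<le>n. ucls sl12_t (p i) \<in> UEA_degree i" unfolding UEA_degree_graded_words using p(1) by blast
  moreover have "x = (\<Oplus>\<^bsub>V\<^esub>i\<in>{..n}. UEA_act V (ucls sl12_t (p i)) (\<theta> v))"
    unfolding a(1) p(2) by (rule fin[of "\<lambda>i. ucls sl12_t (p i)" p, symmetric]) (simp, rule p(1))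
  ultimately show "x \<in> filtration V (\<theta> v) n"
    unfolding filtration_def mem_Collect_eq by (intro exI[of _ "\<lambda>i. ucls sl12_t (p i)"] conjI)
qed

lemma filtration_pred_eq: "filtration_pred V (\<theta> v) n = \<theta> ` filt_pred n"
  unfolding filtration_pred_def filt_pred_def by (cases n) (simp_all add: filtration_eq VD(5))

definition gcls :: "nat \<Rightarrow> 'v \<Rightarrow> 'a set" where "gcls n a = \<theta> ` filt_pred n +>\<^bsub>V\<^esub> \<theta> a"

lemma presents_piece: "presents (graded_piece V (\<theta> v) n) (filt n) (gcls n) (filt_pred n)"
proof -
  define V' where "V' = V\<lparr>carrier := filtration V (\<theta> v) n, part := (\<lambda>d. part V d \<inter> filtration V (\<theta> v) n)\<rparr>"
  have f: "a \<in> filt n ==> a \<in> M" for a using filt_M by blast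
  have z: "{0} \<subseteq> filt n" "{0} \<subseteq> filt_pred n" using subspace_0[OF filt_subspace] subspace_0[OF filt_pred_subspace] by simp_all
  have "presents V' (filt n) \<theta> {0}"
    unfolding presents_def V'_def using VD z f by (simp add: filtration_eq filt_subspace)
  from presents_quotient[OF this filt_pred_subspace z(2) filt_pred_subset]
  have "presents (quotient V' (\<theta> ` filt_pred n)) (filt n) (\<lambda>a. \<theta> ` filt_pred n +>\<^bsub>V'\<^esub> \<theta> a) (filt_pred n)" .
  moreover have "(\<lambda>a. \<theta> ` filt_pred n +>\<^bsub>V'\<^esub> \<theta> a) = gcls n"
    by (simp add: fun_eq_iff gcls_def V'_def a_r_coset_def r_coset_def)
  ultimately show ?thesis unfolding graded_piece_def V'_def filtration_pred_eq by simp
qed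

lemmas GD = presentsD[OF presents_piece]

text \<open>
  Elements of the associated graded module are classes of sequences with \<open>n\<close>-th
  term in step \<open>n\<close> of the filtration.
\<close>

definition graded_cls :: "(nat \<Rightarrow> 'v) \<Rightarrow> nat \<Rightarrow> 'a set" where "graded_cls f = (\<lambda>n. gcls n (f n))"

definition good :: "(nat \<Rightarrow> 'v) \<Rightarrow> bool" where "good f \<longleftrightarrow> (\<forall>n. f n \<in> filt n) \<and> finite {n. f n \<noteq> 0}"

abbreviation "Gr \<equiv> associated_graded V (\<theta> v)"

lemma graded_cls_eq: "(\<And>n. f n \<in> filt n) ==> (\<And>n. f' n \<in> filt n) ==> graded_cls f = graded_cls f' \<longleftrightarrow> (\<forall>n. f n - f' n \<in> filt_pred n)"
  unfolding graded_cls_def fun_eq_iff using GD(8) by blast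

lemma carrier_Gr: "carrier Gr = graded_cls ` Collect good"
proof (intro equalityI subsetI)
  fix F assume "F \<in> carrier Gr"
  then have F: "\<And>n. F n \<in> gcls n ` filt n" "finite {n. F n \<noteq> gcls n 0}"
    unfolding associated_graded_def by (simp_all add: GD(4,5))
  have "\<exists>a. a \<in> filt n \<and> F n = gcls n a \<and> (F n = gcls n 0 \<longrightarrow> a = 0)" for n
    using F(1)[of n] subspace_0[OF filt_subspace] by (cases "F n = gcls n 0") auto
  then obtain f where f: "\<And>n. f n \<in> filt n \<and> F n = gcls n (f n) \<and> (F n = gcls n 0 \<longrightarrow> f n = 0)" by metis
  have "{n. f n \<noteq> 0} \<subseteq> {n. F n \<noteq> gcls n 0}" using f by blast
  then have "good f" unfolding good_def using f F(2) finite_subset by blast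
  moreover have "F = graded_cls f" unfolding graded_cls_def using f by blast
  ultimately show "F \<in> graded_cls ` Collect good" by blast
next
  fix F assume "F \<in> graded_cls ` Collect good"
  then obtain f where f: "F = graded_cls f" "\<And>n. f n \<in> filt n" "finite {n. f n \<noteq> 0}" unfolding good_def by blast
  have "{n. gcls n (f n) \<noteq> gcls n 0} \<subseteq> {n. f n \<noteq> 0}" by auto
  then have "finite {n. gcls n (f n) \<noteq> gcls n 0}" using f(3) finite_subset by blast
  then show "F \<in> carrier Gr" using f(2) unfolding f(1) graded_cls_def associated_graded_def by (simp add: GD(4,5))
qed

lemma add_Gr: "(\<And>n. f n \<in> filt n) ==> (\<And>n. f' n \<in> filt n) ==> graded_cls f \<oplus>\<^bsub>Gr\<^esub> graded_cls f' = graded_cls (f + f')"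
  and smult_Gr: "(\<And>n. f n \<in> filt n) ==> c \<odot>\<^bsub>Gr\<^esub> graded_cls f = graded_cls (seq_scale c f)"
  unfolding associated_graded_def graded_cls_def by (simp_all add: GD(6,7) seq_scale_def)

text \<open>
  By this lemma the associated graded module is a subquotient of the module of sequences.
\<close>

lemma act_Gr:
  assumes g: "g \<in> carrier sl12_t" and f: "\<And>n. f n \<in> filt n"
  shows "act Gr g (graded_cls f) = graded_cls (shift g f)"
proof
  fix n
  define t where "t r = T (single r (lookup g r))" for r
  have gr: "single r (lookup g r) \<in> carrier sl12_t" for r by (rule single_carrier[OF coeff_carrier[OF g]])
  have map: "coset_map V (filtration_pred V (\<theta> v) n) (act V (single r (lookup g r))) (gcls (n - r) (f (n - r)))
      = gcls n (t r (f (n - r)))" if "r \<le> n" for r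
    unfolding filtration_pred_eq gcls_def
  proof (rule coset_map_eq[OF V filt_pred_subspace filt_pred_M filt_pred_subspace _ filt_pred_M, where t = "t r"])
    show "{0} \<subseteq> filt_pred n" using subspace_0[OF filt_pred_subspace] by simp
    show "act V (single r (lookup g r)) (\<theta> a) = \<theta> (t r a)" "t r a \<in> M" if "a \<in> M" for a
      unfolding t_def by (rule act_V[OF gr that] T_M[OF gr that])+
    show "t r (k + a) - t r a \<in> filt_pred n" if "k \<in> filt_pred (n - r)" for k a
      using filt_pred_step[OF coeff_carrier[OF g] that, of r r] \<open>r \<le> n\<close> unfolding t_def linmap_add[OF lin[OF coeff_carrier[OF g]]] by simp
    show "f (n - r) \<in> M" using f filt_M by blast
  qed
  interpret G: abelian_group "graded_piece V (\<theta> v) n" by (rule presents_abelian_group[OF presents_piece])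
  have tf: "(if r \<le> n then t r (f (n - r)) else 0) \<in> filt n" for r
    using filt_step[OF coeff_carrier[OF g] f, of r r "n - r"] subspace_0[OF filt_subspace] unfolding t_def by (cases "r \<le> n") simp_all
  have "act Gr g (graded_cls f) n = (\<Oplus>\<^bsub>graded_piece V (\<theta> v) n\<^esub>r\<in>{..n}. gcls n (if r \<le> n then t r (f (n - r)) else 0))"
    unfolding associated_graded_def graded_cls_def
  proof (simp, rule G.finsum_cong')
    show "(\<lambda>r. gcls n (if r \<le> n then t r (f (n - r)) else 0)) \<in> {..n} \<rightarrow> carrier (graded_piece V (\<theta> v) n)"
      using tf unfolding GD(4) by blast
  qed (simp_all add: map)
  also have "\<dots> = gcls n (\<Sum>r\<le>n. if r \<le> n then t r (f (n - r)) else 0)"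
    by (rule presents_finsum[OF presents_piece _ tf]) simp
  also have "(\<Sum>r\<le>n. if r \<le> n then t r (f (n - r)) else 0) = shift g f n" unfolding shift_def t_def by simp
  finally show "act Gr g (graded_cls f) n = graded_cls (shift g f) n" unfolding graded_cls_def .
qed

lemma associated_graded_isomorphic:
  assumes P: "P \<subseteq> fa sl12_t" and rel: "\<And>p n. p \<in> P ==> comps p n \<in> filt_pred n"
    and upper: "\<And>T' u. is_rep sl12_t pscale T' ==> (\<And>p. p \<in> P ==> pc.action T' p u = 0) ==>
      \<exists>F. finite F \<and> card F \<le> N \<and> F \<subseteq> pc.homogeneous_orbit T' u \<and>
        (\<forall>w\<in>lists (carrier sl12_t). foldr T' w u \<in> pscale.span (F :: ((nat \<Rightarrow>\<^sub>0 mat3) list \<Rightarrow>\<^sub>0 complex) set))"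
    and lower: "\<And>F. finite F ==> card F \<le> N ==> (\<forall>w\<in>lists (carrier sl12_t). foldr T w v \<in> span F) ==> N \<le> card F \<and> independent F"
  shows "module_isomorphic sl12_t (slt.cyc P) Gr"
proof -
  note CD = pc.presentsD[OF slt.presents_cyc[OF P]]
  define rp where "rp X = (SOME p. p \<in> fa sl12_t \<and> X = slt.ccls P p)" for X
  define \<Phi> where "\<Phi> X = graded_cls (comps (rp X))" for X
  have cf: "comps p n \<in> filt n" if "p \<in> fa sl12_t" for p n using comps_filt[OF that] by blast
  have eq: "slt.ccls P p = slt.ccls P q \<longleftrightarrow> graded_cls (comps p) = graded_cls (comps q)" if p: "p \<in> fa sl12_t" and q: "q \<in> fa sl12_t" for p q
  proof -
    have "p - q \<in> fa sl12_t" by (rule pscale.subspace_diff[OF fa_subspace p q])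
    then have "p - q \<in> slt.lgen P \<longleftrightarrow> (\<forall>n. comps (p - q) n \<in> filt_pred n)"
      using comps_kernel[OF P rel, of "p - q"] comps_kernel_converse[OF P rel upper lower, of "p - q"] by blast
    then show ?thesis unfolding CD(8)[OF p q] graded_cls_eq[OF cf[OF p] cf[OF q]] comps_diff .
  qed
  have \<Phi>: "\<Phi> (slt.ccls P p) = graded_cls (comps p)" if p: "p \<in> fa sl12_t" for p
  proof -
    have "\<exists>q. q \<in> fa sl12_t \<and> slt.ccls P p = slt.ccls P q" using p by blast
    then have "rp (slt.ccls P p) \<in> fa sl12_t \<and> slt.ccls P p = slt.ccls P (rp (slt.ccls P p))" unfolding rp_def by (rule someI_ex)
    then show ?thesis unfolding \<Phi>_def using eq[OF p] by metis
  qed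
  have car: "\<exists>p\<in>fa sl12_t. X = slt.ccls P p" if "X \<in> carrier (slt.cyc P)" for X using that CD(4) by blast
  have surj: "\<exists>p\<in>fa sl12_t. F = graded_cls (comps p)" if F: "F \<in> carrier Gr" for F
  proof -
    obtain f where f: "F = graded_cls f" "\<And>n. f n \<in> filt n" "finite {n. f n \<noteq> 0}" using F unfolding carrier_Gr good_def by blast
    have "\<exists>p. \<forall>n. p n \<in> fa sl12_t \<and> (\<forall>k. k \<noteq> n \<longrightarrow> comps (p n) k = 0) \<and> comps (p n) n - f n \<in> filt_pred n"
      using filt_lift[OF f(2)] by (intro choice) blast
    then obtain p where p: "\<And>n. p n \<in> fa sl12_t" "\<And>n k. k \<noteq> n ==> comps (p n) k = 0" "\<And>n. comps (p n) n - f n \<in> filt_pred n" by blast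
    define q where "q = (\<Sum>n | f n \<noteq> 0. p n)"
    have q: "q \<in> fa sl12_t" unfolding q_def by (rule pscale.subspace_sum[OF fa_subspace p(1)])
    have "comps q k - f k \<in> filt_pred k" for k
    proof -
      have "comps q k = (\<Sum>n | f n \<noteq> 0. if n = k then comps (p k) k else 0)"
        unfolding q_def comps_sum by (rule sum.cong) (auto simp: p(2))
      also have "\<dots> = (if f k \<noteq> 0 then comps (p k) k else 0)" using f(3) by simp
      finally show ?thesis using p(3)[of k] subspace_0[OF filt_pred_subspace] by auto
    qed
    then have "graded_cls (comps q) = F" unfolding f(1) using graded_cls_eq[OF cf[OF q] f(2)] by blast
    then show ?thesis using q by blast
  qed
  show ?thesis
    unfolding module_isomorphic_def
  proof (intro exI[of _ \<Phi>] conjI ballI allI)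
    show "bij_betw \<Phi> (carrier (slt.cyc P)) (carrier Gr)"
      unfolding bij_betw_def
    proof (rule conjI)
      show "inj_on \<Phi> (carrier (slt.cyc P))"
      proof (rule inj_onI)
        fix X Y assume "X \<in> carrier (slt.cyc P)" "Y \<in> carrier (slt.cyc P)" "\<Phi> X = \<Phi> Y"
        then obtain p q where "p \<in> fa sl12_t" "X = slt.ccls P p" "q \<in> fa sl12_t" "Y = slt.ccls P q" using car by meson
        then show "X = Y" using \<open>\<Phi> X = \<Phi> Y\<close> eq \<Phi> by metis
      qed
      show "\<Phi> ` carrier (slt.cyc P) = carrier Gr"
      proof (intro equalityI subsetI)
        fix F assume "F \<in> \<Phi> ` carrier (slt.cyc P)"
        then obtain p where p: "p \<in> fa sl12_t" "F = \<Phi> (slt.ccls P p)" using car by blast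
        then show "F \<in> carrier Gr" using comps_filt[OF p(1)] unfolding carrier_Gr p(2) \<Phi>[OF p(1)] good_def by blast
      next
        fix F assume "F \<in> carrier Gr"
        then obtain p where p: "p \<in> fa sl12_t" "F = graded_cls (comps p)" using surj by blast
        then have "F = \<Phi> (slt.ccls P p)" using \<Phi> by simp
        then show "F \<in> \<Phi> ` carrier (slt.cyc P)" using CD(4) p(1) by blast
      qed
    qed
    fix X assume "X \<in> carrier (slt.cyc P)"
    then obtain p where p: "p \<in> fa sl12_t" "X = slt.ccls P p" using car by blast
    show "\<Phi> (c \<odot>\<^bsub>slt.cyc P\<^esub> X) = c \<odot>\<^bsub>Gr\<^esub> \<Phi> X" for c
      unfolding p(2) CD(7)[OF p(1)] \<Phi>[OF p(1)] \<Phi>[OF pscale.subspace_scale[OF fa_subspace p(1)]] smult_Gr[OF cf[OF p(1)]]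
      using linmap_scale[OF linmap_comps] by simp
    { fix Y assume "Y \<in> carrier (slt.cyc P)"
      then obtain q where q: "q \<in> fa sl12_t" "Y = slt.ccls P q" using car by blast
      show "\<Phi> (X \<oplus>\<^bsub>slt.cyc P\<^esub> Y) = \<Phi> X \<oplus>\<^bsub>Gr\<^esub> \<Phi> Y"
        unfolding p(2) q(2) CD(6)[OF p(1) q(1)] \<Phi>[OF p(1)] \<Phi>[OF q(1)] \<Phi>[OF pscale.subspace_add[OF fa_subspace p(1) q(1)]]
          add_Gr[OF cf[OF p(1)] cf[OF q(1)]] linmap_add[OF linmap_comps] .. }
    fix g assume g: "g \<in> carrier sl12_t"
    have gp: "word_mult (gen [g]) p \<in> fa sl12_t" by (rule fa_word_mult[OF _ p(1)]) (use g in simp)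
    show "\<Phi> (act (slt.cyc P) g X) = act Gr g (\<Phi> X)"
      unfolding p(2) slt.act_cyc[OF P g p(1)] \<Phi>[OF gp] \<Phi>[OF p(1)] act_Gr[OF g cf[OF p(1)]] comps_mult[OF g p(1)] ..
  qed
qed

end

section \<open>Tensor products of Kac modules\<close>

text \<open>
  The element \<open>A \<otimes> f(t)\<close>.
\<close>

definition poly_current :: "mat3 \<Rightarrow> complex poly \<Rightarrow> (nat \<Rightarrow>\<^sub>0 mat3)" where
  "poly_current A f = (\<Sum>m\<le>degree f. single m (coeff f m *\<^sub>M A))"

lemma evaluate_poly_current: "evaluate z (poly_current A f) = poly f z *\<^sub>M A"
  by (simp add: poly_current_def evaluate_sum mscale_assoc poly_altdef sum_mscale mult.commute)

lemma poly_current_part: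
  assumes "A \<in> part sl12 d"
  shows "poly_current A f \<in> part sl12_t d"
  unfolding part_sl12_t
proof
  fix m
  show "lookup (poly_current A f) m \<in> part sl12 d"
    unfolding poly_current_def lookup_sum
    by (rule sum_part_sl12) (auto simp: lookup_single when_def intro: part_sl12_closed scale_part_sl12[OF assms])
qed

lemma interpolation_poly:
  fixes q :: nat and z :: "nat \<Rightarrow> complex"
  assumes "inj_on z {..<q}" "j < q"
  shows "\<exists>f. \<forall>i<q. poly f (z i) = (if i = j then 1 else (0::complex))"
proof (intro exI allI impI)
  fix i assume i: "i < q"
  let ?f = "\<Prod>k\<in>{..<q} - {j}. smult (1 / (z j - z k)) [:- z k, 1:]"
  show "poly ?f (z i) = (if i = j then 1 else 0)"
  proof (cases "i = j")
    case True
    have "z j \<noteq> z k" if "k \<in> {..<q} - {j}" for k using assms that by (auto simp: inj_on_def)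
    then have "poly (smult (1 / (z j - z k)) [:- z k, 1:]) (z j) = 1" if "k \<in> {..<q} - {j}" for k
      using that by (simp add: diff_divide_distrib[symmetric])
    then have "(\<Prod>k\<in>{..<q} - {j}. poly (smult (1 / (z j - z k)) [:- z k, 1:]) (z j)) = 1" by (intro prod.neutral) blast
    then show ?thesis unfolding poly_prod True by simp
  next
    case False
    then show ?thesis unfolding poly_prod using i by (auto intro!: prod_zero bexI[of _ i])
  qed
qed

lemma K_relation_n_plus: "x \<in> n_plus ==> gen [x] \<in> K_relations \<mu>"
  and K_relation_h: "gen [a *\<^sub>M h1 + b *\<^sub>M h2] - pscale (a * fst \<mu> + b * snd \<mu>) (gen []) \<in> K_relations \<mu>"
  and K_relation_y: "snd \<mu> = of_nat k ==> gen (replicate (k + 1) y2) \<in> K_relations \<mu>"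
  unfolding K_relations_def by blast+

lemma n_plus_scale: "x \<in> n_plus ==> c *\<^sub>M x \<in> n_plus"
proof -
  assume "x \<in> n_plus"
  then obtain a b d where "x = a *\<^sub>M E 2 1 + b *\<^sub>M E 2 3 + d *\<^sub>M E 1 3" unfolding n_plus_def by blast
  then have "c *\<^sub>M x = (c * a) *\<^sub>M E 2 1 + (c * b) *\<^sub>M E 2 3 + (c * d) *\<^sub>M E 1 3"
    by (simp add: mscale_add_right mscale_assoc)
  then show "c *\<^sub>M x \<in> n_plus" unfolding n_plus_def by blast
qed

lemma E_n_plus: "E 2 1 \<in> n_plus" "E 2 3 \<in> n_plus" "E 1 3 \<in> n_plus"
proof -
  have "E 2 1 = 1 *\<^sub>M E 2 1 + 0 *\<^sub>M E 2 3 + 0 *\<^sub>M E 1 3" "E 2 3 = 0 *\<^sub>M E 2 1 + 1 *\<^sub>M E 2 3 + 0 *\<^sub>M E 1 3"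
    "E 1 3 = 0 *\<^sub>M E 2 1 + 0 *\<^sub>M E 2 3 + 1 *\<^sub>M E 1 3" by simp_all
  then show "E 2 1 \<in> n_plus" "E 2 3 \<in> n_plus" "E 1 3 \<in> n_plus" unfolding n_plus_def by blast+
qed

lemma complex_cspace: "cspace ((*) :: complex \<Rightarrow> complex \<Rightarrow> complex)"
  unfolding cspace_def by unfold_locales (simp_all add: algebra_simps)

interpretation cx: cspace "(*) :: complex \<Rightarrow> complex \<Rightarrow> complex" by (rule complex_cspace)

locale kac_tensor =
  fixes q :: nat and \<kappa> :: "nat \<Rightarrow> complex" and n :: "nat \<Rightarrow> nat" and z :: "nat \<Rightarrow> complex"
  assumes n: "\<And>i. i < q ==> n i \<ge> 1" and z: "inj_on z {..<q}"
begin

definition \<mu> :: "nat \<Rightarrow> weight" where "\<mu> i = (\<kappa> i, of_nat (n i))"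
definition \<phi> where "\<phi> i = sl.ccls (K_relations (\<mu> i))"
definition Vs where "Vs = map (\<lambda>i. eval_module (K (\<mu> i)) (z i)) [0..<q]"
definition vs where "vs = map (\<lambda>i. K_vec (\<mu> i)) [0..<q]"

lemma length_Vs [simp]: "length Vs = q" and Vs_nth: "i < q ==> Vs ! i = eval_module (K (\<mu> i)) (z i)"
  by (simp_all add: Vs_def)

sublocale tensor_reps sl12_t Vs
proof (intro tensor_reps.intro tensor_reps_axioms.intro)
  show "graded_lie sl12_t" by (rule graded_lie_sl12_t)
  show "super_rep sl12_t (Vs ! i)" if "i < length Vs" for i
    using that super_rep_eval by (simp add: Vs_nth)
qed

lemma VD:
  assumes "i < q"
  shows "carrier (Vs ! i) = \<phi> i ` fa sl12"
    and "a \<in> fa sl12 ==> b \<in> fa sl12 ==> \<phi> i a \<oplus>\<^bsub>Vs ! i\<^esub> \<phi> i b = \<phi> i (a + b)"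
    and "a \<in> fa sl12 ==> c \<odot>\<^bsub>Vs ! i\<^esub> \<phi> i a = \<phi> i (pscale c a)"
proof -
  have W: "pc.presents (Vs ! i) (fa sl12) (\<phi> i) (sl.lgen (K_relations (\<mu> i)))"
    unfolding Vs_nth[OF assms] \<phi>_def by (rule presents_eval)
  show "carrier (Vs ! i) = \<phi> i ` fa sl12" by (rule pc.presentsD(4)[OF W])
  show "a \<in> fa sl12 ==> b \<in> fa sl12 ==> \<phi> i a \<oplus>\<^bsub>Vs ! i\<^esub> \<phi> i b = \<phi> i (a + b)" by (rule pc.presentsD(6)[OF W])
  show "a \<in> fa sl12 ==> c \<odot>\<^bsub>Vs ! i\<^esub> \<phi> i a = \<phi> i (pscale c a)" by (rule pc.presentsD(7)[OF W])
qed

lemma \<phi>_eq: "a \<in> fa sl12 ==> b \<in> fa sl12 ==> \<phi> i a = \<phi> i b \<longleftrightarrow> a - b \<in> sl.lgen (K_relations (\<mu> i))"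
  unfolding \<phi>_def by (rule pc.presentsD(8)[OF presents_eval])

text \<open>
  Tuples in the factors are described by representatives in the free algebra.
\<close>

definition tp :: "(nat \<Rightarrow> mat3 list \<Rightarrow>\<^sub>0 complex) \<Rightarrow> (mat3 list \<Rightarrow>\<^sub>0 complex) set set list" where
  "tp a = map (\<lambda>i. \<phi> i (a i)) [0..<q]"

lemma length_tp [simp]: "length (tp a) = q" and tp_nth: "i < q ==> tp a ! i = \<phi> i (a i)"
  by (simp_all add: tp_def)

lemma tp_tup: "(\<And>i. a i \<in> fa sl12) ==> tp a \<in> tup"
  unfolding tup_iff by (simp add: tp_nth VD(1) del: mem_Collect_eq)

lemma tp_update: "i < q ==> tp (a(i := b)) = (tp a)[i := \<phi> i b]"
  by (rule nth_equalityI) (simp_all add: tp_nth nth_list_update)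

lemma tup_tp:
  assumes "w \<in> tup"
  shows "\<exists>a. (\<forall>i. a i \<in> fa sl12) \<and> w = tp a"
proof -
  have "\<exists>b. b \<in> fa sl12 \<and> (i < q \<longrightarrow> w ! i = \<phi> i b)" for i
  proof (cases "i < q")
    case True
    then have "w ! i \<in> carrier (Vs ! i)" using assms unfolding tup_iff by simp
    then have "w ! i \<in> \<phi> i ` fa sl12" unfolding VD(1)[OF True] .
    then show ?thesis by blast
  next
    case False
    have "(0 :: mat3 list \<Rightarrow>\<^sub>0 complex) \<in> fa sl12" by simp
    then show ?thesis using False by blast
  qed
  then have "\<forall>i. \<exists>b. b \<in> fa sl12 \<and> (i < q \<longrightarrow> w ! i = \<phi> i b)" by (rule allI)
  from choice[OF this] obtain a where a': "\<forall>i. a i \<in> fa sl12 \<and> (i < q \<longrightarrow> w ! i = \<phi> i (a i))" by (rule exE)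
  have afa: "\<forall>i. a i \<in> fa sl12" and a: "i < q ==> w ! i = \<phi> i (a i)" for i using a'[rule_format, of i] a'[rule_format] by (simp_all del: mem_Collect_eq)
  have "length w = q" using assms unfolding tup_iff by simp
  have "w = tp a"
  proof (rule nth_equalityI)
    show "length w = length (tp a)" using \<open>length w = q\<close> by simp
    fix i assume "i < length w"
    then have i: "i < q" using \<open>length w = q\<close> by simp
    then have "w ! i = \<phi> i (a i)" by (rule a)
    then show "w ! i = tp a ! i" unfolding tp_nth[OF i] .
  qed
  with afa show ?thesis by (intro exI[of _ a] conjI)
qed

lemma vs_tp: "vs = tp (\<lambda>i. gen [])"
  by (simp add: vs_def tp_def \<phi>_def K_vec_cyc)

definition tw :: "bit \<Rightarrow> (mat3 list \<Rightarrow>\<^sub>0 complex) \<Rightarrow> mat3 list \<Rightarrow>\<^sub>0 complex" where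
  "tw d p = (if d = 0 then p else flip_words p)"

lemma tw_one [simp]: "tw d (gen []) = gen []" and tw_zero [simp]: "tw 0 p = p" by (simp_all add: tw_def)

lemma slot_tp:
  assumes i: "i < q" and a: "\<And>k. a k \<in> fa sl12" and g: "g \<in> carrier sl12_t"
  shows "slot d i g (tp a) = tp (\<lambda>k. if k < i then tw d (a k) else if k = i then word_mult (gen [evaluate (z i) g]) (a i) else a k)"
proof (rule nth_equalityI)
  fix k assume "k < length (slot d i g (tp a))"
  then have k: "k < q" using i by simp
  have t: "parity_twist (Vs ! k) d (\<phi> k (a k)) = \<phi> k (tw d (a k))"
    unfolding Vs_nth[OF k] \<phi>_def tw_def by (rule eval_twist[OF a])
  have e: "act (Vs ! k) g (\<phi> k (a k)) = \<phi> k (word_mult (gen [evaluate (z k) g]) (a k))"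
    unfolding Vs_nth[OF k] \<phi>_def by (rule eval_act[OF g a])
  have "slot d i g (tp a) ! k = (if k < i then parity_twist (Vs ! k) d (tp a ! k) else if k = i then act (Vs ! k) g (tp a ! k) else tp a ! k)"
    by (rule slot_nth) (simp_all add: i k)
  then show "slot d i g (tp a) ! k = tp (\<lambda>k. if k < i then tw d (a k) else if k = i then word_mult (gen [evaluate (z i) g]) (a i) else a k) ! k"
    unfolding tp_nth[OF k] t e by simp
qed (simp add: i)

definition \<Lambda> where "\<Lambda> i p = p4.action (kac (of_nat (n i)) (\<kappa> i / of_nat (n i))) p (1, 0, 0, 0)"

lemma linmap_\<Lambda>: "linmap pscale pscale4 (\<Lambda> i)"
  unfolding \<Lambda>_def[abs_def] by (rule p4.linmap_action)

lemma \<Lambda>_kernel: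
  assumes i: "i < q" and p: "p \<in> sl.lgen (K_relations (\<mu> i))"
  shows "\<Lambda> i p = 0"
  unfolding \<Lambda>_def
proof (rule sl.lgen_minimal[OF pscale4_cspace kac_rep _ K_relations_fa p])
  let ?T = "kac (of_nat (n i)) (\<kappa> i / of_nat (n i))"
  have n0: "n i \<noteq> 0" using n[OF i] by simp
  note lk = linmap_zero[OF kac_linear] p4.scale_zero_right
  fix r assume "r \<in> K_relations (\<mu> i)"
  then consider x where "x \<in> n_plus" "r = gen [x]"
    | a b where "r = gen [a *\<^sub>M h1 + b *\<^sub>M h2] - pscale (a * fst (\<mu> i) + b * snd (\<mu> i)) (gen [])"
    | k where "r = gen (replicate (k + 1) y2)" "snd (\<mu> i) = of_nat k"
    unfolding K_relations_def by blast
  then show "p4.action ?T r (1, 0, 0, 0) = 0"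
  proof cases
    case 1
    then obtain a b c where "x = a *\<^sub>M E 2 1 + b *\<^sub>M E 2 3 + c *\<^sub>M E 1 3" unfolding n_plus_def by blast
    then show ?thesis unfolding 1(2) p4.action_single p4.scale_one by (simp add: kac_add kac_scale kac_highest lk)
  next
    case 2
    have "p4.action ?T r (1, 0, 0, 0) = p4.action ?T (gen [a *\<^sub>M h1 + b *\<^sub>M h2]) (1, 0, 0, 0)
       - pscale4 (a * fst (\<mu> i) + b * snd (\<mu> i)) (p4.action ?T (gen []) (1, 0, 0, 0))"
      unfolding 2 linmap_diff[OF p4.linmap_action] linmap_scale[OF p4.linmap_action] ..
    then show ?thesis unfolding p4.action_single p4.scale_one by (simp add: kac_highest \<mu>_def n0)
  next
    case 3
    then have "k = n i" unfolding \<mu>_def by simp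
    then show ?thesis unfolding 3(1) p4.action_single p4.scale_one foldr_replicate y2_def
      using kac_lower_nilpotent[of "n i" "\<kappa> i / of_nat (n i)"] by simp
  qed
qed

definition \<Lambda>_cls where "\<Lambda>_cls i X = \<Lambda> i (SOME p. p \<in> fa sl12 \<and> X = \<phi> i p)"

lemma \<Lambda>_cls:
  assumes i: "i < q" and p: "p \<in> fa sl12"
  shows "\<Lambda>_cls i (\<phi> i p) = \<Lambda> i p"
proof -
  have "\<exists>r. r \<in> fa sl12 \<and> \<phi> i p = \<phi> i r" using p by blast
  then have r: "(SOME r. r \<in> fa sl12 \<and> \<phi> i p = \<phi> i r) \<in> fa sl12 \<and> \<phi> i p = \<phi> i (SOME r. r \<in> fa sl12 \<and> \<phi> i p = \<phi> i r)" by (rule someI_ex)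
  then have "p - (SOME r. r \<in> fa sl12 \<and> \<phi> i p = \<phi> i r) \<in> sl.lgen (K_relations (\<mu> i))" using \<phi>_eq[OF p] by blast
  from \<Lambda>_kernel[OF i this] show ?thesis unfolding \<Lambda>_cls_def linmap_diff[OF linmap_\<Lambda>] by simp
qed

definition coordinate where "coordinate b p = cx.lift (\<lambda>w. \<Prod>i<q. kac_coord (b i) (\<Lambda>_cls i (w ! i))) p"

lemma linmap_coordinate: "linmap pscale (*) (coordinate b)"
  unfolding coordinate_def[abs_def] by (rule cx.linmap_lift)

lemma coordinate_tp: "(\<And>i. a i \<in> fa sl12) ==> coordinate b (gen (tp a)) = (\<Prod>i<q. kac_coord (b i) (\<Lambda> i (a i)))"
  unfolding coordinate_def cx.lift_single by (simp add: tp_nth \<Lambda>_cls del: mem_Collect_eq)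

text \<open>
  The functional is a product of linear functionals of the factors, hence multilinear.
\<close>

lemma coordinate_kernel:
  assumes "p \<in> tensor_kernel sl12_t Vs"
  shows "coordinate b p = 0"
proof -
  have upd: "coordinate b (gen (tp (a(i := c)))) = kac_coord (b i) (\<Lambda> i c) * (\<Prod>k\<in>{..<q} - {i}. kac_coord (b k) (\<Lambda> k (a k)))"
    if "i < q" "\<And>k. a k \<in> fa sl12" "c \<in> fa sl12" for i a c
  proof -
    have "coordinate b (gen (tp (a(i := c)))) = (\<Prod>k<q. kac_coord (b k) (\<Lambda> k ((a(i := c)) k)))"
      by (rule coordinate_tp) (use that(2,3) in \<open>simp del: mem_Collect_eq\<close>)
    also have "\<dots> = kac_coord (b i) (\<Lambda> i c) * (\<Prod>k\<in>{..<q} - {i}. kac_coord (b k) (\<Lambda> k ((a(i := c)) k)))"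
      using prod.remove[of "{..<q}" i "\<lambda>k. kac_coord (b k) (\<Lambda> k ((a(i := c)) k))"] that(1) by simp
    also have "(\<Prod>k\<in>{..<q} - {i}. kac_coord (b k) (\<Lambda> k ((a(i := c)) k))) = (\<Prod>k\<in>{..<q} - {i}. kac_coord (b k) (\<Lambda> k (a k)))"
      by (rule prod.cong) auto
    finally show ?thesis .
  qed
  note lc = linmap_diff[OF linmap_coordinate] linmap_scale[OF linmap_coordinate]
  have rel: "coordinate b r = 0" if r: "r \<in> multilinear_relations Vs" for r
  proof -
    show ?thesis using r unfolding multilinear_relations_def length_Vs
    proof (elim UnE CollectE exE conjE)
      fix w i c d
      assume req: "r = gen (w[i := c \<oplus>\<^bsub>Vs ! i\<^esub> d]) - gen (w[i := c]) - gen (w[i := d])"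
        and w: "w \<in> tup" and i: "i < q" and c: "c \<in> carrier (Vs ! i)" and d: "d \<in> carrier (Vs ! i)"
      obtain a where a: "\<And>i. a i \<in> fa sl12" "w = tp a" using tup_tp[OF w] by blast
      obtain c' where c': "c' \<in> fa sl12" "c = \<phi> i c'" using c unfolding VD(1)[OF i] by (rule imageE)
      obtain d' where d': "d' \<in> fa sl12" "d = \<phi> i d'" using d unfolding VD(1)[OF i] by (rule imageE)
      have cd: "c' + d' \<in> fa sl12" by (rule pscale.subspace_add[OF fa_subspace c'(1) d'(1)])
      show "coordinate b r = 0"
        unfolding req a(2) c'(2) d'(2) VD(2)[OF i c'(1) d'(1)] tp_update[OF i, symmetric] lc
          upd[OF i a(1) c'(1)] upd[OF i a(1) d'(1)] upd[OF i a(1) cd] linmap_add[OF linmap_\<Lambda>] kac_coord_linear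
        by (simp add: algebra_simps)
    next
      fix w i k c
      assume req: "r = gen (w[i := k \<odot>\<^bsub>Vs ! i\<^esub> c]) - single (w[i := c]) k"
        and w: "w \<in> tup" and i: "i < q" and c: "c \<in> carrier (Vs ! i)"
      obtain a where a: "\<And>i. a i \<in> fa sl12" "w = tp a" using tup_tp[OF w] by blast
      obtain c' where c': "c' \<in> fa sl12" "c = \<phi> i c'" using c unfolding VD(1)[OF i] by (rule imageE)
      have kc: "pscale k c' \<in> fa sl12" by (rule pscale.subspace_scale[OF fa_subspace c'(1)])
      have s: "coordinate b (single x k) = k * coordinate b (gen x)" for x using lc(2)[of b k "gen x"] by simp
      show "coordinate b r = 0"
        unfolding req a(2) c'(2) VD(3)[OF i c'(1)] tp_update[OF i, symmetric] lc s
          upd[OF i a(1) c'(1)] upd[OF i a(1) kc] linmap_scale[OF linmap_\<Lambda>] kac_coord_linear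
        by simp
    qed
  qed
  have "p \<in> pscale.span (multilinear_relations Vs)" using assms unfolding tensor_kernel_span .
  then show ?thesis
    by (induction rule: pscale.span_induct_alt) (simp_all add: linmap_zero[OF linmap_coordinate] linmap_add[OF linmap_coordinate] lc rel)
qed

end

locale kac_tensor_rep = kac_tensor +
  fixes \<pi> :: "((mat3 list \<Rightarrow>\<^sub>0 complex) set set list \<Rightarrow>\<^sub>0 complex) \<Rightarrow> ((mat3 list \<Rightarrow>\<^sub>0 complex) set set list \<Rightarrow>\<^sub>0 complex)" and T
  assumes pi_linear: "linmap pscale pscale \<pi>" and pi_zero: "\<And>a. \<pi> a = 0 \<longleftrightarrow> a \<in> tensor_kernel sl12_t Vs"
    and rep: "is_rep sl12_t pscale T"
    and T_pi: "\<And>g p. g \<in> carrier sl12_t ==> p \<in> ft ==> T g (\<pi> p) = \<pi> (tensor_act sl12_t Vs g p)"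
begin

lemma pi_tproj: "tproj p = tproj p' ==> \<pi> p = \<pi> p'"
  using pi_zero[of "p - p'"] tproj(2)[of "p - p'"] unfolding linmap_diff[OF pi_linear] linmap_diff[OF tproj(1)] by simp

definition pt where "pt a = \<pi> (gen (tp a))"

lemma pt_add:
  assumes "i < q" "\<And>k. a k \<in> fa sl12" "b \<in> fa sl12" "c \<in> fa sl12"
  shows "pt (a(i := b + c)) = pt (a(i := b)) + pt (a(i := c))"
proof -
  have "\<tau> ((tp a)[i := \<phi> i b \<oplus>\<^bsub>Vs ! i\<^esub> \<phi> i c]) = \<tau> ((tp a)[i := \<phi> i b]) + \<tau> ((tp a)[i := \<phi> i c])"
    by (rule \<tau>_add[OF tp_tup[OF assms(2)]]) (use assms VD(1)[OF assms(1)] in \<open>simp_all del: mem_Collect_eq\<close>)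
  then have "tproj (gen (tp (a(i := b + c)))) = tproj (gen (tp (a(i := b))) + gen (tp (a(i := c))))"
    unfolding \<tau>_def VD(2)[OF assms(1,3,4)] tp_update[OF assms(1)] linmap_add[OF tproj(1)] .
  from pi_tproj[OF this] show ?thesis unfolding pt_def linmap_add[OF pi_linear] .
qed

lemma pt_scale:
  assumes "i < q" "\<And>k. a k \<in> fa sl12" "b \<in> fa sl12"
  shows "pt (a(i := pscale c b)) = pscale c (pt (a(i := b)))"
proof -
  have "\<tau> ((tp a)[i := c \<odot>\<^bsub>Vs ! i\<^esub> \<phi> i b]) = pscale c (\<tau> ((tp a)[i := \<phi> i b]))"
    by (rule \<tau>_smult[OF tp_tup[OF assms(2)]]) (use assms VD(1)[OF assms(1)] in \<open>simp_all del: mem_Collect_eq\<close>)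
  then have "tproj (gen (tp (a(i := pscale c b)))) = tproj (pscale c (gen (tp (a(i := b)))))"
    unfolding \<tau>_def VD(3)[OF assms(1,3)] tp_update[OF assms(1)] linmap_scale[OF tproj(1)] .
  from pi_tproj[OF this] show ?thesis unfolding pt_def linmap_scale[OF pi_linear] .
qed

lemma pt_cong:
  assumes "\<And>i. i < q ==> \<phi> i (a i) = \<phi> i (b i)"
  shows "pt a = pt b"
proof -
  have "tp a = tp b" unfolding tp_def by (rule map_cong) (use assms in auto)
  then show ?thesis unfolding pt_def by simp
qed

lemma pt_update_cong: "\<phi> i b = \<phi> i c ==> pt (a(i := b)) = pt (a(i := c))"
  by (rule pt_cong) simp

lemma pt_zero:
  assumes "i < q" "\<And>k. a k \<in> fa sl12" "a i \<in> sl.lgen (K_relations (\<mu> i))"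
  shows "pt a = 0"
proof -
  have z: "(0 :: mat3 list \<Rightarrow>\<^sub>0 complex) \<in> fa sl12" by simp
  have "\<phi> i (a i) = \<phi> i (pscale 0 0)" using \<phi>_eq[OF assms(2) z, of i i] assms(3) by simp
  then have "pt (a(i := a i)) = pt (a(i := pscale 0 0))" by (rule pt_update_cong)
  also have "\<dots> = pscale 0 (pt (a(i := 0)))" by (rule pt_scale[OF assms(1,2) z])
  finally show ?thesis by simp
qed

lemma T_pt:
  assumes g: "g \<in> part sl12_t d" and a: "\<And>k. a k \<in> fa sl12"
  shows "T g (pt a) = (\<Sum>i<q. pt (\<lambda>k. if k < i then tw d (a k) else if k = i then word_mult (gen [evaluate (z i) g]) (a i) else a k))"
proof -
  have gc: "g \<in> carrier sl12_t" by (rule part_carrier_sl12_t[OF g])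
  have "tproj (tensor_act sl12_t Vs g (gen (tp a))) = (\<Sum>i<q. \<tau> (slot d i g (tp a)))"
    unfolding tproj_tensor_act pc.lift_single pscale.scale_one using A_homogeneous[OF g tp_tup[OF a]] by simp
  also have "\<dots> = tproj (\<Sum>i<q. gen (slot d i g (tp a)))" unfolding linmap_sum[OF tproj(1)] \<tau>_def ..
  finally have "\<pi> (tensor_act sl12_t Vs g (gen (tp a))) = (\<Sum>i<q. \<pi> (gen (slot d i g (tp a))))"
    unfolding linmap_sum[OF pi_linear, symmetric] by (rule pi_tproj)
  then have "T g (pt a) = (\<Sum>i<q. \<pi> (gen (slot d i g (tp a))))"
    unfolding pt_def using T_pi[OF gc gen_ft[OF tp_tup[OF a]]] by simp
  also have "\<dots> = (\<Sum>i<q. pt (\<lambda>k. if k < i then tw d (a k) else if k = i then word_mult (gen [evaluate (z i) g]) (a i) else a k))"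
    unfolding pt_def by (rule sum.cong) (simp_all add: slot_tp[OF _ a gc])
  finally show ?thesis .
qed

definition v where "v = pt (\<lambda>i. gen [])"

lemma one_fa: "gen [] \<in> fa sl12" by simp

text \<open>
  The signs disappear because the cyclic vectors are even.
\<close>

lemma T_eigen:
  assumes g: "g \<in> part sl12_t d"
    and c: "\<And>i. i < q ==> \<phi> i (gen [evaluate (z i) g]) = \<phi> i (pscale (c i) (gen []))"
  shows "T g v = pscale (\<Sum>i<q. c i) v"
proof -
  have "pt (\<lambda>k. if k < i then tw d (gen []) else if k = i then word_mult (gen [evaluate (z i) g]) (gen []) else gen []) = pscale (c i) v" if i: "i < q" for i
  proof -
    have "(\<lambda>k. if k < i then tw d (gen []) else if k = i then word_mult (gen [evaluate (z i) g]) (gen []) else gen [])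
      = (\<lambda>k. gen [])(i := gen [evaluate (z i) g])" by (simp add: fun_eq_iff)
    then show ?thesis using pt_update_cong[OF c[OF i], of "\<lambda>k. gen []"] pt_scale[OF i one_fa one_fa, of "c i"]
      by (simp add: v_def fun_upd_idem del: pscale_single)
  qed
  then show ?thesis unfolding v_def T_pt[OF g one_fa] by (simp add: v_def pscale.scale_sum_left)
qed

lemma T_n_plus:
  assumes "X \<in> n_plus"
  shows "T (single r X) v = 0"
proof -
  have hom: "T (single r X) v = 0" if X: "X \<in> n_plus" "X \<in> part sl12 d" for X d
  proof -
    have "T (single r X) v = pscale (\<Sum>i<q. 0) v"
    proof (rule T_eigen[OF single_part[OF X(2)]])
      fix i
      have x: "z i ^ r *\<^sub>M X \<in> n_plus" by (rule n_plus_scale[OF X(1)])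
      have xfa: "gen [z i ^ r *\<^sub>M X] \<in> fa sl12" "pscale 0 (gen []) \<in> fa sl12" using n_plus_carrier[OF x] by simp_all
      have "gen [z i ^ r *\<^sub>M X] \<in> sl.lgen (K_relations (\<mu> i))"
        using sl.lgen_superset[OF K_relations_fa] K_relation_n_plus[OF x] by blast
      then show "\<phi> i (gen [evaluate (z i) (single r X)]) = \<phi> i (pscale 0 (gen []))"
        using \<phi>_eq[OF xfa, of i] by simp
    qed
    then show ?thesis by simp
  qed
  obtain a b c where X: "X = a *\<^sub>M E 2 1 + b *\<^sub>M E 2 3 + c *\<^sub>M E 1 3" using assms unfolding n_plus_def by blast
  note cE = E_part(2,6,7)[THEN part_carrier_sl12]
  show ?thesis unfolding X
    using hom[OF E_n_plus(1) E_part(7)] hom[OF E_n_plus(2) E_part(2)] hom[OF E_n_plus(3) E_part(6)]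
    by (simp add: pc.rep_single_linear[OF rep] cE carrier_sl12_closed)
qed

lemma T_h: "T (single r (a *\<^sub>M h1 + b *\<^sub>M h2)) v = pscale (\<Sum>i<q. z i ^ r * (a * \<kappa> i + b * of_nat (n i))) v"
proof (rule T_eigen[OF single_part[OF h_part]])
  fix i
  have e: "evaluate (z i) (single r (a *\<^sub>M h1 + b *\<^sub>M h2)) = (z i ^ r * a) *\<^sub>M h1 + (z i ^ r * b) *\<^sub>M h2"
    by (simp add: mscale_add_right mscale_assoc)
  have c: "z i ^ r * (a * \<kappa> i + b * of_nat (n i)) = (z i ^ r * a) * fst (\<mu> i) + (z i ^ r * b) * snd (\<mu> i)"
    by (simp add: \<mu>_def algebra_simps)
  have f: "gen [(z i ^ r * a) *\<^sub>M h1 + (z i ^ r * b) *\<^sub>M h2] \<in> fa sl12" using part_carrier_sl12[OF h_part] by simp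
  show "\<phi> i (gen [evaluate (z i) (single r (a *\<^sub>M h1 + b *\<^sub>M h2))]) = \<phi> i (pscale (z i ^ r * (a * \<kappa> i + b * of_nat (n i))) (gen []))"
    unfolding e c \<phi>_eq[OF f pscale.subspace_scale[OF fa_subspace one_fa]]
    using sl.lgen_superset[OF K_relations_fa] K_relation_h by blast
qed

lemma UEA_ideal_lgen_mult:
  assumes "r \<in> UEA_relations sl12" "p \<in> fa sl12"
  shows "word_mult r p \<in> sl.lgen P"
  using sl.UEA_ideal_mult(2)[OF subsetD[OF sl.UEA_relations_ideal assms(1)] assms(2)] sl.UEA_ideal_lgen by blast

lemma \<phi>_smult_word:
  assumes "x \<in> carrier sl12" "p \<in> fa sl12"
  shows "\<phi> i (word_mult (gen [c *\<^sub>M x]) p) = \<phi> i (pscale c (word_mult (gen [x]) p))"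
proof -
  have r: "gen [c \<odot>\<^bsub>sl12\<^esub> x] - single [x] c \<in> UEA_relations sl12" using assms(1) unfolding UEA_relations_def by blast
  have s: "single [x] c = pscale c (gen [x])" by simp
  have f: "gen [c *\<^sub>M x] \<in> fa sl12" "gen [x] \<in> fa sl12" using assms(1) carrier_sl12_closed(3) by simp_all
  show ?thesis
    unfolding \<phi>_eq[OF fa_word_mult[OF f(1) assms(2)] pscale.subspace_scale[OF fa_subspace fa_word_mult[OF f(2) assms(2)]]]
    using UEA_ideal_lgen_mult[OF r assms(2), of "K_relations (\<mu> i)"] unfolding s word_mult_diff_left word_mult_scale_left smult_sl12 .
qed

lemma \<phi>_add_word:
  assumes "x \<in> carrier sl12" "y \<in> carrier sl12" "p \<in> fa sl12"
  shows "\<phi> i (word_mult (gen [x + y]) p) = \<phi> i (word_mult (gen [x]) p + word_mult (gen [y]) p)"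
proof -
  have r: "gen [x \<oplus>\<^bsub>sl12\<^esub> y] - gen [x] - gen [y] \<in> UEA_relations sl12" using assms(1,2) unfolding UEA_relations_def by blast
  have f: "gen [x + y] \<in> fa sl12" "gen [x] \<in> fa sl12" "gen [y] \<in> fa sl12" using assms(1,2) carrier_sl12_closed(2) by simp_all
  note fp = f[THEN fa_word_mult, OF assms(3)]
  show ?thesis
    unfolding \<phi>_eq[OF fp(1) pscale.subspace_add[OF fa_subspace fp(2,3)]]
    using UEA_ideal_lgen_mult[OF r assms(3), of "K_relations (\<mu> i)"] unfolding word_mult_diff_left add_sl12 by (simp add: diff_diff_eq)
qed

definition R where "R = pscale.span {foldr T w v | w. w \<in> lists (carrier sl12_t)}"

lemma R_T:
  assumes "g \<in> carrier sl12_t" "x \<in> R"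
  shows "T g x \<in> R"
  unfolding R_def
proof (rule pc.linmap_span_subset[OF is_repD(1)[OF rep assms(1)] _ assms(2)[unfolded R_def]])
  fix b assume "b \<in> {foldr T w v | w. w \<in> lists (carrier sl12_t)}"
  then obtain w where w: "b = foldr T w v" "w \<in> lists (carrier sl12_t)" by blast
  have "g # w \<in> lists (carrier sl12_t)" using assms(1) w(2) by simp
  then have "foldr T (g # w) v \<in> {foldr T w v | w. w \<in> lists (carrier sl12_t)}" by blast
  then show "T g b \<in> pscale.span {foldr T w v | w. w \<in> lists (carrier sl12_t)}" unfolding w(1) by (intro pscale.span_base) simp
qed

text \<open>
  Fill the slots from the last one to the first. With an interpolation polynomial
  \<open>f\<close> that is \<open>1\<close> at \<open>z j\<close> and \<open>0\<close> at the
  other parameters, \<open>x \<otimes> f\<close> acts in slot \<open>j\<close> only, and it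
  produces no sign as long as the slots on the left contain even cyclic vectors.
\<close>

lemma pt_R:
  assumes "\<And>i. a i \<in> fa sl12"
  shows "pt a \<in> R"
proof -
  have R: "pscale.subspace R" unfolding R_def by (rule pscale.subspace_span)
  have "\<forall>a. (\<forall>i. a i \<in> fa sl12) \<longrightarrow> (\<forall>i<j. a i = gen []) \<longrightarrow> pt a \<in> R" if "j \<le> q" for j
    using that
  proof (induction rule: inc_induct)
    case base
    have "foldr T [] v \<in> {foldr T w v | w. w \<in> lists (carrier sl12_t)}" by blast
    then have "v \<in> R" unfolding R_def by (intro pscale.span_base) simp
    moreover have "pt a = v" if "\<forall>i<q. a i = gen []" for a unfolding v_def by (rule pt_cong) (use that in simp)
    ultimately show ?case by metis
  next
    case (step j)
    then have j: "j < q" by simp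
    obtain f where f: "\<And>i. i < q ==> poly f (z i) = (if i = j then 1 else 0)" using interpolation_poly[OF z j] by blast
    show ?case
    proof (intro allI impI)
      fix a assume a: "\<forall>i. a i \<in> fa sl12" "\<forall>i<j. a i = gen []"
      have ak: "a k \<in> fa sl12" for k using a(1) by blast
      have upd: "(a(j := p)) k \<in> fa sl12" if "p \<in> fa sl12" for p k using ak that by (simp del: mem_Collect_eq)
      have word: "pt (a(j := gen w)) \<in> R" if "w \<in> lists (carrier sl12)" for w
        using that
      proof (induction w)
        case Nil
        have "\<forall>i<Suc j. (a(j := gen [])) i = gen []" using a(2) by (simp add: less_Suc_eq)
        then show ?case using step.IH upd[OF one_fa] by blast
      next
        case (Cons x w)
        then have x: "x \<in> carrier sl12" and wl: "w \<in> lists (carrier sl12)" by auto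
        have w: "gen w \<in> fa sl12" using wl by simp
        have IH: "pt (a(j := gen w)) \<in> R" by (rule Cons.IH)
        define b where "b = a(j := gen w)"
        have b: "b k \<in> fa sl12" for k unfolding b_def by (rule upd[OF w])
        have bl: "b k = gen []" if "k < j" for k using a(2) that unfolding b_def by simp
        have hom: "pt (a(j := word_mult (gen [y]) (gen w))) \<in> R" if y: "y \<in> part sl12 d" for y d
        proof -
          have yc: "y \<in> carrier sl12" by (rule part_carrier_sl12[OF y])
          define g where "g = poly_current y f"
          have g: "g \<in> part sl12_t d" unfolding g_def by (rule poly_current_part[OF y])
          have ev: "evaluate (z i) g = (if i = j then y else 0)" if "i < q" for i
            unfolding g_def evaluate_poly_current f[OF that] by simp
          define t where "t i = (\<lambda>k. if k < i then tw d (b k) else if k = i then word_mult (gen [evaluate (z i) g]) (b i) else b k)" for i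
          have t0: "pt (t i) = 0" if i: "i < q" "i \<noteq> j" for i
          proof (rule pt_zero[OF i(1)])
            have "gen [0 \<odot>\<^bsub>sl12\<^esub> y] - single [y] 0 \<in> UEA_relations sl12" using yc unfolding UEA_relations_def by blast
            then have "gen [0] \<in> UEA_relations sl12" by simp
            then have "word_mult (gen [0]) (b i) \<in> sl.lgen (K_relations (\<mu> i))" by (rule UEA_ideal_lgen_mult[OF _ b])
            then show ti: "t i i \<in> sl.lgen (K_relations (\<mu> i))" unfolding t_def using ev[OF i(1)] i(2) by simp
            show "t i k \<in> fa sl12" for k
            proof (cases "k = i")
              case True
              then show ?thesis using ti sl.lgen_subset by blast
            next
              case False
              have "tw d (b k) \<in> fa sl12" using b[of k] flip_words_fa[OF b[of k]] unfolding tw_def by (simp del: mem_Collect_eq)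
              then show ?thesis unfolding t_def using False b[of k] by (simp del: mem_Collect_eq)
            qed
          qed
          have tj: "t j = a(j := word_mult (gen [y]) (gen w))"
            unfolding t_def fun_eq_iff using ev[OF j] bl a(2) by (auto simp: b_def)
          have "T g (pt b) = (\<Sum>i<q. pt (t i))" unfolding t_def by (rule T_pt[OF g b])
          also have "\<dots> = (\<Sum>i<q. if i = j then pt (t j) else 0)" by (rule sum.cong) (auto simp: t0)
          also have "\<dots> = pt (t j)" using j by simp
          finally have "T g (pt b) = pt (a(j := word_mult (gen [y]) (gen w)))" unfolding tj .
          then show ?thesis using R_T[OF part_carrier_sl12_t[OF g] IH] unfolding b_def by simp
        qed
        note bx = block_part[OF x]
        note bc = part_carrier_sl12[OF bx]
        have m: "word_mult (gen [block d x]) (gen w) \<in> fa sl12" for d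
          by (rule fa_word_mult[OF _ w]) (use bc in simp)
        have "gen (x # w) = word_mult (gen [block 0 x + block 1 x]) (gen w)" by (simp add: block_sum)
        then have "\<phi> j (gen (x # w)) = \<phi> j (word_mult (gen [block 0 x]) (gen w) + word_mult (gen [block 1 x]) (gen w))"
          using \<phi>_add_word[OF bc[of 0] bc[of 1] w, of j] by simp
        then have eq: "pt (a(j := gen (x # w))) = pt (a(j := word_mult (gen [block 0 x]) (gen w))) + pt (a(j := word_mult (gen [block 1 x]) (gen w)))"
          using pt_update_cong[of j "gen (x # w)" "word_mult (gen [block 0 x]) (gen w) + word_mult (gen [block 1 x]) (gen w)" a]
            pt_add[OF j ak m[of 0] m[of 1]] by simp
        have "pt (a(j := gen (x # w))) \<in> R"
          unfolding eq by (rule pscale.subspace_add[OF R hom[OF bx[of 0]] hom[OF bx[of 1]]])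
        then show ?case unfolding fun_upd_def .
      qed
      have "pt (a(j := p)) \<in> R" if "p \<in> fa sl12" for p
        using that
      proof (induction rule: fa_induct)
        case zero
        have z0: "(0 :: mat3 list \<Rightarrow>\<^sub>0 complex) \<in> fa sl12" by simp
        have p0: "pt (a(j := 0)) = 0"
          by (rule pt_zero[OF j upd[OF z0]]) (simp add: pscale.subspace_0[OF sl.lgen_subspace])
        have "pt (a(j := 0)) \<in> R" unfolding p0 by (rule pscale.subspace_0[OF R])
        then show ?case unfolding fun_upd_def .
      next
        case (add c w p)
        have w: "gen w \<in> fa sl12" using add(1) by simp
        have cw: "pscale c (gen w) \<in> fa sl12" by (rule pscale.subspace_scale[OF fa_subspace w])
        have IH: "pt (a(j := p)) \<in> R" using add(3) unfolding fun_upd_def .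
        have "pt (a(j := pscale c (gen w) + p)) \<in> R"
          unfolding pt_add[OF j ak cw add(2)] pt_scale[OF j ak w]
          by (rule pscale.subspace_add[OF R pscale.subspace_scale[OF R word[OF add(1)]] IH])
        then show ?case unfolding fun_upd_def .
      qed
      from this[OF ak[of j]] show "pt a \<in> R" by simp
    qed
  qed
  from this[of 0] assms show ?thesis by simp
qed

text \<open>
  The coordinate functionals are dual to the pure tensors whose factors map to the basis vectors
  of the models.
\<close>

lemma tensor_lower_bound:
  assumes F: "finite F" "card F \<le> (\<Prod>i<q. 4 * n i)" "\<forall>w\<in>lists (carrier sl12_t). foldr T w v \<in> pscale.span F"
  shows "(\<Prod>i<q. 4 * n i) \<le> card F \<and> pscale.independent F"
proof -
  have "\<exists>r. \<forall>i b. (i < q \<and> b \<in> kac_index (n i) \<longrightarrow> \<Lambda> i (r i b) = kac_vec b) \<and> r i b \<in> fa sl12"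
  proof (intro choice allI)
    fix i b
    show "\<exists>y. (i < q \<and> b \<in> kac_index (n i) \<longrightarrow> \<Lambda> i y = kac_vec b) \<and> y \<in> fa sl12"
    proof (cases "i < q \<and> b \<in> kac_index (n i)")
      case True
      then show ?thesis using kac_vec_generated[OF n[of i], of b "\<kappa> i / of_nat (n i)"] unfolding \<Lambda>_def by blast
    next
      case False
      then show ?thesis using one_fa by blast
    qed
  qed
  then obtain r where r: "\<And>i b. i < q ==> b \<in> kac_index (n i) ==> \<Lambda> i (r i b) = kac_vec b" and rfa: "\<And>i b. r i b \<in> fa sl12" by blast
  define I where "I = (\<Pi>\<^sub>E i\<in>{..<q}. kac_index (n i))"
  have fI: "finite I" unfolding I_def using card_kac_index n by (intro finite_PiE) auto
  have cI: "card I = (\<Prod>i<q. 4 * n i)" unfolding I_def using card_kac_index n by (simp add: card_PiE)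
  define a where "a b = (\<lambda>i. r i (b i))" for b :: "nat \<Rightarrow> nat \<times> nat"
  have afa: "a b i \<in> fa sl12" for b i unfolding a_def by (rule rfa)
  define e where "e b = pt (a b)" for b
  have dual: "coordinate c (gen (tp (a b))) = (if b = c then 1 else 0)" if bI: "b \<in> I" and cI: "c \<in> I" for b c
  proof -
    have bc: "b i \<in> kac_index (n i)" "c i \<in> kac_index (n i)" if "i < q" for i using bI cI that unfolding I_def by auto
    have "coordinate c (gen (tp (a b))) = (\<Prod>i<q. if c i = b i then 1 else 0)"
      unfolding coordinate_tp[OF afa] by (rule prod.cong) (simp_all add: a_def r bc kac_coord_vec[OF bc(2) bc(1)])
    also have "\<dots> = (if b = c then 1 else 0)"
    proof (cases "b = c")
      case False
      have "\<exists>i<q. c i \<noteq> b i"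
      proof (rule ccontr)
        assume "\<not> (\<exists>i<q. c i \<noteq> b i)"
        then have "b = c" by (intro PiE_ext[OF bI[unfolded I_def] cI[unfolded I_def]]) auto
        then show False using False by simp
      qed
      then have "(\<Prod>i<q. if c i = b i then 1 else 0) = (0 :: complex)" by (intro prod_zero) auto
      then show ?thesis using False by simp
    qed simp
    finally show ?thesis .
  qed
  have zero: "u c = 0" if "(\<Sum>b\<in>I. pscale (u b) (e b)) = 0" "c \<in> I" for u c
  proof -
    have "\<pi> (\<Sum>b\<in>I. pscale (u b) (gen (tp (a b)))) = 0"
      unfolding linmap_sum[OF pi_linear] linmap_scale[OF pi_linear] using that(1) unfolding e_def pt_def .
    then have "coordinate c (\<Sum>b\<in>I. pscale (u b) (gen (tp (a b)))) = 0" unfolding pi_zero by (rule coordinate_kernel)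
    then have "(\<Sum>b\<in>I. u b * (if b = c then 1 else 0)) = 0"
      unfolding linmap_sum[OF linmap_coordinate] linmap_scale[OF linmap_coordinate] using dual[OF _ that(2)] by simp
    moreover have "(\<Sum>b\<in>I. u b * (if b = c then 1 else 0)) = (\<Sum>b\<in>I. if b = c then u c else 0)"
      by (rule sum.cong) auto
    moreover have "(\<Sum>b\<in>I. if b = c then u c else 0) = u c" using fI that(2) by simp
    ultimately show ?thesis by metis
  qed
  have inj: "inj_on e I"
  proof (rule inj_onI, rule ccontr)
    fix b c assume b: "b \<in> I" "c \<in> I" "e b = e c" "b \<noteq> c"
    define u where "u x = (if x = b then 1 else 0) - (if x = c then 1 else (0::complex))" for x
    have "(\<Sum>x\<in>I. pscale (u x) (e x)) = (\<Sum>x\<in>I. if x = b then e b else 0) - (\<Sum>x\<in>I. if x = c then e c else 0)"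
      unfolding sum_subtractf[symmetric] u_def by (rule sum.cong) (auto simp: pscale.scale_left_diff_distrib)
    also have "\<dots> = 0" using b fI by simp
    finally have "u b = 0" by (rule zero[OF _ b(1)])
    then show False using b(4) by (simp add: u_def)
  qed
  have ind: "pscale.independent (e ` I)"
  proof
    assume "pscale.dependent (e ` I)"
    then obtain u x where u: "x \<in> e ` I" "u x \<noteq> 0" "(\<Sum>x\<in>e ` I. pscale (u x) x) = 0"
      unfolding pscale.dependent_finite[OF finite_imageI[OF fI]] by blast
    then obtain c where c: "c \<in> I" "x = e c" by blast
    have "(\<Sum>b\<in>I. pscale (u (e b)) (e b)) = 0" using u(3) unfolding sum.reindex[OF inj] by simp
    from zero[OF this c(1)] show False using u(2) c(2) by simp
  qed
  have "R \<subseteq> pscale.span F"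
    unfolding R_def by (rule pscale.span_minimal[OF _ pscale.subspace_span]) (use F(3) in blast)
  moreover have "e b \<in> R" for b unfolding e_def by (rule pt_R[OF afa])
  ultimately have sub: "e ` I \<subseteq> pscale.span F" by blast
  have cardI: "card (e ` I) = (\<Prod>i<q. 4 * n i)" using card_image[OF inj] cI by simp
  have 1: "(\<Prod>i<q. 4 * n i) \<le> card F" using pscale.independent_span_bound[OF F(1) ind sub] cardI by simp
  have "pscale.independent F"
  proof
    assume "pscale.dependent F"
    then obtain x where x: "x \<in> F" "x \<in> pscale.span (F - {x})" unfolding pscale.dependent_def by blast
    have "F \<subseteq> pscale.span (F - {x})"
    proof
      fix y assume "y \<in> F"
      then show "y \<in> pscale.span (F - {x})" using x(2) by (cases "y = x") (simp_all add: pscale.span_base)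
    qed
    then have "pscale.span F \<subseteq> pscale.span (F - {x})" by (rule pscale.span_minimal[OF _ pscale.subspace_span])
    then have "e ` I \<subseteq> pscale.span (F - {x})" using sub by blast
    then have "card (e ` I) \<le> card (F - {x})" using pscale.independent_span_bound[OF _ ind, of "F - {x}"] F(1) by simp
    then show False using cardI F(1,2) x(1) card_Diff1_less[OF F(1) x(1)] by simp
  qed
  with 1 show ?thesis by blast
qed

definition yv where "yv c = pt (\<lambda>i. gen (replicate (c i) y2))"

lemma y_words_fa: "gen (replicate k y2) \<in> fa sl12"
  using part_carrier_sl12[OF y2_part] by (auto simp: in_lists_conv_set)

lemma yv_zero:
  assumes "i < q" "c i > n i"
  shows "yv c = 0"
  unfolding yv_def
proof (rule pt_zero[OF assms(1) y_words_fa])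
  have c: "c i = (c i - (n i + 1)) + (n i + 1)" using assms(2) by simp
  have "gen (replicate (n i + 1) y2) \<in> sl.lgen (K_relations (\<mu> i))"
    using sl.lgen_superset[OF K_relations_fa] K_relation_y[of "\<mu> i" "n i"] unfolding \<mu>_def by auto
  from sl.lgen_word_mult[OF y_words_fa[of "c i - (n i + 1)"] this]
  show "gen (replicate (c i) y2) \<in> sl.lgen (K_relations (\<mu> i))"
    by (subst c) (simp only: word_mult_single replicate_add mult_1_left)
qed

lemma T_yv: "T (poly_current y2 f) (yv c) = (\<Sum>i<q. pscale (poly f (z i)) (yv (c(i := Suc (c i)))))"
  unfolding yv_def T_pt[OF poly_current_part[OF y2_part] y_words_fa] evaluate_poly_current tw_zero
proof (rule sum.cong[OF refl])
  fix i assume "i \<in> {..<q}"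
  then have i: "i < q" by simp
  define a where "a = (\<lambda>k. gen (replicate (c k) y2))"
  have a: "a k \<in> fa sl12" for k unfolding a_def by (rule y_words_fa)
  have s: "gen (replicate (Suc (c i)) y2) = word_mult (gen [y2]) (a i)" by (simp add: a_def)
  have "pt (a(i := word_mult (gen [poly f (z i) *\<^sub>M y2]) (a i))) = pt (a(i := pscale (poly f (z i)) (word_mult (gen [y2]) (a i))))"
    by (rule pt_update_cong) (rule \<phi>_smult_word[OF part_carrier_sl12[OF y2_part] a])
  also have "\<dots> = pscale (poly f (z i)) (pt (a(i := word_mult (gen [y2]) (a i))))"
    by (rule pt_scale[OF i a]) (rule y_words_fa[of "Suc (c i)", unfolded s])
  also have "a(i := word_mult (gen [y2]) (a i)) = (\<lambda>k. gen (replicate ((c(i := Suc (c i))) k) y2))"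
    by (auto simp: fun_eq_iff a_def)
  also have "a(i := word_mult (gen [poly f (z i) *\<^sub>M y2]) (a i)) = (\<lambda>k. if k < i then gen (replicate (c k) y2) else if k = i
      then word_mult (gen [poly f (z i) *\<^sub>M y2]) (gen (replicate (c i) y2)) else gen (replicate (c k) y2))"
    by (auto simp: fun_eq_iff a_def)
  finally show "pt (\<lambda>k. if k < i then gen (replicate (c k) y2) else if k = i
      then word_mult (gen [poly f (z i) *\<^sub>M y2]) (gen (replicate (c i) y2)) else gen (replicate (c k) y2)) =
     pscale (poly f (z i)) (pt (\<lambda>k. gen (replicate ((c(i := Suc (c i))) k) y2)))" .
qed

text \<open>
  The powers of \<open>y2 \<otimes> f\<close> distribute over the factors at which
  \<open>f\<close> is nonzero, and in factor \<open>i\<close> the vector survives at most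
  \<open>n i\<close> applications.
\<close>

lemma poly_current_nilpotent:
  assumes f: "\<And>i. i < q ==> i < r ==> poly f (z i) = 0" and k: "(\<Sum>i\<in>{r..<q}. n i) < k"
  shows "(T (poly_current y2 f) ^^ k) v = 0"
proof -
  define G where "G = T (poly_current y2 f)"
  define S where "S j = {yv c | c. (\<Sum>i<q. c i) = j \<and> (\<forall>i<q. i < r \<longrightarrow> c i = 0)}" for j
  have G: "linmap pscale pscale G" unfolding G_def by (rule is_repD(1)[OF rep part_carrier_sl12_t[OF poly_current_part[OF y2_part]]])
  have "(G ^^ j) v \<in> pscale.span (S j)" for j
  proof (induction j)
    case 0
    have "v = yv (\<lambda>i. 0)" by (simp add: v_def yv_def)
    then have "v \<in> S 0" unfolding S_def by auto
    then show ?case by (simp add: pscale.span_base)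
  next
    case (Suc j)
    have "G ((G ^^ j) v) \<in> pscale.span (S (Suc j))"
    proof (rule pc.linmap_span_subset[OF G _ Suc])
      fix b assume "b \<in> S j"
      then obtain c where c: "b = yv c" "(\<Sum>i<q. c i) = j" "\<And>i. i < q ==> i < r ==> c i = 0" unfolding S_def by blast
      have "pscale (poly f (z i)) (yv (c(i := Suc (c i)))) \<in> pscale.span (S (Suc j))" if i: "i < q" for i
      proof (cases "i < r")
        case True
        then show ?thesis using f[OF i] by (simp add: pscale.span_zero)
      next
        case False
        have "(\<Sum>k<q. (c(i := Suc (c i))) k) = (\<Sum>k<q. c k + (if k = i then 1 else 0))" by (rule sum.cong) auto
        also have "\<dots> = Suc j" using c(2) i by (simp add: sum.distrib)
        finally have "yv (c(i := Suc (c i))) \<in> S (Suc j)" unfolding S_def using c(3) False by auto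
        then show ?thesis by (intro pscale.span_scale pscale.span_base)
      qed
      then show "G b \<in> pscale.span (S (Suc j))" unfolding c(1) G_def T_yv by (intro pscale.span_sum) simp
    qed
    then show ?case by simp
  qed
  from this[of k] have "(G ^^ k) v \<in> pscale.span (S k)" .
  moreover have "S k \<subseteq> {0}"
  proof
    fix b assume "b \<in> S k"
    then obtain c where c: "b = yv c" "(\<Sum>i<q. c i) = k" "\<And>i. i < q ==> i < r ==> c i = 0" unfolding S_def by blast
    have "\<exists>i<q. c i > n i"
    proof (rule ccontr)
      assume "\<not> (\<exists>i<q. c i > n i)"
      then have le: "c i \<le> n i" if "i < q" for i using that by (meson not_le)
      have "(\<Sum>i<q. c i) = (\<Sum>i\<in>{r..<q}. c i)"
        by (rule sum.mono_neutral_right) (use c(3) in auto)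
      also have "\<dots> \<le> (\<Sum>i\<in>{r..<q}. n i)" by (rule sum_mono) (use le in auto)
      finally show False using c(2) k by simp
    qed
    then show "b \<in> {0}" unfolding c(1) using yv_zero by auto
  qed
  ultimately have "(G ^^ k) v \<in> pscale.span {0}" using pscale.span_mono by blast
  then show ?thesis unfolding G_def by simp
qed

end

section \<open>The isomorphism\<close>

context sl12_rep
begin

text \<open>
  Terms of lower degree in \<open>t\<close> change a power only by elements of an earlier step
  of the filtration.
\<close>

lemma current_power_difference:
  assumes A: "A \<in> carrier sl12" and g: "g \<in> carrier sl12_t"
    and top: "lookup g r = A" and deg: "\<And>m. r < m ==> lookup g m = 0"
  shows "(T g ^^ j) v - (T (single r A) ^^ j) v \<in> filt_pred (j * r) \<and> (T g ^^ j) v \<in> filt (j * r)"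
proof (induction j)
  case 0
  then show ?case using filt_base[OF graded_words_Nil, of 0] subspace_0[OF filt_pred_subspace] by simp
next
  case (Suc j)
  let ?Y = "T (single r A)"
  have c: "single m (lookup g m) \<in> carrier sl12_t" for m by (rule single_carrier[OF coeff_carrier[OF g]])
  have diff: "T g x - ?Y x \<in> filt_pred (r + N)" if x: "x \<in> filt N" for x N
  proof -
    have "T g x = (\<Sum>m\<in>keys g. T (single m (lookup g m)) x)" by (rule rep_sum_singles[OF rep g])
    also have "\<dots> = (\<Sum>m\<le>r. T (single m (lookup g m)) x)"
    proof (rule sum.mono_neutral_left)
      show "keys g \<subseteq> {..r}" using deg by (auto simp: in_keys_iff not_less[symmetric])
      show "\<forall>m\<in>{..r} - keys g. T (single m (lookup g m)) x = 0"
        using rep_zero[OF rep] by (simp add: in_keys_iff)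
    qed simp
    also have "{..r} = insert r {..<r}" by auto
    also have "(\<Sum>m\<in>insert r {..<r}. T (single m (lookup g m)) x) =
        ?Y x + (\<Sum>m<r. T (single m (lookup g m)) x)" by (simp add: top)
    finally have "T g x - ?Y x = (\<Sum>m<r. T (single m (lookup g m)) x)" by simp
    also have "\<dots> \<in> filt_pred (r + N)"
    proof (rule subspace_sum[OF filt_pred_subspace])
      fix m assume "m \<in> {..<r}"
      then show "T (single m (lookup g m)) x \<in> filt_pred (r + N)"
        using filt_step[OF coeff_carrier[OF g] x, of m m] filt_pred_mono[of "m + N" "r + N"] by auto
    qed
    finally show ?thesis .
  qed
  define a b where "a = (T g ^^ j) v" and "b = (?Y ^^ j) v"
  have ab: "a - b \<in> filt_pred (j * r)" "a \<in> filt (j * r)" using Suc unfolding a_def b_def by blast+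
  have eq: "T g a - ?Y b = (T g a - ?Y a) + ?Y (a - b)" unfolding linmap_diff[OF lin[OF A]] by simp
  have 1: "T g a - ?Y b \<in> filt_pred (r + j * r)"
    unfolding eq by (rule subspace_add[OF filt_pred_subspace diff[OF ab(2)] filt_pred_step[OF A ab(1)]])
  have "T g a = (T g a - ?Y a) + ?Y a" by simp
  moreover have "(T g a - ?Y a) + ?Y a \<in> filt (r + j * r)"
    by (rule subspace_add[OF filt_subspace subsetD[OF filt_pred_subset diff[OF ab(2)]] filt_step[OF A ab(2)]])
  ultimately have "T g a \<in> filt (r + j * r)" by simp
  then show ?case using 1 by (simp add: a_def b_def)
qed

end

definition D_relations :: "nat \<Rightarrow> weight \<Rightarrow> ((nat \<Rightarrow>\<^sub>0 mat3) list \<Rightarrow>\<^sub>0 complex) set" where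
  "D_relations l \<mu> = (\<lambda>x. gen [x]) ` {p. \<forall>r. lookup p r \<in> n_plus} \<union>
    {gen [single r (a *\<^sub>M h1 + b *\<^sub>M h2)] - pscale (if r = 0 then a * fst \<mu> + b * snd \<mu> else 0) (gen []) | r a b. True} \<union>
    {gen (replicate (nat (max 0 (int n - int l * int r)) + 1) (single r y2)) | n r. snd \<mu> = of_nat n}"

lemma h_carrier: "single r (a *\<^sub>M h1 + b *\<^sub>M h2) \<in> carrier sl12_t"
  by (rule single_carrier[OF part_carrier_sl12[OF h_part]])

lemma y_carrier: "single r y2 \<in> carrier sl12_t"
  by (rule single_carrier[OF part_carrier_sl12[OF y2_part]])

lemma D_relations_fa: "D_relations l \<mu> \<subseteq> fa sl12_t"
proof
  fix p assume "p \<in> D_relations l \<mu>"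
  then show "p \<in> fa sl12_t" unfolding D_relations_def
  proof (elim UnE imageE CollectE exE conjE)
    fix x assume "p = gen [x]" "\<forall>r. lookup x r \<in> n_plus"
    then show ?thesis using n_plus_carrier by (simp add: carrier_sl12_t)
  next
    fix r a b assume "p = gen [single r (a *\<^sub>M h1 + b *\<^sub>M h2)] - pscale (if r = 0 then a * fst \<mu> + b * snd \<mu> else 0) (gen [])"
    then show ?thesis using gen_minus_scalar_fa[of "[single r (a *\<^sub>M h1 + b *\<^sub>M h2)]" sl12_t] h_carrier by simp
  next
    fix n r assume "p = gen (replicate (nat (max 0 (int n - int l * int r)) + 1) (single r y2))"
    then show ?thesis using y_carrier by (auto simp: in_lists_conv_set)
  qed
qed

lemma D_ideal_relations: "D_ideal l \<mu> = generated_left_ideal (UEA sl12_t) (ucls sl12_t ` D_relations l \<mu>)"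
proof -
  have 1: "UEA_incl sl12_t ` X = ucls sl12_t ` ((\<lambda>x. gen [x]) ` X)" for X
    unfolding image_image slt.UEA_incl_ucls ..
  have e2: "UEA_incl sl12_t (single r (a *\<^sub>M h1 + b *\<^sub>M h2)) \<ominus>\<^bsub>UEA sl12_t\<^esub> c \<odot>\<^bsub>UEA sl12_t\<^esub> \<one>\<^bsub>UEA sl12_t\<^esub> =
      ucls sl12_t (gen [single r (a *\<^sub>M h1 + b *\<^sub>M h2)] - pscale c (gen []))" for r a b c
  proof -
    have one: "gen [] \<in> fa sl12_t" "gen [single r (a *\<^sub>M h1 + b *\<^sub>M h2)] \<in> fa sl12_t" using h_carrier by simp_all
    show ?thesis
      unfolding slt.UEA_incl_ucls slt.UEA_one pc.presentsD(7)[OF slt.presents_UEA one(1)]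
      by (rule pc.presents_minus[OF slt.presents_UEA one(2) pscale.subspace_scale[OF fa_subspace one(1)]])
  qed
  have e3: "UEA_incl sl12_t (single r y2) [^]\<^bsub>UEA sl12_t\<^esub> (k::nat) = ucls sl12_t (gen (replicate k (single r y2)))" for k r
    by (rule slt.UEA_pow[OF y_carrier])
  show ?thesis
    unfolding D_ideal_def Let_def D_relations_def image_Un 1 e2 e3
    by (rule arg_cong[where f = "generated_left_ideal (UEA sl12_t)"]) (intro arg_cong2[where f = "(\<union>)"] refl; blast)
qed

lemma D_cyc: "D l \<mu> = slt.cyc (D_relations l \<mu>)"
  by (simp add: D_def slt.cyc_def D_ideal_relations)

lemma D_upper_bound:
  fixes N :: nat
  assumes rep: "is_rep sl12_t pscale T" and rel: "\<And>p. p \<in> D_relations l \<mu> ==> pc.action T p u = 0"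
    and \<mu>: "snd \<mu> = of_nat N" and q: "q = 0 \<and> N = 0 \<or> (\<exists>k. q = Suc k \<and> N = k * l + m)" and m: "0 < m" "m \<le> l"
  shows "\<exists>F. finite F \<and> card F \<le> (\<Prod>i<q. 4 * (if Suc i < q then l else m)) \<and> F \<subseteq> pc.homogeneous_orbit T u \<and>
    (\<forall>w\<in>lists (carrier sl12_t). foldr T w u \<in> pscale.span F)"
proof (rule pc.highest_weight_span_bound[OF rep _ _ _ q m])
  show "T (single r X) u = 0" if "X \<in> n_plus" for r X
  proof -
    have "(0 :: mat3) = 0 *\<^sub>M E 2 1 + 0 *\<^sub>M E 2 3 + 0 *\<^sub>M E 1 3" by simp
    then have "0 \<in> n_plus" unfolding n_plus_def by blast
    then have "\<forall>s. lookup (single r X) s \<in> n_plus" using that by (simp add: lookup_single when_def)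
    then have "gen [single r X] \<in> D_relations l \<mu>" unfolding D_relations_def by blast
    from rel[OF this] show ?thesis by simp
  qed
  show "T (single r (a *\<^sub>M h1 + b *\<^sub>M h2)) u = pscale (if r = 0 then a * fst \<mu> + b * snd \<mu> else 0) u" for r a b
  proof -
    have "gen [single r (a *\<^sub>M h1 + b *\<^sub>M h2)] - pscale (if r = 0 then a * fst \<mu> + b * snd \<mu> else 0) (gen []) \<in> D_relations l \<mu>"
      unfolding D_relations_def by blast
    from rel[OF this] show ?thesis
      unfolding linmap_diff[OF pc.linmap_action] linmap_scale[OF pc.linmap_action] pc.action_single by simp
  qed
  show "foldr T (replicate (nat (max 0 (int N - int l * int r)) + 1) (single r y2)) u = 0" for r
  proof -
    have "gen (replicate (nat (max 0 (int N - int l * int r)) + 1) (single r y2)) \<in> D_relations l \<mu>"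
      unfolding D_relations_def using \<mu> by blast
    from rel[OF this] show ?thesis unfolding pc.action_single by simp
  qed
qed

context kac_tensor_rep
begin

definition \<theta> where "\<theta> x = tcls (SOME p. p \<in> ft \<and> x = \<pi> p)"

lemma \<theta>_pi:
  assumes "p \<in> ft"
  shows "\<theta> (\<pi> p) = tcls p"
proof -
  have "\<exists>r. r \<in> ft \<and> \<pi> p = \<pi> r" using assms by blast
  then have r: "(SOME r. r \<in> ft \<and> \<pi> p = \<pi> r) \<in> ft \<and> \<pi> p = \<pi> (SOME r. r \<in> ft \<and> \<pi> p = \<pi> r)" by (rule someI_ex)
  have "(SOME r. r \<in> ft \<and> \<pi> p = \<pi> r) - p \<in> tensor_kernel sl12_t Vs"
    unfolding pi_zero[symmetric] linmap_diff[OF pi_linear] using r by simp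
  then show ?thesis unfolding \<theta>_def using pc.presentsD(8)[OF presents_tensor _ assms] r by blast
qed

lemma presents_\<theta>: "pc.presents (tensor_product sl12_t Vs) (\<pi> ` ft) \<theta> {0}"
proof -
  note P = pc.presentsD[OF presents_tensor]
  have sub: "pscale.subspace (\<pi> ` ft)"
    unfolding pscale.subspace_def
  proof (intro conjI ballI allI)
    show "0 \<in> \<pi> ` ft" by (rule image_eqI[of _ _ 0]) (simp_all add: linmap_zero[OF pi_linear])
    fix x assume "x \<in> \<pi> ` ft"
    then obtain p where p: "x = \<pi> p" "p \<in> ft" by blast
    show "pscale c x \<in> \<pi> ` ft" for c unfolding p(1) linmap_scale[OF pi_linear, symmetric] by (rule imageI[OF pscale.subspace_scale[OF ft_subspace p(2)]])
    fix y assume "y \<in> \<pi> ` ft"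
    then obtain r where r: "y = \<pi> r" "r \<in> ft" by blast
    show "x + y \<in> \<pi> ` ft" unfolding p(1) r(1) linmap_add[OF pi_linear, symmetric] by (rule imageI[OF pscale.subspace_add[OF ft_subspace p(2) r(2)]])
  qed
  show ?thesis
    unfolding pc.presents_def
  proof (intro conjI ballI allI)
    show "pscale.subspace {0 :: (mat3 list \<Rightarrow>\<^sub>0 complex) set set list \<Rightarrow>\<^sub>0 complex}" by (rule pscale.subspace_single_0)
    show "{0} \<subseteq> \<pi> ` ft" using pscale.subspace_0[OF sub] by simp
    show "carrier (tensor_product sl12_t Vs) = \<theta> ` \<pi> ` ft" unfolding P(4) image_image by (rule image_cong) (simp_all add: \<theta>_pi del: mem_Collect_eq)
    show "\<zero>\<^bsub>tensor_product sl12_t Vs\<^esub> = \<theta> 0" using \<theta>_pi[OF pscale.subspace_0[OF ft_subspace]] P(5) linmap_zero[OF pi_linear] by simp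
    fix x assume "x \<in> \<pi> ` ft"
    then obtain p where p: "x = \<pi> p" "p \<in> ft" by blast
    show "c \<odot>\<^bsub>tensor_product sl12_t Vs\<^esub> \<theta> x = \<theta> (pscale c x)" for c
      unfolding p(1) linmap_scale[OF pi_linear, symmetric] \<theta>_pi[OF p(2)] \<theta>_pi[OF pscale.subspace_scale[OF ft_subspace p(2)]] by (rule P(7)[OF p(2)])
    fix y assume "y \<in> \<pi> ` ft"
    then obtain r where r: "y = \<pi> r" "r \<in> ft" by blast
    show "\<theta> x \<oplus>\<^bsub>tensor_product sl12_t Vs\<^esub> \<theta> y = \<theta> (x + y)"
      unfolding p(1) r(1) linmap_add[OF pi_linear, symmetric] \<theta>_pi[OF p(2)] \<theta>_pi[OF r(2)] \<theta>_pi[OF pscale.subspace_add[OF ft_subspace p(2) r(2)]]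
      by (rule P(6)[OF p(2) r(2)])
    show "\<theta> x = \<theta> y \<longleftrightarrow> x - y \<in> {0}"
      unfolding p(1) r(1) \<theta>_pi[OF p(2)] \<theta>_pi[OF r(2)] P(8)[OF p(2) r(2)] pi_zero[symmetric] linmap_diff[OF pi_linear] by simp
  qed (rule sub)
qed

lemma v_gen: "v = \<pi> (gen vs)"
  unfolding v_def pt_def vs_tp ..

lemma gen_vs_ft: "gen vs \<in> ft"
  unfolding vs_tp by (rule gen_ft[OF tp_tup[OF one_fa]])

sublocale S: sl12_module pscale T v "tensor_product sl12_t Vs" "\<pi> ` ft" \<theta>
proof
  show "is_rep sl12_t pscale T" by (rule rep)
  show "pc.presents (tensor_product sl12_t Vs) (\<pi> ` ft) \<theta> {0}" by (rule presents_\<theta>)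
  show "v \<in> \<pi> ` ft" unfolding v_gen by (rule imageI[OF gen_vs_ft])
  fix g x assume g: "g \<in> carrier sl12_t" and "x \<in> \<pi> ` ft"
  then obtain p where p: "x = \<pi> p" "p \<in> ft" by blast
  note t = tensor_act_ft[OF g p(2)]
  show "T g x \<in> \<pi> ` ft" unfolding p(1) T_pi[OF g p(2)] by (rule imageI[OF t])
  show "act (tensor_product sl12_t Vs) g (\<theta> x) = \<theta> (T g x)"
    unfolding p(1) T_pi[OF g p(2)] \<theta>_pi[OF p(2)] \<theta>_pi[OF t] by (rule act_tensor[OF g p(2)])
qed

text \<open>
  The relations for \<open>n_plus\<close> hold already in the tensor product. The scalar by
  which an element of positive degree of the Cartan part acts is absorbed by the filtration. The
  powers of \<open>y2(r)\<close> are compared with those of \<open>y2 \<otimes> f\<close>, where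
  \<open>f\<close> is monic of degree \<open>r\<close> and vanishes at the first
  \<open>r\<close> parameters, as far as these exist.
\<close>

lemma D_relations_comps:
  assumes \<mu>: "fst lam = (\<Sum>i<q. \<kappa> i)" "snd lam = of_nat N" and N: "(\<Sum>i<q. n i) = N"
    and tail: "\<And>r. (\<Sum>i\<in>{r..<q}. n i) \<le> nat (max 0 (int N - int l * int r))"
    and p: "p \<in> D_relations l lam"
  shows "S.comps p k \<in> S.filt_pred k"
proof -
  note zero = pscale.subspace_0[OF S.filt_pred_subspace]
  have letter: "S.comps (gen [g]) k = T (single k (lookup g k)) v" if "g \<in> carrier sl12_t" for g k
  proof -
    have "S.comps (gen [g]) k = (\<Sum>r\<le>k. T (single r (lookup g r)) (if k - r = 0 then v else 0))"
      unfolding S.comps_gen by (simp add: S.shift_def)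
    also have "\<dots> = (\<Sum>r\<le>k. if r = k then T (single k (lookup g k)) v else 0)"
      by (rule sum.cong) (auto simp: linmap_zero[OF S.lin[OF S.coeff_carrier[OF that]]])
    finally show ?thesis by simp
  qed
  show ?thesis using p unfolding D_relations_def
  proof (elim UnE imageE CollectE exE conjE)
    fix x assume x: "p = gen [x]" "\<forall>r. lookup x r \<in> n_plus"
    then have "x \<in> carrier sl12_t" using n_plus_carrier unfolding carrier_sl12_t by blast
    from letter[OF this] show ?thesis unfolding x(1) using T_n_plus x(2) zero by simp
  next
    fix r a b
    assume pr: "p = gen [single r (a *\<^sub>M h1 + b *\<^sub>M h2)] - pscale (if r = 0 then a * fst lam + b * snd lam else 0) (gen [])"
    have z0: "T (single k 0) v = 0" using pc.rep_zero[OF rep] by simp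
    have one: "S.comps (gen []) k = (if k = 0 then v else 0)" unfolding S.comps_gen by simp
    have vf: "v \<in> S.filt 0" using S.filt_base[OF graded_words_Nil, of 0] by simp
    have e: "S.comps p k = T (single k (lookup (single r (a *\<^sub>M h1 + b *\<^sub>M h2)) k)) v
        - pscale (if r = 0 then a * fst lam + b * snd lam else 0) (if k = 0 then v else 0)"
      unfolding pr S.comps_diff S.comps_scale one letter[OF h_carrier] ..
    consider "k \<noteq> r" | "k = r" "r = 0" | "k = r" "r > 0" by blast
    then show ?thesis
    proof cases
      case 1
      then have "S.comps p k = 0" unfolding e using z0 by (auto simp: lookup_single)
      then show ?thesis using zero by simp
    next
      case 2
      have "(\<Sum>i<q. a * \<kappa> i + b * of_nat (n i)) = a * fst lam + b * snd lam"
        unfolding \<mu> N[symmetric] by (simp add: sum.distrib sum_distrib_left)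
      then have "S.comps p k = 0" unfolding e using 2 T_h[of 0 a b] by simp
      then show ?thesis using zero by simp
    next
      case 3
      have "S.comps p k = pscale (\<Sum>i<q. z i ^ r * (a * \<kappa> i + b * of_nat (n i))) v" unfolding e using 3 T_h[of r a b] by simp
      then show ?thesis using pscale.subspace_scale[OF S.filt_subspace vf] S.filt_pred_mono[of 0 k] 3 by auto
    qed
  next
    fix N' r
    assume pr: "p = gen (replicate (nat (max 0 (int N' - int l * int r)) + 1) (single r y2))" and "snd lam = of_nat N'"
    then have N': "N' = N" using \<mu>(2) by simp
    define j where "j = nat (max 0 (int N - int l * int r)) + 1"
    have yc: "y2 \<in> carrier sl12" by (rule part_carrier_sl12[OF y2_part])
    have gw: "replicate i (single r y2) \<in> graded_words (i * r)" for i
    proof (induction i)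
      case 0 then show ?case using graded_words_Nil by simp
    next
      case (Suc i) then show ?case using graded_words_Cons[OF yc Suc, of r] by simp
    qed
    have cw: "S.comps p k = (if k = j * r then (T (single r y2) ^^ j) v else 0)"
      unfolding pr N' j_def[symmetric] S.comps_word[OF gw] pc.foldr_replicate ..
    \<comment> \<open>If \<open>r > q\<close>, the value \<open>0\<close> supplies the missing roots.\<close>
    define \<zeta> where "\<zeta> i = (if i < q then z i else 0)" for i
    define f where "f = (\<Prod>i<r. [:- \<zeta> i, 1:])"
    have df: "degree f = r" unfolding f_def by (subst degree_prod_eq_sum_degree) auto
    have lf: "coeff f r = 1" using lead_coeff_prod[of "\<lambda>i. [:- \<zeta> i, 1:]" "{..<r}"] df unfolding f_def by simp
    have f0: "poly f (z i) = 0" if "i < q" "i < r" for i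
      unfolding f_def poly_prod using that by (auto intro!: prod_zero bexI[of _ i] simp: \<zeta>_def)
    define g where "g = poly_current y2 f"
    have g: "g \<in> carrier sl12_t" unfolding g_def by (rule part_carrier_sl12_t[OF poly_current_part[OF y2_part]])
    have lg: "lookup g m = (if m \<le> r then coeff f m *\<^sub>M y2 else 0)" for m
    proof -
      have "lookup g m = (\<Sum>i\<le>r. if i = m then coeff f m *\<^sub>M y2 else 0)"
        unfolding g_def poly_current_def df lookup_sum by (rule sum.cong) (auto simp: lookup_single when_def)
      then show ?thesis by simp
    qed
    have lt: "(\<Sum>i\<in>{r..<q}. n i) < j" using tail[of r] unfolding j_def by simp
    have "(T g ^^ j) v = 0" unfolding g_def by (rule poly_current_nilpotent[where r = r, OF _ lt]) (rule f0)
    moreover have "(T g ^^ j) v - (T (single r y2) ^^ j) v \<in> S.filt_pred (j * r)"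
      using S.current_power_difference[OF yc g, of r j] lg lf by simp
    ultimately have "(T (single r y2) ^^ j) v \<in> S.filt_pred (j * r)"
      using pscale.subspace_neg[OF S.filt_pred_subspace, of "- (T (single r y2) ^^ j) v" "j * r"] by simp
    then show ?thesis unfolding cw using zero by simp
  qed
qed

end

lemma fusion_of_kac_modules:
  fixes l m q N :: nat and lam :: weight and \<kappa> z :: "nat \<Rightarrow> complex"
  assumes z: "inj_on z {..<q}" and \<mu>: "fst lam = (\<Sum>i<q. \<kappa> i)" "snd lam = of_nat N"
    and q: "q = 0 \<and> N = 0 \<or> (\<exists>k. q = Suc k \<and> N = k * l + m)" and m: "0 < m" "m \<le> l"
  defines "\<nu> \<equiv> \<lambda>i. (\<kappa> i, of_nat (if Suc i < q then l else m))"
  shows "module_isomorphic sl12_t (D l lam) (fusion_product (map (\<lambda>i. (K (\<nu> i), K_vec (\<nu> i), z i)) [0..<q]))"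
proof -
  define n where "n i = (if Suc i < q then l else m)" for i
  interpret kac_tensor q \<kappa> n z by unfold_locales (use m z in \<open>auto simp: n_def\<close>)
  obtain \<pi> :: "((mat3 list \<Rightarrow>\<^sub>0 complex) set set list \<Rightarrow>\<^sub>0 complex) \<Rightarrow> ((mat3 list \<Rightarrow>\<^sub>0 complex) set set list \<Rightarrow>\<^sub>0 complex)"
    and T :: "(nat \<Rightarrow>\<^sub>0 mat3) \<Rightarrow> ((mat3 list \<Rightarrow>\<^sub>0 complex) set set list \<Rightarrow>\<^sub>0 complex) \<Rightarrow> ((mat3 list \<Rightarrow>\<^sub>0 complex) set set list \<Rightarrow>\<^sub>0 complex)"
    where *: "linmap pscale pscale \<pi> \<and> (\<forall>a. \<pi> a = 0 \<longleftrightarrow> a \<in> tensor_kernel sl12_t Vs) \<and> is_rep sl12_t pscale T \<and>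
    (\<forall>x\<in>carrier sl12_t. \<forall>p\<in>ft. T x (\<pi> p) = \<pi> (tensor_act sl12_t Vs x p))"
    using tensor_representation by (elim exE)
  interpret kac_tensor_rep q \<kappa> n z \<pi> T
  proof (intro kac_tensor_rep.intro kac_tensor_rep_axioms.intro kac_tensor_axioms)
    show "linmap pscale pscale \<pi>" "is_rep sl12_t pscale T" using * by blast+
    show "\<pi> a = 0 \<longleftrightarrow> a \<in> tensor_kernel sl12_t Vs" for a using * by blast
    show "T g (\<pi> p) = \<pi> (tensor_act sl12_t Vs g p)" if "g \<in> carrier sl12_t" "p \<in> ft" for g p using * that by blast
  qed
  have sumN: "(\<Sum>i<q. n i) = N"
    using q by (auto simp: n_def lessThan_Suc_atMost[symmetric])
  have tail: "(\<Sum>i\<in>{r..<q}. n i) \<le> nat (max 0 (int N - int l * int r))" for r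
  proof (cases "r < q")
    case True
    then obtain k where k: "q = Suc k" "N = k * l + m" "r \<le> k" using q by auto
    have "(\<Sum>i\<in>{r..<q}. n i) = (\<Sum>i\<in>{r..<k}. n i) + n k" unfolding k(1) using k(3) by simp
    also have "(\<Sum>i\<in>{r..<k}. n i) = (\<Sum>i\<in>{r..<k}. l)" by (rule sum.cong) (auto simp: n_def k(1))
    finally have e1: "(\<Sum>i\<in>{r..<q}. n i) = (k - r) * l + m" by (simp add: n_def k(1))
    have e2: "int N - int l * int r = int ((k - r) * l + m)"
    proof -
      obtain d where d: "k = r + d" using k(3) le_Suc_ex by blast
      show ?thesis unfolding k(2) d by (simp add: algebra_simps)
    qed
    show ?thesis unfolding e1 e2 by (simp only: max_absorb2[OF of_nat_0_le_iff] nat_int order_refl)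
  qed simp
  have "module_isomorphic sl12_t (slt.cyc (D_relations l lam)) (associated_graded (tensor_product sl12_t Vs) (\<theta> v))"
  proof (rule S.associated_graded_isomorphic[where N = "\<Prod>i<q. 4 * n i"])
    show "D_relations l lam \<subseteq> fa sl12_t" by (rule D_relations_fa)
    show "S.comps p k \<in> S.filt_pred k" if "p \<in> D_relations l lam" for p k
      by (rule D_relations_comps[OF \<mu> sumN tail that])
    show "\<exists>F. finite F \<and> card F \<le> (\<Prod>i<q. 4 * n i) \<and> F \<subseteq> pc.homogeneous_orbit T' u \<and>
        (\<forall>w\<in>lists (carrier sl12_t). foldr T' w u \<in> pscale.span F)"
      if "is_rep sl12_t pscale T'" "\<And>p. p \<in> D_relations l lam ==> pc.action T' p u = 0"
      for T' and u :: "(nat \<Rightarrow>\<^sub>0 mat3) list \<Rightarrow>\<^sub>0 complex"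
      unfolding n_def by (rule D_upper_bound[OF that \<mu>(2) q m])
    show "(\<Prod>i<q. 4 * n i) \<le> card F \<and> pscale.independent F"
      if "finite F" "card F \<le> (\<Prod>i<q. 4 * n i)" "\<forall>w\<in>lists (carrier sl12_t). foldr T w v \<in> pscale.span F" for F
      by (rule tensor_lower_bound[OF that])
  qed
  moreover have "\<theta> v = pure_tensor sl12_t Vs vs" unfolding v_gen \<theta>_pi[OF gen_vs_ft] by (rule tcls_pure)
  moreover have "fusion_product (map (\<lambda>i. (K (\<nu> i), K_vec (\<nu> i), z i)) [0..<q]) = associated_graded (tensor_product sl12_t Vs) (pure_tensor sl12_t Vs vs)"
    unfolding fusion_product_def Let_def Vs_def vs_def \<nu>_def \<mu>_def n_def by (simp add: comp_def)
  ultimately show ?thesis unfolding D_cyc by simp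
qed

theorem proposition5p2:
  fixes l :: nat and lam :: weight and q m :: int and \<kappa> z :: "int \<Rightarrow> complex"
  assumes "l > 0"
    and "lam \<in> P_plus"
    and "snd lam = of_int ((q - 1) * int l + m)"
    and "0 < m" and "m \<le> int l"
    and "(\<Sum>i\<in>{1..q}. \<kappa> i) = fst lam"
    and "inj_on z {1..q}"
  shows "module_isomorphic sl12_t (D l lam)
    (fusion_product
      (map (\<lambda>i. let \<mu> = (\<kappa> i, if i < q then of_nat l else of_int m) in (K \<mu>, K_vec \<mu>, z i)) [1..q]))"
proof -
  \<comment> \<open>The equation for the second weight excludes \<open>q < 0\<close>, and \<open>q = 0\<close> is possible only for weight zero and \<open>m = l\<close>.\<close>
  obtain N :: nat where N: "snd lam = of_nat N" using assms(2) unfolding P_plus_def by force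
  have "(of_int ((q - 1) * int l + m) :: complex) = of_int (int N)" using assms(3) N by simp
  then have Nm: "(q - 1) * int l + m = int N" by (simp only: of_int_eq_iff)
  have q0: "q \<ge> 0"
  proof (rule ccontr)
    assume "\<not> q \<ge> 0"
    then have "(q - 1) * int l \<le> (- 2) * int l" by (intro mult_right_mono) auto
    then show False using Nm assms(1,5) by simp
  qed
  define Q M where "Q = nat q" and "M = nat m"
  have QM: "q = int Q" "m = int M" using q0 assms(4) by (simp_all add: Q_def M_def)
  have cases: "Q = 0 \<and> N = 0 \<or> (\<exists>k. Q = Suc k \<and> N = k * l + M)"
  proof (cases Q)
    case 0
    then show ?thesis using Nm QM assms(5) by simp
  next
    case (Suc k)
    then have "int N = int (k * l + M)" using Nm QM by simp
    then show ?thesis using Suc by (simp only: of_nat_eq_iff) simp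
  qed
  have range: "{1..q} = (\<lambda>i. int i + 1) ` {..<Q}"
  proof (intro equalityI subsetI)
    fix i assume "i \<in> {1..q}"
    then have "i = int (nat (i - 1)) + 1" "nat (i - 1) < Q" using QM by auto
    then show "i \<in> (\<lambda>i. int i + 1) ` {..<Q}" by blast
  qed (use QM in auto)
  have inj: "inj_on (\<lambda>i. int i + 1) {..<Q}" by (simp add: inj_on_def)
  have upto: "[1..q] = map (\<lambda>i. int i + 1) [0..<Q]"
    by (rule nth_equalityI) (simp_all add: QM nth_upto)
  define \<kappa>' z' where "\<kappa>' i = \<kappa> (int i + 1)" and "z' i = z (int i + 1)" for i
  have "module_isomorphic sl12_t (D l lam) (fusion_product
    (map (\<lambda>i. (K (\<kappa>' i, of_nat (if Suc i < Q then l else M)), K_vec (\<kappa>' i, of_nat (if Suc i < Q then l else M)), z' i)) [0..<Q]))"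
  proof (rule fusion_of_kac_modules)
    show "inj_on z' {..<Q}" using comp_inj_on[OF inj assms(7)[unfolded range]] unfolding z'_def comp_def .
    show "fst lam = (\<Sum>i<Q. \<kappa>' i)" using assms(6) unfolding range sum.reindex[OF inj] \<kappa>'_def by simp
  qed (use N cases assms(4,5) QM in auto)
  moreover have "map (\<lambda>i. let \<mu> = (\<kappa> i, if i < q then of_nat l else of_int m) in (K \<mu>, K_vec \<mu>, z i)) [1..q] =
    map (\<lambda>i. (K (\<kappa>' i, of_nat (if Suc i < Q then l else M)), K_vec (\<kappa>' i, of_nat (if Suc i < Q then l else M)), z' i)) [0..<Q]"
    unfolding upto map_map
  proof (rule map_cong[OF refl])
    fix i
    have "(if int i + 1 < q then of_nat l else of_int m) = (of_nat (if Suc i < Q then l else M) :: complex)"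
      using QM by auto
    then show "((\<lambda>i. let \<mu> = (\<kappa> i, if i < q then of_nat l else of_int m) in (K \<mu>, K_vec \<mu>, z i)) \<circ> (\<lambda>i. int i + 1)) i =
      (K (\<kappa>' i, of_nat (if Suc i < Q then l else M)), K_vec (\<kappa>' i, of_nat (if Suc i < Q then l else M)), z' i)"
      by (simp add: Let_def \<kappa>'_def z'_def)
  qed
  ultimately show ?thesis by simp
qed

end
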